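(* Let $F$ be a finitely generated free group of rank $k\ge 2$ and let $\mathcal{P}:CV(F)\to\mathbb{P}Curr(F)$ be the Patterson–Sullivan embedding. (1) If $k\ge 3$, then $\mathcal{P}$ does not extend to a homeomorphism from $\overline{CV(F)}$ to the closure of the image of $\mathcal{P}$, and $\mathcal{P}$ does not induce a topological embedding $\partial CV(F)\to\mathbb{P}Curr(F)$ (that is, there is no continuous extension $\overline{CV(F)}\to\mathbb{P}Curr(F)$ of $\mathcal{P}$ whose restriction to $\partial CV(F)$ is a topological embedding). (2) Moreover, if $k\ge 5$, then $\mathcal{P}$ does not extend to a continuous map from $\overline{CV(F)}$ to $\mathbb{P}Curr(F)$.
   Context: Currents. $\partial F$ is the hyperbolic (Gromov) boundary of $F$, and $\partial^2F=\{(\zeta,\xi): \zeta,\xi\in\partial F,\ \zeta\neq\xi\}$, with flip map $\sigma(\zeta,\xi)=(\xi,\zeta)$. A geodesic current on $F$ is a positive Radon measure on $\partial^2F$ that is $F$-invariant and $\sigma$-invariant. $Curr(F)$ is the space of all geodesic currents with the weak topology: $\nu_n\to\nu$ iff $\nu_n(S\times S')\to\nu(S\times S')$ for all disjoint closed-open $S,S'\subseteq\partial F$. $\mathbb{P}Curr(F)$ is the set of non-zero currents modulo multiplication by non-zero (necessarily positive) scalars, with the quotient topology; the class of $\nu$ is $[\nu]$. An automorphism $\phi\in Aut(F)$ induces a homeomorphism $\hat\phi$ of $\partial^2F$, and $(\phi\nu)(S)=\nu(\hat\phi^{-1}(S))$; this induces a continuous left action of $Out(F)$ on $\mathbb{P}Curr(F)$.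 Outer space. $cv(F)$ is the space of $\mathbb{R}$-trees $T$ with a minimal, free and discrete isometric action of $F$, up to $F$-equivariant isometry, identified with the set of their translation length functions $\|\cdot\|_T\in\mathbb{R}^F$ (topology of pointwise convergence). $CV(F)=\mathbb{P}cv(F)\subset\mathbb{P}\mathbb{R}^F=(\mathbb{R}^F\setminus\{0\})/\text{scaling}$ is its projectivization, $\overline{CV(F)}$ is its (compact) closure in $\mathbb{P}\mathbb{R}^F$, and $\partial CV(F)=\overline{CV(F)}\setminus CV(F)$. $Out(F)$ acts on the left by homeomorphisms via $\|w\|_{\phi T}=\|\phi^{-1}(w)\|_T$. Patterson–Sullivan embedding. For $T\in cv(F)$, let $h=h(T)=\lim_{R\to\infty}\frac1R\log\#\{g\in F: d_T(x,gx)\le R\}$ (independent of $x\in T$), and identify $\partial T$ with $\partial F$. There is a family $(m_x)_{x\in T}$ of non-zero finite Borel measures on $\partial F$, unique up to a common positive scalar, with $g_*m_x=m_{gx}$ for $g\in F$ and $\frac{dm_x}{dm_y}(\xi)=e^{-h\beta_\xi(x,y)}$, where $\beta_\xi(x,y)=\lim_{z\to\xi}(d_T(x,z)-d_T(y,z))$. The measure $d\nu(\xi,\zeta)=e^{2h(\xi|\zeta)_x}\,dm_x(\xi)\,dm_x(\zeta)$ on $\partial^2F$, where $(\xi|\zeta)_x$ is the distance in $T$ from $x$ to the bi-infinite geodesic from $\xi$ to $\zeta$, is a geodesic current independent of $x$ (up to scaling of the family). Put $\mathcal{P}([T])=[\nu]$. It is known (Kapovich–Nagnibeda) that $\mathcal{P}:CV(F)\to\mathbb{P}Curr(F)$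 is an $Out(F)$-equivariant topological embedding. *)

theory Defs
  imports "HOL-Analysis.Analysis" "HOL-Algebra.Group_Action"
begin

section \<open>Quotient topologies and Borel measures on abstract topologies\<close>

definition quotient_topology :: "'a topology \<Rightarrow> ('a \<Rightarrow> 'b) \<Rightarrow> 'b topology" where
  "quotient_topology X q =
     topology (\<lambda>U. U \<subseteq> q ` topspace X \<and> openin X {x \<in> topspace X. q x \<in> U})"

lemma openin_quotient_topology:
  "openin (quotient_topology X q) U \<longleftrightarrow>
     U \<subseteq> q ` topspace X \<and> openin X {x \<in> topspace X. q x \<in> U}"
proof -
  let ?P = "\<lambda>U. U \<subseteq> q ` topspace X \<and> openin X {x \<in> topspace X. q x \<in> U}"
  have "?P (S \<inter> T)" if "?P S" "?P T" for S T
  proof -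
    have "{x \<in> topspace X. q x \<in> S \<inter> T} =
        {x \<in> topspace X. q x \<in> S} \<inter> {x \<in> topspace X. q x \<in> T}" by auto
    then show ?thesis using that by (auto intro: openin_Int)
  qed
  moreover have "?P (\<Union>K)" if "\<forall>S\<in>K. ?P S" for K
  proof -
    have "{x \<in> topspace X. q x \<in> \<Union>K} = (\<Union>S\<in>K. {x \<in> topspace X. q x \<in> S})" by auto
    then show ?thesis using that by auto
  qed
  ultimately have "istopology ?P" unfolding istopology_def by blast
  then show ?thesis by (simp add: quotient_topology_def topology_inverse')
qed

lemma topspace_quotient_topology: "topspace (quotient_topology X q) = q ` topspace X"
proof
  show "topspace (quotient_topology X q) \<subseteq> q ` topspace X"
    using openin_quotient_topology[of X q "topspace (quotient_topology X q)"] by simp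
  have "{x \<in> topspace X. q x \<in> q ` topspace X} = topspace X" by auto
  then have "openin (quotient_topology X q) (q ` topspace X)"
    by (simp add: openin_quotient_topology)
  then show "q ` topspace X \<subseteq> topspace (quotient_topology X q)" by (rule openin_subset)
qed

lemma quotient_map_quotient_topology: "quotient_map X (quotient_topology X q) q"
  by (auto simp: quotient_map_def topspace_quotient_topology openin_quotient_topology)

definition borel_on :: "'a topology \<Rightarrow> 'a measure" where
  "borel_on X = sigma (topspace X) {U. openin X U}"

definition radon_measure :: "'a topology \<Rightarrow> 'a measure \<Rightarrow> bool" where
  "radon_measure X \<nu> \<longleftrightarrow>
     space \<nu> = topspace X \<and> sets \<nu> = sets (borel_on X) \<and>
     (\<forall>K. compactin X K \<longrightarrow> emeasure \<nu> K < \<infinity>) \<and>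
     (\<forall>A\<in>sets \<nu>. emeasure \<nu> A = (SUP K\<in>{K. compactin X K \<and> K \<subseteq> A}. emeasure \<nu> K))"


section \<open>The Gromov boundary of a metric space\<close>

text \<open>Points at infinity of a metric space \<open>(M, d)\<close> are equivalence classes of sequences
  converging to infinity, in the sense of Gromov.  The same construction is used for the free
  group with a word metric and for the trees on which it acts.\<close>

definition gromov_product :: "('a \<Rightarrow> 'a \<Rightarrow> real) \<Rightarrow> 'a \<Rightarrow> 'a \<Rightarrow> 'a \<Rightarrow> real" where
  "gromov_product d e x y = (d e x + d e y - d x y) / 2"

definition converges_to_infinity :: "'a set \<Rightarrow> ('a \<Rightarrow> 'a \<Rightarrow> real) \<Rightarrow> (nat \<Rightarrow> 'a) \<Rightarrow> bool" where
  "converges_to_infinity M d u \<longleftrightarrow> range u \<subseteq> M \<and>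
     (\<forall>e\<in>M. filterlim (\<lambda>(i, j). gromov_product d e (u i) (u j)) at_top
              (sequentially \<times>\<^sub>F sequentially))"

definition gromov_rel :: "'a set \<Rightarrow> ('a \<Rightarrow> 'a \<Rightarrow> real) \<Rightarrow> ((nat \<Rightarrow> 'a) \<times> (nat \<Rightarrow> 'a)) set" where
  "gromov_rel M d = {(u, v). converges_to_infinity M d u \<and> converges_to_infinity M d v \<and>
     (\<forall>e\<in>M. filterlim (\<lambda>(i, j). gromov_product d e (u i) (v j)) at_top
              (sequentially \<times>\<^sub>F sequentially))}"

definition gromov_boundary :: "'a set \<Rightarrow> ('a \<Rightarrow> 'a \<Rightarrow> real) \<Rightarrow> (nat \<Rightarrow> 'a) set set" where
  "gromov_boundary M d = {u. converges_to_infinity M d u} // gromov_rel M d"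

definition boundary_product ::
    "('a \<Rightarrow> 'a \<Rightarrow> real) \<Rightarrow> 'a \<Rightarrow> (nat \<Rightarrow> 'a) set \<Rightarrow> (nat \<Rightarrow> 'a) set \<Rightarrow> ereal" where
  "boundary_product d e \<xi> \<zeta> =
     (SUP (u, v) \<in> \<xi> \<times> \<zeta>. Liminf (sequentially \<times>\<^sub>F sequentially)
        (\<lambda>(i, j). ereal (gromov_product d e (u i) (v j))))"

text \<open>The sets \<open>{\<zeta>. (\<xi>|\<zeta>)\<^sub>e \<ge> r}\<close> are the basic neighbourhoods of \<open>\<xi>\<close>.\<close>

definition boundary_topology :: "'a set \<Rightarrow> ('a \<Rightarrow> 'a \<Rightarrow> real) \<Rightarrow> (nat \<Rightarrow> 'a) set topology" where
  "boundary_topology M d = topology (\<lambda>U. U \<subseteq> gromov_boundary M d \<and>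
     (\<forall>\<xi>\<in>U. \<forall>e\<in>M. \<exists>r::real. \<forall>\<zeta>\<in>gromov_boundary M d. boundary_product d e \<xi> \<zeta> \<ge> ereal r \<longrightarrow> \<zeta> \<in> U))"

lemma openin_boundary_topology:
  "openin (boundary_topology M d) U \<longleftrightarrow> U \<subseteq> gromov_boundary M d \<and>
     (\<forall>\<xi>\<in>U. \<forall>e\<in>M. \<exists>r::real. \<forall>\<zeta>\<in>gromov_boundary M d. boundary_product d e \<xi> \<zeta> \<ge> ereal r \<longrightarrow> \<zeta> \<in> U)"
proof -
  let ?N = "\<lambda>U \<xi> e r. \<forall>\<zeta>\<in>gromov_boundary M d. boundary_product d e \<xi> \<zeta> \<ge> ereal r \<longrightarrow> \<zeta> \<in> U"
  let ?P = "\<lambda>U. U \<subseteq> gromov_boundary M d \<and> (\<forall>\<xi>\<in>U. \<forall>e\<in>M. \<exists>r::real. ?N U \<xi> e r)"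
  have "?P (S \<inter> T)" if S: "?P S" and T: "?P T" for S T
  proof (intro conjI ballI)
    show "S \<inter> T \<subseteq> gromov_boundary M d" using S by blast
    fix \<xi> e assume \<xi>: "\<xi> \<in> S \<inter> T" and e: "e \<in> M"
    obtain r where r: "?N S \<xi> e r" using S \<xi> e by blast
    obtain s where s: "?N T \<xi> e s" using T \<xi> e by blast
    have "ereal r \<le> ereal (max r s)" "ereal s \<le> ereal (max r s)" by auto
    then have "?N (S \<inter> T) \<xi> e (max r s)" using r s by (meson IntI order_trans)
    then show "\<exists>r. ?N (S \<inter> T) \<xi> e r" by blast
  qed
  moreover have "?P (\<Union>K)" if K: "\<forall>S\<in>K. ?P S" for K
  proof (intro conjI ballI)
    show "\<Union>K \<subseteq> gromov_boundary M d" using K by blast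
    fix \<xi> e assume \<xi>: "\<xi> \<in> \<Union>K" and e: "e \<in> M"
    then obtain S where S: "S \<in> K" "\<xi> \<in> S" by blast
    then obtain r where "?N S \<xi> e r" using K e by blast
    then show "\<exists>r. ?N (\<Union>K) \<xi> e r" using S by blast
  qed
  ultimately have "istopology ?P" unfolding istopology_def by blast
  then show ?thesis by (simp add: boundary_topology_def topology_inverse')
qed


section \<open>Free groups\<close>

text \<open>A letter \<open>(b, True)\<close> stands for \<open>b\<close> and \<open>(b, False)\<close> for its inverse.  Keeping the sign
  separate from the group element is what excludes bases containing involutions or mutually
  inverse elements.\<close>

definition word_value :: "('g, 'm) monoid_scheme \<Rightarrow> ('g \<times> bool) list \<Rightarrow> 'g" where
  "word_value F w = foldr (\<lambda>(b, s) a. (if s then b else inv\<^bsub>F\<^esub> b) \<otimes>\<^bsub>F\<^esub> a) w \<one>\<^bsub>F\<^esub>"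

definition reduced_word :: "('g \<times> bool) list \<Rightarrow> bool" where
  "reduced_word = successively (\<lambda>x y. \<not> (fst x = fst y \<and> snd x \<noteq> snd y))"

definition free_basis :: "('g, 'm) monoid_scheme \<Rightarrow> 'g set \<Rightarrow> bool" where
  "free_basis F B \<longleftrightarrow> B \<subseteq> carrier F \<and>
     bij_betw (word_value F) {w. set w \<subseteq> B \<times> UNIV \<and> reduced_word w} (carrier F)"

definition word_length :: "('g, 'm) monoid_scheme \<Rightarrow> 'g set \<Rightarrow> 'g \<Rightarrow> nat" where
  "word_length F B g = (LEAST n. \<exists>w. set w \<subseteq> B \<times> UNIV \<and> length w = n \<and> word_value F w = g)"

definition word_metric :: "('g, 'm) monoid_scheme \<Rightarrow> 'g set \<Rightarrow> 'g \<Rightarrow> 'g \<Rightarrow> real" where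
  "word_metric F B g h = real (word_length F B (inv\<^bsub>F\<^esub> g \<otimes>\<^bsub>F\<^esub> h))"

text \<open>The boundary of \<open>F\<close>, realised with the word metric of a finite generating set \<open>B\<close>.\<close>

type_synonym 'g bdry = "(nat \<Rightarrow> 'g) set"

definition bdry_top :: "('g, 'm) monoid_scheme \<Rightarrow> 'g set \<Rightarrow> 'g bdry topology" where
  "bdry_top F B = boundary_topology (carrier F) (word_metric F B)"

definition bdry_act :: "('g, 'm) monoid_scheme \<Rightarrow> 'g \<Rightarrow> 'g bdry \<Rightarrow> 'g bdry" where
  "bdry_act F g \<xi> = (\<lambda>u n. g \<otimes>\<^bsub>F\<^esub> u n) ` \<xi>"

definition dbl_bdry_top :: "('g, 'm) monoid_scheme \<Rightarrow> 'g set \<Rightarrow> ('g bdry \<times> 'g bdry) topology" where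
  "dbl_bdry_top F B =
     subtopology (prod_topology (bdry_top F B) (bdry_top F B)) {(\<zeta>, \<xi>). \<zeta> \<noteq> \<xi>}"


section \<open>Geodesic currents\<close>

definition Curr :: "('g, 'm) monoid_scheme \<Rightarrow> 'g set \<Rightarrow> ('g bdry \<times> 'g bdry) measure set" where
  "Curr F B = {\<nu>. radon_measure (dbl_bdry_top F B) \<nu> \<and>
     (\<forall>g\<in>carrier F. \<forall>A\<in>sets \<nu>. emeasure \<nu> (map_prod (bdry_act F g) (bdry_act F g) ` A) = emeasure \<nu> A) \<and>
     (\<forall>A\<in>sets \<nu>. emeasure \<nu> (prod.swap ` A) = emeasure \<nu> A)}"

definition clopen_rectangles :: "('g, 'm) monoid_scheme \<Rightarrow> 'g set \<Rightarrow> ('g bdry set \<times> 'g bdry set) set" where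
  "clopen_rectangles F B = {(S, S').
     openin (bdry_top F B) S \<and> closedin (bdry_top F B) S \<and>
     openin (bdry_top F B) S' \<and> closedin (bdry_top F B) S' \<and> S \<inter> S' = {}}"

definition Curr_top :: "('g, 'm) monoid_scheme \<Rightarrow> 'g set \<Rightarrow> ('g bdry \<times> 'g bdry) measure topology" where
  "Curr_top F B = pullback_topology (Curr F B)
     (\<lambda>\<nu>. \<lambda>(S, S')\<in>clopen_rectangles F B. measure \<nu> (S \<times> S'))
     (product_topology (\<lambda>_. euclideanreal) (clopen_rectangles F B))"

definition nonzero_currents :: "('g, 'm) monoid_scheme \<Rightarrow> 'g set \<Rightarrow> ('g bdry \<times> 'g bdry) measure set" where
  "nonzero_currents F B = {\<nu> \<in> Curr F B. emeasure \<nu> (space \<nu>) \<noteq> 0}"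

definition current_class :: "'a measure \<Rightarrow> 'a measure set" where
  "current_class \<nu> = {scale_measure (ennreal c) \<nu> | c::real. c > 0}"

definition PCurr_top :: "('g, 'm) monoid_scheme \<Rightarrow> 'g set \<Rightarrow> ('g bdry \<times> 'g bdry) measure set topology" where
  "PCurr_top F B =
     quotient_topology (subtopology (Curr_top F B) (nonzero_currents F B)) current_class"


section \<open>Trees with an action of the free group\<close>

definition real_tree :: "'p set \<Rightarrow> ('p \<Rightarrow> 'p \<Rightarrow> real) \<Rightarrow> bool" where
  "real_tree M d \<longleftrightarrow> Metric_space M d \<and> M \<noteq> {} \<and>
     (\<forall>x\<in>M. \<forall>y\<in>M. \<exists>\<gamma>. \<gamma> ` {0..d x y} \<subseteq> M \<and> \<gamma> 0 = x \<and> \<gamma> (d x y) = y \<and>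
        (\<forall>s\<in>{0..d x y}. \<forall>t\<in>{0..d x y}. d (\<gamma> s) (\<gamma> t) = \<bar>s - t\<bar>) \<and>
        (\<forall>p. pathin (Metric_space.mtopology M d) p \<and> inj_on p {0..1} \<and> p 0 = x \<and> p 1 = y
           \<longrightarrow> p ` {0..1} = \<gamma> ` {0..d x y}))"

record ('g, 'p) gtree =
  tpts :: "'p set"
  tdist :: "'p \<Rightarrow> 'p \<Rightarrow> real"
  tact :: "'g \<Rightarrow> 'p \<Rightarrow> 'p"

abbreviation ttop :: "('g, 'p) gtree \<Rightarrow> 'p topology" where
  "ttop T \<equiv> Metric_space.mtopology (tpts T) (tdist T)"

definition isometric_action :: "('g, 'm) monoid_scheme \<Rightarrow> ('g, 'p) gtree \<Rightarrow> bool" where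
  "isometric_action F T \<longleftrightarrow> group_action F (tpts T) (tact T) \<and>
     (\<forall>g\<in>carrier F. \<forall>x\<in>tpts T. \<forall>y\<in>tpts T. tdist T (tact T g x) (tact T g y) = tdist T x y)"

definition free_tree_action :: "('g, 'm) monoid_scheme \<Rightarrow> ('g, 'p) gtree \<Rightarrow> bool" where
  "free_tree_action F T \<longleftrightarrow> (\<forall>x\<in>tpts T. stabilizer F (tact T) x = {\<one>\<^bsub>F\<^esub>})"

definition discrete_tree_action :: "('g, 'm) monoid_scheme \<Rightarrow> ('g, 'p) gtree \<Rightarrow> bool" where
  "discrete_tree_action F T \<longleftrightarrow>
     (\<forall>x\<in>tpts T. subtopology (ttop T) (orbit F (tact T) x) = discrete_topology (orbit F (tact T) x))"

text \<open>Subtrees of a real tree are its non-empty connected subsets.\<close>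

definition minimal_tree_action :: "('g, 'm) monoid_scheme \<Rightarrow> ('g, 'p) gtree \<Rightarrow> bool" where
  "minimal_tree_action F T \<longleftrightarrow>
     (\<forall>S. S \<noteq> {} \<and> connectedin (ttop T) S \<and> (\<forall>g\<in>carrier F. tact T g ` S \<subseteq> S) \<longrightarrow> S = tpts T)"

definition cv_tree :: "('g, 'm) monoid_scheme \<Rightarrow> ('g, 'p) gtree \<Rightarrow> bool" where
  "cv_tree F T \<longleftrightarrow> real_tree (tpts T) (tdist T) \<and> isometric_action F T \<and>
     free_tree_action F T \<and> discrete_tree_action F T \<and> minimal_tree_action F T"

definition length_fun :: "('g, 'm) monoid_scheme \<Rightarrow> ('g, 'p) gtree \<Rightarrow> 'g \<Rightarrow> real" where
  "length_fun F T = (\<lambda>g\<in>carrier F. INF x\<in>tpts T. tdist T x (tact T g x))"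


section \<open>Outer space\<close>

text \<open>A tree in \<open>cv(F)\<close> is the union of countably many segments, so its set of points has the
  cardinality of the continuum.  Hence, up to equivariant isometry, nothing is lost by drawing the
  points from the type \<^typ>\<open>real\<close>, which serves here only as a set of that cardinality; the
  metric on the points is unrelated to the usual one.\<close>

definition cv :: "('g, 'm) monoid_scheme \<Rightarrow> ('g \<Rightarrow> real) set" where
  "cv F = {length_fun F T | T :: ('g, real) gtree. cv_tree F T}"

definition fun_top :: "('g, 'm) monoid_scheme \<Rightarrow> ('g \<Rightarrow> real) topology" where
  "fun_top F = product_topology (\<lambda>_. euclideanreal) (carrier F)"

definition proj_class :: "('g, 'm) monoid_scheme \<Rightarrow> ('g \<Rightarrow> real) \<Rightarrow> ('g \<Rightarrow> real) set" where
  "proj_class F f = {(\<lambda>g\<in>carrier F. c * f g) | c. c \<noteq> 0}"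

definition PFun_top :: "('g, 'm) monoid_scheme \<Rightarrow> ('g \<Rightarrow> real) set topology" where
  "PFun_top F = quotient_topology
     (subtopology (fun_top F) (- {\<lambda>g\<in>carrier F. 0})) (proj_class F)"

definition CV :: "('g, 'm) monoid_scheme \<Rightarrow> ('g \<Rightarrow> real) set set" where
  "CV F = proj_class F ` cv F"

definition CV_closure :: "('g, 'm) monoid_scheme \<Rightarrow> ('g \<Rightarrow> real) set set" where
  "CV_closure F = PFun_top F closure_of CV F"

definition CV_boundary :: "('g, 'm) monoid_scheme \<Rightarrow> ('g \<Rightarrow> real) set set" where
  "CV_boundary F = CV_closure F - CV F"


section \<open>The Patterson--Sullivan map\<close>

definition volume_entropy :: "('g, 'm) monoid_scheme \<Rightarrow> ('g, 'p) gtree \<Rightarrow> real \<Rightarrow> bool" where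
  "volume_entropy F T h \<longleftrightarrow> (\<forall>x\<in>tpts T.
     ((\<lambda>R. ln (real (card {g \<in> carrier F. tdist T x (tact T g x) \<le> R})) / R) \<longlongrightarrow> h) at_top)"

text \<open>The identification of the boundary of \<open>F\<close> with that of \<open>T\<close> induced by orbit maps:
  \<open>\<xi>\<close> is sent to the class of \<open>n \<mapsto> u n \<cdot> x\<close>, for any sequence \<open>u\<close> representing \<open>\<xi>\<close> and any
  \<open>x\<close> in \<open>T\<close>.\<close>

definition tree_end :: "('g, 'p) gtree \<Rightarrow> 'g bdry \<Rightarrow> (nat \<Rightarrow> 'p) set" where
  "tree_end T \<xi> = {z. \<exists>u\<in>\<xi>. \<exists>x\<in>tpts T. ((\<lambda>n. tact T (u n) x), z) \<in> gromov_rel (tpts T) (tdist T)}"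

text \<open>The members of \<^term>\<open>tree_end T \<xi>\<close> are exactly the sequences in \<open>T\<close> that tend to \<open>\<xi>\<close>.\<close>

definition busemann :: "('g, 'p) gtree \<Rightarrow> 'g bdry \<Rightarrow> 'p \<Rightarrow> 'p \<Rightarrow> real" where
  "busemann T \<xi> x y = (THE b. \<forall>z\<in>tree_end T \<xi>. (\<lambda>n. tdist T x (z n) - tdist T y (z n)) \<longlonglongrightarrow> b)"

definition geodesic_between :: "('g, 'p) gtree \<Rightarrow> 'g bdry \<Rightarrow> 'g bdry \<Rightarrow> (real \<Rightarrow> 'p) \<Rightarrow> bool" where
  "geodesic_between T \<xi> \<zeta> l \<longleftrightarrow> range l \<subseteq> tpts T \<and> (\<forall>s t. tdist T (l s) (l t) = \<bar>s - t\<bar>) \<and>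
     (\<lambda>n. l (- real n)) \<in> tree_end T \<xi> \<and> (\<lambda>n. l (real n)) \<in> tree_end T \<zeta>"

definition dist_to_geodesic :: "('g, 'p) gtree \<Rightarrow> 'p \<Rightarrow> 'g bdry \<Rightarrow> 'g bdry \<Rightarrow> real" where
  "dist_to_geodesic T x \<xi> \<zeta> =
     (THE r. \<exists>l. geodesic_between T \<xi> \<zeta> l \<and> r = (INF t. tdist T x (l t)))"

definition patterson_sullivan_family ::
    "('g, 'm) monoid_scheme \<Rightarrow> 'g set \<Rightarrow> ('g, 'p) gtree \<Rightarrow> real \<Rightarrow> ('p \<Rightarrow> 'g bdry measure) \<Rightarrow> bool" where
  "patterson_sullivan_family F B T h m \<longleftrightarrow>
     (\<forall>x\<in>tpts T. space (m x) = topspace (bdry_top F B) \<and> sets (m x) = sets (borel_on (bdry_top F B)) \<and>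
        finite_measure (m x) \<and> emeasure (m x) (space (m x)) \<noteq> 0) \<and>
     (\<forall>g\<in>carrier F. \<forall>x\<in>tpts T. distr (m x) (borel_on (bdry_top F B)) (bdry_act F g) = m (tact T g x)) \<and>
     (\<forall>x\<in>tpts T. \<forall>y\<in>tpts T. m x = density (m y) (\<lambda>\<xi>. ennreal (exp (- h * busemann T \<xi> x y))))"

definition patterson_sullivan_current ::
    "('g, 'm) monoid_scheme \<Rightarrow> 'g set \<Rightarrow> ('g, 'p) gtree \<Rightarrow> ('g bdry \<times> 'g bdry) measure \<Rightarrow> bool" where
  "patterson_sullivan_current F B T \<nu> \<longleftrightarrow>
     (\<exists>h m. volume_entropy F T h \<and> patterson_sullivan_family F B T h m \<and>
        (\<exists>x\<in>tpts T. \<nu> = density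
           (restrict_space (m x \<Otimes>\<^sub>M m x) (topspace (dbl_bdry_top F B)))
           (\<lambda>(\<xi>, \<zeta>). ennreal (exp (2 * h * dist_to_geodesic T x \<xi> \<zeta>)))))"

text \<open>The choice is harmless: a point of \<^term>\<open>CV F\<close> determines its tree up to equivariant
  isometry and rescaling, and the tree determines its Patterson--Sullivan current up to a positive
  scalar.\<close>

definition PS_map :: "('g, 'm) monoid_scheme \<Rightarrow> 'g set \<Rightarrow> ('g \<Rightarrow> real) set \<Rightarrow> ('g bdry \<times> 'g bdry) measure set" where
  "PS_map F B c = (SOME C. \<exists>(T :: ('g, real) gtree) \<nu>. cv_tree F T \<and> proj_class F (length_fun F T) = c \<and>
     patterson_sullivan_current F B T \<nu> \<and> C = current_class \<nu>)"

end

theory Submission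
  imports Defs "HOL-Real_Asymp.Real_Asymp"
begin

text \<open>
  Already roses obstruct an extension.  Normalise the petal lengths \<open>l b\<close> so that the entropy
  is \<open>1\<close>, that is, \<open>\<Sum>b. 1 / (1 + exp (l b)) = 1 / 2\<close>, and put \<open>p b = 1 / (1 + exp (l b))\<close>.  The
  Patterson--Sullivan measure at the vertex gives the cylinder of a reduced word \<open>w\<close> the mass
  \<open>exp (- l w) * (1 - p (last w))\<close>, and the current gives the rectangle of the cylinders of two
  distinct letters \<open>a\<close>, \<open>b\<close> the mass \<open>p a * p b\<close>.  Let \<open>p b\<close> tend to \<open>0\<close> at the same rate for all
  petals except two, \<open>x\<close> and \<open>y\<close>.  After rescaling, the lengths of \<open>x\<close> and \<open>y\<close> tend to \<open>0\<close>, so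
  the limit in the closure of outer space does not depend on the ratio \<open>p x : p y\<close>.  The currents
  do: their masses on the rectangles of \<open>(x, x\<inverse>)\<close> and \<open>(y, y\<inverse>)\<close> have the ratio
  \<open>(p x)\<^sup>2 : (p y)\<^sup>2\<close>.  Running through the degeneration with \<open>p x : p y\<close> equal to \<open>1 : 1\<close> and to
  \<open>1 : 3\<close> gives contradictory conditions on the value of an extension at the limit point.

  The Patterson--Sullivan map is defined by a choice of a tree with the given projective length
  function.  In any such tree the length function forces the axes of the basis elements to have
  a common point, and all Patterson--Sullivan data can be computed from there.
\<close>

section \<open>Real trees as 0-hyperbolic spaces\<close>

text \<open>Three petals are what the argument uses: two of them collapse, and a third keeps the
  limiting length function non-zero. It excludes every continuous extension in rank at least 3, and
  this contains all the claims. The value of an extension at the limit point is never computed. Only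
  homogeneous linear inequalities between masses of letter rectangles are passed to the limit, since
  these make sense for projective classes. The contradiction requires that the limit has positive
  mass on the rectangle of \<open>x\<close> and its inverse: a non-zero current charges some letter
  rectangle, and along the sequence no letter rectangle outweighs that one by more than a fixed
  factor. The shape of the proof is dictated by \<open>PS_map\<close> being a Hilbert choice. A tree
  and a current have to be exhibited for each rose, since otherwise the choice is arbitrary; then
  the masses have to be computed in whatever tree was chosen, from its length function alone. As
  \<open>cv\<close> draws the points of trees from the reals, the exhibited tree has to be encoded
  there.\<close>

locale zero_hyperbolic =
  fixes M :: "'p set" and d :: "'p \<Rightarrow> 'p \<Rightarrow> real"
  assumes d_nonneg: "\<And>x y. \<lbrakk>x \<in> M; y \<in> M\<rbrakk> \<Longrightarrow> 0 \<le> d x y"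
    and d_comm: "\<And>x y. \<lbrakk>x \<in> M; y \<in> M\<rbrakk> \<Longrightarrow> d x y = d y x"
    and d_zero: "\<And>x y. \<lbrakk>x \<in> M; y \<in> M\<rbrakk> \<Longrightarrow> d x y = 0 \<longleftrightarrow> x = y"
    and d_tri: "\<And>x y z. \<lbrakk>x \<in> M; y \<in> M; z \<in> M\<rbrakk> \<Longrightarrow> d x z \<le> d x y + d y z"
    and four_point: "\<And>x y z w. \<lbrakk>x \<in> M; y \<in> M; z \<in> M; w \<in> M\<rbrakk> \<Longrightarrow>
      d x y + d z w \<le> d x z + d y w \<or> d x y + d z w \<le> d x w + d y z"
begin

abbreviation gp :: "'p \<Rightarrow> 'p \<Rightarrow> 'p \<Rightarrow> real" where "gp \<equiv> gromov_product d"

lemma d_self [simp]: "x \<in> M \<Longrightarrow> d x x = 0"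
  using d_zero by blast

lemma gp_comm: "\<lbrakk>e \<in> M; x \<in> M; y \<in> M\<rbrakk> \<Longrightarrow> gp e x y = gp e y x"
  by (simp add: gromov_product_def d_comm)

lemma gp_nonneg: "\<lbrakk>e \<in> M; x \<in> M; y \<in> M\<rbrakk> \<Longrightarrow> 0 \<le> gp e x y"
  using d_tri[of x e y] d_comm[of x e] by (simp add: gromov_product_def)

lemma gp_le: "\<lbrakk>e \<in> M; x \<in> M; y \<in> M\<rbrakk> \<Longrightarrow> gp e x y \<le> d e x"
  using d_tri[of e x y] by (simp add: gromov_product_def)

text \<open>For a fixed base point the four-point inequality is an ultrametric inequality for Gromov
  products, with the minimum in place of the maximum.\<close>

lemma gp_ultra: "\<lbrakk>e \<in> M; x \<in> M; y \<in> M; z \<in> M\<rbrakk> \<Longrightarrow> min (gp e x y) (gp e y z) \<le> gp e x z"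
  using four_point[of x z e y] d_comm[of x e] d_comm[of y z] d_comm[of z e]
  by (auto simp add: gromov_product_def min_def field_simps)

lemma gp_base: "\<lbrakk>e \<in> M; e' \<in> M; x \<in> M; y \<in> M\<rbrakk> \<Longrightarrow> \<bar>gp e x y - gp e' x y\<bar> \<le> d e e'"
  using d_tri[of e e' x] d_tri[of e e' y] d_tri[of e' e x] d_tri[of e' e y] d_comm[of e e']
  by (simp add: gromov_product_def abs_le_iff field_simps)

definition btw :: "'p \<Rightarrow> 'p \<Rightarrow> 'p \<Rightarrow> bool" where
  "btw x y z \<longleftrightarrow> d x z = d x y + d y z"

text \<open>Geodesics that overlap in a non-trivial segment fit together. The condition
  \<open>b \<noteq> c\<close> excludes one alternative of the four-point inequality, and the other
  one says that the lengths add.\<close>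

lemma btw_trans:
  assumes "a \<in> M" "b \<in> M" "c \<in> M" "e \<in> M" "btw a b c" "btw b c e" "b \<noteq> c"
  shows "btw a c e" "btw a b e"
proof -
  have "d b c > 0" using d_nonneg[of b c] d_zero[of b c] assms by force
  then have "d a b + d b c + d c e \<le> d a e"
    using four_point[of a c b e] assms d_comm[of c b] unfolding btw_def by auto
  moreover have "d a e \<le> d a c + d c e" "d a c \<le> d a b + d b c" "d a e \<le> d a b + d b e"
    "d b e \<le> d b c + d c e" using d_tri assms by auto
  ultimately show "btw a c e" "btw a b e" unfolding btw_def by linarith+
qed

lemma filterlim_pair_sequentially:
  "filterlim (\<lambda>(i, j). F i j :: real) at_top (sequentially \<times>\<^sub>F sequentially) \<longleftrightarrow>
   (\<forall>Z. \<exists>N. \<forall>i\<ge>N. \<forall>j\<ge>N. Z \<le> F i j)"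
proof -
  have "eventually (\<lambda>(i, j). Z \<le> F i j) (sequentially \<times>\<^sub>F sequentially) \<longleftrightarrow>
      (\<exists>N. \<forall>i\<ge>N. \<forall>j\<ge>N. Z \<le> F i j)" for Z
    using eventually_prod_sequentially[of "\<lambda>(i, j). Z \<le> F i j"] by auto
  then show ?thesis unfolding filterlim_at_top by (simp add: case_prod_unfold)
qed

text \<open>The relation \<open>gromov_rel\<close> seen from a single base point. A change of base
  point alters Gromov products by a bounded amount, so the quantifier over base points
  collapses.\<close>

definition gprel :: "'p \<Rightarrow> (nat \<Rightarrow> 'p) \<Rightarrow> (nat \<Rightarrow> 'p) \<Rightarrow> bool" where
  "gprel e u v \<longleftrightarrow> (\<forall>Z. \<exists>N. \<forall>i\<ge>N. \<forall>j\<ge>N. Z \<le> gp e (u i) (v j))"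

lemma gprel_base:
  assumes "gprel e u v" "e \<in> M" "e' \<in> M" "range u \<subseteq> M" "range v \<subseteq> M"
  shows "gprel e' u v"
  unfolding gprel_def
proof
  fix Z
  obtain N where N: "\<And>i j. i \<ge> N \<Longrightarrow> j \<ge> N \<Longrightarrow> Z + d e e' \<le> gp e (u i) (v j)"
    using assms(1) unfolding gprel_def by meson
  have "Z \<le> gp e' (u i) (v j)" if "i \<ge> N" "j \<ge> N" for i j
    using N[OF that] gp_base[OF assms(2,3), of "u i" "v j"] range_subsetD[OF assms(4), of i]
      range_subsetD[OF assms(5), of j] by linarith
  then show "\<exists>N. \<forall>i\<ge>N. \<forall>j\<ge>N. Z \<le> gp e' (u i) (v j)" by blast
qed

lemma gprel_sym:
  assumes "gprel e u v" "e \<in> M" "range u \<subseteq> M" "range v \<subseteq> M"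
  shows "gprel e v u"
  unfolding gprel_def
proof
  fix Z
  obtain N where N: "\<And>i j. i \<ge> N \<Longrightarrow> j \<ge> N \<Longrightarrow> Z \<le> gp e (u i) (v j)"
    using assms(1) unfolding gprel_def by meson
  then have "\<And>i j. i \<ge> N \<Longrightarrow> j \<ge> N \<Longrightarrow> Z \<le> gp e (v i) (u j)"
    using gp_comm assms by (metis range_subsetD)
  then show "\<exists>N. \<forall>i\<ge>N. \<forall>j\<ge>N. Z \<le> gp e (v i) (u j)" by blast
qed

lemma gprel_trans:
  assumes "gprel e u v" "gprel e v w" "e \<in> M" "range u \<subseteq> M" "range v \<subseteq> M" "range w \<subseteq> M"
  shows "gprel e u w"
  unfolding gprel_def
proof
  fix Z
  obtain N where N: "\<And>i j. i \<ge> N \<Longrightarrow> j \<ge> N \<Longrightarrow> Z \<le> gp e (u i) (v j)"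
    using assms(1) unfolding gprel_def by meson
  obtain N' where N': "\<And>i j. i \<ge> N' \<Longrightarrow> j \<ge> N' \<Longrightarrow> Z \<le> gp e (v i) (w j)"
    using assms(2) unfolding gprel_def by meson
  have "Z \<le> gp e (u i) (w j)" if "i \<ge> max N N'" "j \<ge> max N N'" for i j
    using N[of i "max N N'"] N'[of "max N N'" j] gp_ultra[of e "u i" "v (max N N')" "w j"] assms that
    by (auto simp: min_def range_subsetD split: if_splits)
  then show "\<exists>N. \<forall>i\<ge>N. \<forall>j\<ge>N. Z \<le> gp e (u i) (w j)" by blast
qed

lemma converges_to_infinity_iff:
  assumes "e \<in> M"
  shows "converges_to_infinity M d u \<longleftrightarrow> range u \<subseteq> M \<and> gprel e u u"
  unfolding converges_to_infinity_def filterlim_pair_sequentially gprel_def[symmetric]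
  using gprel_base assms by blast

lemma gromov_rel_iff:
  assumes "e \<in> M"
  shows "(u, v) \<in> gromov_rel M d \<longleftrightarrow> range u \<subseteq> M \<and> range v \<subseteq> M \<and> gprel e u v"
proof -
  have "gprel e u u \<and> gprel e v v" if "range u \<subseteq> M" "range v \<subseteq> M" "gprel e u v"
    using that gprel_sym gprel_trans assms by blast
  then show ?thesis
    unfolding gromov_rel_def using converges_to_infinity_iff[OF assms] gprel_base assms
    by (auto simp: filterlim_pair_sequentially gprel_def[symmetric])
qed

text \<open>Isosceles property: of the three products of \<open>x\<close>, \<open>y\<close>,
  \<open>z\<close>, the two smallest agree.\<close>

lemma gp_le_cases:
  assumes "e \<in> M" "x \<in> M" "y \<in> M" "z \<in> M" "gp e x z < gp e y z"
  shows "gp e x y = gp e x z"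
  using gp_ultra[of e x y z] gp_ultra[of e x z y] gp_comm[of e z y] assms
  by (auto simp: min_def split: if_splits)

end

text \<open>A description of real trees without paths, convenient for computing with distances. It
  is equivalent to the path-theoretic definition: \<open>real_tree\<close> below gives one
  direction, \<open>real_tree_imp_rtree\<close> the other.\<close>

locale rtree = Metric_space M d for M :: "'p set" and d +
  assumes nonempty: "M \<noteq> {}"
    and four: "\<And>x y z w. \<lbrakk>x \<in> M; y \<in> M; z \<in> M; w \<in> M\<rbrakk> \<Longrightarrow>
      d x y + d z w \<le> d x z + d y w \<or> d x y + d z w \<le> d x w + d y z"
    and intermediate: "\<And>x y s. \<lbrakk>x \<in> M; y \<in> M; 0 \<le> s; s \<le> d x y\<rbrakk> \<Longrightarrow>
      \<exists>c\<in>M. d x c = s \<and> d c y = d x y - s"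

sublocale rtree \<subseteq> zero_hyperbolic
  by unfold_locales (simp, rule commute, simp, rule triangle, assumption+, rule four)

context rtree
begin

text \<open>The points \<open>x\<close>, \<open>y\<close>, \<open>z\<close> span a tripod, and the
  distance from \<open>c\<close> to \<open>z\<close> can be read off from the endpoint that
  \<open>c\<close> separates from \<open>z\<close>. The four-point inequality gives one direction,
  the triangle inequality the other.\<close>

lemma point_formula:
  assumes "x \<in> M" "y \<in> M" "z \<in> M" "c \<in> M" "btw x c y"
  shows "d c z = max (d x z - d x c) (d y z - d c y)"
proof -
  have "d c z \<le> max (d x z - d x c) (d y z - d c y)"
    using four[of c z x y] assms commute[of c x] commute[of z y] commute[of z x] commute[of c y]
    unfolding btw_def by auto
  moreover have "d x z \<le> d x c + d c z" "d y z \<le> d y c + d c z" using triangle assms by auto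
  ultimately show ?thesis using commute[of c y] by (auto simp: max_def)
qed

lemma obtain_point:
  assumes "x \<in> M" "y \<in> M" "0 \<le> s" "s \<le> d x y"
  obtains c where "c \<in> M" "d x c = s" "d c y = d x y - s" "btw x c y"
    "\<And>z. z \<in> M \<Longrightarrow> d c z = max (d x z - s) (d y z - (d x y - s))"
proof -
  obtain c where c: "c \<in> M" "d x c = s" "d c y = d x y - s" using intermediate assms by blast
  moreover have "btw x c y" using c unfolding btw_def by simp
  ultimately show ?thesis using that[of c] point_formula[OF assms(1,2) _ c(1)] by auto
qed

lemma btw_unique:
  assumes "x \<in> M" "y \<in> M" "p \<in> M" "q \<in> M" "btw x p y" "btw x q y" "d x p = d x q"
  shows "p = q"
proof -
  have "d p q = max (d x q - d x p) (d y q - d p y)"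
    using point_formula assms by blast
  also have "\<dots> = 0" using assms commute[of y q] unfolding btw_def by simp
  finally show ?thesis using assms by simp
qed

text \<open>Removing \<open>w\<close> separates \<open>x\<close> from \<open>y\<close>:
  \<open>0 < gp w x z\<close> says that \<open>z\<close> is on the side of \<open>x\<close>, and
  both sides are open.\<close>

lemma connectedin_contains_btw:
  assumes "connectedin mtopology S" "x \<in> S" "y \<in> S" "w \<in> M" "btw x w y"
  shows "w \<in> S"
proof (rule ccontr)
  assume w: "w \<notin> S"
  have SM: "S \<subseteq> M" using assms(1) connectedin_subset_topspace topspace_mtopology by metis
  then have xy: "x \<in> M" "y \<in> M" using assms by auto
  let ?U = "{z \<in> M. z \<noteq> w \<and> 0 < gp w x z}" and ?V = "{z \<in> M. z \<noteq> w \<and> gp w x z = 0}"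
  \<comment> \<open>An open ball about \<open>z\<close> that does not reach \<open>w\<close> stays
    on the side of \<open>z\<close>.\<close>
  have near: "z' \<noteq> w \<and> 0 < gp w z z'" if "z \<in> M" "z' \<in> M" "z \<noteq> w" "d z z' < d w z" for z z'
  proof -
    have "d w z \<le> d w z' + d z z'" "0 \<le> d w z'"
      using triangle[of w z' z] that assms(4) commute[of z z'] by auto
    then show ?thesis using that commute[of w z] by (auto simp: gromov_product_def)
  qed
  have U: "openin mtopology ?U"
    unfolding openin_mtopology
  proof (intro conjI allI impI)
    show "{z \<in> M. z \<noteq> w \<and> 0 < gp w x z} \<subseteq> M" by blast
    fix z assume "z \<in> {z \<in> M. z \<noteq> w \<and> 0 < gp w x z}"
    then have z: "z \<in> M \<and> z \<noteq> w \<and> 0 < gp w x z" by blast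
    have "mball z (d w z) \<subseteq> {z \<in> M. z \<noteq> w \<and> 0 < gp w x z}"
    proof
      fix z' assume "z' \<in> mball z (d w z)"
      then have z': "z' \<in> M" "d z z' < d w z" by auto
      then show "z' \<in> {z \<in> M. z \<noteq> w \<and> 0 < gp w x z}"
        using near[of z z'] z gp_ultra[of w x z z'] xy assms(4) by auto
    qed
    moreover have "0 < d w z" using z assms(4) mdist_pos_less[of w z] by auto
    ultimately show "\<exists>r>0. mball z r \<subseteq> {z \<in> M. z \<noteq> w \<and> 0 < gp w x z}" by blast
  qed
  have V: "openin mtopology ?V"
    unfolding openin_mtopology
  proof (intro conjI allI impI)
    show "{z \<in> M. z \<noteq> w \<and> gp w x z = 0} \<subseteq> M" by blast
    fix z assume "z \<in> {z \<in> M. z \<noteq> w \<and> gp w x z = 0}"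
    then have z: "z \<in> M \<and> z \<noteq> w \<and> gp w x z = 0" by blast
    have "mball z (d w z) \<subseteq> {z \<in> M. z \<noteq> w \<and> gp w x z = 0}"
    proof
      fix z' assume "z' \<in> mball z (d w z)"
      then have z': "z' \<in> M" "d z z' < d w z" by auto
      have "gp w x z' \<le> 0"
        using near[of z z'] z z' gp_ultra[of w x z' z] gp_comm[of w z z'] xy assms(4) by auto
      then show "z' \<in> {z \<in> M. z \<noteq> w \<and> gp w x z = 0}"
        using near[of z z'] z z' gp_nonneg[of w x z'] xy assms(4) by auto
    qed
    moreover have "0 < d w z" using z assms(4) mdist_pos_less[of w z] by auto
    ultimately show "\<exists>r>0. mball z r \<subseteq> {z \<in> M. z \<noteq> w \<and> gp w x z = 0}" by blast
  qed
  have "S \<subseteq> ?U \<union> ?V"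
  proof
    fix z assume "z \<in> S"
    then have "z \<in> M" "z \<noteq> w" "0 \<le> gp w x z" using SM w gp_nonneg xy assms(4) by auto
    then show "z \<in> ?U \<union> ?V" by (cases "gp w x z = 0") auto
  qed
  moreover have "x \<in> ?U" using xy w assms(2,4) mdist_pos_less[of w x] by (auto simp: gromov_product_def)
  moreover have "y \<in> ?V"
    using xy w assms(3,5) commute[of w x] unfolding btw_def by (auto simp: gromov_product_def)
  ultimately have "openin mtopology ?U \<and> openin mtopology ?V \<and> S \<subseteq> ?U \<union> ?V \<and>
      ?U \<inter> ?V \<inter> S = {} \<and> ?U \<inter> S \<noteq> {} \<and> ?V \<inter> S \<noteq> {}"
    using U V assms(2,3) by auto
  then show False using assms(1) unfolding connectedin by blast
qed

definition seg :: "'p \<Rightarrow> 'p \<Rightarrow> real \<Rightarrow> 'p" where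
  "seg x y s = (SOME c. c \<in> M \<and> d x c = s \<and> btw x c y)"

lemma seg:
  assumes "x \<in> M" "y \<in> M" "0 \<le> s" "s \<le> d x y"
  shows "seg x y s \<in> M" "d x (seg x y s) = s" "btw x (seg x y s) y"
proof -
  have "\<exists>c. c \<in> M \<and> d x c = s \<and> btw x c y" using obtain_point[OF assms] by metis
  then have "seg x y s \<in> M \<and> d x (seg x y s) = s \<and> btw x (seg x y s) y"
    unfolding seg_def by (rule someI_ex)
  then show "seg x y s \<in> M" "d x (seg x y s) = s" "btw x (seg x y s) y" by auto
qed

lemma seg_dist:
  assumes "x \<in> M" "y \<in> M" "s \<in> {0..d x y}" "t \<in> {0..d x y}"
  shows "d (seg x y s) (seg x y t) = \<bar>s - t\<bar>"
proof -
  have s: "seg x y s \<in> M" "d x (seg x y s) = s" "btw x (seg x y s) y"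
    and t: "seg x y t \<in> M" "d x (seg x y t) = t" "btw x (seg x y t) y"
    using seg assms by auto
  have "d (seg x y s) (seg x y t) = max (t - s) (d y (seg x y t) - d (seg x y s) y)"
    using point_formula[OF assms(1,2) t(1) s(1,3)] s t by simp
  also have "\<dots> = \<bar>s - t\<bar>" using s t commute[of y] unfolding btw_def by auto
  finally show ?thesis .
qed

lemma seg_image: "x \<in> M \<Longrightarrow> y \<in> M \<Longrightarrow> seg x y ` {0..d x y} = {c \<in> M. btw x c y}"
proof (intro equalityI subsetI)
  fix c assume "x \<in> M" "y \<in> M" "c \<in> {c \<in> M. btw x c y}"
  then have c: "c \<in> M" "btw x c y" and d: "d x c \<in> {0..d x y}" by (auto simp: btw_def)
  then have "c = seg x y (d x c)"
    using btw_unique[OF \<open>x \<in> M\<close> \<open>y \<in> M\<close> c(1) _ c(2)] seg[of x y "d x c"] \<open>x \<in> M\<close> \<open>y \<in> M\<close> by auto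
  then show "c \<in> seg x y ` {0..d x y}" using d by blast
qed (auto simp: seg)

text \<open>By connectedness an arc covers the segment between its endpoints. An excursion away from
  the segment would have to pass its branch point twice.\<close>

lemma arc_image:
  assumes p: "pathin mtopology p" "inj_on p {0..1}" "p 0 = x" "p 1 = y"
  shows "p ` {0..1} = {c \<in> M. btw x c y}"
proof (intro equalityI subsetI)
  have conn: "connectedin mtopology (p ` {a..b})" if "0 \<le> a" "b \<le> 1" for a b :: real
  proof (rule connectedin_continuous_map_image)
    show "continuous_map (top_of_set {0..1}) mtopology p" using p(1) unfolding pathin_def .
    show "connectedin (top_of_set {0..1}) {a..b}"
      using that by (simp add: connectedin_subtopology connected_Icc)
  qed
  have pM: "p t \<in> M" if "t \<in> {0..1}" for t
    using p(1) that unfolding pathin_def continuous_map_def by auto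
  then have xy: "x \<in> M" "y \<in> M" using p by auto
  show "c \<in> p ` {0..1}" if "c \<in> {c \<in> M. btw x c y}" for c
    using connectedin_contains_btw[OF conn[of 0 1], of x y c] that p by force
  fix w assume "w \<in> p ` {0..1}"
  then obtain t where t: "t \<in> {0..1}" "w = p t" by auto
  then have wM: "w \<in> M" using pM by auto
  have "btw x w y"
  proof (rule ccontr)
    assume nb: "\<not> btw x w y"
    \<comment> \<open>The distance from \<open>x\<close> to the branch point of the tripod
      \<open>x\<close>, \<open>y\<close>, \<open>w\<close>. That point is both between
      \<open>x\<close> and \<open>w\<close> and between \<open>w\<close> and
      \<open>y\<close>.\<close>
    let ?s = "gp x y w"
    have s: "0 \<le> ?s" "?s \<le> d x y" using gp_nonneg gp_le xy wM by auto
    obtain q where q: "q \<in> M" "d x q = ?s" "d q y = d x y - ?s" "btw x q y"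
      "\<And>z. z \<in> M \<Longrightarrow> d q z = max (d x z - ?s) (d y z - (d x y - ?s))"
      using obtain_point[OF xy s] by blast
    have "d q w = d x w - ?s" "d q w = d y w - (d x y - ?s)"
      using q(5)[OF wM] by (auto simp: gromov_product_def field_simps)
    then have b: "btw x q w" "btw w q y"
      using q(2-4) commute[of q w] commute[of w y] unfolding btw_def by linarith+
    have "q \<in> p ` {0..t}"
      by (rule connectedin_contains_btw[OF conn, of 0 t x w]) (use t p q b in auto)
    moreover have "q \<in> p ` {t..1}"
      by (rule connectedin_contains_btw[OF conn, of t 1 w y]) (use t p q b in auto)
    \<comment> \<open>Injectivity identifies the passage through \<open>q\<close> before time
      \<open>t\<close> with the one after it, so both take place at time \<open>t\<close>.\<close>
    ultimately obtain a b where "a \<in> {0..t}" "b \<in> {t..1}" "p a = q" "p b = q" by force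
    moreover then have "a = b" using p(2) t unfolding inj_on_def by auto
    ultimately have "q = w" using t by auto
    then show False using q nb by simp
  qed
  then show "w \<in> {c \<in> M. btw x c y}" using wM by blast
qed

lemma real_tree: "real_tree M d"
  unfolding real_tree_def
proof (intro conjI ballI)
  fix x y assume xy: "x \<in> M" "y \<in> M"
  show "\<exists>\<gamma>. \<gamma> ` {0..d x y} \<subseteq> M \<and> \<gamma> 0 = x \<and> \<gamma> (d x y) = y \<and>
        (\<forall>s\<in>{0..d x y}. \<forall>t\<in>{0..d x y}. d (\<gamma> s) (\<gamma> t) = \<bar>s - t\<bar>) \<and>
        (\<forall>p. pathin mtopology p \<and> inj_on p {0..1} \<and> p 0 = x \<and> p 1 = y
           \<longrightarrow> p ` {0..1} = \<gamma> ` {0..d x y})"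
  proof (intro exI[of _ "seg x y"] conjI ballI allI impI)
    show "seg x y ` {0..d x y} \<subseteq> M" using seg_image xy by auto
    show "seg x y 0 = x" using seg[of x y 0] xy by auto
    have "d x (seg x y (d x y)) = d x y" "btw x (seg x y (d x y)) y" "seg x y (d x y) \<in> M"
      using seg[of x y "d x y"] xy by auto
    then show "seg x y (d x y) = y" using xy by (auto simp: btw_def)
  qed (use seg_dist xy arc_image seg_image in auto)
qed (use nonempty Metric_space_axioms in auto)

end

section \<open>From uniqueness of arcs to the four-point inequality\<close>

lemma (in Metric_space) pathin_Lipschitz:
  assumes "\<And>s t. \<lbrakk>s \<in> {0..1}; t \<in> {0..1}\<rbrakk> \<Longrightarrow> d (p s) (p t) \<le> K * \<bar>s - t\<bar>"
    and "\<And>s. s \<in> {0..1} \<Longrightarrow> p s \<in> M" and "K > 0"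
  shows "pathin mtopology p"
  unfolding pathin_def continuous_map_to_metric
proof (intro ballI allI impI)
  fix x \<epsilon> :: real assume x: "x \<in> topspace (top_of_set {0..1})" and e: "\<epsilon> > 0"
  let ?U = "{0..1} \<inter> ball x (\<epsilon> / K)"
  have "p y \<in> mball (p x) \<epsilon>" if "y \<in> ?U" for y
  proof -
    have "d (p x) (p y) \<le> K * \<bar>x - y\<bar>" using assms x that by auto
    also have "\<dots> < \<epsilon>" using that assms(3) by (auto simp: dist_real_def field_simps)
    finally show ?thesis using assms(2) x that by auto
  qed
  moreover have "openin (top_of_set {0..1}) ?U" by (simp add: openin_open_Int)
  ultimately show "\<exists>U. openin (top_of_set {0..1}) U \<and> x \<in> U \<and> (\<forall>y\<in>U. p y \<in> mball (p x) \<epsilon>)"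
    using x e assms(3) by (intro exI[of _ ?U]) auto
qed

text \<open>The geodesic from \<open>z\<close> to its nearest point on \<open>\<gamma>\<close>,
  continued along \<open>\<gamma>\<close>, is an arc. Uniqueness of arcs puts the nearest point on
  the geodesic from \<open>z\<close> to \<open>\<gamma> 0\<close>, so the lengths add.\<close>

lemma real_tree_nearest:
  fixes \<gamma> :: "real \<Rightarrow> 'p"
  assumes "real_tree M d" and z: "z \<in> M"
    and \<gamma>: "\<And>s. s \<in> {0..D} \<Longrightarrow> \<gamma> s \<in> M"
      "\<And>s t. \<lbrakk>s \<in> {0..D}; t \<in> {0..D}\<rbrakk> \<Longrightarrow> d (\<gamma> s) (\<gamma> t) = \<bar>s - t\<bar>"
    and t: "t \<in> {0..D}" "\<And>s. s \<in> {0..D} \<Longrightarrow> d z (\<gamma> t) \<le> d z (\<gamma> s)"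
  shows "d z (\<gamma> 0) = d z (\<gamma> t) + t"
proof -
  interpret Metric_space M d using assms(1) unfolding real_tree_def by blast
  define e where "e = d z (\<gamma> t)"
  have D: "0 \<le> D" using t by auto
  have M0: "\<gamma> t \<in> M" "\<gamma> 0 \<in> M" using \<gamma> t D by auto
  show ?thesis
  \<comment> \<open>The concatenated path has length \<open>e + t\<close>; it can be rescaled to the
    unit interval when this is positive.\<close>
  proof (cases "e + t = 0")
    case True
    then show ?thesis using t(1) unfolding e_def by (auto simp: add_nonneg_eq_0_iff)
  next
    case False
    then have et: "e + t > 0" using t(1) nonneg[of z "\<gamma> t"] unfolding e_def by (simp add: less_le)
    have e0: "e \<ge> 0" unfolding e_def by simp
    obtain \<sigma> where \<sigma>: "\<sigma> ` {0..e} \<subseteq> M" "\<sigma> 0 = z" "\<sigma> e = \<gamma> t"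
      "\<And>s t. s \<in> {0..e} \<Longrightarrow> t \<in> {0..e} \<Longrightarrow> d (\<sigma> s) (\<sigma> t) = \<bar>s - t\<bar>"
      using assms(1) z M0 unfolding real_tree_def e_def by meson
    obtain \<kappa> where \<kappa>: "\<kappa> ` {0..d z (\<gamma> 0)} \<subseteq> M" "\<kappa> 0 = z" "\<kappa> (d z (\<gamma> 0)) = \<gamma> 0"
      "\<And>s t. s \<in> {0..d z (\<gamma> 0)} \<Longrightarrow> t \<in> {0..d z (\<gamma> 0)} \<Longrightarrow> d (\<kappa> s) (\<kappa> t) = \<bar>s - t\<bar>"
      "\<And>p. pathin mtopology p \<and> inj_on p {0..1} \<and> p 0 = z \<and> p 1 = \<gamma> 0
           \<Longrightarrow> p ` {0..1} = \<kappa> ` {0..d z (\<gamma> 0)}"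
      using assms(1) z M0 unfolding real_tree_def by meson
    define c where "c r = (if r \<le> e then \<sigma> r else \<gamma> (t - (r - e)))" for r
    have cM: "c r \<in> M" if "r \<in> {0..e + t}" for r
      using that \<sigma>(1) \<gamma>(1)[of "t - (r - e)"] t unfolding c_def by auto
    have c1: "d (c r) (c r') = \<bar>r - r'\<bar>" if "r \<in> {0..e}" "r' \<in> {0..e}" for r r'
      using that \<sigma>(4) unfolding c_def by auto
    have c2: "d (c r) (c r') = \<bar>r - r'\<bar>" if "r \<in> {e..e+t}" "r' \<in> {e..e+t}" for r r'
    proof -
      have "c r = \<gamma> (t - (r - e))" "c r' = \<gamma> (t - (r' - e))"
        using that \<sigma>(3) unfolding c_def by auto
      then show ?thesis using \<gamma>(2)[of "t - (r - e)" "t - (r' - e)"] that t by auto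
    qed
    have cL: "d (c r) (c r') \<le> \<bar>r - r'\<bar>" if "r \<in> {0..e}" "r' \<in> {e..e+t}" for r r'
    proof -
      have "d (c r) (c r') \<le> d (c r) (c e) + d (c e) (c r')"
        using cM that t by (intro triangle) auto
      then show ?thesis using c1[of r e] c2[of e r'] that t e0 by auto
    qed
    have Lip: "d (c r) (c r') \<le> \<bar>r - r'\<bar>" if "r \<in> {0..e+t}" "r' \<in> {0..e+t}" for r r'
    proof -
      consider "r \<le> e" "r' \<le> e" | "r \<ge> e" "r' \<ge> e" | "r \<le> e" "r' \<ge> e" | "r \<ge> e" "r' \<le> e"
        by linarith
      then show ?thesis
        using c1[of r r'] c2[of r r'] cL[of r r'] cL[of r' r] commute[of "c r" "c r'"] that
        by cases (auto simp: abs_minus_commute)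
    qed
    \<comment> \<open>Injectivity across the joint: a coincidence would give a point of
      \<open>\<gamma>\<close> at distance \<open>r < e\<close> from \<open>z\<close>.\<close>
    have inj': False if "r \<in> {0..<e}" "r' \<in> {e..e+t}" "c r = c r'" for r r'
    proof -
      have "c r' = \<gamma> (t - (r' - e))" using that \<sigma>(3) unfolding c_def by auto
      moreover have "t - (r' - e) \<in> {0..D}" using that t by auto
      ultimately have "e \<le> d z (c r)" using t(2) that(3) unfolding e_def by simp
      moreover have "d z (c r) = r" using c1[of 0 r] \<sigma>(2) that e0 unfolding c_def by auto
      ultimately show False using that by auto
    qed
    have inj: "r = r'" if "r \<in> {0..e+t}" "r' \<in> {0..e+t}" "c r = c r'" for r r'
    proof -
      have z0: "d (c r) (c r') = 0" using that cM by simp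
      consider "r \<le> e" "r' \<le> e" | "r \<ge> e" "r' \<ge> e" | "r < e" "r' \<ge> e" | "r \<ge> e" "r' < e"
        by linarith
      then show ?thesis
        using c1[of r r'] c2[of r r'] inj'[of r r'] inj'[of r' r] that z0 by cases auto
    qed
    define p where "p s = c ((e + t) * s)" for s
    have rng: "(e + t) * s \<in> {0..e + t}" if "s \<in> {0..1}" for s
      using that et mult_left_le[of s "e + t"] by auto
    have "pathin mtopology p"
    proof (rule pathin_Lipschitz[OF _ _ et])
      fix s s' :: real assume "s \<in> {0..1}" "s' \<in> {0..1}"
      then have "d (p s) (p s') \<le> \<bar>(e + t) * s - (e + t) * s'\<bar>"
        unfolding p_def using Lip rng by blast
      also have "\<dots> = (e + t) * \<bar>s - s'\<bar>"
        using et by (simp add: abs_mult flip: right_diff_distrib)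
      finally show "d (p s) (p s') \<le> (e + t) * \<bar>s - s'\<bar>" .
    qed (use cM rng p_def in auto)
    moreover have "inj_on p {0..1}"
    proof (rule inj_onI)
      fix s s' :: real assume "s \<in> {0..1}" "s' \<in> {0..1}" "p s = p s'"
      then have "(e + t) * s = (e + t) * s'" unfolding p_def using inj rng by blast
      then show "s = s'" using et by simp
    qed
    moreover have "p 0 = z" unfolding p_def c_def using \<sigma> e0 by simp
    moreover have "p 1 = \<gamma> 0" unfolding p_def c_def using \<sigma> e0 t by auto
    ultimately have "p ` {0..1} = \<kappa> ` {0..d z (\<gamma> 0)}" using \<kappa>(5) by blast
    \<comment> \<open>The joint of the two pieces, which therefore lies on the geodesic
      \<open>\<kappa>\<close>.\<close>
    moreover have "\<gamma> t = p (e / (e + t))" unfolding p_def c_def using \<sigma> et by simp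
    moreover have "e / (e + t) \<in> {0..1}" using et e0 t by (auto simp: field_simps)
    ultimately have "\<gamma> t \<in> \<kappa> ` {0..d z (\<gamma> 0)}" by blast
    then obtain r where r: "r \<in> {0..d z (\<gamma> 0)}" "\<gamma> t = \<kappa> r" by auto
    have "d z (\<gamma> t) = r" using \<kappa>(4)[of 0 r] \<kappa>(2) r by auto
    moreover have "d (\<gamma> t) (\<gamma> 0) = d z (\<gamma> 0) - r"
      using \<kappa>(4)[of r "d z (\<gamma> 0)"] \<kappa>(3) r by auto
    moreover have "d (\<gamma> t) (\<gamma> 0) = t" using \<gamma>(2)[of t 0] t D by auto
    ultimately show ?thesis by simp
  qed
qed

text \<open>Project \<open>z\<close> and \<open>w\<close> to the geodesic from \<open>x\<close> to
  \<open>y\<close>. The path through the two feet bounds \<open>d z w\<close>, and the order of the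
  feet decides which alternative of the four-point inequality holds.\<close>

lemma real_tree_imp_rtree:
  assumes "real_tree M d"
  shows "rtree M d"
proof -
  interpret Metric_space M d using assms unfolding real_tree_def by blast
  have geo: "\<exists>\<gamma>. \<gamma> ` {0..d x y} \<subseteq> M \<and> \<gamma> 0 = x \<and> \<gamma> (d x y) = y \<and>
     (\<forall>s\<in>{0..d x y}. \<forall>t\<in>{0..d x y}. d (\<gamma> s) (\<gamma> t) = \<bar>s - t\<bar>)" if "x \<in> M" "y \<in> M" for x y
    using assms that unfolding real_tree_def by meson
  have proj: "\<exists>t\<in>{0..d x y}. d z x = d z (\<gamma> t) + t \<and> d z y = d z (\<gamma> t) + (d x y - t)"
    if xyz: "x \<in> M" "y \<in> M" "z \<in> M"
      and \<gamma>: "\<gamma> ` {0..d x y} \<subseteq> M" "\<gamma> 0 = x" "\<gamma> (d x y) = y"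
      "\<And>s t. s\<in>{0..d x y} \<Longrightarrow> t\<in>{0..d x y} \<Longrightarrow> d (\<gamma> s) (\<gamma> t) = \<bar>s - t\<bar>" for x y z \<gamma>
  proof -
    have "continuous_on {0..d x y} (\<lambda>s. d z (\<gamma> s))"
    proof (rule continuous_onI)
      fix s \<epsilon> :: real assume s: "s \<in> {0..d x y}" and "\<epsilon> > 0"
      have "dist (d z (\<gamma> s')) (d z (\<gamma> s)) \<le> \<epsilon>" if "s' \<in> {0..d x y}" "dist s' s < \<epsilon>" for s'
      proof -
        have "d z (\<gamma> s') \<le> d z (\<gamma> s) + d (\<gamma> s) (\<gamma> s')" "d z (\<gamma> s) \<le> d z (\<gamma> s') + d (\<gamma> s') (\<gamma> s)"
          using \<gamma>(1) s that(1) xyz(3) by (auto intro!: triangle)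
        then show ?thesis using \<gamma>(4)[OF s that(1)] \<gamma>(4)[OF that(1) s] that(2) by (auto simp: dist_real_def abs_le_iff)
      qed
      then show "\<exists>da>0. \<forall>x'\<in>{0..d x y}. dist x' s < da \<longrightarrow> dist (d z (\<gamma> x')) (d z (\<gamma> s)) \<le> \<epsilon>"
        using \<open>\<epsilon> > 0\<close> by blast
    qed
    then obtain t where t: "t \<in> {0..d x y}" "\<And>s. s \<in> {0..d x y} \<Longrightarrow> d z (\<gamma> t) \<le> d z (\<gamma> s)"
      using continuous_attains_inf[of "{0..d x y}" "\<lambda>s. d z (\<gamma> s)"] by fastforce
    have "d z (\<gamma> 0) = d z (\<gamma> t) + t"
      by (rule real_tree_nearest[OF assms xyz(3), of "d x y"]) (use \<gamma> t in auto)
    \<comment> \<open>The same statement for the reversed geodesic yields the distance to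
      \<open>y\<close>.\<close>
    moreover have "d z (\<gamma> (d x y - 0)) = d z (\<gamma> (d x y - (d x y - t))) + (d x y - t)"
      by (rule real_tree_nearest[OF assms xyz(3), of "d x y" "\<lambda>s. \<gamma> (d x y - s)"])
        (use \<gamma> t in auto)
    ultimately show ?thesis using \<gamma>(2,3) t(1) by (intro bexI[of _ t]) auto
  qed
  have inter: "\<exists>c\<in>M. d x c = s \<and> d c y = d x y - s"
    if xy: "x \<in> M" "y \<in> M" and s: "0 \<le> s" "s \<le> d x y" for x y s
  proof -
    obtain \<gamma> where \<gamma>: "\<gamma> ` {0..d x y} \<subseteq> M" "\<gamma> 0 = x" "\<gamma> (d x y) = y"
      "\<And>s t. s\<in>{0..d x y} \<Longrightarrow> t\<in>{0..d x y} \<Longrightarrow> d (\<gamma> s) (\<gamma> t) = \<bar>s - t\<bar>"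
      using geo[OF xy] by blast
    then show ?thesis using s \<gamma>(4)[of 0 s] \<gamma>(4)[of s "d x y"] by (intro bexI[of _ "\<gamma> s"]) auto
  qed
  show ?thesis
  proof
    show "M \<noteq> {}" using assms unfolding real_tree_def by blast
    show "\<exists>c\<in>M. d x c = s \<and> d c y = d x y - s" if "x \<in> M" "y \<in> M" "0 \<le> s" "s \<le> d x y" for x y s
      using inter that .
    fix x y z w assume m: "x \<in> M" "y \<in> M" "z \<in> M" "w \<in> M"
    obtain \<gamma> where \<gamma>: "\<gamma> ` {0..d x y} \<subseteq> M" "\<gamma> 0 = x" "\<gamma> (d x y) = y"
      "\<And>s t. s\<in>{0..d x y} \<Longrightarrow> t\<in>{0..d x y} \<Longrightarrow> d (\<gamma> s) (\<gamma> t) = \<bar>s - t\<bar>"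
      using geo[OF m(1,2)] by blast
    obtain s where s: "s \<in> {0..d x y}" "d z x = d z (\<gamma> s) + s" "d z y = d z (\<gamma> s) + (d x y - s)"
      using proj[OF m(1-3) \<gamma>] by blast
    obtain t where t: "t \<in> {0..d x y}" "d w x = d w (\<gamma> t) + t" "d w y = d w (\<gamma> t) + (d x y - t)"
      using proj[OF m(1,2,4) \<gamma>] by blast
    have st: "\<gamma> s \<in> M" "\<gamma> t \<in> M" using \<gamma>(1) s t by auto
    have "d z w \<le> d z (\<gamma> s) + d (\<gamma> s) (\<gamma> t) + d (\<gamma> t) w"
      using triangle[OF m(3) st(1) m(4)] triangle[OF st m(4)] by linarith
    then show "d x y + d z w \<le> d x z + d y w \<or> d x y + d z w \<le> d x w + d y z"
      using s t \<gamma>(4)[OF s(1) t(1)] commute[of x z] commute[of y w] commute[of x w]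
        commute[of y z] commute[of "\<gamma> t" w]
      by (cases "s \<le> t") auto
  qed
qed

section \<open>Isometries of trees and their axes\<close>

locale tree_action = group F + rtree "tpts T" "tdist T"
  for F :: "('g, 'm) monoid_scheme" (structure) and T :: "('g, 'p) gtree" +
  assumes isometric: "isometric_action F T"
begin

abbreviation "M \<equiv> tpts T"
abbreviation "d \<equiv> tdist T"
abbreviation "act \<equiv> tact T"

lemma action: "group_action F M act"
  using isometric unfolding isometric_action_def by blast

lemma act_closed [simp]: "g \<in> carrier F \<Longrightarrow> x \<in> M \<Longrightarrow> act g x \<in> M"
  using group_action.surj_prop[OF action] by blast

lemma act_mult: "\<lbrakk>g \<in> carrier F; h \<in> carrier F; x \<in> M\<rbrakk> \<Longrightarrow> act (g \<otimes> h) x = act g (act h x)"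
  using group_action.composition_rule[OF action] by blast

lemma act_one [simp]: "x \<in> M \<Longrightarrow> act \<one> x = x"
  using group_action.id_eq_one[OF action] by (metis restrict_apply)

lemma act_isom [simp]: "\<lbrakk>g \<in> carrier F; x \<in> M; y \<in> M\<rbrakk> \<Longrightarrow> d (act g x) (act g y) = d x y"
  using isometric unfolding isometric_action_def by blast

lemma act_inv_cancel [simp]: "\<lbrakk>g \<in> carrier F; x \<in> M\<rbrakk> \<Longrightarrow> act g (act (inv g) x) = x"
  using act_mult[of g "inv g" x] by simp

lemma act_inv_cancel' [simp]: "\<lbrakk>g \<in> carrier F; x \<in> M\<rbrakk> \<Longrightarrow> act (inv g) (act g x) = x"
  using act_mult[of "inv g" g x] by simp

lemma d_act_left: "\<lbrakk>g \<in> carrier F; x \<in> M; y \<in> M\<rbrakk> \<Longrightarrow> d (act g x) y = d x (act (inv g) y)"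
  using act_isom[of g x "act (inv g) y"] by simp

lemma btw_act: "\<lbrakk>g \<in> carrier F; x \<in> M; y \<in> M; z \<in> M; btw x y z\<rbrakk> \<Longrightarrow>
    btw (act g x) (act g y) (act g z)"
  by (simp add: btw_def)

abbreviation lt :: "'g \<Rightarrow> real" where "lt \<equiv> length_fun F T"

text \<open>By the four-point inequality for \<open>z\<close>, \<open>g z\<close>, \<open>g\<^sup>n z\<close>, \<open>g\<^sup>n\<^sup>+\<^sup>1 z\<close> the displacement of \<open>z\<close> under
  \<open>g\<^sup>n\<close> grows at least linearly.\<close>

lemma displacement_ge:
  assumes g: "g \<in> carrier F" and x: "x \<in> M" "z \<in> M"
  shows "d z (act (g \<otimes> g) z) - d z (act g z) \<le> d x (act g x)"
proof (rule ccontr)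
  define L where "L = d z (act (g \<otimes> g) z) - d z (act g z)"
  define D where "D n = d z (act (g [^] (n::nat)) z)" for n
  assume "\<not> ?thesis"
  then have less: "d x (act g x) < L" unfolding L_def by simp
  then have L: "0 < L" using nonneg[of x "act g x"] by linarith
  have step: "act (g [^] Suc n) y = act g (act (g [^] n) y)" if "y \<in> M" for n y
    using that g act_mult[of g "g [^] n" y] unfolding nat_pow_Suc2[OF g] by simp
  \<comment> \<open>The second conjunct is carried along to exclude one alternative of the
    four-point inequality, which would force \<open>D (Suc (Suc n)) \<le> D 1\<close>.\<close>
  have grow: "D (Suc n) + L \<le> D (Suc (Suc n)) \<and> D 1 \<le> D (Suc n)" for n
  proof (induction n)
    case 0
    show ?case using g act_mult[of g g z] x unfolding D_def L_def by (simp add: numeral_2_eq_2)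
  next
    case (Suc n)
    let ?a = "act (g [^] Suc (Suc n)) z" and ?b = "act (g [^] Suc (Suc (Suc n))) z"
    have "d z ?a + d (act g z) ?b \<le> d z (act g z) + d ?a ?b \<or>
        d z ?a + d (act g z) ?b \<le> d z ?b + d ?a (act g z)"
      using four[of z ?a "act g z" ?b] g x commute[of ?a "act g z"] by fastforce
    moreover have "d (act g z) ?b = D (Suc (Suc n))" "d (act g z) ?a = D (Suc n)"
      using step[OF x(2), of "Suc (Suc n)"] step[OF x(2), of "Suc n"] g x unfolding D_def by auto
    moreover have "d ?a ?b = D 1"
      using act_mult[of "g [^] Suc (Suc n)" g z] g x unfolding D_def by simp
    moreover have "D 1 = d z (act g z)" using g unfolding D_def by simp
    ultimately show ?case using Suc L commute[of "act g z" ?a] unfolding D_def by linarith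
  qed
  have "real n * L + D 1 \<le> D (Suc n)" for n
  proof (induction n)
    case (Suc n)
    then show ?case using grow[of n] by (simp add: algebra_simps)
  qed simp
  \<comment> \<open>The orbit of \<open>x\<close> moves with speed at most
    \<open>d x (act g x)\<close> and stays at bounded distance from that of \<open>z\<close>, whose
    speed is at least the larger number \<open>L\<close>.\<close>
  moreover have "d x (act (g [^] n) x) \<le> real n * d x (act g x)" for n
  proof (induction n)
    case (Suc n)
    have "d x (act (g [^] Suc n) x) \<le> d x (act g x) + d (act g x) (act g (act (g [^] n) x))"
      using step[OF x(1), of n] triangle[of x "act g x" "act (g [^] Suc n) x"] g x by auto
    then show ?case using Suc g x by (simp add: algebra_simps)
  qed (use x in simp)
  moreover have "D n \<le> d x (act (g [^] n) x) + 2 * d x z" for n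
  proof -
    have "D n \<le> d z x + d x (act (g [^] n) z)" unfolding D_def using g x by (intro triangle) auto
    moreover have "d x (act (g [^] n) z) \<le> d x (act (g [^] n) x) + d (act (g [^] n) x) (act (g [^] n) z)"
      using g x by (intro triangle) auto
    ultimately show ?thesis using g x commute[of x z] by simp
  qed
  ultimately have "real n * L + D 1 \<le> real (Suc n) * d x (act g x) + 2 * d x z" for n
    by (meson order_trans add_right_mono)
  then have *: "real n * (L - d x (act g x)) \<le> d x (act g x) + 2 * d x z - D 1" for n
    by (simp add: algebra_simps)
  obtain n where "(d x (act g x) + 2 * d x z - D 1) < real n * (L - d x (act g x))"
    using ex_less_of_nat_mult[of "L - d x (act g x)"] less by auto
  then show False using *[of n] by simp
qed

text \<open>The point \<open>act g p\<close> divides the segment from \<open>g z\<close> to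
  \<open>g (g z)\<close> just as \<open>p\<close> divides the one from \<open>z\<close> to
  \<open>g z\<close>, so two uses of \<open>point_formula\<close> give the displacement of
  \<open>p\<close>.\<close>

lemma translation_point:
  assumes g: "g \<in> carrier F" and z: "z \<in> M" and s: "0 \<le> s" "2 * s \<le> d z (act g z)"
  obtains p where "p \<in> M" "d z p = s"
    "d p (act g p) = max (d z (act g z) - 2 * s) (d z (act (g \<otimes> g) z) - d z (act g z))"
    "\<And>y. y \<in> M \<Longrightarrow> d p y = max (d z y - s) (d (act g z) y - (d z (act g z) - s))"
proof -
  let ?D = "d z (act g z)"
  have gz: "act g z \<in> M" "act (g \<otimes> g) z = act g (act g z)" using g z act_mult by auto
  obtain p where p: "p \<in> M" "d z p = s" "d p (act g z) = ?D - s" "btw z p (act g z)"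
    "\<And>y. y \<in> M \<Longrightarrow> d p y = max (d z y - s) (d (act g z) y - (?D - s))"
    using obtain_point[OF z gz(1), of s] s by auto
  have b: "btw (act g z) (act g p) (act g (act g z))" using btw_act[OF g z p(1) gz(1) p(4)] .
  have "d (act g p) p = max (d (act g z) p - d (act g z) (act g p))
      (d (act g (act g z)) p - d (act g p) (act g (act g z)))"
    by (rule point_formula[OF _ _ _ _ b]) (use g z p in auto)
  also have "\<dots> = max (?D - s - s) (d p (act g (act g z)) - (?D - s))"
    using p g z commute[of p "act g z"] commute[of "act g (act g z)" p] by simp
  also have "d p (act g (act g z)) = max (d z (act g (act g z)) - s) (?D - (?D - s))"
    using p(5)[of "act g (act g z)"] g z by simp
  finally have "d p (act g p) = max (?D - 2 * s) (d z (act (g \<otimes> g) z) - ?D)"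
    using gz s commute[of p "act g p"] by (auto simp: max_def)
  then show ?thesis using that[OF p(1,2) _ p(5)] by blast
qed

text \<open>The midpoint of \<open>z\<close> and \<open>g z\<close> attains the infimum, and
  \<open>displacement_ge\<close> bounds all other displacements from below. Hence one orbit
  determines the whole length function.\<close>

lemma lt_eq:
  assumes g: "g \<in> carrier F" and z: "z \<in> M"
  shows "lt g = max 0 (d z (act (g \<otimes> g) z) - d z (act g z))"
proof -
  obtain p where p: "p \<in> M"
    "d p (act g p) = max (d z (act g z) - 2 * (d z (act g z) / 2)) (d z (act (g \<otimes> g) z) - d z (act g z))"
    using translation_point[OF g z, of "d z (act g z) / 2"] by auto
  have "Inf ((\<lambda>x. d x (act g x)) ` M) = d p (act g p)"
  proof (rule cInf_eq_minimum)
    show "d p (act g p) \<in> (\<lambda>x. d x (act g x)) ` M" using p(1) by blast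
    fix y assume "y \<in> (\<lambda>x. d x (act g x)) ` M"
    then show "d p (act g p) \<le> y" using p displacement_ge[OF g _ z] nonneg by auto
  qed
  then show ?thesis using p g unfolding length_fun_def by simp
qed

lemma lt_le: "g \<in> carrier F \<Longrightarrow> x \<in> M \<Longrightarrow> lt g \<le> d x (act g x)"
  using displacement_ge[of g x x] lt_eq[of g x] by simp

lemma lt_nonneg: "g \<in> carrier F \<Longrightarrow> 0 \<le> lt g"
  using lt_eq nonempty by fastforce

definition axis :: "'g \<Rightarrow> 'p set" where
  "axis g = {x \<in> M. d x (act g x) = lt g}"

lemma axis_act: "\<lbrakk>g \<in> carrier F; x \<in> axis g\<rbrakk> \<Longrightarrow> act g x \<in> axis g \<and> act (inv g) x \<in> axis g"
  by (auto simp: axis_def d_act_left)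

lemma axis_projection:
  assumes g: "g \<in> carrier F" "0 < lt g" and z: "z \<in> M"
  obtains p where "p \<in> axis g" "\<And>y. y \<in> axis g \<Longrightarrow> btw z p y"
proof -
  let ?D = "d z (act g z)"
  \<comment> \<open>The segment from \<open>z\<close> to \<open>g z\<close> runs to the axis,
    follows it for the length \<open>lt g\<close>, and leaves it for as long as it took to reach
    it.\<close>
  define s where "s = (?D - lt g) / 2"
  have L: "lt g = d z (act (g \<otimes> g) z) - ?D" using lt_eq[OF g(1) z] g(2) by simp
  have s: "0 \<le> s" "2 * s \<le> ?D" using lt_le[OF g(1) z] g(2) unfolding s_def by auto
  obtain p where p: "p \<in> M" "d z p = s" "d p (act g p) = max (?D - 2 * s) (d z (act (g \<otimes> g) z) - ?D)"
    "\<And>y. y \<in> M \<Longrightarrow> d p y = max (d z y - s) (d (act g z) y - (?D - s))"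
    using translation_point[OF g(1) z s] by blast
  have D: "?D = 2 * s + lt g" unfolding s_def by (simp add: field_simps)
  then have "p \<in> axis g" using p(1,3) L unfolding axis_def by simp
  moreover have "btw z p y" if "y \<in> axis g" for y
  proof -
    have y: "y \<in> M" "d y (act g y) = lt g" using that unfolding axis_def by auto
    have "d (act g z) y \<le> d (act g z) (act g y) + d (act g y) y"
      using y g z by (intro triangle) auto
    then have "d p y = d z y - s"
      using p(4)[OF y(1)] y z g commute[of "act g y" y] D by (auto simp: max_def)
    then show ?thesis using p unfolding btw_def by simp
  qed
  ultimately show ?thesis using that by blast
qed

lemma btw_sym: "btw x y z \<longleftrightarrow> btw z y x"
  by (auto simp: btw_def commute)

text \<open>The projection of \<open>z\<close> to the axis is between \<open>z\<close> and each of
  \<open>x\<close> and \<open>y\<close>, whereas \<open>z\<close> is between \<open>x\<close> and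
  \<open>y\<close>; so \<open>z\<close> is its own projection.\<close>

lemma axis_convex:
  assumes g: "g \<in> carrier F" "0 < lt g" and "x \<in> axis g" "y \<in> axis g" "z \<in> M" "btw x z y"
  shows "z \<in> axis g"
proof -
  obtain p where p: "p \<in> axis g" "\<And>y. y \<in> axis g \<Longrightarrow> btw z p y"
    using axis_projection[OF g assms(5)] by blast
  have pM: "p \<in> M" "x \<in> M" "y \<in> M" using p assms unfolding axis_def by auto
  have "d x y \<le> d x p + d p y" using triangle pM by blast
  moreover have "d z x = d z p + d p x" "d z y = d z p + d p y" "d x y = d x z + d z y"
    using p(2) assms unfolding btw_def by auto
  ultimately have "d z p \<le> 0" using commute[of x z] commute[of p x] by linarith
  then have "z = p" using nonneg[of z p] assms(5) pM zero[of z p] by linarith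
  then show ?thesis using p by simp
qed

text \<open>If the axes are disjoint, the bridge \<open>[p, q]\<close> between them is traversed twice by
  \<open>g \<otimes> h\<close> in each period, which makes its translation length too large.\<close>

lemma axes_meet:
  assumes g: "g \<in> carrier F" "0 < lt g" and h: "h \<in> carrier F" "0 < lt h"
    and gh: "lt (g \<otimes> h) = lt g + lt h"
  shows "axis g \<inter> axis h \<noteq> {}"
proof -
  obtain z where "z \<in> M" using nonempty by blast
  then obtain x where x: "x \<in> axis g" using axis_projection[OF g] by metis
  then have xM: "x \<in> M" unfolding axis_def by auto
  obtain p where p: "p \<in> axis h" "\<And>y. y \<in> axis h \<Longrightarrow> btw x p y"
    using axis_projection[OF h xM] by blast
  then have pM: "p \<in> M" unfolding axis_def by auto
  obtain q where q: "q \<in> axis g" "\<And>y. y \<in> axis g \<Longrightarrow> btw p q y"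
    using axis_projection[OF g pM] by blast
  then have qM: "q \<in> M" unfolding axis_def by auto
  \<comment> \<open>The point \<open>p\<close> is the projection of \<open>x\<close> to the axis of
    \<open>h\<close>, and \<open>q\<close> lies on the way from \<open>p\<close> to
    \<open>x\<close>, so \<open>p\<close> is the projection of \<open>q\<close> as well.\<close>
  have qp: "btw q p y" if "y \<in> axis h" for y
  proof -
    have yM: "y \<in> M" using that unfolding axis_def by auto
    have "d x y \<le> d x q + d q y" "d q y \<le> d q p + d p y" using triangle xM qM yM pM by auto
    moreover have "d p x = d p q + d q x" "d x y = d x p + d p y"
      using q(2)[OF x] p(2)[OF that] unfolding btw_def by auto
    ultimately show ?thesis
      unfolding btw_def using commute[of p x] commute[of p q] commute[of q x] by linarith
  qed
  have "p = q"
  proof (rule ccontr)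
    assume ne: "p \<noteq> q"
    \<comment> \<open>With \<open>f = g \<otimes> h\<close> one has \<open>f a = g p\<close>.
      Consecutive pieces of the path \<open>a\<close>, \<open>p\<close>, \<open>q\<close>,
      \<open>g q\<close>, \<open>g p\<close>, \<open>f p\<close> overlap in non-trivial segments, so
      the path is geodesic; hence \<open>a\<close>, \<open>f a\<close>, \<open>f (f a)\<close> are
      aligned and \<open>f\<close> translates by \<open>d a (f a)\<close>.\<close>
    define a where "a = act (inv h) p"
    define f where "f = g \<otimes> h"
    have f: "f \<in> carrier F" unfolding f_def using g h by simp
    have aM: "a \<in> M" and ah: "a \<in> axis h" using axis_act[OF h(1) p(1)] h pM unfolding a_def by auto
    have fa: "act f a = act g p" unfolding f_def a_def using g h pM act_mult[of g h] by simp
    have fp: "act f p = act g (act h p)" unfolding f_def using g h pM act_mult by simp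
    have M': "act g q \<in> M" "act g p \<in> M" "act f p \<in> M" "act f a \<in> M" "act f (act f a) \<in> M"
      using g f pM qM aM by auto
    have b1: "btw a p q" using qp[OF ah] btw_sym by blast
    have b2: "btw p q (act g q)" using q(2) axis_act[OF g(1) q(1)] by blast
    have "btw (act (inv g) q) q p" using q(2) axis_act[OF g(1) q(1)] btw_sym by blast
    then have b3: "btw q (act g q) (act g p)"
      using btw_act[OF g(1), of "act (inv g) q" q p] g qM pM by simp
    have "btw q p (act h p)" using qp axis_act[OF h(1) p(1)] by blast
    then have b4: "btw (act g q) (act g p) (act f p)"
      using btw_act[OF g(1), of q p "act h p"] g h qM pM fp by simp
    have dq: "d q (act g q) = lt g" using q unfolding axis_def by simp
    then have ne1: "q \<noteq> act g q" using g qM by auto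
    have dqp: "d (act g q) (act g p) = d p q" using g qM pM commute by simp
    then have ne2: "act g q \<noteq> act g p" using ne pM qM zero[of p q] M' by auto
    have dap: "d a p = lt h" using d_act_left[of "inv h" p p] p(1) h pM
      unfolding a_def axis_def by simp
    have ne3: "act f a \<noteq> act f p"
      using act_isom[OF f aM pM] dap h M' by auto
    have c1: "btw a q (act g q)" using btw_trans[OF aM pM qM M'(1) b1 b2 ne] by blast
    have c2: "btw a (act g q) (act g p)" using btw_trans[OF aM qM M'(1,2) c1 b3 ne1] by blast
    have c3: "btw a (act g p) (act f p)" using btw_trans[OF aM M'(1,2,3) c2 b4 ne2] by blast
    have "btw p q (act g p)" using btw_trans[OF pM qM M'(1,2) b2 b3 ne1] by blast
    then have "btw a p (act f a)" using btw_trans[OF aM pM qM M'(2) b1 _ ne] fa by simp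
    then have "btw (act f a) (act f p) (act f (act f a))" using btw_act[OF f aM pM] f aM by simp
    then have c4: "btw a (act f a) (act f (act f a))"
      using btw_trans(2)[OF aM M'(4,3,5) _ _ ne3] c3 fa by simp
    have "lt f = d a (act f a)"
      using lt_eq[OF f aM] c4 act_mult[OF f f aM] f aM unfolding btw_def by simp
    also have "\<dots> = lt h + d p q + lt g + d p q"
      using b1 c1 c2 dap dq dqp fa unfolding btw_def by simp
    finally show False using gh ne pM qM mdist_pos_less[of p q] unfolding f_def by simp
  qed
  then show ?thesis using p q by blast
qed

text \<open>Helly's theorem for subtrees: the projection of a common point of the first axes to the next
  axis lies between that point and every point of the next axis, hence on the first axes as well.\<close>

lemma axes_common_point:
  assumes "finite S" "S \<subseteq> carrier F" "\<And>g. g \<in> S \<Longrightarrow> 0 < lt g"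
    and "\<And>g h. \<lbrakk>g \<in> S; h \<in> S; g \<noteq> h\<rbrakk> \<Longrightarrow> lt (g \<otimes> h) = lt g + lt h"
  shows "\<exists>z\<in>M. \<forall>g\<in>S. z \<in> axis g"
  using assms
proof (induction S)
  case empty
  then show ?case using nonempty by blast
next
  case (insert g S)
  then obtain z where z: "z \<in> M" "\<forall>h\<in>S. z \<in> axis h" by auto
  have g: "g \<in> carrier F" "0 < lt g" using insert by auto
  obtain p where p: "p \<in> axis g" "\<And>y. y \<in> axis g \<Longrightarrow> btw z p y"
    using axis_projection[OF g z(1)] by blast
  have pM: "p \<in> M" using p unfolding axis_def by auto
  have "p \<in> axis h" if h: "h \<in> S" for h
  proof -
    have hh: "h \<in> carrier F" "0 < lt h" "lt (g \<otimes> h) = lt g + lt h"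
      using insert h by auto
    then obtain y where "y \<in> axis g" "y \<in> axis h" using axes_meet[OF g hh] by blast
    then show ?thesis using axis_convex[OF hh(1,2), of z y p] z h p pM by blast
  qed
  then show ?case using p pM by blast
qed

end

section \<open>Reduced words and weighted lengths\<close>

definition linv :: "'g \<times> bool \<Rightarrow> 'g \<times> bool" where
  "linv x = (fst x, \<not> snd x)"

definition winv :: "('g \<times> bool) list \<Rightarrow> ('g \<times> bool) list" where
  "winv w = rev (map linv w)"

lemma linv_linv [simp]: "linv (linv x) = x"
  by (simp add: linv_def)

lemma linv_neq [simp]: "linv x \<noteq> x" "x \<noteq> linv x"
  by (auto simp: linv_def prod_eq_iff)

lemma linv_eq_iff: "linv x = y \<longleftrightarrow> x = linv y"
  by (auto simp: linv_def)

lemma linv_inject [simp]: "linv x = linv y \<longleftrightarrow> x = y"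
  by (auto simp: linv_eq_iff)

lemma fst_linv [simp]: "fst (linv x) = fst x"
  by (simp add: linv_def)

lemma winv_simps [simp]: "winv [] = []" "winv (x # w) = winv w @ [linv x]"
  "winv (u @ v) = winv v @ winv u" "winv (winv w) = w" "length (winv w) = length w"
  "winv w = [] \<longleftrightarrow> w = []"
  by (auto simp: winv_def rev_map comp_def)

lemma set_winv [simp]: "set (winv w) = linv ` set w"
  by (simp add: winv_def)

lemma hd_winv: "w \<noteq> [] \<Longrightarrow> hd (winv w) = linv (last w)"
  by (simp add: winv_def hd_rev last_map)

lemma last_winv: "w \<noteq> [] \<Longrightarrow> last (winv w) = linv (hd w)"
  by (simp add: winv_def last_rev hd_map)

lemma reduced_word_alt: "reduced_word w \<longleftrightarrow> successively (\<lambda>x y. y \<noteq> linv x) w"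
proof -
  have "(\<lambda>x y. \<not> (fst x = fst y \<and> snd x \<noteq> snd y)) = (\<lambda>(x::'a \<times> bool) y. y \<noteq> linv x)"
    by (auto simp: linv_def prod_eq_iff fun_eq_iff)
  then show ?thesis unfolding reduced_word_def by (simp only:)
qed

lemma reduced_word_simps [simp]: "reduced_word []" "reduced_word [x]"
  "reduced_word (x # y # w) \<longleftrightarrow> y \<noteq> linv x \<and> reduced_word (y # w)"
  by (auto simp: reduced_word_alt)

lemma reduced_append: "reduced_word (u @ v) \<longleftrightarrow>
    reduced_word u \<and> reduced_word v \<and> (u = [] \<or> v = [] \<or> hd v \<noteq> linv (last u))"
  by (auto simp: reduced_word_alt successively_append_iff)

lemma reduced_winv [simp]: "reduced_word (winv w) \<longleftrightarrow> reduced_word w"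
proof -
  have "reduced_word (winv w)" if "reduced_word w" for w :: "('a \<times> bool) list"
    using that by (induction w) (auto simp: reduced_append hd_winv last_winv linv_eq_iff
        reduced_append[of "[_]", simplified])
  from this[of w] this[of "winv w"] show ?thesis by auto
qed

text \<open>Cyclic reduction: outer letters are stripped as long as they cancel. The middle never
  becomes empty, because a letter followed by its inverse is not reduced.\<close>

lemma reduced_conj_decomp:
  "reduced_word w \<Longrightarrow> w \<noteq> [] \<Longrightarrow>
    \<exists>u v. w = u @ v @ winv u \<and> v \<noteq> [] \<and> reduced_word (v @ v)"
proof (induction "length w" arbitrary: w rule: less_induct)
  case less
  show ?case
  proof (cases "hd w = linv (last w)")
    case False
    then show ?thesis using less by (intro exI[of _ "[]"] exI[of _ w]) (auto simp: reduced_append)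
  next
    case True
    obtain a w' where w: "w = a # w'" using less(3) by (cases w) auto
    have "w' \<noteq> []" using True w by auto
    then obtain m b where m: "w' = m @ [b]" by (metis append_butlast_last_id)
    have b: "b = linv a" using True w m by (simp add: linv_eq_iff)
    have "m \<noteq> []" using less(2) w m b by auto
    moreover have "reduced_word m" using less(2) w m reduced_append[of "[a]" "m @ [b]"]
      by (simp add: reduced_append)
    ultimately obtain u v where "m = u @ v @ winv u" "v \<noteq> []" "reduced_word (v @ v)"
      using less(1)[of m] w m by auto
    then show ?thesis using w m b by (intro exI[of _ "a # u"] exI[of _ v]) auto
  qed
qed

section \<open>Common prefixes and weighted lengths\<close>

fun lcp :: "'a list \<Rightarrow> 'a list \<Rightarrow> 'a list" where
  "lcp (x # xs) (y # ys) = (if x = y then x # lcp xs ys else [])"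
| "lcp _ _ = []"

lemma lcp_split: "\<exists>x y. u = lcp u v @ x \<and> v = lcp u v @ y \<and> (x = [] \<or> y = [] \<or> hd x \<noteq> hd y)"
  by (induction u v rule: lcp.induct) auto

lemma lcp_append: "x = [] \<or> y = [] \<or> hd x \<noteq> hd y \<Longrightarrow> lcp (c @ x) (c @ y) = c"
proof (induction c)
  case Nil
  then show ?case by (cases x; cases y) auto
qed auto

lemma lcp_comm: "lcp u v = lcp v u"
  by (induction u v rule: lcp.induct) auto

lemma take_eq_lcp: "n \<le> length (lcp u v) \<Longrightarrow> take n u = take n v"
  using lcp_split[of u v] by (metis append_take_drop_id take_append take_all_iff diff_is_0_eq take0 append_Nil2)

lemma length_lcp_ge: "take n u = take n v \<Longrightarrow> n \<le> length u \<Longrightarrow> n \<le> length v \<Longrightarrow> n \<le> length (lcp u v)"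
proof (induction u v arbitrary: n rule: lcp.induct)
  case (1 x xs y ys)
  then show ?case by (cases n) auto
qed auto

lemma length_lcp_le: "length (lcp u v) \<le> length u"
  by (induction u v rule: lcp.induct) auto

definition wl :: "('g \<Rightarrow> real) \<Rightarrow> ('g \<times> bool) list \<Rightarrow> real" where
  "wl \<mu> w = sum_list (map (\<lambda>x. \<mu> (fst x)) w)"

lemma wl_simps [simp]: "wl \<mu> [] = 0" "wl \<mu> (x # w) = \<mu> (fst x) + wl \<mu> w"
  "wl \<mu> (u @ v) = wl \<mu> u + wl \<mu> v" "wl \<mu> (winv w) = wl \<mu> w"
proof -
  show "wl \<mu> (winv w) = wl \<mu> w"
    unfolding wl_def winv_def by (simp add: rev_map[symmetric] sum_list_rev comp_def)
qed (auto simp: wl_def)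

lemma wl_scale: "wl (\<lambda>b. c * \<mu> b) w = c * wl \<mu> w"
  by (induction w) (auto simp: algebra_simps)

lemma wl_one: "wl (\<lambda>_. 1) w = real (length w)"
  by (induction w) auto

lemma wl_nonneg: "(\<And>x. x \<in> set w \<Longrightarrow> 0 \<le> \<mu> (fst x)) \<Longrightarrow> 0 \<le> wl \<mu> w"
proof (induction w)
  case (Cons x w)
  then have "0 \<le> wl \<mu> w" "0 \<le> \<mu> (fst x)" by auto
  then show ?case by simp
qed simp

lemma wl_lcp_nonneg:
  assumes "\<And>x. x \<in> set u \<Longrightarrow> 0 \<le> \<mu> (fst x)"
  shows "0 \<le> wl \<mu> (lcp u v)"
proof (rule wl_nonneg)
  fix a assume "a \<in> set (lcp u v)"
  then have "a \<in> set u" using lcp_split[of u v] by (metis Un_iff set_append)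
  then show "0 \<le> \<mu> (fst a)" using assms by blast
qed

lemma wl_ge: "(\<And>x. x \<in> set w \<Longrightarrow> c \<le> \<mu> (fst x)) \<Longrightarrow> c * real (length w) \<le> wl \<mu> w"
proof (induction w)
  case (Cons x w)
  then have "c * real (length w) \<le> wl \<mu> w" "c \<le> \<mu> (fst x)" by auto
  then show ?case by (simp add: algebra_simps)
qed auto

text \<open>The shorter of the common prefixes of \<open>u\<close>, \<open>v\<close> and of
  \<open>v\<close>, \<open>w\<close> is a prefix of both \<open>u\<close> and \<open>w\<close>; for
  non-negative weights this becomes an ultrametric inequality.\<close>

lemma wl_lcp_ultra:
  "(\<And>x. x \<in> set u \<Longrightarrow> 0 \<le> \<mu> (fst x)) \<Longrightarrow>
    min (wl \<mu> (lcp u v)) (wl \<mu> (lcp v w)) \<le> wl \<mu> (lcp u w)"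
proof (induction u v arbitrary: w rule: lcp.induct)
  case (1 x xs y ys)
  note IH = 1
  show ?case
  proof (cases w)
    case (Cons z zs)
    have n: "0 \<le> wl \<mu> (lcp (x # xs) w)" using wl_lcp_nonneg IH(2) by blast
    show ?thesis
    proof (cases "x = y \<and> y = z")
      case True
      then show ?thesis using IH(1)[of zs] IH(2) Cons by (auto simp: min_def split: if_splits)
    qed (use n Cons in \<open>auto simp: min_def split: if_splits\<close>)
  qed auto
qed (simp_all add: min_le_iff_disj wl_lcp_nonneg)

section \<open>Normal forms in a free group\<close>

locale free_group = group F for F :: "('g, 'm) monoid_scheme" (structure) +
  fixes B :: "'g set"
  assumes basis: "free_basis F B"
begin

abbreviation "Lam \<equiv> B \<times> (UNIV :: bool set)"
abbreviation "val \<equiv> word_value F"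

definition reduced_words :: "('g \<times> bool) list set" where
  "reduced_words = {w. set w \<subseteq> Lam \<and> reduced_word w}"

lemma B_carrier: "B \<subseteq> carrier F"
  using basis unfolding free_basis_def by blast

lemma val_bij: "bij_betw val reduced_words (carrier F)"
  using basis unfolding free_basis_def reduced_words_def by blast

lemma val_Nil [simp]: "val [] = \<one>"
  by (simp add: word_value_def)

lemma val_Cons: "val (x # w) = (if snd x then fst x else inv (fst x)) \<otimes> val w"
  by (simp add: word_value_def split: prod.split)

lemma val_closed [simp]: "set w \<subseteq> Lam \<Longrightarrow> val w \<in> carrier F"
  using B_carrier by (induction w) (auto simp: val_Cons split: prod.splits)

lemma val_append: "set u \<subseteq> Lam \<Longrightarrow> set v \<subseteq> Lam \<Longrightarrow> val (u @ v) = val u \<otimes> val v"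
proof (induction u)
  case (Cons x u)
  then have "fst x \<in> carrier F" using B_carrier by auto
  then show ?case using Cons by (auto simp: val_Cons m_assoc)
qed simp

lemma linv_Lam: "x \<in> Lam \<Longrightarrow> linv x \<in> Lam"
  by (auto simp: linv_def)

lemma set_winv_Lam [simp]: "set w \<subseteq> Lam \<Longrightarrow> linv ` set w \<subseteq> Lam"
  using linv_Lam by blast

lemma val_winv: "set w \<subseteq> Lam \<Longrightarrow> val (winv w) = inv (val w)"
proof (induction w)
  case (Cons x w)
  then have x: "fst x \<in> carrier F" using B_carrier by auto
  have "val [linv x] = inv (val [x])" using x by (auto simp: val_Cons linv_def)
  moreover have "val (winv w @ [linv x]) = val (winv w) \<otimes> val [linv x]"
    by (rule val_append) (use Cons linv_Lam in auto)
  moreover have "val (x # w) = val [x] \<otimes> val w" using x by (simp add: val_Cons)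
  moreover have "val [x] \<in> carrier F" using x by (simp add: val_Cons)
  ultimately show ?case using Cons by (simp add: inv_mult_group)
qed simp

definition rwd :: "'g \<Rightarrow> ('g \<times> bool) list" where
  "rwd g = inv_into reduced_words val g"

lemma rwd_reduced: "g \<in> carrier F \<Longrightarrow> rwd g \<in> reduced_words"
  using val_bij unfolding rwd_def by (metis bij_betw_imp_surj_on inv_into_into)

lemma val_rwd [simp]: "g \<in> carrier F \<Longrightarrow> val (rwd g) = g"
  using val_bij unfolding rwd_def by (metis bij_betw_inv_into_right)

lemma rwd_val: "w \<in> reduced_words \<Longrightarrow> rwd (val w) = w"
  using val_bij unfolding rwd_def by (metis bij_betw_inv_into_left)

lemma reduced_words_D: "w \<in> reduced_words \<Longrightarrow> set w \<subseteq> Lam" "w \<in> reduced_words \<Longrightarrow> reduced_word w"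
  by (auto simp: reduced_words_def)

lemma rwd_Lam: "g \<in> carrier F \<Longrightarrow> set (rwd g) \<subseteq> Lam"
  using rwd_reduced reduced_words_D by blast

lemma rwd_one [simp]: "rwd \<one> = []"
  using rwd_val[of "[]"] by (simp add: reduced_words_def)

lemma rwd_eq_Nil: "g \<in> carrier F \<Longrightarrow> rwd g = [] \<longleftrightarrow> g = \<one>"
  by (metis rwd_one val_Nil val_rwd)

lemma rwd_inj: "\<lbrakk>g \<in> carrier F; h \<in> carrier F; rwd g = rwd h\<rbrakk> \<Longrightarrow> g = h"
  by (metis val_rwd)

lemma rwd_inv: "g \<in> carrier F \<Longrightarrow> rwd (inv g) = winv (rwd g)"
  using val_winv[of "rwd g"] rwd_reduced[of g] rwd_val[of "winv (rwd g)"] linv_Lam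
  by (auto simp: reduced_words_def)

text \<open>Only the common prefix cancels. The remainders start with different letters, so nothing
  cancels where they meet.\<close>

lemma rwd_inv_mult:
  assumes g: "g \<in> carrier F" "rwd g = c @ x" and h: "h \<in> carrier F" "rwd h = c @ y"
    and ne: "x = [] \<or> y = [] \<or> hd x \<noteq> hd y"
  shows "rwd (inv g \<otimes> h) = winv x @ y"
proof -
  have R: "c @ x \<in> reduced_words" "c @ y \<in> reduced_words" using rwd_reduced[of g] rwd_reduced[of h] g h by auto
  then have L: "set c \<subseteq> Lam" "set x \<subseteq> Lam" "set y \<subseteq> Lam" by (auto simp: reduced_words_def)
  have "g = val c \<otimes> val x" "h = val c \<otimes> val y"
    using val_rwd[OF g(1)] val_rwd[OF h(1)] g h val_append L by auto
  then have "inv g \<otimes> h = inv (val x) \<otimes> (inv (val c) \<otimes> (val c \<otimes> val y))"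
    using L by (simp add: inv_mult_group m_assoc)
  also have "inv (val c) \<otimes> (val c \<otimes> val y) = val y"
    using L by (simp flip: m_assoc)
  also have "inv (val x) \<otimes> val y = val (winv x @ y)"
    using L val_append[of "winv x" y] by (simp add: val_winv)
  finally have "inv g \<otimes> h = val (winv x @ y)" .
  moreover have "winv x @ y \<in> reduced_words"
    using R L ne linv_Lam by (auto simp: reduced_words_def reduced_append last_winv)
  ultimately show ?thesis using rwd_val by simp
qed

text \<open>Weights are a parameter because two metrics are needed: weight 1 gives the word metric
  behind the boundary, and petal lengths give the distances between vertices of a rose tree.\<close>

definition wlen :: "('g \<Rightarrow> real) \<Rightarrow> 'g \<Rightarrow> real" where
  "wlen \<mu> g = wl \<mu> (rwd g)"

definition wmet :: "('g \<Rightarrow> real) \<Rightarrow> 'g \<Rightarrow> 'g \<Rightarrow> real" where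
  "wmet \<mu> g h = wlen \<mu> (inv g \<otimes> h)"

lemma wmet_eq:
  assumes "g \<in> carrier F" "h \<in> carrier F"
  shows "wmet \<mu> g h = wlen \<mu> g + wlen \<mu> h - 2 * wl \<mu> (lcp (rwd g) (rwd h))"
proof -
  obtain x y where *: "rwd g = lcp (rwd g) (rwd h) @ x" "rwd h = lcp (rwd g) (rwd h) @ y"
    "x = [] \<or> y = [] \<or> hd x \<noteq> hd y" using lcp_split by blast
  then have "rwd (inv g \<otimes> h) = winv x @ y" using rwd_inv_mult[OF assms(1) _ assms(2)] by blast
  moreover have "wlen \<mu> g = wl \<mu> (lcp (rwd g) (rwd h)) + wl \<mu> x"
    "wlen \<mu> h = wl \<mu> (lcp (rwd g) (rwd h)) + wl \<mu> y"
    unfolding wlen_def using * by (metis wl_simps(3))+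
  ultimately show ?thesis unfolding wmet_def wlen_def[of _ "inv g \<otimes> h"] by simp
qed

lemma wlen_one [simp]: "wlen \<mu> \<one> = 0"
  by (simp add: wlen_def)

lemma wmet_one: "g \<in> carrier F \<Longrightarrow> wmet \<mu> \<one> g = wlen \<mu> g"
  by (simp add: wmet_def)

lemma wlen_inv: "g \<in> carrier F \<Longrightarrow> wlen \<mu> (inv g) = wlen \<mu> g"
  by (simp add: wlen_def rwd_inv)

lemma gp_wmet_one:
  "g \<in> carrier F \<Longrightarrow> h \<in> carrier F \<Longrightarrow>
    gromov_product (wmet \<mu>) \<one> g h = wl \<mu> (lcp (rwd g) (rwd h))"
  unfolding gromov_product_def by (simp add: wmet_eq)

lemma wmet_mult_left:
  assumes "a \<in> carrier F" "g \<in> carrier F" "h \<in> carrier F"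
  shows "wmet \<mu> (a \<otimes> g) (a \<otimes> h) = wmet \<mu> g h"
proof -
  have "inv (a \<otimes> g) \<otimes> (a \<otimes> h) = inv g \<otimes> (inv a \<otimes> (a \<otimes> h))"
    using assms by (simp add: inv_mult_group m_assoc)
  also have "inv a \<otimes> (a \<otimes> h) = h" using assms by (simp flip: m_assoc)
  finally show ?thesis unfolding wmet_def by simp
qed

text \<open>The core is obtained before any weights are chosen. Its weight is the translation
  length, by the formula \<open>lt_eq\<close>, and is positive for positive weights.\<close>

lemma cyclic_core:
  assumes g: "g \<in> carrier F" "g \<noteq> \<one>"
  obtains v where "v \<noteq> []" "set v \<subseteq> Lam" "\<And>\<mu>. wlen \<mu> (g \<otimes> g) - wlen \<mu> g = wl \<mu> v"
proof -
  have R: "rwd g \<in> reduced_words" "rwd g \<noteq> []" using rwd_reduced rwd_eq_Nil g by auto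
  then obtain u v where uv: "rwd g = u @ v @ winv u" "v \<noteq> []" "reduced_word (v @ v)"
    using reduced_conj_decomp reduced_words_D by blast
  have L: "set u \<subseteq> Lam" "set v \<subseteq> Lam" using R uv by (auto simp: reduced_words_def)
  then have c: "val u \<in> carrier F" "val v \<in> carrier F" by auto
  have gv: "g = val u \<otimes> val v \<otimes> inv (val u)"
    using val_rwd[OF g(1)] uv L by (simp add: val_append val_winv m_assoc)
  then have "g \<otimes> g = val u \<otimes> val v \<otimes> (inv (val u) \<otimes> (val u \<otimes> (val v \<otimes> inv (val u))))"
    using c by (simp add: m_assoc)
  also have "inv (val u) \<otimes> (val u \<otimes> (val v \<otimes> inv (val u))) = val v \<otimes> inv (val u)"
    using c by (simp flip: m_assoc)
  also have "val u \<otimes> val v \<otimes> (val v \<otimes> inv (val u)) = val (u @ v @ v @ winv u)"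
    using L c by (simp add: val_append val_winv m_assoc)
  finally have "g \<otimes> g = val (u @ v @ v @ winv u)" .
  moreover have "u @ v @ v @ winv u \<in> reduced_words"
    using R uv L linv_Lam by (auto simp: reduced_words_def reduced_append)
  ultimately have "rwd (g \<otimes> g) = u @ v @ v @ winv u" using rwd_val by simp
  then show ?thesis using that[of v] uv L unfolding wlen_def by auto
qed

lemma wlen_pair:
  assumes "a \<in> Lam" "b \<in> Lam" "b \<noteq> linv a"
  shows "wlen \<mu> (val [a] \<otimes> val [b]) = \<mu> (fst a) + \<mu> (fst b)"
    "wlen \<mu> ((val [a] \<otimes> val [b]) \<otimes> (val [a] \<otimes> val [b])) = 2 * (\<mu> (fst a) + \<mu> (fst b))"
proof -
  have "val [a] \<otimes> val [b] = val [a, b]" using val_append[of "[a]" "[b]"] assms by simp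
  moreover have "val [a, b] \<otimes> val [a, b] = val [a, b, a, b]"
    using val_append[of "[a, b]" "[a, b]"] assms by simp
  moreover have "[a, b] \<in> reduced_words" "[a, b, a, b] \<in> reduced_words" using assms by (auto simp: reduced_words_def linv_eq_iff)
  ultimately show "wlen \<mu> (val [a] \<otimes> val [b]) = \<mu> (fst a) + \<mu> (fst b)"
    "wlen \<mu> ((val [a] \<otimes> val [b]) \<otimes> (val [a] \<otimes> val [b])) = 2 * (\<mu> (fst a) + \<mu> (fst b))"
    using rwd_val unfolding wlen_def by auto
qed

lemma wlen_letter: "a \<in> Lam \<Longrightarrow> wlen \<mu> (val [a]) = \<mu> (fst a)"
  using rwd_val[of "[a]"] unfolding wlen_def by (auto simp: reduced_words_def)

text \<open>Prepending a letter lengthens the normal form by at most one. Consequently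
  \<open>word_length\<close> is the length of the normal form.\<close>

lemma length_rwd_val_le: "set w \<subseteq> Lam \<Longrightarrow> length (rwd (val w)) \<le> length w"
proof (induction w)
  case (Cons x w)
  then have L: "x \<in> Lam" "set w \<subseteq> Lam" by auto
  have "val (x # w) = inv (val [linv x]) \<otimes> val w"
    using val_append[of "[x]" w] val_winv[of "[linv x]"] L linv_Lam by simp
  then have "wlen (\<lambda>_. 1) (val (x # w)) = wmet (\<lambda>_. 1) (val [linv x]) (val w)"
    unfolding wmet_def by simp
  also have "\<dots> \<le> 1 + wlen (\<lambda>_. 1) (val w)"
    using wmet_eq[of "val [linv x]" "val w" "\<lambda>_. 1"] wlen_letter[of "linv x" "\<lambda>_. 1"] L linv_Lam
    by (simp add: wl_one)
  finally show ?case using Cons L unfolding wlen_def wl_one by simp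
qed simp

lemma word_length_eq:
  assumes g: "g \<in> carrier F"
  shows "word_length F B g = length (rwd g)"
  unfolding word_length_def
proof (rule Least_equality)
  show "\<exists>w. set w \<subseteq> Lam \<and> length w = length (rwd g) \<and> val w = g"
    using g rwd_Lam by (intro exI[of _ "rwd g"]) auto
qed (use length_rwd_val_le in auto)

lemma word_metric_eq:
  "\<lbrakk>g \<in> carrier F; h \<in> carrier F\<rbrakk> \<Longrightarrow> word_metric F B g h = wmet (\<lambda>_. 1) g h"
  unfolding word_metric_def wmet_def wlen_def by (simp add: word_length_eq wl_one)

end

text \<open>For distances of the form \<open>ht x + ht y - 2 * A x y\<close> the heights drop out of
  the four-point inequality, and this statement about \<open>A\<close> remains. It serves both the
  group with a weighted metric and the points of the rose tree.\<close>

lemma ultra_four_point: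
  fixes A :: "'p \<Rightarrow> 'p \<Rightarrow> real"
  assumes comm: "\<And>x y. \<lbrakk>x \<in> M; y \<in> M\<rbrakk> \<Longrightarrow> A x y = A y x"
    and ultra: "\<And>x y z. \<lbrakk>x \<in> M; y \<in> M; z \<in> M\<rbrakk> \<Longrightarrow> min (A x y) (A y z) \<le> A x z"
    and m: "x \<in> M" "y \<in> M" "z \<in> M" "w \<in> M"
  shows "A x z + A y w \<le> A x y + A z w \<or> A x w + A y z \<le> A x y + A z w"
proof -
  have u: "A a b \<le> A a c \<or> A b c \<le> A a c" if "a \<in> M" "b \<in> M" "c \<in> M" for a b c
    using ultra[OF that] by (auto simp: min_def split: if_splits)
  show ?thesis
    using u[of x z y] u[of x w y] u[of z x w] u[of z y w] u[of x z w] u[of x w z] u[of y z w]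
      u[of y w z] u[of x y z] u[of x y w] u[of y x z] u[of y x w]
      comm[of x y] comm[of x z] comm[of x w] comm[of y z] comm[of y w] comm[of z w] m
    by argo
qed

lemma zero_hyperbolicI:
  fixes \<delta> :: "'p \<Rightarrow> 'p \<Rightarrow> real"
  assumes nonneg: "\<And>x y. \<lbrakk>x \<in> M; y \<in> M\<rbrakk> \<Longrightarrow> 0 \<le> \<delta> x y"
    and zero: "\<And>x y. \<lbrakk>x \<in> M; y \<in> M\<rbrakk> \<Longrightarrow> \<delta> x y = 0 \<longleftrightarrow> x = y"
    and form: "\<And>x y. \<lbrakk>x \<in> M; y \<in> M\<rbrakk> \<Longrightarrow> \<delta> x y = ht x + ht y - 2 * A x y"
    and comm: "\<And>x y. \<lbrakk>x \<in> M; y \<in> M\<rbrakk> \<Longrightarrow> A x y = A y x"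
    and ht: "\<And>x y. \<lbrakk>x \<in> M; y \<in> M\<rbrakk> \<Longrightarrow> A x y \<le> ht x"
    and ultra: "\<And>x y z. \<lbrakk>x \<in> M; y \<in> M; z \<in> M\<rbrakk> \<Longrightarrow> min (A x y) (A y z) \<le> A x z"
  shows "zero_hyperbolic M \<delta>"
proof
  fix x y z w assume m: "x \<in> M" "y \<in> M" "z \<in> M" "w \<in> M"
  show "\<delta> x y + \<delta> z w \<le> \<delta> x z + \<delta> y w \<or> \<delta> x y + \<delta> z w \<le> \<delta> x w + \<delta> y z"
    using ultra_four_point[where A = A, OF comm ultra m] form m by auto
next
  fix x y z assume m: "x \<in> M" "y \<in> M" "z \<in> M"
  show "\<delta> x z \<le> \<delta> x y + \<delta> y z"
    using ultra[OF m] ht[of y x] ht[OF m(2,3)] comm[of x y] form m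
    by (auto simp: min_def split: if_splits)
qed (use nonneg zero form comm in auto)

locale weighted_free_group = free_group F B for F :: "('g, 'm) monoid_scheme" (structure) and B +
  fixes \<mu> :: "'g \<Rightarrow> real"
  assumes pos: "b \<in> B \<Longrightarrow> 0 < \<mu> b"
begin

lemma wl_lam_nonneg: "set w \<subseteq> Lam \<Longrightarrow> 0 \<le> wl \<mu> w"
  by (rule wl_nonneg) (use pos in \<open>auto simp: less_imp_le\<close>)

lemma wl_pos: "set w \<subseteq> Lam \<Longrightarrow> w \<noteq> [] \<Longrightarrow> 0 < wl \<mu> w"
  using wl_lam_nonneg[of "tl w"] pos[of "fst (hd w)"] by (cases w) auto

lemma wlen_nonneg: "g \<in> carrier F \<Longrightarrow> 0 \<le> wlen \<mu> g"
  unfolding wlen_def using wl_lam_nonneg rwd_Lam by blast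

lemma wl_lcp_le: "set u \<subseteq> Lam \<Longrightarrow> wl \<mu> (lcp u v) \<le> wl \<mu> u"
  using lcp_split[of u v] wl_lam_nonneg by (metis le_add_same_cancel1 set_append sup.bounded_iff wl_simps(3))

lemma zero_hyperbolic_wmet: "zero_hyperbolic (carrier F) (wmet \<mu>)"
proof (rule zero_hyperbolicI[where ht = "wlen \<mu>" and A = "\<lambda>g h. wl \<mu> (lcp (rwd g) (rwd h))"])
  fix g h assume gh: "g \<in> carrier F" "h \<in> carrier F"
  then have c: "inv g \<otimes> h \<in> carrier F" by simp
  show "0 \<le> wmet \<mu> g h" unfolding wmet_def using wlen_nonneg c by blast
  have "wmet \<mu> g h = 0 \<longleftrightarrow> rwd (inv g \<otimes> h) = []"
    unfolding wmet_def wlen_def using wl_pos[OF rwd_Lam[OF c]] by fastforce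
  also have "\<dots> \<longleftrightarrow> inv g \<otimes> h = \<one>" using rwd_eq_Nil c by blast
  also have "\<dots> \<longleftrightarrow> g = h" using gh by (metis inv_equality inv_inv l_inv inv_closed)
  finally show "wmet \<mu> g h = 0 \<longleftrightarrow> g = h" .
  show "wl \<mu> (lcp (rwd g) (rwd h)) \<le> wlen \<mu> g"
    unfolding wlen_def using wl_lcp_le rwd_Lam gh by blast
next
  fix g h k assume "g \<in> carrier F" "h \<in> carrier F" "k \<in> carrier F"
  then show "min (wl \<mu> (lcp (rwd g) (rwd h))) (wl \<mu> (lcp (rwd h) (rwd k))) \<le> wl \<mu> (lcp (rwd g) (rwd k))"
    using rwd_Lam[of g] pos by (intro wl_lcp_ultra) (auto simp: less_imp_le subset_eq)
qed (auto simp: wmet_eq lcp_comm)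

end

section \<open>The boundary of a free group\<close>

locale fin_free_group = free_group F B for F :: "('g, 'm) monoid_scheme" (structure) and B +
  assumes finite_basis: "finite B"
begin

text \<open>Ends of \<open>F\<close> are coded by infinite reduced words.\<close>

definition rays :: "(nat \<Rightarrow> 'g \<times> bool) set" where
  "rays = {\<omega>. range \<omega> \<subseteq> Lam \<and> (\<forall>n. \<omega> (Suc n) \<noteq> linv (\<omega> n))}"

definition pre :: "(nat \<Rightarrow> 'g \<times> bool) \<Rightarrow> nat \<Rightarrow> ('g \<times> bool) list" where
  "pre \<omega> n = map \<omega> [0..<n]"

definition ray :: "(nat \<Rightarrow> 'g \<times> bool) \<Rightarrow> nat \<Rightarrow> 'g" where
  "ray \<omega> n = val (pre \<omega> n)"

text \<open>Convergence to an end expressed through normal forms: every finite prefix stabilises.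
  The set \<open>ray_end \<omega>\<close> of all such sequences turns out to be a full class in the
  sense of Gromov.\<close>

definition tends :: "(nat \<Rightarrow> 'g) \<Rightarrow> (nat \<Rightarrow> 'g \<times> bool) \<Rightarrow> bool" where
  "tends u \<omega> \<longleftrightarrow> range u \<subseteq> carrier F \<and> (\<forall>n. \<exists>N. \<forall>i\<ge>N. take n (rwd (u i)) = pre \<omega> n)"

definition ray_end :: "(nat \<Rightarrow> 'g \<times> bool) \<Rightarrow> 'g bdry" where
  "ray_end \<omega> = {u. tends u \<omega>}"

definition cyl :: "('g \<times> bool) list \<Rightarrow> 'g bdry set" where
  "cyl w = {ray_end \<omega> | \<omega>. \<omega> \<in> rays \<and> pre \<omega> (length w) = w}"

abbreviation "Bd \<equiv> gromov_boundary (carrier F) (word_metric F B)"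

lemma length_pre [simp]: "length (pre \<omega> n) = n"
  by (simp add: pre_def)

lemma pre_Suc: "pre \<omega> (Suc n) = pre \<omega> n @ [\<omega> n]"
  by (simp add: pre_def)

lemma pre_0 [simp]: "pre \<omega> 0 = []"
  by (simp add: pre_def)

lemma take_pre [simp]: "take m (pre \<omega> n) = pre \<omega> (min m n)"
  by (simp add: pre_def take_map min_def)

lemma pre_eq_iff: "pre \<omega> n = pre \<omega>' n \<longleftrightarrow> (\<forall>i<n. \<omega> i = \<omega>' i)"
  by (auto simp: pre_def)

lemma pre_inject: "(\<And>n. pre \<omega> n = pre \<omega>' n) \<Longrightarrow> \<omega> = \<omega>'"
  unfolding pre_eq_iff by blast

lemma pre_eq_mono: "pre \<omega> n = pre \<omega>' n \<Longrightarrow> m \<le> n \<Longrightarrow> pre \<omega> m = pre \<omega>' m"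
  unfolding pre_eq_iff by auto

lemma pre_reduced: "\<omega> \<in> rays \<Longrightarrow> pre \<omega> n \<in> reduced_words"
proof (induction n)
  case (Suc n)
  have "n = 0 \<or> last (pre \<omega> n) = \<omega> (n - 1) \<and> \<omega> n \<noteq> linv (\<omega> (n - 1))"
    using Suc(2) by (cases n) (auto simp: pre_Suc rays_def)
  then show ?case using Suc by (auto simp: pre_Suc reduced_words_def rays_def reduced_append)
qed (auto simp: reduced_words_def)

lemma rays_if_pre_reduced: "(\<And>n. pre \<omega> n \<in> reduced_words) \<Longrightarrow> \<omega> \<in> rays"
  unfolding rays_def
proof (safe)
  fix n assume R: "\<And>n. pre \<omega> n \<in> reduced_words"
  have *: "\<omega> (Suc n) \<noteq> linv (\<omega> n)" "\<omega> n \<in> Lam"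
    using R[of "Suc (Suc n)"] by (auto simp: reduced_words_def pre_Suc reduced_append)
  show "\<omega> (Suc n) = linv (\<omega> n) \<Longrightarrow> False" using * by blast
  fix a b assume "(a, b) = \<omega> n"
  then show "a \<in> B" using * by (metis mem_Sigma_iff)
qed auto

lemma rwd_ray: "\<omega> \<in> rays \<Longrightarrow> rwd (ray \<omega> n) = pre \<omega> n"
  unfolding ray_def using rwd_val pre_reduced by blast

lemma ray_carrier [simp]: "\<omega> \<in> rays \<Longrightarrow> ray \<omega> n \<in> carrier F"
  unfolding ray_def using reduced_words_D(1)[OF pre_reduced[of \<omega> n]] by simp

lemma tends_ray: "\<omega> \<in> rays \<Longrightarrow> tends (ray \<omega>) \<omega>"
proof -
  assume "\<omega> \<in> rays"
  then have "\<forall>i\<ge>n. take n (rwd (ray \<omega> i)) = pre \<omega> n" for n by (simp add: rwd_ray)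
  then show ?thesis unfolding tends_def using \<open>\<omega> \<in> rays\<close> by auto
qed

lemma tends_unique: "tends u \<omega> \<Longrightarrow> tends u \<omega>' \<Longrightarrow> \<omega> = \<omega>'"
proof (rule pre_inject)
  fix n assume t: "tends u \<omega>" "tends u \<omega>'"
  obtain N N' where "\<forall>i\<ge>N. take n (rwd (u i)) = pre \<omega> n" "\<forall>i\<ge>N'. take n (rwd (u i)) = pre \<omega>' n"
    using t unfolding tends_def by meson
  then have "take n (rwd (u (max N N'))) = pre \<omega> n" "take n (rwd (u (max N N'))) = pre \<omega>' n"
    by (meson max.cobounded1 max.cobounded2)+
  then show "pre \<omega> n = pre \<omega>' n" by (rule trans[OF sym])
qed

lemma ray_end_inj: "inj_on ray_end rays"
proof (rule inj_onI)
  fix \<omega> \<omega>' assume "\<omega> \<in> rays" "\<omega>' \<in> rays" "ray_end \<omega> = ray_end \<omega>'"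
  then have "tends (ray \<omega>) \<omega>'" using tends_ray[of \<omega>] unfolding ray_end_def by blast
  then show "\<omega> = \<omega>'" using tends_unique tends_ray \<open>\<omega> \<in> rays\<close> by blast
qed

section \<open>The Gromov boundary as the space of infinite reduced words\<close>

lemma zero_hyperbolic_word_metric: "zero_hyperbolic (carrier F) (word_metric F B)"
proof -
  have "weighted_free_group F B (\<lambda>_. 1)" by unfold_locales simp
  from weighted_free_group.zero_hyperbolic_wmet[OF this] interpret W: zero_hyperbolic "carrier F" "wmet (\<lambda>_. 1)" .
  show ?thesis
    by unfold_locales
      (simp_all add: word_metric_eq W.d_nonneg W.d_comm W.d_zero W.d_tri W.four_point)
qed

sublocale W: zero_hyperbolic "carrier F" "word_metric F B"
  by (rule zero_hyperbolic_word_metric)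

lemma gp_word: "g \<in> carrier F \<Longrightarrow> h \<in> carrier F \<Longrightarrow>
    W.gp \<one> g h = real (length (lcp (rwd g) (rwd h)))"
  using gp_wmet_one[of g h "\<lambda>_. 1"] by (simp add: gromov_product_def word_metric_eq wl_one)

lemma gprel_word_iff:
  assumes "range u \<subseteq> carrier F" "range v \<subseteq> carrier F"
  shows "W.gprel \<one> u v \<longleftrightarrow> (\<forall>n. \<exists>N. \<forall>i\<ge>N. \<forall>j\<ge>N. n \<le> length (lcp (rwd (u i)) (rwd (v j))))"
    (is "?L \<longleftrightarrow> ?R")
proof -
  have eq: "W.gp \<one> (u i) (v j) = real (length (lcp (rwd (u i)) (rwd (v j))))" for i j
    using gp_word assms by (metis range_subsetD)
  show ?thesis
  proof
    assume ?L
    show ?R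
    proof
      fix n :: nat
      obtain N where "\<forall>i\<ge>N. \<forall>j\<ge>N. real n \<le> W.gp \<one> (u i) (v j)"
        using \<open>?L\<close> unfolding W.gprel_def by blast
      then show "\<exists>N. \<forall>i\<ge>N. \<forall>j\<ge>N. n \<le> length (lcp (rwd (u i)) (rwd (v j)))" unfolding eq by auto
    qed
  next
    assume R: ?R
    show ?L
      unfolding W.gprel_def eq
    proof
      fix Z :: real
      obtain N where N: "\<forall>i\<ge>N. \<forall>j\<ge>N. nat \<lceil>Z\<rceil> \<le> length (lcp (rwd (u i)) (rwd (v j)))"
        using R by blast
      have "Z \<le> real (length (lcp (rwd (u i)) (rwd (v j))))" if "i \<ge> N" "j \<ge> N" for i j
        using N that by (metis nat_ceiling_le_eq)
      then show "\<exists>N. \<forall>i\<ge>N. \<forall>j\<ge>N. Z \<le> real (length (lcp (rwd (u i)) (rwd (v j))))" by blast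
    qed
  qed
qed

lemma tends_lengths: "tends u \<omega> \<Longrightarrow> \<exists>N. \<forall>i\<ge>N. take n (rwd (u i)) = pre \<omega> n \<and> n \<le> length (rwd (u i))"
proof -
  assume "tends u \<omega>"
  then obtain N where N: "\<forall>i\<ge>N. take n (rwd (u i)) = pre \<omega> n" unfolding tends_def by blast
  then have "n \<le> length (rwd (u i))" if "i \<ge> N" for i
    using that by (metis length_pre length_take min.absorb_iff2 min.commute)
  then show ?thesis using N by blast
qed

lemma tends_gprel:
  assumes "tends u \<omega>" "tends v \<omega>"
  shows "W.gprel \<one> u v"
proof -
  have r: "range u \<subseteq> carrier F" "range v \<subseteq> carrier F" using assms unfolding tends_def by auto
  show ?thesis
    unfolding gprel_word_iff[OF r]
  proof
    fix n
    obtain N N' where N: "\<forall>i\<ge>N. take n (rwd (u i)) = pre \<omega> n \<and> n \<le> length (rwd (u i))"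
      "\<forall>i\<ge>N'. take n (rwd (v i)) = pre \<omega> n \<and> n \<le> length (rwd (v i))"
      using tends_lengths assms by metis
    then have "n \<le> length (lcp (rwd (u i)) (rwd (v j)))" if "i \<ge> max N N'" "j \<ge> max N N'" for i j
      using that by (intro length_lcp_ge) auto
    then show "\<exists>N. \<forall>i\<ge>N. \<forall>j\<ge>N. n \<le> length (lcp (rwd (u i)) (rwd (v j)))" by blast
  qed
qed

lemma gprel_tends:
  assumes r: "range u \<subseteq> carrier F" "range v \<subseteq> carrier F" and "W.gprel \<one> u v" "tends u \<omega>"
  shows "tends v \<omega>"
  unfolding tends_def
proof (intro conjI r allI)
  fix n
  obtain N N' where N: "\<forall>i\<ge>N. take n (rwd (u i)) = pre \<omega> n"
    "\<forall>i\<ge>N'. \<forall>j\<ge>N'. n \<le> length (lcp (rwd (u i)) (rwd (v j)))"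
    using assms(3,4) unfolding gprel_word_iff[OF r] tends_def by meson
  have "take n (rwd (v j)) = pre \<omega> n" if "j \<ge> max N N'" for j
    using N(1) N(2) that take_eq_lcp[of n "rwd (u (max N N'))" "rwd (v j)"] by auto
  then show "\<exists>N. \<forall>i\<ge>N. take n (rwd (v i)) = pre \<omega> n" by blast
qed

text \<open>Convergence to infinity makes the prefixes of the normal forms stabilise. The limit word
  is reduced since all its prefixes are prefixes of normal forms.\<close>

lemma gprel_self_tends:
  assumes r: "range u \<subseteq> carrier F" and "W.gprel \<one> u u"
  shows "\<exists>\<omega>\<in>rays. tends u \<omega>"
proof -
  obtain K where K: "\<And>n i j. i \<ge> K n \<Longrightarrow> j \<ge> K n \<Longrightarrow> n \<le> length (lcp (rwd (u i)) (rwd (u j)))"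
    using assms(2) unfolding gprel_word_iff[OF r r] by metis
  have len: "n \<le> length (rwd (u i))" if "i \<ge> K n" for n i
    using K[OF that that] length_lcp_le order_trans by blast
  define \<omega> where "\<omega> n = rwd (u (K (Suc n))) ! n" for n
  have nth: "rwd (u i) ! m = \<omega> m" if "i \<ge> K n" "m < n" for i m n
  proof -
    \<comment> \<open>An index beyond both thresholds, which can be compared with \<open>i\<close>
      and with \<open>K (Suc m)\<close>.\<close>
    let ?j = "max i (K (Suc m))"
    have "take n (rwd (u i)) = take n (rwd (u ?j))"
      using K[of n i ?j] that by (intro take_eq_lcp) auto
    moreover have "take (Suc m) (rwd (u ?j)) = take (Suc m) (rwd (u (K (Suc m))))"
      using K[of "Suc m" ?j "K (Suc m)"] by (intro take_eq_lcp) auto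
    ultimately show ?thesis unfolding \<omega>_def using that(2) by (metis lessI nth_take)
  qed
  have tk: "take n (rwd (u i)) = pre \<omega> n" if "i \<ge> K n" for i n
    unfolding pre_def using len[OF that] nth[OF that] by (intro nth_equalityI) auto
  have "tends u \<omega>" unfolding tends_def using r tk by blast
  moreover have "\<omega> \<in> rays"
  proof (rule rays_if_pre_reduced)
    fix n
    have "rwd (u (K n)) \<in> reduced_words" using r by (intro rwd_reduced) auto
    then have "take n (rwd (u (K n))) @ drop n (rwd (u (K n))) \<in> reduced_words" by simp
    then have "take n (rwd (u (K n))) \<in> reduced_words"
      unfolding reduced_words_def by (simp only: reduced_append set_append mem_Collect_eq Un_subset_iff)
    then show "pre \<omega> n \<in> reduced_words" using tk[of n "K n"] by simp
  qed
  ultimately show ?thesis by blast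
qed

lemma converges_iff: "converges_to_infinity (carrier F) (word_metric F B) u \<longleftrightarrow> (\<exists>\<omega>\<in>rays. tends u \<omega>)"
  unfolding W.converges_to_infinity_iff[OF one_closed]
  using gprel_self_tends tends_gprel tends_def by blast

lemma rel_iff: "(u, v) \<in> gromov_rel (carrier F) (word_metric F B) \<longleftrightarrow> (\<exists>\<omega>\<in>rays. tends u \<omega> \<and> tends v \<omega>)"
proof
  assume "(u, v) \<in> gromov_rel (carrier F) (word_metric F B)"
  then have "\<exists>\<omega>\<in>rays. tends u \<omega>" "range u \<subseteq> carrier F \<and> range v \<subseteq> carrier F \<and> W.gprel \<one> u v"
    using W.gromov_rel_iff[OF one_closed] converges_iff unfolding gromov_rel_def by auto
  then show "\<exists>\<omega>\<in>rays. tends u \<omega> \<and> tends v \<omega>" using gprel_tends by blast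
next
  assume "\<exists>\<omega>\<in>rays. tends u \<omega> \<and> tends v \<omega>"
  then show "(u, v) \<in> gromov_rel (carrier F) (word_metric F B)"
    unfolding W.gromov_rel_iff[OF one_closed] using tends_gprel tends_def by blast
qed

lemma Bd_eq: "Bd = ray_end ` rays"
proof -
  have "gromov_rel (carrier F) (word_metric F B) `` {u} = ray_end \<omega>" if "\<omega> \<in> rays" "tends u \<omega>" for u \<omega>
    using that rel_iff tends_unique[of u \<omega>] unfolding ray_end_def by blast
  then show ?thesis
    unfolding gromov_boundary_def quotient_def using converges_iff tends_ray by fast
qed

lemma ray_end_Bd [simp]: "\<omega> \<in> rays \<Longrightarrow> ray_end \<omega> \<in> Bd"
  using Bd_eq by blast

lemma ray_end_in_cyl: "\<omega> \<in> rays \<Longrightarrow> ray_end \<omega> \<in> cyl w \<longleftrightarrow> pre \<omega> (length w) = w"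
  using ray_end_inj unfolding cyl_def inj_on_def by blast

lemma cyl_Bd: "cyl w \<subseteq> Bd"
  unfolding cyl_def Bd_eq by blast

lemma cyl_Nil [simp]: "cyl [] = Bd"
  unfolding cyl_def Bd_eq by auto

lemma cyl_disjoint: "length w = length w' \<Longrightarrow> w \<noteq> w' \<Longrightarrow> cyl w \<inter> cyl w' = {}"
  unfolding cyl_def using ray_end_inj unfolding inj_on_def by fastforce

lemma cyl_pre_antimono: "m \<le> n \<Longrightarrow> cyl (pre \<omega> n) \<subseteq> cyl (pre \<omega> m)"
proof
  fix \<xi> assume mn: "m \<le> n" and "\<xi> \<in> cyl (pre \<omega> n)"
  then obtain \<omega>' where w: "\<omega>' \<in> rays" "\<xi> = ray_end \<omega>'" "pre \<omega>' n = pre \<omega> n" unfolding cyl_def by auto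
  then show "\<xi> \<in> cyl (pre \<omega> m)" using pre_eq_mono[OF w(3) mn] ray_end_in_cyl by simp
qed

lemma Bd_cases: "\<xi> \<in> Bd \<Longrightarrow> (\<And>\<omega>. \<omega> \<in> rays \<Longrightarrow> \<xi> = ray_end \<omega> \<Longrightarrow> P) \<Longrightarrow> P"
  unfolding Bd_eq by blast

text \<open>The product is a supremum over representatives, so for a lower bound the two rays
  suffice.\<close>

lemma boundary_product_ge:
  assumes "\<omega> \<in> rays" "\<omega>' \<in> rays" "pre \<omega> n = pre \<omega>' n"
  shows "ereal n \<le> boundary_product (word_metric F B) \<one> (ray_end \<omega>) (ray_end \<omega>')"
  unfolding boundary_product_def
proof (rule SUP_upper2)
  show "(ray \<omega>, ray \<omega>') \<in> ray_end \<omega> \<times> ray_end \<omega>'" using assms tends_ray by (auto simp: ray_end_def)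
  have "ereal n \<le> ereal (W.gp \<one> (ray \<omega> i) (ray \<omega>' j))" if "i \<ge> n" "j \<ge> n" for i j
  proof -
    have "take n (rwd (ray \<omega> i)) = take n (rwd (ray \<omega>' j))" using that assms rwd_ray by simp
    then have "n \<le> length (lcp (rwd (ray \<omega> i)) (rwd (ray \<omega>' j)))"
      using that assms rwd_ray by (intro length_lcp_ge) auto
    then show ?thesis using gp_word assms by simp
  qed
  then have "\<forall>\<^sub>F p in sequentially \<times>\<^sub>F sequentially.
      ereal n \<le> (case p of (i, j) \<Rightarrow> ereal (W.gp \<one> (ray \<omega> i) (ray \<omega>' j)))"
    unfolding eventually_prod_sequentially by auto
  then show "ereal n \<le> (case (ray \<omega>, ray \<omega>') of (u, v) \<Rightarrow> Liminf (sequentially \<times>\<^sub>F sequentially)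
        (\<lambda>(i, j). ereal (W.gp \<one> (u i) (v j))))"
    by (simp add: Liminf_bounded)
qed

text \<open>All representatives of the two ends eventually disagree within the first
  \<open>n\<close> letters. The base point is arbitrary, at the cost of a constant, because
  \<open>boundary_topology\<close> quantifies over base points.\<close>

lemma boundary_product_le:
  assumes "\<omega> \<in> rays" "\<omega>' \<in> rays" "pre \<omega> n \<noteq> pre \<omega>' n" "e \<in> carrier F"
  shows "boundary_product (word_metric F B) e (ray_end \<omega>) (ray_end \<omega>') \<le> ereal (n + word_metric F B e \<one>)"
  unfolding boundary_product_def
proof (rule SUP_least)
  fix p assume "p \<in> ray_end \<omega> \<times> ray_end \<omega>'"
  then obtain u v where p: "p = (u, v)" "tends u \<omega>" "tends v \<omega>'" by (auto simp: ray_end_def)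
  obtain N N' where N: "\<forall>i\<ge>N. take n (rwd (u i)) = pre \<omega> n" "\<forall>i\<ge>N'. take n (rwd (v i)) = pre \<omega>' n"
    using p unfolding tends_def by meson
  have uv: "u i \<in> carrier F" "v i \<in> carrier F" for i using p unfolding tends_def by auto
  have "ereal (W.gp e (u i) (v j)) \<le> ereal (n + word_metric F B e \<one>)"
    if "i \<ge> max N N'" "j \<ge> max N N'" for i j
  proof -
    have "\<not> n \<le> length (lcp (rwd (u i)) (rwd (v j)))"
      using take_eq_lcp[of n "rwd (u i)" "rwd (v j)"] N that assms(3) by auto
    then have "W.gp \<one> (u i) (v j) \<le> n" using gp_word uv by auto
    then show ?thesis using W.gp_base[of e \<one> "u i" "v j"] uv assms by simp
  qed
  then have "\<forall>\<^sub>F p in sequentially \<times>\<^sub>F sequentially.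
      (case p of (i, j) \<Rightarrow> ereal (W.gp e (u i) (v j))) \<le> ereal (n + word_metric F B e \<one>)"
    unfolding eventually_prod_sequentially by (auto intro!: exI[of _ "max N N'"])
  then have "Limsup (sequentially \<times>\<^sub>F sequentially) (\<lambda>(i, j). ereal (W.gp e (u i) (v j)))
      \<le> ereal (n + word_metric F B e \<one>)" by (rule Limsup_bounded)
  moreover have "sequentially \<times>\<^sub>F sequentially \<noteq> (bot :: (nat \<times> nat) filter)"
    by (simp add: prod_filter_eq_bot)
  ultimately show "(case p of (u, v) \<Rightarrow> Liminf (sequentially \<times>\<^sub>F sequentially)
        (\<lambda>(i, j). ereal (W.gp e (u i) (v j)))) \<le> ereal (n + word_metric F B e \<one>)"
    unfolding p(1) using Liminf_le_Limsup order_trans by (metis (no_types, lifting) case_prod_conv)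
qed

lemma openin_bdry: "openin (bdry_top F B) U \<longleftrightarrow>
    U \<subseteq> Bd \<and> (\<forall>\<omega>\<in>rays. ray_end \<omega> \<in> U \<longrightarrow> (\<exists>n. cyl (pre \<omega> n) \<subseteq> U))"
proof (intro iffI conjI ballI impI)
  assume o: "openin (bdry_top F B) U"
  then show "U \<subseteq> Bd" unfolding bdry_top_def openin_boundary_topology by blast
  fix \<omega> assume w: "\<omega> \<in> rays" "ray_end \<omega> \<in> U"
  then obtain r :: real where r: "\<forall>\<zeta>\<in>Bd. boundary_product (word_metric F B) \<one> (ray_end \<omega>) \<zeta> \<ge> ereal r \<longrightarrow> \<zeta> \<in> U"
    using o unfolding bdry_top_def openin_boundary_topology by fast
  have "cyl (pre \<omega> (nat \<lceil>r\<rceil>)) \<subseteq> U"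
  proof
    fix \<zeta> assume "\<zeta> \<in> cyl (pre \<omega> (nat \<lceil>r\<rceil>))"
    then obtain \<omega>' where w': "\<zeta> = ray_end \<omega>'" "\<omega>' \<in> rays" "pre \<omega> (nat \<lceil>r\<rceil>) = pre \<omega>' (nat \<lceil>r\<rceil>)"
      unfolding cyl_def by auto
    have "ereal r \<le> ereal (nat \<lceil>r\<rceil>)" by (simp add: real_nat_ceiling_ge)
    then show "\<zeta> \<in> U" using boundary_product_ge[OF w(1) w'(2,3)] r w' order_trans ray_end_Bd by blast
  qed
  then show "\<exists>n. cyl (pre \<omega> n) \<subseteq> U" by blast
next
  assume U: "U \<subseteq> Bd \<and> (\<forall>\<omega>\<in>rays. ray_end \<omega> \<in> U \<longrightarrow> (\<exists>n. cyl (pre \<omega> n) \<subseteq> U))"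
  show "openin (bdry_top F B) U"
    unfolding bdry_top_def openin_boundary_topology
  proof (intro conjI ballI)
    show "U \<subseteq> Bd" using U by blast
    fix \<xi> e assume "\<xi> \<in> U" and e: "e \<in> carrier F"
    then obtain \<omega> where w: "\<xi> = ray_end \<omega>" "\<omega> \<in> rays" using U by (auto elim: Bd_cases)
    then obtain n where n: "cyl (pre \<omega> n) \<subseteq> U" using U \<open>\<xi> \<in> U\<close> by blast
    \<comment> \<open>The extra 1 pushes the product above the bound of
      \<open>boundary_product_le\<close>, so the two words must agree up to
      \<open>n\<close>.\<close>
    have "\<zeta> \<in> U" if "\<zeta> \<in> Bd"
      "ereal (n + word_metric F B e \<one> + 1) \<le> boundary_product (word_metric F B) e \<xi> \<zeta>" for \<zeta>
    proof -
      obtain \<omega>' where w': "\<zeta> = ray_end \<omega>'" "\<omega>' \<in> rays" using \<open>\<zeta> \<in> Bd\<close> by (auto elim: Bd_cases)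
      have "pre \<omega> n = pre \<omega>' n"
      proof (rule ccontr)
        assume "\<not> ?thesis"
        then have "ereal (n + word_metric F B e \<one> + 1) \<le> ereal (n + word_metric F B e \<one>)"
          using boundary_product_le[OF w(2) w'(2) _ e] that(2) w w' order_trans by blast
        then show False by simp
      qed
      then have "\<zeta> \<in> cyl (pre \<omega> n)" using w' ray_end_in_cyl by simp
      then show ?thesis using n by blast
    qed
    then show "\<exists>r::real. \<forall>\<zeta>\<in>Bd. boundary_product (word_metric F B) e \<xi> \<zeta> \<ge> ereal r \<longrightarrow> \<zeta> \<in> U"
      by blast
  qed
qed

lemma topspace_bdry [simp]: "topspace (bdry_top F B) = Bd"
proof
  have "openin (bdry_top F B) Bd" unfolding openin_bdry using cyl_Bd by blast
  then show "Bd \<subseteq> topspace (bdry_top F B)" by (rule openin_subset)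
  show "topspace (bdry_top F B) \<subseteq> Bd" using openin_bdry openin_topspace by blast
qed

lemma openin_cyl [simp]: "openin (bdry_top F B) (cyl w)"
  unfolding openin_bdry
proof (intro conjI ballI impI)
  fix \<omega> assume "\<omega> \<in> rays" "ray_end \<omega> \<in> cyl w"
  then show "\<exists>n. cyl (pre \<omega> n) \<subseteq> cyl w" using ray_end_in_cyl by (intro exI[of _ "length w"]) simp
qed (rule cyl_Bd)

lemma closedin_cyl [simp]: "closedin (bdry_top F B) (cyl w)"
  unfolding closedin_def
proof (intro conjI)
  show "openin (bdry_top F B) (topspace (bdry_top F B) - cyl w)"
    unfolding openin_bdry
  proof (intro conjI ballI impI)
    fix \<omega> assume "\<omega> \<in> rays" "ray_end \<omega> \<in> topspace (bdry_top F B) - cyl w"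
    then show "\<exists>n. cyl (pre \<omega> n) \<subseteq> topspace (bdry_top F B) - cyl w"
      using cyl_disjoint[of "pre \<omega> (length w)" w] ray_end_in_cyl cyl_Bd[of "pre \<omega> (length w)"]
      by (intro exI[of _ "length w"]) auto
  qed auto
qed (use cyl_Bd in auto)

lemma countable_reduced_words: "countable reduced_words"
proof -
  have "countable (lists Lam)" using finite_basis by (intro countable_lists) (simp add: countable_finite)
  moreover have "reduced_words \<subseteq> lists Lam" unfolding reduced_words_def by auto
  ultimately show ?thesis using countable_subset by blast
qed

text \<open>The boundary is a continuous image of \<open>rays\<close>, which is closed in a product
  of finite discrete spaces. Compactness makes Radon measures finite on rectangles of disjoint
  cylinders.\<close>

lemma compact_bdry: "compact_space (bdry_top F B)"
proof -
  let ?P = "product_topology (\<lambda>_::nat. discrete_topology Lam) UNIV"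
  have Pc: "compact_space ?P"
    using finite_basis by (simp add: compact_space_product_topology compact_space_discrete_topology)
  have Om_top: "rays \<subseteq> topspace ?P" unfolding rays_def by auto
  have o: "openin ?P {\<omega> \<in> topspace ?P. \<omega> n = a}" for n a
  proof -
    have "continuous_map ?P (discrete_topology Lam) (\<lambda>\<omega>. \<omega> n)"
      by (rule continuous_map_product_projection) simp
    then have "openin ?P {\<omega> \<in> topspace ?P. \<omega> n \<in> {a} \<inter> Lam}"
      by (rule openin_continuous_map_preimage) simp
    moreover have "{\<omega> \<in> topspace ?P. \<omega> n \<in> {a} \<inter> Lam} = {\<omega> \<in> topspace ?P. \<omega> n = a}"
      by (auto simp: PiE_iff)
    ultimately show ?thesis by simp
  qed
  \<comment> \<open>Failure to be reduced shows in two consecutive letters, which is an open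
    condition.\<close>
  have "topspace ?P - rays = (\<Union>n. \<Union>a. {\<omega> \<in> topspace ?P. \<omega> n = a} \<inter> {\<omega> \<in> topspace ?P. \<omega> (Suc n) = linv a})"
  proof -
    have "\<omega> \<in> rays \<longleftrightarrow> (\<forall>n. \<omega> (Suc n) \<noteq> linv (\<omega> n))" if "\<omega> \<in> topspace ?P" for \<omega>
      using that unfolding rays_def by (auto simp: PiE_iff image_subset_iff)
    moreover have "S - rays = (\<Union>n. \<Union>a. {\<omega> \<in> S. \<omega> n = a} \<inter> {\<omega> \<in> S. \<omega> (Suc n) = linv a})"
      if "\<And>\<omega>. \<omega> \<in> S \<Longrightarrow> \<omega> \<in> rays \<longleftrightarrow> (\<forall>n. \<omega> (Suc n) \<noteq> linv (\<omega> n))" for S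
    proof (rule Set.set_eqI)
      fix \<omega>
      show "\<omega> \<in> S - rays \<longleftrightarrow> \<omega> \<in> (\<Union>n. \<Union>a. {\<omega> \<in> S. \<omega> n = a} \<inter> {\<omega> \<in> S. \<omega> (Suc n) = linv a})"
        using that[of \<omega>] by (cases "\<omega> \<in> S") auto
    qed
    ultimately show ?thesis by blast
  qed
  moreover have "openin ?P (\<Union>n. \<Union>a. {\<omega> \<in> topspace ?P. \<omega> n = a} \<inter> {\<omega> \<in> topspace ?P. \<omega> (Suc n) = linv a})"
    by (rule openin_Union, clarify, rule openin_Union, clarify, rule openin_Int[OF o o])
  ultimately have "openin ?P (topspace ?P - rays)" by (simp only:)
  then have "closedin ?P rays" using Om_top unfolding closedin_def by blast
  then have comp: "compactin ?P rays" by (rule closedin_compact_space[OF Pc])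
  have "continuous_map (subtopology ?P rays) (bdry_top F B) ray_end"
    unfolding continuous_map_def
  proof (intro conjI allI impI)
    show "ray_end \<in> topspace (subtopology ?P rays) \<rightarrow> topspace (bdry_top F B)" by auto
    fix U assume U: "openin (bdry_top F B) U"
    have top: "topspace (subtopology ?P rays) = rays" using Om_top by auto
    show "openin (subtopology ?P rays) {\<omega> \<in> topspace (subtopology ?P rays). ray_end \<omega> \<in> U}"
      unfolding top
    proof (subst openin_subopen, intro ballI)
      fix \<omega> assume "\<omega> \<in> {\<omega> \<in> rays. ray_end \<omega> \<in> U}"
      then obtain n where n: "cyl (pre \<omega> n) \<subseteq> U" and w: "\<omega> \<in> rays" using U unfolding openin_bdry by blast
      let ?V = "(\<Inter>i\<in>{..<n}. {\<omega>' \<in> topspace ?P. \<omega>' i = \<omega> i}) \<inter> topspace ?P"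
      have "openin ?P ?V" by (rule openin_INT, simp, rule o)
      then have "openin (subtopology ?P rays) (?V \<inter> rays)" by (simp add: openin_subtopology_Int)
      moreover have "\<omega> \<in> ?V \<inter> rays" using w Om_top by auto
      moreover have "?V \<inter> rays \<subseteq> {\<omega> \<in> rays. ray_end \<omega> \<in> U}"
      proof
        fix \<omega>' assume w': "\<omega>' \<in> ?V \<inter> rays"
        then have "pre \<omega>' n = pre \<omega> n" unfolding pre_eq_iff by auto
        then have "ray_end \<omega>' \<in> cyl (pre \<omega> n)" using w' ray_end_in_cyl by auto
        then show "\<omega>' \<in> {\<omega> \<in> rays. ray_end \<omega> \<in> U}" using n w' by auto
      qed
      ultimately show "\<exists>T. openin (subtopology ?P rays) T \<and> \<omega> \<in> T \<and> T \<subseteq> {\<omega> \<in> rays. ray_end \<omega> \<in> U}" by blast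
    qed
  qed
  then have "compactin (bdry_top F B) (ray_end ` rays)"
    using comp image_compactin[of "subtopology ?P rays" rays] by (simp add: compactin_subtopology)
  then show ?thesis unfolding compact_space_def by (simp add: Bd_eq)
qed

lemma compactin_cyl: "compactin (bdry_top F B) (cyl w)"
  using closedin_compact_space[OF compact_bdry closedin_cyl] .

text \<open>The action is defined as an elementwise image of a class, and the point is that the
  image is again a whole class. Left translations are isometries of the word metric, and translating
  back by \<open>inv g\<close> gives the missing inclusion.\<close>

lemma bdry_act_ray_end:
  assumes g: "g \<in> carrier F" and w: "\<omega> \<in> rays"
  shows "\<exists>\<omega>'\<in>rays. bdry_act F g (ray_end \<omega>) = ray_end \<omega>' \<and> tends (\<lambda>n. g \<otimes> ray \<omega> n) \<omega>'"
proof -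
  have shift: "W.gprel \<one> (\<lambda>n. a \<otimes> u n) (\<lambda>n. a \<otimes> v n)"
    if "a \<in> carrier F" "W.gprel \<one> u v" "range u \<subseteq> carrier F" "range v \<subseteq> carrier F" for a u v
  proof -
    have uv: "u n \<in> carrier F" "v n \<in> carrier F" for n using that by auto
    have wm: "word_metric F B (a \<otimes> x) (a \<otimes> y) = word_metric F B x y" if "x \<in> carrier F" "y \<in> carrier F" for x y
      using wmet_mult_left[of a x y] that \<open>a \<in> carrier F\<close> by (simp add: word_metric_eq)
    have "W.gprel a (\<lambda>n. a \<otimes> u n) (\<lambda>n. a \<otimes> v n)"
      using that(2) uv wm wm[OF one_closed] \<open>a \<in> carrier F\<close> unfolding W.gprel_def gromov_product_def by simp
    then show ?thesis using W.gprel_base that uv by (simp add: image_subset_iff)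
  qed
  have r: "range (ray \<omega>) \<subseteq> carrier F" "range (\<lambda>n. g \<otimes> ray \<omega> n) \<subseteq> carrier F" using w g by auto
  have "W.gprel \<one> (\<lambda>n. g \<otimes> ray \<omega> n) (\<lambda>n. g \<otimes> ray \<omega> n)"
    using shift[OF g tends_gprel[OF tends_ray[OF w] tends_ray[OF w]]] r by blast
  then obtain \<omega>' where w': "\<omega>' \<in> rays" "tends (\<lambda>n. g \<otimes> ray \<omega> n) \<omega>'" using gprel_self_tends r by blast
  have "bdry_act F g (ray_end \<omega>) = ray_end \<omega>'"
  proof (intro equalityI subsetI)
    fix v assume "v \<in> bdry_act F g (ray_end \<omega>)"
    then obtain u where u: "v = (\<lambda>n. g \<otimes> u n)" "tends u \<omega>" unfolding bdry_act_def ray_end_def by auto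
    have ru: "range u \<subseteq> carrier F" using u unfolding tends_def by blast
    have "W.gprel \<one> (\<lambda>n. g \<otimes> ray \<omega> n) v"
      unfolding u(1) by (rule shift[OF g tends_gprel[OF tends_ray[OF w] u(2)] r(1) ru])
    moreover have "range v \<subseteq> carrier F" using u(1) ru g by auto
    ultimately show "v \<in> ray_end \<omega>'" using gprel_tends[OF r(2) _ _ w'(2)] unfolding ray_end_def by blast
  next
    fix v assume "v \<in> ray_end \<omega>'"
    then have v: "tends v \<omega>'" "\<And>n. v n \<in> carrier F" unfolding ray_end_def tends_def by auto
    have "W.gprel \<one> (\<lambda>n. inv g \<otimes> (g \<otimes> ray \<omega> n)) (\<lambda>n. inv g \<otimes> v n)"
      by (rule shift[OF _ tends_gprel[OF w'(2) v(1)] r(2)]) (use g v in auto)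
    moreover have "(\<lambda>n. inv g \<otimes> (g \<otimes> ray \<omega> n)) = ray \<omega>" using g w by (simp flip: m_assoc)
    moreover have "range (\<lambda>n. inv g \<otimes> v n) \<subseteq> carrier F" using g v by auto
    ultimately have "tends (\<lambda>n. inv g \<otimes> v n) \<omega>"
      using gprel_tends[OF r(1) _ _ tends_ray[OF w]] by metis
    moreover have "v = (\<lambda>n. g \<otimes> (inv g \<otimes> v n))" using g v(2) by (simp flip: m_assoc)
    ultimately show "v \<in> bdry_act F g (ray_end \<omega>)"
      unfolding bdry_act_def ray_end_def by (intro image_eqI[of _ _ "\<lambda>n. inv g \<otimes> v n"]) auto
  qed
  then show ?thesis using w' by blast
qed

lemma bdry_act_Bd: "g \<in> carrier F \<Longrightarrow> \<xi> \<in> Bd \<Longrightarrow> bdry_act F g \<xi> \<in> Bd"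
  by (erule Bd_cases) (use bdry_act_ray_end ray_end_Bd in force)

lemma bdry_act_mult:
  assumes "g \<in> carrier F" "h \<in> carrier F" "\<xi> \<in> Bd"
  shows "bdry_act F (g \<otimes> h) \<xi> = bdry_act F g (bdry_act F h \<xi>)"
proof -
  have "u n \<in> carrier F" if "u \<in> \<xi>" for u n using assms(3) that unfolding Bd_eq ray_end_def tends_def by auto
  then have "(\<lambda>n. g \<otimes> h \<otimes> u n) = (\<lambda>n. g \<otimes> (h \<otimes> u n))" if "u \<in> \<xi>" for u
    using assms that by (auto simp: m_assoc)
  then show ?thesis unfolding bdry_act_def image_image by (intro image_cong) auto
qed

lemma bdry_act_one: "\<xi> \<in> Bd \<Longrightarrow> bdry_act F \<one> \<xi> = \<xi>"
proof -
  assume "\<xi> \<in> Bd"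
  then have "u n \<in> carrier F" if "u \<in> \<xi>" for u n using that unfolding Bd_eq ray_end_def tends_def by auto
  then have "(\<lambda>n. \<one> \<otimes> u n) = u" if "u \<in> \<xi>" for u using that by auto
  then show ?thesis unfolding bdry_act_def by simp
qed

lemma bdry_act_inv [simp]:
  assumes "g \<in> carrier F" "\<xi> \<in> Bd"
  shows "bdry_act F g (bdry_act F (inv g) \<xi>) = \<xi>" "bdry_act F (inv g) (bdry_act F g \<xi>) = \<xi>"
  using assms bdry_act_mult[of g "inv g" \<xi>] bdry_act_mult[of "inv g" g \<xi>] bdry_act_one by auto

text \<open>A non-empty \<open>y\<close> that branches off from \<open>x\<close> stops the
  cancellation exactly after \<open>c\<close>, so the prefix \<open>c\<close> is replaced by
  \<open>winv x\<close>.\<close>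

lemma bdry_act_cyl_subset:
  assumes g: "g \<in> carrier F" "rwd g = c @ x" and y: "x = [] \<or> y = [] \<or> hd x \<noteq> hd y" "y \<noteq> []"
    and xi: "\<xi> \<in> cyl (c @ y)"
  shows "bdry_act F (inv g) \<xi> \<in> cyl (winv x @ y)"
proof -
  obtain \<omega> where w: "\<omega> \<in> rays" "\<xi> = ray_end \<omega>" "pre \<omega> (length (c @ y)) = c @ y"
    using xi unfolding cyl_def by blast
  obtain \<omega>' where w': "\<omega>' \<in> rays" "bdry_act F (inv g) (ray_end \<omega>) = ray_end \<omega>'" "tends (\<lambda>n. inv g \<otimes> ray \<omega> n) \<omega>'"
    using bdry_act_ray_end[of "inv g"] g w by blast
  let ?n = "length (winv x @ y)"
  obtain N where N: "\<forall>i\<ge>N. take ?n (rwd (inv g \<otimes> ray \<omega> i)) = pre \<omega>' ?n"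
    using w'(3) unfolding tends_def by blast
  define i where "i = max N (length (c @ y))"
  have "take (length (c @ y)) (pre \<omega> i) = c @ y" using w(3) unfolding i_def by (simp add: min_def)
  then have "pre \<omega> i = (c @ y) @ drop (length (c @ y)) (pre \<omega> i)"
    by (metis append_take_drop_id)
  then have "rwd (ray \<omega> i) = c @ (y @ drop (length (c @ y)) (pre \<omega> i))"
    using rwd_ray[OF w(1)] by simp
  then have "rwd (inv g \<otimes> ray \<omega> i) = winv x @ (y @ drop (length (c @ y)) (pre \<omega> i))"
    using rwd_inv_mult[OF g, of "ray \<omega> i"] w(1) y by simp
  then have "pre \<omega>' ?n = winv x @ y" using N[rule_format, of i] unfolding i_def by simp
  then show ?thesis using w w' ray_end_in_cyl by simp
qed

text \<open>The reverse inclusion is the preceding lemma for \<open>inv g\<close>; its branching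
  condition at \<open>winv c\<close> holds because \<open>c @ y\<close> is reduced.\<close>

lemma bdry_act_cyl:
  assumes g: "g \<in> carrier F" "rwd g = c @ x" and y: "x = [] \<or> y = [] \<or> hd x \<noteq> hd y" "y \<noteq> []"
    and red: "reduced_word (c @ y)"
  shows "bdry_act F (inv g) ` cyl (c @ y) = cyl (winv x @ y)"
proof (intro equalityI subsetI)
  fix \<zeta> assume z: "\<zeta> \<in> cyl (winv x @ y)"
  have "rwd (inv g) = winv x @ winv c" using g rwd_inv by simp
  moreover have "winv c = [] \<or> y = [] \<or> hd (winv c) \<noteq> hd y"
    using red by (auto simp: reduced_append hd_winv)
  ultimately have "bdry_act F (inv (inv g)) \<zeta> \<in> cyl (winv (winv c) @ y)"
    using bdry_act_cyl_subset[of "inv g" "winv x" "winv c" y \<zeta>] g y z by simp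
  then have "bdry_act F g \<zeta> \<in> cyl (c @ y)" using g by simp
  moreover have "\<zeta> \<in> Bd" using z cyl_Bd by blast
  then have "\<zeta> = bdry_act F (inv g) (bdry_act F g \<zeta>)" using g bdry_act_inv by simp
  ultimately show "\<zeta> \<in> bdry_act F (inv g) ` cyl (c @ y)" by blast
qed (use bdry_act_cyl_subset[OF g y] in blast)

lemma distinct_ends_split:
  assumes "\<omega> \<in> rays" "\<omega>' \<in> rays" "\<omega> \<noteq> \<omega>'"
  obtains n where "pre \<omega> n = pre \<omega>' n" "\<omega> n \<noteq> \<omega>' n"
proof -
  have "\<exists>n. \<omega> n \<noteq> \<omega>' n" using assms(3) by (simp add: fun_eq_iff)
  then obtain n where "\<omega> n \<noteq> \<omega>' n" "\<forall>i<n. \<omega> i = \<omega>' i"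
    using exists_least_iff[of "\<lambda>n. \<omega> n \<noteq> \<omega>' n"] by blast
  then show ?thesis using that pre_eq_iff by blast
qed

section \<open>Borel sets of the boundary and of its square\<close>

abbreviation "BB \<equiv> borel_on (bdry_top F B)"

lemma space_BB [simp]: "space BB = Bd"
  and sets_BB: "sets BB = sigma_sets Bd {U. openin (bdry_top F B) U}"
proof -
  have "{U. openin (bdry_top F B) U} \<subseteq> Pow Bd" using openin_subset by fastforce
  then show "space BB = Bd" "sets BB = sigma_sets Bd {U. openin (bdry_top F B) U}"
    unfolding borel_on_def by auto
qed

lemma open_sets_BB: "openin (bdry_top F B) U \<Longrightarrow> U \<in> sets BB"
  unfolding sets_BB by (rule sigma_sets.Basic) simp

lemma cyl_sets [simp, measurable]: "cyl w \<in> sets BB"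
  by (rule open_sets_BB) simp

lemma open_eq_Union_cyl:
  assumes "openin (bdry_top F B) U"
  shows "U = \<Union> (cyl ` {w \<in> reduced_words. N \<le> length w \<and> cyl w \<subseteq> U})"
proof (intro equalityI subsetI)
  fix \<xi> assume x: "\<xi> \<in> U"
  then obtain \<omega> n where w: "\<xi> = ray_end \<omega>" "\<omega> \<in> rays" "cyl (pre \<omega> n) \<subseteq> U"
    using assms unfolding openin_bdry by (metis Bd_cases subsetD)
  have "cyl (pre \<omega> (max n N)) \<subseteq> U" using w cyl_pre_antimono by (meson max.cobounded1 order_trans)
  moreover have "\<xi> \<in> cyl (pre \<omega> (max n N))" using w ray_end_in_cyl by simp
  moreover have "pre \<omega> (max n N) \<in> reduced_words" using pre_reduced[OF w(2)] .
  ultimately show "\<xi> \<in> \<Union> (cyl ` {w \<in> reduced_words. N \<le> length w \<and> cyl w \<subseteq> U})"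
    by (intro UN_I[of "pre \<omega> (max n N)"]) auto
qed auto

text \<open>The lower bound \<open>N\<close> on the lengths is there for translations by a fixed
  group element, which map cylinders of sufficiently long words to cylinders.\<close>

lemma sets_BB_cyl: "sets BB = sigma_sets Bd (cyl ` {w \<in> reduced_words. N \<le> length w})"
  unfolding sets_BB
proof (rule sigma_sets_eqI)
  fix U assume "U \<in> {U. openin (bdry_top F B) U}"
  then have U: "U = \<Union> (cyl ` {w \<in> reduced_words. N \<le> length w \<and> cyl w \<subseteq> U})" using open_eq_Union_cyl by blast
  have "countable (cyl ` {w \<in> reduced_words. N \<le> length w \<and> cyl w \<subseteq> U})"
    using countable_reduced_words by (metis (no_types, lifting) countable_image countable_subset mem_Collect_eq subsetI)
  then have "\<Union> (cyl ` {w \<in> reduced_words. N \<le> length w \<and> cyl w \<subseteq> U}) \<in> sigma_sets Bd (cyl ` {w \<in> reduced_words. N \<le> length w})"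
    by (rule sigma_sets_UNION) (auto intro: sigma_sets.Basic)
  then show "U \<in> sigma_sets Bd (cyl ` {w \<in> reduced_words. N \<le> length w})" using U by simp
next
  fix U assume "U \<in> cyl ` {w \<in> reduced_words. N \<le> length w}"
  then show "U \<in> sigma_sets Bd {U. openin (bdry_top F B) U}" by (auto intro: sigma_sets.Basic)
qed

text \<open>The preimage of any set under a locally constant map is open.\<close>

lemma measurable_locally_constant:
  assumes "\<And>\<omega>. \<omega> \<in> rays \<Longrightarrow> \<exists>n. \<forall>\<xi>\<in>cyl (pre \<omega> n). f \<xi> = f (ray_end \<omega>)" and "f ` Bd \<subseteq> space N"
  shows "f \<in> measurable BB N"
proof (rule measurableI)
  show "f \<xi> \<in> space N" if "\<xi> \<in> space BB" for \<xi> using assms(2) that by auto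
  fix A assume "A \<in> sets N"
  have "openin (bdry_top F B) (f -` A \<inter> Bd)"
    unfolding openin_bdry
  proof (intro conjI ballI impI)
    fix \<omega> assume w: "\<omega> \<in> rays" "ray_end \<omega> \<in> f -` A \<inter> Bd"
    obtain n where "\<forall>\<xi>\<in>cyl (pre \<omega> n). f \<xi> = f (ray_end \<omega>)" using assms(1) w by blast
    then show "\<exists>n. cyl (pre \<omega> n) \<subseteq> f -` A \<inter> Bd" using w cyl_Bd by (intro exI[of _ n]) auto
  qed auto
  then show "f -` A \<inter> space BB \<in> sets BB" using open_sets_BB by simp
qed

text \<open>There are only countably many products of two cylinders, so every union of them is
  measurable.\<close>

lemma locally_rectangular_sets:
  assumes "V \<subseteq> Bd \<times> Bd"
    and "\<And>\<omega> \<omega>'. \<omega> \<in> rays \<Longrightarrow> \<omega>' \<in> rays \<Longrightarrow> (ray_end \<omega>, ray_end \<omega>') \<in> V \<Longrightarrow>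
      \<exists>n. cyl (pre \<omega> n) \<times> cyl (pre \<omega>' n) \<subseteq> V"
  shows "V \<in> sets (BB \<Otimes>\<^sub>M BB)"
proof -
  let ?I = "{(u, v) \<in> reduced_words \<times> reduced_words. cyl u \<times> cyl v \<subseteq> V}"
  have "V = (\<Union>(u, v)\<in>?I. cyl u \<times> cyl v)"
  proof (intro equalityI subsetI)
    fix p assume p: "p \<in> V"
    then have "p \<in> Bd \<times> Bd" using assms(1) by blast
    then obtain \<omega> \<omega>' where w: "p = (ray_end \<omega>, ray_end \<omega>')" "\<omega> \<in> rays" "\<omega>' \<in> rays"
      by (auto elim!: Bd_cases)
    then obtain n where "cyl (pre \<omega> n) \<times> cyl (pre \<omega>' n) \<subseteq> V" using assms(2) p by blast
    then have "(pre \<omega> n, pre \<omega>' n) \<in> ?I" using pre_reduced w by blast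
    moreover have "p \<in> cyl (pre \<omega> n) \<times> cyl (pre \<omega>' n)" using w ray_end_in_cyl by simp
    ultimately show "p \<in> (\<Union>(u, v)\<in>?I. cyl u \<times> cyl v)" by blast
  qed auto
  moreover have "countable ?I"
    by (rule countable_subset[OF _ countable_SIGMA[OF countable_reduced_words, of "\<lambda>_. reduced_words"]]) (use countable_reduced_words in auto)
  then have "(\<Union>(u, v)\<in>?I. cyl u \<times> cyl v) \<in> sets (BB \<Otimes>\<^sub>M BB)"
    by (rule sets.countable_UN'') auto
  ultimately show ?thesis by simp
qed

lemma topspace_dbl: "topspace (dbl_bdry_top F B) = {(\<xi>, \<zeta>). \<xi> \<in> Bd \<and> \<zeta> \<in> Bd \<and> \<xi> \<noteq> \<zeta>}"
  unfolding dbl_bdry_top_def by auto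

lemma topspace_dbl_sets: "topspace (dbl_bdry_top F B) \<in> sets (BB \<Otimes>\<^sub>M BB)"
proof (rule locally_rectangular_sets)
  fix \<omega> \<omega>' assume w: "\<omega> \<in> rays" "\<omega>' \<in> rays" "(ray_end \<omega>, ray_end \<omega>') \<in> topspace (dbl_bdry_top F B)"
  then have "\<omega> \<noteq> \<omega>'" unfolding topspace_dbl by auto
  then obtain n where n: "\<omega> n \<noteq> \<omega>' n" by (auto simp: fun_eq_iff)
  then have "pre \<omega> (Suc n) \<noteq> pre \<omega>' (Suc n)" unfolding pre_eq_iff by blast
  then have "cyl (pre \<omega> (Suc n)) \<inter> cyl (pre \<omega>' (Suc n)) = {}" by (intro cyl_disjoint) auto
  then show "\<exists>n. cyl (pre \<omega> n) \<times> cyl (pre \<omega>' n) \<subseteq> topspace (dbl_bdry_top F B)"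
    unfolding topspace_dbl using cyl_Bd by (intro exI[of _ "Suc n"]) blast
qed (auto simp: topspace_dbl)

end

section \<open>Trees with a base vertex on the axes of the basis\<close>

text \<open>Points \<open>a k\<close> and \<open>b k\<close> at the positions \<open>- A k\<close>
  and \<open>B k\<close> are to be joined by one isometric line. The position of a point on it is
  determined by its distances to \<open>a k\<close> and \<open>b k\<close> for large
  \<open>k\<close>.\<close>

lemma (in rtree) bi_infinite_line:
  fixes a b :: "nat \<Rightarrow> 'p" and A B :: "nat \<Rightarrow> real"
  assumes ab: "\<And>k. a k \<in> M" "\<And>k. b k \<in> M"
    and aa: "\<And>j k. d (a j) (a k) = \<bar>A j - A k\<bar>" and bb: "\<And>j k. d (b j) (b k) = \<bar>B j - B k\<bar>"
    and ab': "\<And>j k. d (a j) (b k) = A j + B k"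
    and mono: "mono A" "mono B" and unb: "\<And>Z. \<exists>k. Z \<le> A k" "\<And>Z. \<exists>k. Z \<le> B k"
  shows "\<exists>l. range l \<subseteq> M \<and> (\<forall>s t. d (l s) (l t) = \<bar>s - t\<bar>) \<and> (\<forall>k. l (- A k) = a k) \<and> (\<forall>k. l (B k) = b k)"
proof -
  \<comment> \<open>\<open>Q p t\<close> says that \<open>p\<close> has position \<open>t\<close>.
    Such points come from the segments between \<open>a N\<close> and \<open>b N\<close>, and
    \<open>point_formula\<close> makes the position isometric, hence the point unique.\<close>
  define Q where "Q p t \<longleftrightarrow> p \<in> M \<and> (\<exists>N. \<forall>k\<ge>N. d p (b k) = B k - t \<and> d p (a k) = A k + t)" for p t
  have big: "\<exists>N. \<forall>k\<ge>N. Z \<le> A k \<and> Z \<le> B k" for Z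
  proof -
    obtain k k' where k: "Z \<le> A k" "Z \<le> B k'" using unb by metis
    have "Z \<le> A j \<and> Z \<le> B j" if "j \<ge> max k k'" for j
      using k monoD[OF mono(1), of k j] monoD[OF mono(2), of k' j] that by auto
    then show ?thesis by blast
  qed
  have ex: "\<exists>p. Q p t" for t
  proof -
    obtain N where N: "\<forall>k\<ge>N. \<bar>t\<bar> \<le> A k \<and> \<bar>t\<bar> \<le> B k" using big by blast
    then have t: "\<bar>t\<bar> \<le> A N" "\<bar>t\<bar> \<le> B N" by auto
    obtain c where c: "c \<in> M"
      "\<And>z. z \<in> M \<Longrightarrow> d c z = max (d (a N) z - (A N + t)) (d (b N) z - (d (a N) (b N) - (A N + t)))"
      using obtain_point[OF ab, of "A N + t" N N] t ab' by (smt (verit))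
    have "d c (b k) = B k - t \<and> d c (a k) = A k + t" if "k \<ge> N" for k
    proof -
      have m: "A N \<le> A k" "B N \<le> B k" using mono that by (auto dest: monoD)
      have "d c (b k) = B k - t" using c(2)[OF ab(2)] m t ab'[of N N] ab'[of N k] bb[of N k] by auto
      moreover have "d c (a k) = A k + t"
        using c(2)[OF ab(1)] m t ab'[of N N] ab'[of k N] aa[of N k] commute[of "b N" "a k"] by auto
      ultimately show ?thesis by simp
    qed
    then show ?thesis unfolding Q_def using c(1) by blast
  qed
  have iso: "d p q = \<bar>t - t'\<bar>" if pq': "Q p t" "Q q t'" for p q t t'
  proof -
    obtain N N' where N: "\<forall>k\<ge>N. d p (b k) = B k - t \<and> d p (a k) = A k + t"
      "\<forall>k\<ge>N'. d q (b k) = B k - t' \<and> d q (a k) = A k + t'" using pq' unfolding Q_def by meson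
    define K where "K = max N N'"
    have K: "d p (b K) = B K - t" "d p (a K) = A K + t" "d q (b K) = B K - t'" "d q (a K) = A K + t'"
      using N unfolding K_def by auto
    have pq: "p \<in> M" "q \<in> M" using pq' unfolding Q_def by auto
    have "btw (a K) p (b K)" using K ab' commute[of "a K" p] unfolding btw_def by simp
    then have "d p q = max (d (a K) q - d (a K) p) (d (b K) q - d p (b K))"
      using point_formula[OF ab pq(2,1)] by blast
    then show ?thesis using K commute[of "a K"] commute[of "b K"] by auto
  qed
  define l where "l t = (SOME p. Q p t)" for t
  have Ql: "Q (l t) t" for t unfolding l_def using ex by (rule someI_ex)
  have lM: "l t \<in> M" for t using Ql unfolding Q_def by blast
  have Qb: "Q (b k) (B k)" for k
    unfolding Q_def
  proof (intro conjI exI[of _ k] allI impI ab)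
    fix j assume "k \<le> j"
    then have "B k \<le> B j" using mono by (auto dest: monoD)
    then show "d (b k) (b j) = B j - B k" "d (b k) (a j) = A j + B k"
      using bb ab' commute[of "b k" "a j"] by auto
  qed
  have Qa: "Q (a k) (- A k)" for k
    unfolding Q_def
  proof (intro conjI exI[of _ k] allI impI ab)
    fix j assume "k \<le> j"
    then have "A k \<le> A j" using mono by (auto dest: monoD)
    then show "d (a k) (b j) = B j - - A k" "d (a k) (a j) = A j + - A k"
      using aa ab' by auto
  qed
  have "l (- A k) = a k" "l (B k) = b k" for k
    using iso[OF Ql Qa] iso[OF Ql Qb] lM ab by (metis abs_zero diff_self zero)+
  then show ?thesis using iso Ql lM by (intro exI[of _ l]) auto
qed

text \<open>The displacements of a single vertex are prescribed. By equivariance its orbit is then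
  an isometric copy of \<open>F\<close> with the weighted word metric, and all boundary data can be
  computed there.\<close>

locale based_tree = fin_free_group F B + weighted_free_group F B \<mu> + tree_action F T
  for F :: "('g, 'm) monoid_scheme" (structure) and B and \<mu> and T :: "('g, 'p) gtree" +
  fixes o\<^sub>T :: 'p
  assumes base_M [simp]: "o\<^sub>T \<in> M"
    and base_dist: "\<And>g. g \<in> carrier F \<Longrightarrow> d o\<^sub>T (act g o\<^sub>T) = wlen \<mu> g"
begin

abbreviation orb :: "'g \<Rightarrow> 'p" where "orb g \<equiv> act g o\<^sub>T"

lemma orb_dist: "g \<in> carrier F \<Longrightarrow> h \<in> carrier F \<Longrightarrow> d (orb g) (orb h) = wmet \<mu> g h"
  using base_dist[of "inv g \<otimes> h"] by (simp add: d_act_left act_mult wmet_def)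

lemma gp_orb: "g \<in> carrier F \<Longrightarrow> h \<in> carrier F \<Longrightarrow> gp o\<^sub>T (orb g) (orb h) = wl \<mu> (lcp (rwd g) (rwd h))"
  unfolding gromov_product_def by (simp add: base_dist orb_dist wmet_eq)

lemma weight_bound: "\<exists>c>0. \<forall>w. set w \<subseteq> Lam \<longrightarrow> c * real (length w) \<le> wl \<mu> w"
proof -
  define c where "c = (if B = {} then 1 else Min (\<mu> ` B))"
  have c: "c > 0" "\<And>b. b \<in> B \<Longrightarrow> c \<le> \<mu> b" unfolding c_def using finite_basis pos by auto
  have "c * real (length w) \<le> wl \<mu> w" if "set w \<subseteq> Lam" for w
    by (rule wl_ge) (use that c in auto)
  then show ?thesis using c by blast
qed

lemma wl_pre_mono:
  assumes "\<omega> \<in> rays" "m \<le> n" shows "wl \<mu> (pre \<omega> m) \<le> wl \<mu> (pre \<omega> n)"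
proof -
  have "pre \<omega> n = pre \<omega> m @ drop m (pre \<omega> n)"
    using assms(2) by (metis append_take_drop_id min.absorb1 take_pre)
  moreover have "set (drop m (pre \<omega> n)) \<subseteq> Lam"
    using reduced_words_D(1)[OF pre_reduced[OF assms(1), of n]] set_drop_subset by fastforce
  ultimately show ?thesis using wl_lam_nonneg by (metis le_add_same_cancel1 wl_simps(3))
qed

lemma wl_pre_unbounded:
  assumes "\<omega> \<in> rays" shows "\<exists>n. Z < wl \<mu> (pre \<omega> n)"
proof -
  obtain c where c: "c > 0" "\<And>w. set w \<subseteq> Lam \<Longrightarrow> c * real (length w) \<le> wl \<mu> w"
    using weight_bound by blast
  obtain n where "Z < real n * c" using ex_less_of_nat_mult c(1) by blast
  then have "Z < wl \<mu> (pre \<omega> n)"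
    using c(2)[OF reduced_words_D(1)[OF pre_reduced[OF assms, of n]]] by (simp add: mult.commute)
  then show ?thesis by blast
qed

lemma tends_orb_gprel:
  assumes "tends u \<omega>" "tends v \<omega>" "\<omega> \<in> rays"
  shows "gprel o\<^sub>T (\<lambda>n. orb (u n)) (\<lambda>n. orb (v n))"
  unfolding gprel_def
proof
  fix Z
  obtain n where n: "Z < wl \<mu> (pre \<omega> n)" using wl_pre_unbounded[OF assms(3)] by blast
  obtain N where N: "\<forall>i\<ge>N. take n (rwd (u i)) = pre \<omega> n" using assms(1) unfolding tends_def by blast
  obtain N' where N': "\<forall>i\<ge>N'. take n (rwd (v i)) = pre \<omega> n" using assms(2) unfolding tends_def by blast
  have uv: "u i \<in> carrier F" "v i \<in> carrier F" for i using assms unfolding tends_def by auto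
  have "Z \<le> gp o\<^sub>T (orb (u i)) (orb (v j))" if "i \<ge> max N N'" "j \<ge> max N N'" for i j
  proof -
    have t: "take n (rwd (u i)) = pre \<omega> n" "take n (rwd (v j)) = pre \<omega> n" using N N' that by auto
    then have "n \<le> length (rwd (u i))" "n \<le> length (rwd (v j))"
      by (metis length_pre length_take min.absorb_iff2 min.commute)+
    then have "n \<le> length (lcp (rwd (u i)) (rwd (v j)))" using t by (intro length_lcp_ge) auto
    moreover have "take (length (lcp (rwd (u i)) (rwd (v j)))) (rwd (u i)) = lcp (rwd (u i)) (rwd (v j))"
      using lcp_split[of "rwd (u i)" "rwd (v j)"] by (metis append_eq_conv_conj)
    ultimately have "take n (lcp (rwd (u i)) (rwd (v j))) = pre \<omega> n"
      using t by (metis min.absorb1 take_take)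
    then have e: "lcp (rwd (u i)) (rwd (v j)) = pre \<omega> n @ drop n (lcp (rwd (u i)) (rwd (v j)))"
      by (metis append_take_drop_id)
    have "set (lcp (rwd (u i)) (rwd (v j))) \<subseteq> Lam"
      using lcp_split[of "rwd (u i)" "rwd (v j)"] rwd_Lam[OF uv(1)] by (metis le_sup_iff set_append)
    then have "set (drop n (lcp (rwd (u i)) (rwd (v j)))) \<subseteq> Lam" using set_drop_subset by fastforce
    then have "wl \<mu> (pre \<omega> n) \<le> wl \<mu> (lcp (rwd (u i)) (rwd (v j)))"
      using e wl_lam_nonneg by (metis le_add_same_cancel1 wl_simps(3))
    then show ?thesis using n gp_orb uv by simp
  qed
  then show "\<exists>N. \<forall>i\<ge>N. \<forall>j\<ge>N. Z \<le> gp o\<^sub>T (orb (u i)) (orb (v j))" by blast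
qed

section \<open>Ends of the tree and Busemann functions\<close>

abbreviation oray :: "(nat \<Rightarrow> 'g \<times> bool) \<Rightarrow> nat \<Rightarrow> 'p" where
  "oray \<omega> \<equiv> \<lambda>n. orb (ray \<omega> n)"

lemma gp_oray:
  assumes "\<omega> \<in> rays" shows "gp o\<^sub>T (oray \<omega> i) (oray \<omega> j) = wl \<mu> (pre \<omega> (min i j))"
proof -
  have "lcp (pre \<omega> i) (pre \<omega> j) = pre \<omega> (min i j)"
  proof -
    have "pre \<omega> i = pre \<omega> (min i j) @ drop (min i j) (pre \<omega> i)"
      "pre \<omega> j = pre \<omega> (min i j) @ drop (min i j) (pre \<omega> j)"
      by (metis append_take_drop_id take_pre min.assoc min.commute min.idem)+
    moreover have "drop (min i j) (pre \<omega> i) = [] \<or> drop (min i j) (pre \<omega> j) = []"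
      by (auto simp: min_def)
    ultimately show ?thesis using lcp_append by metis
  qed
  then show ?thesis using gp_orb assms rwd_ray by simp
qed

text \<open>The definition of \<open>tree_end\<close> admits every representative and every orbit;
  here both are fixed. Passing from the orbit of \<open>x\<close> to that of
  \<open>o\<^sub>T\<close> costs at most \<open>d x o\<^sub>T\<close> in Gromov products.\<close>

lemma tree_end_iff:
  assumes w: "\<omega> \<in> rays"
  shows "z \<in> tree_end T (ray_end \<omega>) \<longleftrightarrow> range z \<subseteq> M \<and> gprel o\<^sub>T (oray \<omega>) z"
proof
  assume "z \<in> tree_end T (ray_end \<omega>)"
  then obtain u x where ux: "tends u \<omega>" "x \<in> M" "((\<lambda>n. act (u n) x), z) \<in> gromov_rel M d"
    unfolding tree_end_def ray_end_def by auto
  have u: "u n \<in> carrier F" for n using ux unfolding tends_def by auto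
  have r: "range (\<lambda>n. act (u n) x) \<subseteq> M" "range z \<subseteq> M" "range (\<lambda>n. orb (u n)) \<subseteq> M"
    "range (oray \<omega>) \<subseteq> M" and g1: "gprel o\<^sub>T (\<lambda>n. act (u n) x) z"
    using ux(3) u w unfolding gromov_rel_iff[OF base_M] by auto
  have g2: "gprel o\<^sub>T (oray \<omega>) (\<lambda>n. orb (u n))"
    using tends_orb_gprel[OF tends_ray[OF w] ux(1) w] .
  have "gprel o\<^sub>T (\<lambda>n. orb (u n)) (\<lambda>n. act (u n) x)"
    unfolding gprel_def
  proof
    fix Z
    have "gprel o\<^sub>T (\<lambda>n. orb (u n)) (\<lambda>n. orb (u n))" using tends_orb_gprel ux(1) w by blast
    then obtain N where N: "\<forall>i\<ge>N. \<forall>j\<ge>N. Z + d x o\<^sub>T \<le> gp o\<^sub>T (orb (u i)) (orb (u j))"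
      unfolding gprel_def by blast
    have "Z \<le> gp o\<^sub>T (orb (u i)) (act (u j) x)" if "i \<ge> N" "j \<ge> N" for i j
    proof -
      have "d (orb (u j)) (act (u j) x) = d o\<^sub>T x" using u ux(2) by simp
      moreover have "d o\<^sub>T (orb (u j)) \<le> d o\<^sub>T (act (u j) x) + d (act (u j) x) (orb (u j))"
        "d (act (u j) x) (orb (u i)) \<le> d (act (u j) x) (orb (u j)) + d (orb (u j)) (orb (u i))"
        by (rule triangle; simp add: u ux(2))+
      ultimately have "gp o\<^sub>T (orb (u i)) (orb (u j)) - d x o\<^sub>T \<le> gp o\<^sub>T (orb (u i)) (act (u j) x)"
        using commute[of "orb (u i)" "orb (u j)"] commute[of "orb (u j)" "act (u j) x"]
          commute[of "act (u j) x" "orb (u i)"] commute[of x o\<^sub>T]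
        unfolding gromov_product_def by (simp add: field_simps)
      moreover have "Z + d x o\<^sub>T \<le> gp o\<^sub>T (orb (u i)) (orb (u j))" using N that by blast
      ultimately show ?thesis by linarith
    qed
    then show "\<exists>N. \<forall>i\<ge>N. \<forall>j\<ge>N. Z \<le> gp o\<^sub>T (orb (u i)) (act (u j) x)" by blast
  qed
  then have "gprel o\<^sub>T (oray \<omega>) (\<lambda>n. act (u n) x)" using gprel_trans[OF g2 _ base_M] r by blast
  then show "range z \<subseteq> M \<and> gprel o\<^sub>T (oray \<omega>) z" using gprel_trans[OF _ g1 base_M] r by blast
next
  assume "range z \<subseteq> M \<and> gprel o\<^sub>T (oray \<omega>) z"
  then have "(oray \<omega>, z) \<in> gromov_rel M d" using w unfolding gromov_rel_iff[OF base_M] by auto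
  then show "z \<in> tree_end T (ray_end \<omega>)"
    unfolding tree_end_def ray_end_def using tends_ray[OF w] base_M by blast
qed

lemma oray_tree_end: "\<omega> \<in> rays \<Longrightarrow> oray \<omega> \<in> tree_end T (ray_end \<omega>)"
  unfolding tree_end_iff using tends_orb_gprel tends_ray by auto

text \<open>In a tree the limit defining a Busemann function is reached after finitely many steps:
  once two points agree beyond distance \<open>d y x\<close> as seen from \<open>y\<close>, their
  Gromov products with \<open>x\<close> coincide.\<close>

lemma end_difference:
  assumes w: "\<omega> \<in> rays" and xy: "x \<in> M" "y \<in> M"
    and far: "\<And>i j. i \<ge> N \<Longrightarrow> j \<ge> N \<Longrightarrow> d y x < gp y (oray \<omega> i) (oray \<omega> j)"
    and z: "z \<in> tree_end T (ray_end \<omega>)"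
  shows "\<exists>K. \<forall>n\<ge>K. d x (z n) - d y (z n) = d x (oray \<omega> N) - d y (oray \<omega> N)"
proof -
  have r: "range z \<subseteq> M" "range (oray \<omega>) \<subseteq> M" "gprel o\<^sub>T (oray \<omega>) z"
    using z w tree_end_iff[OF w] by auto
  then have rM: "z i \<in> M" "oray \<omega> i \<in> M" for i by auto
  have "gprel y (oray \<omega>) z" using gprel_base[OF r(3) base_M xy(2) r(2,1)] .
  then obtain K where K: "\<forall>i\<ge>K. \<forall>j\<ge>K. d y x + 1 \<le> gp y (oray \<omega> i) (z j)"
    unfolding gprel_def by blast
  have "d x (z n) - d y (z n) = d x (oray \<omega> N) - d y (oray \<omega> N)" if n: "n \<ge> K" for n
  proof -
    let ?j = "max N K"
    have le: "gp y x (oray \<omega> i) \<le> d y x" for i using gp_le xy rM by blast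
    have "gp y x (oray \<omega> ?j) < gp y (z n) (oray \<omega> ?j)"
      using le[of ?j] K[rule_format, of ?j n] n gp_comm[of y "z n" "oray \<omega> ?j"] xy rM by simp
    then have "gp y x (z n) = gp y x (oray \<omega> ?j)" using gp_le_cases[OF xy(2,1) rM(1,2)] by blast
    moreover have "gp y x (oray \<omega> ?j) < gp y (oray \<omega> N) (oray \<omega> ?j)"
      using le[of ?j] far[of N ?j] by simp
    then have "gp y x (oray \<omega> N) = gp y x (oray \<omega> ?j)" using gp_le_cases[OF xy(2,1) rM(2,2)] by blast
    ultimately have "gp y x (z n) = gp y x (oray \<omega> N)" by simp
    then show ?thesis unfolding gromov_product_def by (simp add: field_simps)
  qed
  then show ?thesis by blast
qed

lemma busemann_eq:
  assumes w: "\<omega> \<in> rays" and xy: "x \<in> M" "y \<in> M"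
    and far: "\<And>i j. i \<ge> N \<Longrightarrow> j \<ge> N \<Longrightarrow> d y x < gp y (oray \<omega> i) (oray \<omega> j)"
  shows "busemann T (ray_end \<omega>) x y = d x (oray \<omega> N) - d y (oray \<omega> N)"
  unfolding busemann_def
proof (rule the_equality)
  let ?b = "d x (oray \<omega> N) - d y (oray \<omega> N)"
  have lim: "(\<lambda>n. d x (z n) - d y (z n)) \<longlonglongrightarrow> ?b" if "z \<in> tree_end T (ray_end \<omega>)" for z
    using end_difference[OF w xy far that]
    by (intro tendsto_eventually) (auto simp: eventually_sequentially)
  then show "\<forall>z\<in>tree_end T (ray_end \<omega>). (\<lambda>n. d x (z n) - d y (z n)) \<longlonglongrightarrow> ?b" by blast
  fix b assume "\<forall>z\<in>tree_end T (ray_end \<omega>). (\<lambda>n. d x (z n) - d y (z n)) \<longlonglongrightarrow> b"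
  then show "b = ?b" using lim oray_tree_end[OF w] LIMSEQ_unique by blast
qed

lemma busemann_eventually:
  assumes w: "\<omega> \<in> rays" and xy: "x \<in> M" "y \<in> M" and z: "z \<in> tree_end T (ray_end \<omega>)"
  shows "\<exists>K. \<forall>n\<ge>K. d x (z n) - d y (z n) = busemann T (ray_end \<omega>) x y"
proof -
  have "gprel o\<^sub>T (oray \<omega>) (oray \<omega>)" using oray_tree_end[OF w] tree_end_iff[OF w] by blast
  then have "gprel y (oray \<omega>) (oray \<omega>)"
    by (rule gprel_base) (use xy w in auto)
  then obtain N where N: "\<forall>i\<ge>N. \<forall>j\<ge>N. d y x + 1 \<le> gp y (oray \<omega> i) (oray \<omega> j)"
    unfolding gprel_def by blast
  have far: "d y x < gp y (oray \<omega> i) (oray \<omega> j)" if "i \<ge> N" "j \<ge> N" for i j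
    using N that by fastforce
  show ?thesis using end_difference[OF w xy far z] busemann_eq[OF w xy far] by simp
qed

text \<open>A prefix longer than \<open>d o\<^sub>T x\<close> decides the value. This is the source
  of local constancy, and thereby of measurability.\<close>

lemma busemann_prefix:
  assumes w: "\<omega> \<in> rays" and x: "x \<in> M" and far: "d o\<^sub>T x < wl \<mu> (pre \<omega> N)"
  shows "busemann T (ray_end \<omega>) x o\<^sub>T = d x (oray \<omega> N) - wl \<mu> (pre \<omega> N)"
proof -
  have "d o\<^sub>T x < gp o\<^sub>T (oray \<omega> i) (oray \<omega> j)" if "i \<ge> N" "j \<ge> N" for i j
    using far wl_pre_mono[OF w, of N "min i j"] gp_oray[OF w] that by simp
  then have "busemann T (ray_end \<omega>) x o\<^sub>T = d x (oray \<omega> N) - d o\<^sub>T (oray \<omega> N)"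
    by (intro busemann_eq[OF w x base_M]) auto
  then show ?thesis using base_dist w rwd_ray unfolding wlen_def by simp
qed

lemma busemann_locally_constant:
  assumes w: "\<omega> \<in> rays" and x: "x \<in> M"
  shows "\<exists>n. \<forall>\<xi>\<in>cyl (pre \<omega> n). busemann T \<xi> x o\<^sub>T = busemann T (ray_end \<omega>) x o\<^sub>T"
proof -
  obtain n where n: "d o\<^sub>T x < wl \<mu> (pre \<omega> n)" using wl_pre_unbounded[OF w] by blast
  have "busemann T \<xi> x o\<^sub>T = busemann T (ray_end \<omega>) x o\<^sub>T" if "\<xi> \<in> cyl (pre \<omega> n)" for \<xi>
  proof -
    obtain \<omega>' where w': "\<omega>' \<in> rays" "\<xi> = ray_end \<omega>'" "pre \<omega>' n = pre \<omega> n"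
      using \<open>\<xi> \<in> cyl (pre \<omega> n)\<close> unfolding cyl_def by auto
    then show ?thesis using busemann_prefix[OF w x n] busemann_prefix[OF w'(1) x, of n] n
      unfolding ray_def by simp
  qed
  then show ?thesis by blast
qed

lemma busemann_measurable: "x \<in> M \<Longrightarrow> (\<lambda>\<xi>. busemann T \<xi> x o\<^sub>T) \<in> borel_measurable BB"
  by (rule measurable_locally_constant) (use busemann_locally_constant in auto)

lemma busemann_cocycle:
  assumes \<xi>: "\<xi> \<in> Bd" and "x \<in> M" "y \<in> M" "z \<in> M"
  shows "busemann T \<xi> x y + busemann T \<xi> y z = busemann T \<xi> x z"
proof -
  obtain \<omega> where w: "\<omega> \<in> rays" "\<xi> = ray_end \<omega>" using Bd_cases[OF \<xi>] by metis
  obtain K1 K2 K3 where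
    "\<forall>n\<ge>K1. d x (oray \<omega> n) - d y (oray \<omega> n) = busemann T (ray_end \<omega>) x y"
    "\<forall>n\<ge>K2. d y (oray \<omega> n) - d z (oray \<omega> n) = busemann T (ray_end \<omega>) y z"
    "\<forall>n\<ge>K3. d x (oray \<omega> n) - d z (oray \<omega> n) = busemann T (ray_end \<omega>) x z"
    using busemann_eventually[OF w(1) _ _ oray_tree_end[OF w(1)]] assms(2-4) by meson
  then have "d x (oray \<omega> n) - d y (oray \<omega> n) = busemann T (ray_end \<omega>) x y"
    "d y (oray \<omega> n) - d z (oray \<omega> n) = busemann T (ray_end \<omega>) y z"
    "d x (oray \<omega> n) - d z (oray \<omega> n) = busemann T (ray_end \<omega>) x z" if "n = max K1 (max K2 K3)" for n
    using that by auto
  then show ?thesis using w by fastforce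
qed

lemma busemann_equivariant:
  assumes g: "g \<in> carrier F" and \<xi>: "\<xi> \<in> Bd" and xy: "x \<in> M" "y \<in> M"
  shows "busemann T (bdry_act F g \<xi>) (act g x) (act g y) = busemann T \<xi> x y"
proof -
  obtain \<omega> where w: "\<omega> \<in> rays" "\<xi> = ray_end \<omega>" using Bd_cases[OF \<xi>] by metis
  obtain \<omega>' where w': "\<omega>' \<in> rays" "bdry_act F g (ray_end \<omega>) = ray_end \<omega>'" "tends (\<lambda>n. g \<otimes> ray \<omega> n) \<omega>'"
    using bdry_act_ray_end[OF g w(1)] by blast
  have eq: "orb (g \<otimes> ray \<omega> n) = act g (oray \<omega> n)" for n using act_mult g w by simp
  have te: "(\<lambda>n. orb (g \<otimes> ray \<omega> n)) \<in> tree_end T (ray_end \<omega>')"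
    unfolding tree_end_iff[OF w'(1)] using tends_orb_gprel[OF tends_ray[OF w'(1)] w'(3,1)] g w by auto
  obtain K where K: "\<forall>n\<ge>K. d (act g x) (act g (oray \<omega> n)) - d (act g y) (act g (oray \<omega> n)) =
      busemann T (ray_end \<omega>') (act g x) (act g y)"
    using busemann_eventually[OF w'(1) act_closed[OF g xy(1)] act_closed[OF g xy(2)] te]
    unfolding eq by blast
  obtain K' where K': "\<forall>n\<ge>K'. d x (oray \<omega> n) - d y (oray \<omega> n) = busemann T (ray_end \<omega>) x y"
    using busemann_eventually[OF w(1) xy oray_tree_end[OF w(1)]] by blast
  have "d (act g x) (act g (oray \<omega> (max K K'))) - d (act g y) (act g (oray \<omega> (max K K'))) =
      busemann T (ray_end \<omega>') (act g x) (act g y)" using K by simp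
  moreover have "d x (oray \<omega> (max K K')) - d y (oray \<omega> (max K K')) = busemann T (ray_end \<omega>) x y"
    using K' by simp
  ultimately show ?thesis using g xy w w' by simp
qed

text \<open>On the way to the end, \<open>orb g\<close> is behind \<open>o\<^sub>T\<close> by the
  weight of \<open>x\<close> and ahead of it by the weight of \<open>c\<close>.\<close>

lemma busemann_orb:
  assumes g: "g \<in> carrier F" "rwd g = c @ x" and \<xi>: "\<xi> \<in> cyl (c @ y)"
    and ne: "x = [] \<or> (y \<noteq> [] \<and> hd x \<noteq> hd y)"
  shows "busemann T \<xi> (orb g) o\<^sub>T = wlen \<mu> g - 2 * wl \<mu> c"
proof -
  obtain \<omega> where w: "\<omega> \<in> rays" "\<xi> = ray_end \<omega>" "pre \<omega> (length (c @ y)) = c @ y"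
    using \<xi> unfolding cyl_def by blast
  obtain K where K: "\<forall>n\<ge>K. d (orb g) (oray \<omega> n) - d o\<^sub>T (oray \<omega> n) = busemann T (ray_end \<omega>) (orb g) o\<^sub>T"
    using busemann_eventually[OF w(1) _ _ oray_tree_end[OF w(1)]] g base_M by (meson act_closed)
  define n where "n = max K (length (c @ y))"
  have "take (length (c @ y)) (pre \<omega> n) = c @ y" using w(3) unfolding n_def by (simp add: min_def)
  then have "pre \<omega> n = c @ (y @ drop (length (c @ y)) (pre \<omega> n))"
    by (metis append_take_drop_id append.assoc)
  then have "lcp (rwd g) (rwd (ray \<omega> n)) = c"
    using lcp_append[of x "y @ drop (length (c @ y)) (pre \<omega> n)" c] ne g w rwd_ray
    by (metis Nil_is_append_conv hd_append2)
  then have "d (orb g) (oray \<omega> n) - d o\<^sub>T (oray \<omega> n) = wlen \<mu> g - 2 * wl \<mu> c"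
    using orb_dist[of g "ray \<omega> n"] base_dist[of "ray \<omega> n"] wmet_eq[of g "ray \<omega> n"] g w by simp
  then show ?thesis using K w unfolding n_def by simp
qed

text \<open>The two rays part after \<open>n\<close> letters. Their tails from this vertex on run in
  opposite directions and form a line.\<close>

lemma geodesic_exists:
  assumes w: "\<omega> \<in> rays" "\<omega>' \<in> rays" and n: "pre \<omega> n = pre \<omega>' n" "\<omega> n \<noteq> \<omega>' n"
  shows "\<exists>l. geodesic_between T (ray_end \<omega>) (ray_end \<omega>') l"
proof -
  define a where "a k = oray \<omega> (n + k)" for k
  define b where "b k = oray \<omega>' (n + k)" for k
  define A where "A k = wl \<mu> (pre \<omega> (n + k)) - wl \<mu> (pre \<omega> n)" for k
  define C where "C k = wl \<mu> (pre \<omega>' (n + k)) - wl \<mu> (pre \<omega>' n)" for k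
  have abM: "a k \<in> M" "b k \<in> M" for k unfolding a_def b_def using w by auto
  have dist1: "d (oray \<omega> i) (oray \<omega> j) = \<bar>wl \<mu> (pre \<omega> i) - wl \<mu> (pre \<omega> j)\<bar>" if "\<omega> \<in> rays" for \<omega> i j
  proof -
    have "d (oray \<omega> i) (oray \<omega> j) = d o\<^sub>T (oray \<omega> i) + d o\<^sub>T (oray \<omega> j) - 2 * gp o\<^sub>T (oray \<omega> i) (oray \<omega> j)"
      unfolding gromov_product_def by (simp add: field_simps)
    then have "d (oray \<omega> i) (oray \<omega> j) = wl \<mu> (pre \<omega> i) + wl \<mu> (pre \<omega> j) - 2 * wl \<mu> (pre \<omega> (min i j))"
      using gp_oray[OF that] base_dist that rwd_ray unfolding wlen_def by simp
    then show ?thesis using wl_pre_mono[OF that, of i j] wl_pre_mono[OF that, of j i]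
      by (cases "i \<le> j") (auto simp: min_def)
  qed
  have dist2: "d (oray \<omega> (n + i)) (oray \<omega>' (n + j)) = A i + C j" for i j
  proof -
    have "gp o\<^sub>T (oray \<omega> (n + i)) (oray \<omega>' (n + j)) = wl \<mu> (pre \<omega> n)"
    proof -
      have split: "pre \<omega> (n + i) = pre \<omega> n @ map \<omega> [n..<n+i]" for \<omega> :: "nat \<Rightarrow> 'g \<times> bool" and i
        unfolding pre_def upt_add_eq_append[of 0 n i, simplified] by simp
      have "map \<omega> [n..<n+i] = [] \<or> map \<omega>' [n..<n+j] = [] \<or> hd (map \<omega> [n..<n+i]) \<noteq> hd (map \<omega>' [n..<n+j])"
        using n(2) by (cases "i = 0 \<or> j = 0") (auto simp: hd_map hd_upt)
      then have "lcp (pre \<omega> (n + i)) (pre \<omega>' (n + j)) = pre \<omega> n"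
        unfolding split n(1)[symmetric] by (rule lcp_append)
      then show ?thesis using gp_orb w rwd_ray by simp
    qed
    moreover have "d (oray \<omega> (n + i)) (oray \<omega>' (n + j)) =
      d o\<^sub>T (oray \<omega> (n + i)) + d o\<^sub>T (oray \<omega>' (n + j)) - 2 * gp o\<^sub>T (oray \<omega> (n + i)) (oray \<omega>' (n + j))"
      unfolding gromov_product_def by (simp add: field_simps)
    ultimately show ?thesis
      using base_dist w rwd_ray n(1) unfolding wlen_def A_def C_def by simp
  qed
  have mono: "mono A" "mono C" unfolding A_def C_def using wl_pre_mono w by (auto intro!: monoI)
  have unb: "\<exists>k. Z \<le> wl \<mu> (pre \<omega> (n + k)) - wl \<mu> (pre \<omega> n)" if w: "\<omega> \<in> rays" for Z \<omega>
  proof -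
    obtain k where "Z + wl \<mu> (pre \<omega> n) < wl \<mu> (pre \<omega> k)" using wl_pre_unbounded[OF w] by blast
    then show ?thesis using wl_pre_mono[OF w, of k "n + k"] by (intro exI[of _ k]) simp
  qed
  obtain l where l: "range l \<subseteq> M" "\<And>s t. d (l s) (l t) = \<bar>s - t\<bar>" "\<And>k. l (- A k) = a k" "\<And>k. l (C k) = b k"
    using bi_infinite_line[of a b A C] abM dist1 dist2 mono unb w
    unfolding a_def b_def A_def C_def by (auto simp: abs_minus_commute)
  have lM: "l t \<in> M" for t using l by auto
  \<comment> \<open>The sign \<open>\<epsilon>\<close> of the parameter lets one argument serve both
    ends of the line.\<close>
  have "(\<lambda>i. l (\<epsilon> * real i)) \<in> tree_end T (ray_end \<zeta>)"
    if \<zeta>: "\<zeta> \<in> rays" and A': "\<And>k. l (\<epsilon> * (wl \<mu> (pre \<zeta> (n + k)) - wl \<mu> (pre \<zeta> n))) = oray \<zeta> (n + k)"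
      and \<epsilon>: "\<bar>\<epsilon>\<bar> = 1" for \<zeta> \<epsilon>
    unfolding tree_end_iff[OF \<zeta>]
  proof
    show r: "range (\<lambda>i. l (\<epsilon> * real i)) \<subseteq> M" using lM by auto
    have "gprel (l 0) (oray \<zeta>) (\<lambda>i. l (\<epsilon> * real i))"
      unfolding gprel_def
    proof
      fix Z
      obtain k where k: "Z \<le> wl \<mu> (pre \<zeta> (n + k)) - wl \<mu> (pre \<zeta> n)" using unb[OF \<zeta>] by blast
      obtain m :: nat where m: "Z \<le> real m" using real_arch_simple by blast
      have "Z \<le> gp (l 0) (oray \<zeta> i) (l (\<epsilon> * real j))" if ij: "i \<ge> n + k + m" "j \<ge> n + k + m" for i j
      proof -
        define t where "t = wl \<mu> (pre \<zeta> i) - wl \<mu> (pre \<zeta> n)"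
        have li: "oray \<zeta> i = l (\<epsilon> * t)" using A'[of "i - n"] ij unfolding t_def by simp
        have "Z \<le> t" "0 \<le> t" using k wl_pre_mono[OF \<zeta>, of "n + k" i] wl_pre_mono[OF \<zeta>, of n i] ij
          unfolding t_def by auto
        moreover have "\<bar>\<epsilon> * t - \<epsilon> * real j\<bar> = \<bar>t - real j\<bar>"
          using \<epsilon> by (simp flip: right_diff_distrib add: abs_mult)
        moreover have "Z \<le> real j" using m ij by linarith
        ultimately show ?thesis
          unfolding li gromov_product_def l(2) using \<epsilon> by (simp add: abs_mult)
      qed
      then show "\<exists>N. \<forall>i\<ge>N. \<forall>j\<ge>N. Z \<le> gp (l 0) (oray \<zeta> i) (l (\<epsilon> * real j))" by blast
    qed
    then show "gprel o\<^sub>T (oray \<zeta>) (\<lambda>i. l (\<epsilon> * real i))"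
      by (rule gprel_base) (use lM \<zeta> in auto)
  qed
  from this[OF w(1), of "-1"] this[OF w(2), of 1]
  show ?thesis
    unfolding geodesic_between_def using l unfolding a_def b_def A_def C_def by (intro exI[of _ l]) auto
qed

text \<open>The distance from \<open>x\<close> to a line is the Gromov product at \<open>x\<close>
  of two points far out on it. Moving the base point to \<open>o\<^sub>T\<close> produces the
  Busemann terms, and at \<open>o\<^sub>T\<close> the product is the weight of the common
  prefix.\<close>

lemma geodesic_distance:
  assumes w: "\<omega> \<in> rays" "\<omega>' \<in> rays" and n: "pre \<omega> n = pre \<omega>' n" "\<omega> n \<noteq> \<omega>' n"
    and l: "geodesic_between T (ray_end \<omega>) (ray_end \<omega>') l" and x: "x \<in> M"
  shows "(INF t. d x (l t)) =
    (busemann T (ray_end \<omega>) x o\<^sub>T + busemann T (ray_end \<omega>') x o\<^sub>T) / 2 + wl \<mu> (pre \<omega> n)" (is "_ = ?K")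
proof -
  have l': "\<And>t. l t \<in> M" "\<And>s t. d (l s) (l t) = \<bar>s - t\<bar>"
    "(\<lambda>n. l (- real n)) \<in> tree_end T (ray_end \<omega>)" "(\<lambda>n. l (real n)) \<in> tree_end T (ray_end \<omega>')"
    using l unfolding geodesic_between_def by auto
  obtain K1 where K1: "\<forall>n\<ge>K1. d x (l (- real n)) - d o\<^sub>T (l (- real n)) = busemann T (ray_end \<omega>) x o\<^sub>T"
    using busemann_eventually[OF w(1) x base_M l'(3)] by blast
  obtain K2 where K2: "\<forall>n\<ge>K2. d x (l (real n)) - d o\<^sub>T (l (real n)) = busemann T (ray_end \<omega>') x o\<^sub>T"
    using busemann_eventually[OF w(2) x base_M l'(4)] by blast
  let ?h = "wl \<mu> (pre \<omega> n)"
  obtain K3 where K3: "\<forall>i\<ge>K3. \<forall>j\<ge>K3. ?h + 1 \<le> gp o\<^sub>T (oray \<omega> i) (l (- real j))"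
    using l'(3) unfolding tree_end_iff[OF w(1)] gprel_def by blast
  obtain K4 where K4: "\<forall>i\<ge>K4. \<forall>j\<ge>K4. ?h + 1 \<le> gp o\<^sub>T (oray \<omega>' i) (l (real j))"
    using l'(4) unfolding tree_end_iff[OF w(2)] gprel_def by blast
  \<comment> \<open>Beyond all thresholds; \<open>Suc n\<close> ensures that the two rays have
    already parted.\<close>
  define N where "N = Max {K1, K2, K3, K4, Suc n}"
  have N: "K1 \<le> N" "K2 \<le> N" "K3 \<le> N" "K4 \<le> N" "Suc n \<le> N" unfolding N_def by auto
  have K: "gp x (l (- real i)) (l (real i)) = ?K" if i: "i \<ge> N" for i
  proof -
    let ?r = "oray \<omega> N" and ?r' = "oray \<omega>' N" and ?z = "l (- real i)" and ?w = "l (real i)"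
    have rM: "?r \<in> M" "?r' \<in> M" "?z \<in> M" "?w \<in> M" using w l' by auto
    have "lcp (pre \<omega> N) (pre \<omega>' N) = pre \<omega> n"
    proof -
      have split: "pre \<omega> N = pre \<omega> n @ map \<omega> [n..<N]" for \<omega> :: "nat \<Rightarrow> 'g \<times> bool"
        using N(5) upt_add_eq_append[of 0 n "N - n"] unfolding pre_def by simp
      show ?thesis
        unfolding split n(1)[symmetric] using n(2) N(5) by (intro lcp_append) (simp add: hd_map hd_upt)
    qed
    then have h: "gp o\<^sub>T ?r ?r' = ?h" using gp_orb w rwd_ray by simp
    have "gp o\<^sub>T ?r' ?r < gp o\<^sub>T ?z ?r"
      using K3[rule_format, of N i] N i gp_comm[of o\<^sub>T] rM h by simp
    then have 1: "gp o\<^sub>T ?r' ?z = ?h" using gp_le_cases[OF base_M rM(2,3,1)] h gp_comm[of o\<^sub>T ?r ?r'] rM by simp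
    have "gp o\<^sub>T ?z ?r' < gp o\<^sub>T ?w ?r'"
      using K4[rule_format, of N i] N i gp_comm[of o\<^sub>T ?w ?r'] gp_comm[of o\<^sub>T ?z ?r'] rM 1 by simp
    then have "gp o\<^sub>T ?z ?w = ?h"
      using gp_le_cases[OF base_M rM(3,4,2)] 1 gp_comm[of o\<^sub>T ?z ?r'] rM by simp
    moreover have "d x ?z - d o\<^sub>T ?z = busemann T (ray_end \<omega>) x o\<^sub>T" using K1 N i by simp
    moreover have "d x ?w - d o\<^sub>T ?w = busemann T (ray_end \<omega>') x o\<^sub>T" using K2 N i by simp
    ultimately show ?thesis unfolding gromov_product_def by (simp add: field_simps)
  qed
  show ?thesis
  proof (rule cInf_eq_minimum)
    let ?a = "l (- real N)" and ?b = "l (real N)"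
    have ab: "?a \<in> M" "?b \<in> M" "d ?a ?b = 2 * real N" using l' by auto
    obtain c where c: "c \<in> M" "d ?a c = gp ?a x ?b" "btw ?a c ?b"
      "\<And>z. z \<in> M \<Longrightarrow> d c z = max (d ?a z - gp ?a x ?b) (d ?b z - (d ?a ?b - gp ?a x ?b))"
      using obtain_point[OF ab(1,2), of "gp ?a x ?b"] gp_nonneg[of ?a x ?b] gp_le[of ?a ?b x]
        gp_comm[of ?a x ?b] ab x by metis
    \<comment> \<open>The parameter of the foot of \<open>x\<close>, counted from \<open>?a\<close>,
      which has parameter \<open>- real N\<close>.\<close>
    define t where "t = gp ?a x ?b - real N"
    have g: "0 \<le> gp ?a x ?b" "gp ?a x ?b \<le> 2 * real N"
      using gp_nonneg[of ?a x ?b] gp_le[of ?a ?b x] gp_comm[of ?a x ?b] ab x by auto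
    have "btw ?a (l t) ?b" "d ?a (l t) = gp ?a x ?b" using l' g unfolding btw_def t_def by auto
    then have "c = l t" using btw_unique[OF ab(1,2) c(1) l'(1) c(3)] c(2) by simp
    moreover have "d c x = gp x ?a ?b"
      using c(4)[OF x] ab commute[of x] unfolding gromov_product_def by (simp add: field_simps)
    ultimately have "d x (l t) = ?K" using K[of N] commute[of x] by simp
    then show "?K \<in> range (\<lambda>t. d x (l t))" by (metis rangeI)
    fix y assume "y \<in> range (\<lambda>t. d x (l t))"
    then obtain t where t: "y = d x (l t)" by blast
    obtain m :: nat where m: "\<bar>t\<bar> \<le> real m" using real_arch_simple by blast
    let ?i = "max N m"
    have "gp x (l (- real ?i)) (l (real ?i)) \<le> d x (l t)"
    proof -
      have "d x (l (- real ?i)) \<le> d x (l t) + d (l t) (l (- real ?i))"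
        "d x (l (real ?i)) \<le> d x (l t) + d (l t) (l (real ?i))"
        using triangle[OF x l'(1,1)] by blast+
      moreover have "d (l t) (l (- real ?i)) + d (l t) (l (real ?i)) = d (l (- real ?i)) (l (real ?i))"
        using m unfolding l' by auto
      ultimately show ?thesis unfolding gromov_product_def by (simp add: field_simps)
    qed
    then show "?K \<le> y" using K[of ?i] t by simp
  qed
qed

text \<open>This turns the density of the current with respect to \<open>m x\<close> into the one with respect
  to the measure at the base vertex.\<close>

lemma dist_to_geodesic_eq:
  assumes w: "\<omega> \<in> rays" "\<omega>' \<in> rays" and n: "pre \<omega> n = pre \<omega>' n" "\<omega> n \<noteq> \<omega>' n" and x: "x \<in> M"
  shows "dist_to_geodesic T x (ray_end \<omega>) (ray_end \<omega>') =
    (busemann T (ray_end \<omega>) x o\<^sub>T + busemann T (ray_end \<omega>') x o\<^sub>T) / 2 + wl \<mu> (pre \<omega> n)"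
  unfolding dist_to_geodesic_def
proof (rule the_equality)
  obtain l where l: "geodesic_between T (ray_end \<omega>) (ray_end \<omega>') l" using geodesic_exists[OF w n] by blast
  then show "\<exists>l. geodesic_between T (ray_end \<omega>) (ray_end \<omega>') l \<and>
      (busemann T (ray_end \<omega>) x o\<^sub>T + busemann T (ray_end \<omega>') x o\<^sub>T) / 2 + wl \<mu> (pre \<omega> n) = (INF t. d x (l t))"
    using geodesic_distance[OF w n l x] by (intro exI[of _ l]) simp
next
  fix r assume "\<exists>l. geodesic_between T (ray_end \<omega>) (ray_end \<omega>') l \<and> r = (INF t. d x (l t))"
  then show "r = (busemann T (ray_end \<omega>) x o\<^sub>T + busemann T (ray_end \<omega>') x o\<^sub>T) / 2 + wl \<mu> (pre \<omega> n)"
    using geodesic_distance[OF w n _ x] by auto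
qed

end

section \<open>Uniqueness of the Patterson--Sullivan data\<close>

text \<open>What is known about the tree chosen by \<open>PS_map\<close> after rescaling of the
  weights: its length function is that of a weighted rose. The right-hand side has the form provided
  by \<open>lt_eq\<close>.\<close>

locale weighted_tree = fin_free_group F B + weighted_free_group F B \<mu> + tree_action F T
  for F :: "('g, 'm) monoid_scheme" (structure) and B and \<mu> and T :: "('g, 'p) gtree" +
  assumes lengths: "\<And>g. g \<in> carrier F \<Longrightarrow> length_fun F T g = max 0 (wlen \<mu> (g \<otimes> g) - wlen \<mu> g)"
begin

lemma lt_pair:
  assumes "a \<in> Lam" "b \<in> Lam" "b \<noteq> linv a"
  shows "lt (val [a] \<otimes> val [b]) = \<mu> (fst a) + \<mu> (fst b)"
proof -
  have "val [a] \<otimes> val [b] \<in> carrier F" using assms by (intro m_closed val_closed) auto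
  moreover have "0 < \<mu> (fst a)" "0 < \<mu> (fst b)" using assms pos by auto
  ultimately show ?thesis using lengths wlen_pair[OF assms] by simp
qed

lemma lt_letter: "a \<in> Lam \<Longrightarrow> lt (val [a]) = \<mu> (fst a)"
  using lengths[of "val [a]"] wlen_pair(2)[of a a \<mu>] wlen_letter[of a \<mu>] wlen_pair(1)[of a a \<mu>]
    pos[of "fst a"] by auto

text \<open>Additivity of the lengths of products of two basis elements makes their axes meet
  pairwise, hence in a common point. From there, two-letter words of all signs move the point as far
  as possible, and local geodesics in a tree are geodesics.\<close>

lemma base_point_exists: "\<exists>z\<in>M. \<forall>g\<in>carrier F. d z (act g z) = wlen \<mu> g"
proof -
  have vb: "val [(b, True)] = b" if "b \<in> B" for b using that B_carrier by (auto simp: val_Cons)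
  have ax: "\<exists>z\<in>M. \<forall>b\<in>B. z \<in> axis b"
  proof (rule axes_common_point[OF finite_basis B_carrier])
    show "0 < lt b" if "b \<in> B" for b using lt_letter[of "(b, True)"] vb pos that by simp
    show "lt (g \<otimes> h) = lt g + lt h" if "g \<in> B" "h \<in> B" "g \<noteq> h" for g h
      using lt_pair[of "(g, True)" "(h, True)"] lt_letter[of "(g, True)"] lt_letter[of "(h, True)"] vb that
      by (simp add: linv_def)
  qed
  obtain z where z: "z \<in> M" "\<And>b. b \<in> B \<Longrightarrow> d z (act b z) = \<mu> b"
  proof -
    assume *: "\<And>z. z \<in> M \<Longrightarrow> (\<And>b. b \<in> B \<Longrightarrow> d z (act b z) = \<mu> b) \<Longrightarrow> thesis"
    obtain z where z: "z \<in> M" "\<forall>b\<in>B. z \<in> axis b" using ax by blast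
    have "d z (act b z) = \<mu> b" if "b \<in> B" for b
      using z(2) lt_letter[of "(b, True)"] vb[OF that] that unfolding axis_def by simp
    then show thesis using * z(1) by blast
  qed
  have letter: "d z (act (val [a]) z) = \<mu> (fst a)" if a: "a \<in> Lam" for a
  proof (cases "snd a")
    case True
    then show ?thesis using z(2) a vb[of "fst a"] by (metis mem_Times_iff prod.collapse)
  next
    case False
    have b: "fst a \<in> B" "fst a \<in> carrier F" using a B_carrier by auto
    then have "val [a] = inv (fst a)" using False by (simp add: val_Cons)
    then show ?thesis using z b d_act_left[of "fst a" z z] commute by simp
  qed
  \<comment> \<open>The common point alone would allow two axes to share a segment there. The
    translation lengths of all reduced two-letter words exclude this; the upper bound is the
    triangle inequality.\<close>
  have pair: "d z (act (val [a] \<otimes> val [b]) z) = \<mu> (fst a) + \<mu> (fst b)"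
    if "a \<in> Lam" "b \<in> Lam" "b \<noteq> linv a" for a b
  proof -
    have c: "val [a] \<in> carrier F" "val [b] \<in> carrier F" using that by auto
    have "d z (act (val [a] \<otimes> val [b]) z) \<le> d z (act (val [a]) z) + d (act (val [a]) z) (act (val [a] \<otimes> val [b]) z)"
      using c z by (intro triangle) auto
    also have "\<dots> = \<mu> (fst a) + \<mu> (fst b)" using c z letter that by (simp add: act_mult)
    finally show ?thesis using lt_le[of "val [a] \<otimes> val [b]" z] lt_pair[OF that] c z by simp
  qed
  \<comment> \<open>Betweenness of the first vertex is carried along, since \<open>btw_trans\<close>
    needs it to attach the next letter.\<close>
  have main: "w \<noteq> [] \<longrightarrow> d z (act (val w) z) = wl \<mu> w \<and> btw z (act (val [hd w]) z) (act (val w) z)"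
    if "w \<in> reduced_words" for w using that
  proof (induction w)
    case (Cons a w)
    then have a: "a \<in> Lam" "w \<in> reduced_words" by (auto simp: reduced_words_def reduced_append[of "[a]", simplified])
    then have c: "val [a] \<in> carrier F" "val w \<in> carrier F" by (auto simp: reduced_words_def)
    have v: "val (a # w) = val [a] \<otimes> val w" using val_append[of "[a]" w] a by (simp add: reduced_words_def)
    show ?case
    proof (cases w)
      case Nil
      then show ?thesis using letter a c z unfolding btw_def by simp
    next
      case (Cons b w')
      then have b: "b \<in> Lam" "b \<noteq> linv a" using \<open>a # w \<in> reduced_words\<close> by (auto simp: reduced_words_def)
      then have cb: "val [b] \<in> carrier F" by simp
      let ?x = "act (val [a]) z" and ?y = "act (val [a] \<otimes> val [b]) z" and ?w = "act (val (a # w)) z"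
      have M': "?x \<in> M" "?y \<in> M" "?w \<in> M" using c cb z v by auto
      have IH: "d z (act (val w) z) = wl \<mu> w" "btw z (act (val [b]) z) (act (val w) z)"
        using Cons.IH a Cons by auto
      have "btw ?x ?y ?w"
        using btw_act[OF c(1) z(1) _ _ IH(2)] c cb z v by (simp add: act_mult)
      moreover have dxy: "d ?x ?y = \<mu> (fst b)" using c cb z letter[OF b(1)] by (simp add: act_mult)
      then have "btw z ?x ?y" using pair[OF a(1) b] letter[OF a(1)] unfolding btw_def by simp
      moreover have "?x \<noteq> ?y" using dxy pos[of "fst b"] b M' by force
      ultimately have "btw z ?x ?w" using btw_trans(2)[OF z(1) M'] by blast
      moreover have "d ?x ?w = wl \<mu> w" using IH(1) c z v by (simp add: act_mult)
      ultimately show ?thesis using letter[OF a(1)] unfolding btw_def by simp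
    qed
  qed simp
  have "d z (act g z) = wlen \<mu> g" if "g \<in> carrier F" for g
    using main[OF rwd_reduced[OF that]] that z by (cases "rwd g = []") (auto simp: wlen_def rwd_eq_Nil)
  then show ?thesis using z by blast
qed

end

section \<open>Cylinders under left translations\<close>

context fin_free_group
begin

lemma cyl_letter_cases:
  assumes "\<xi> \<in> Bd" obtains a where "a \<in> Lam" "\<xi> \<in> cyl [a]"
proof -
  obtain \<omega> where w: "\<omega> \<in> rays" "\<xi> = ray_end \<omega>" using Bd_cases[OF assms] by metis
  then have "\<omega> 0 \<in> Lam" "\<xi> \<in> cyl [\<omega> 0]" using ray_end_in_cyl by (simp_all add: rays_def pre_def image_subset_iff)
  then show ?thesis by (rule that)
qed

lemma bdry_act_letter_vimage:
  assumes a: "a \<in> Lam"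
  shows "bdry_act F (inv (val [a])) -` (Bd - cyl [linv a]) \<inter> Bd = cyl [a]"
proof (intro equalityI subsetI)
  have va: "val [a] \<in> carrier F" "rwd (val [a]) = [a]" using rwd_val[of "[a]"] a by (simp_all add: reduced_words_def)
  fix \<xi>
  {
    assume "\<xi> \<in> cyl [a]"
    then obtain \<omega> where w: "\<omega> \<in> rays" "\<xi> = ray_end \<omega>" "\<omega> 0 = a" unfolding cyl_def by (auto simp: pre_def)
    have "\<xi> \<in> cyl ([a] @ [\<omega> 1])" using w ray_end_in_cyl by (simp add: pre_def upt_conv_Cons)
    then have "bdry_act F (inv (val [a])) \<xi> \<in> cyl (winv [] @ [\<omega> 1])"
      using bdry_act_cyl_subset[of "val [a]" "[a]" "[]" "[\<omega> 1]"] va by simp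
    moreover have "\<omega> 1 \<noteq> linv a" using w unfolding rays_def by (metis (mono_tags, lifting) One_nat_def mem_Collect_eq)
    then have "cyl [\<omega> 1] \<inter> cyl [linv a] = {}" by (intro cyl_disjoint) auto
    ultimately show "\<xi> \<in> bdry_act F (inv (val [a])) -` (Bd - cyl [linv a]) \<inter> Bd"
      using \<open>\<xi> \<in> cyl [a]\<close> cyl_Bd by auto
  }
  assume x: "\<xi> \<in> bdry_act F (inv (val [a])) -` (Bd - cyl [linv a]) \<inter> Bd"
  then obtain b where b: "b \<in> Lam" "\<xi> \<in> cyl [b]" using cyl_letter_cases by blast
  have "b = a"
  proof (rule ccontr)
    assume "b \<noteq> a"
    then have "bdry_act F (inv (val [a])) \<xi> \<in> cyl (winv [a] @ [b])"
      using bdry_act_cyl_subset[of "val [a]" "[]" "[a]" "[b]" \<xi>] va b by simp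
    moreover have "cyl [linv a, b] \<subseteq> cyl [linv a]" unfolding cyl_def by (force simp: pre_def)
    ultimately show False using x by auto
  qed
  then show "\<xi> \<in> cyl [a]" using b by simp
qed

lemma letters_partition: "Bd = (\<Union>a\<in>Lam. cyl [a])" "disjoint_family_on (\<lambda>a. cyl [a]) Lam"
proof -
  show "Bd = (\<Union>a\<in>Lam. cyl [a])"
  proof (rule equalityI; rule subsetI)
    fix \<xi> assume "\<xi> \<in> Bd"
    then obtain a where "a \<in> Lam" "\<xi> \<in> cyl [a]" by (rule cyl_letter_cases)
    then show "\<xi> \<in> (\<Union>a\<in>Lam. cyl [a])" by (rule UN_I)
  next
    fix \<xi> assume "\<xi> \<in> (\<Union>a\<in>Lam. cyl [a])"
    then show "\<xi> \<in> Bd" using cyl_Bd by (elim UN_E) (rule subsetD)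
  qed
  show "disjoint_family_on (\<lambda>a. cyl [a]) Lam"
    unfolding disjoint_family_on_def using cyl_disjoint[of "[_]" "[_]"] by simp
qed

lemma bdry_act_vimage_cyl:
  assumes g: "g \<in> carrier F" and w: "w \<in> reduced_words" "length (rwd g) < length w"
  obtains c x y where "rwd g = c @ x" "w = c @ y" "y \<noteq> []" "x = [] \<or> hd x \<noteq> hd y"
    "bdry_act F g -` cyl w \<inter> Bd = cyl (winv x @ y)" "winv x @ y \<in> reduced_words"
proof -
  obtain x y where xy: "rwd g = lcp (rwd g) w @ x" "w = lcp (rwd g) w @ y"
    "x = [] \<or> y = [] \<or> hd x \<noteq> hd y" using lcp_split by blast
  have y: "y \<noteq> []"
  proof
    assume "y = []"
    then have "length w = length (lcp (rwd g) w)" using xy(2) by (metis append_Nil2)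
    then show False using w(2) length_lcp_le[of "rwd g" w] by simp
  qed
  have im: "bdry_act F (inv g) ` cyl w = cyl (winv x @ y)"
    using bdry_act_cyl[OF g xy(1) xy(3) y] xy(2) w reduced_words_D by metis
  have "bdry_act F g -` cyl w \<inter> Bd = bdry_act F (inv g) ` cyl w"
  proof (intro equalityI subsetI)
    fix \<xi> assume "\<xi> \<in> bdry_act F g -` cyl w \<inter> Bd"
    then have "bdry_act F g \<xi> \<in> cyl w" "\<xi> = bdry_act F (inv g) (bdry_act F g \<xi>)" using g by auto
    then show "\<xi> \<in> bdry_act F (inv g) ` cyl w" by blast
  next
    fix \<xi> assume "\<xi> \<in> bdry_act F (inv g) ` cyl w"
    then obtain \<zeta> where z: "\<zeta> \<in> cyl w" "\<xi> = bdry_act F (inv g) \<zeta>" by blast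
    then have "\<zeta> \<in> Bd" using cyl_Bd by blast
    then show "\<xi> \<in> bdry_act F g -` cyl w \<inter> Bd" using z g bdry_act_Bd by simp
  qed
  moreover have "winv x @ y \<in> reduced_words"
  proof -
    have "val w \<in> carrier F" "rwd (val w) = w" using w(1) rwd_val reduced_words_D by auto
    then have "rwd (inv g \<otimes> val w) = winv x @ y" using rwd_inv_mult[OF g xy(1) _ _ xy(3)] xy(2) by simp
    then show ?thesis using rwd_reduced[of "inv g \<otimes> val w"] g \<open>val w \<in> carrier F\<close> by simp
  qed
  ultimately show ?thesis using that[OF xy(1,2) y] xy(3) y im by simp
qed

lemma bdry_act_measurable:
  assumes g: "g \<in> carrier F"
  shows "bdry_act F g \<in> measurable BB BB"
proof (rule measurable_sigma_sets[OF sets_BB_cyl[of "length (rwd g) + 1"]])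
  show "cyl ` {w \<in> reduced_words. length (rwd g) + 1 \<le> length w} \<subseteq> Pow Bd" using cyl_Bd by auto
  show "bdry_act F g \<in> space BB \<rightarrow> Bd" using bdry_act_Bd g by auto
  fix A assume "A \<in> cyl ` {w \<in> reduced_words. length (rwd g) + 1 \<le> length w}"
  then obtain w where w: "A = cyl w" "w \<in> reduced_words" "length (rwd g) < length w" by auto
  then show "bdry_act F g -` A \<inter> space BB \<in> sets BB"
    using bdry_act_vimage_cyl[OF g w(2,3)] by (metis cyl_sets space_BB)
qed

end

section \<open>Masses of letter cylinders and of their rectangles\<close>

context based_tree
begin

lemma busemann_letter:
  assumes "a \<in> Lam" "\<xi> \<in> Bd - cyl [linv a]"
  shows "busemann T \<xi> (orb (inv (val [a]))) o\<^sub>T = \<mu> (fst a)"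
proof -
  have va: "val [a] \<in> carrier F" "rwd (val [a]) = [a]" using rwd_val[of "[a]"] assms by (auto simp: reduced_words_def)
  obtain b where b: "b \<in> Lam" "\<xi> \<in> cyl [b]" using cyl_letter_cases assms by blast
  then have "b \<noteq> linv a" using assms by auto
  then have "busemann T \<xi> (orb (inv (val [a]))) o\<^sub>T = wlen \<mu> (inv (val [a])) - 2 * wl \<mu> []"
    using busemann_orb[of "inv (val [a])" "[]" "[linv a]" \<xi> "[b]"] va b by (simp add: rwd_inv)
  then show ?thesis using va wlen_inv[of "val [a]" \<mu>] wlen_letter[OF assms(1)] by simp
qed

text \<open>Equivariance under \<open>a\<inverse>\<close>, which maps the cylinder of \<open>a\<close> onto the complement of the cylinder
  of \<open>a\<inverse>\<close>.\<close>

lemma PS_family_letters: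
  assumes ps: "patterson_sullivan_family F B T h m" and a: "a \<in> Lam"
  shows "measure (m o\<^sub>T) (cyl [a]) =
    exp (- h * \<mu> (fst a)) * (measure (m o\<^sub>T) Bd - measure (m o\<^sub>T) (cyl [linv a]))"
proof -
  let ?g = "inv (val [a])" and ?A = "Bd - cyl [linv a]"
  have g: "?g \<in> carrier F" using a by simp
  have m: "space (m o\<^sub>T) = Bd" "sets (m o\<^sub>T) = sets BB" "finite_measure (m o\<^sub>T)"
    using ps base_M unfolding patterson_sullivan_family_def by auto
  interpret finite_measure "m o\<^sub>T" by (rule m(3))
  have A: "?A \<in> sets BB" using sets.top[of BB] by (intro sets.Diff) auto
  have f: "(\<lambda>\<xi>. ennreal (exp (- h * busemann T \<xi> (orb ?g) o\<^sub>T))) \<in> borel_measurable (m o\<^sub>T)"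
  proof -
    have "(\<lambda>\<xi>. busemann T \<xi> (orb ?g) o\<^sub>T) \<in> borel_measurable (m o\<^sub>T)"
      using busemann_measurable[of "orb ?g"] g by (simp add: measurable_cong_sets[OF m(2) refl])
    then show ?thesis by measurable
  qed
  have "emeasure (m o\<^sub>T) (cyl [a]) = emeasure (distr (m o\<^sub>T) BB (bdry_act F ?g)) ?A"
    using emeasure_distr[of "bdry_act F ?g" "m o\<^sub>T" BB ?A] bdry_act_measurable[OF g] A
      bdry_act_letter_vimage[OF a] m by (simp add: measurable_cong_sets[OF m(2) refl])
  also have "\<dots> = emeasure (density (m o\<^sub>T) (\<lambda>\<xi>. ennreal (exp (- h * busemann T \<xi> (orb ?g) o\<^sub>T)))) ?A"
    using ps g base_M unfolding patterson_sullivan_family_def by (metis act_closed)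
  also have "\<dots> = (\<integral>\<^sup>+\<xi>. ennreal (exp (- h * busemann T \<xi> (orb ?g) o\<^sub>T)) * indicator ?A \<xi> \<partial>m o\<^sub>T)"
    using emeasure_density[OF f] A m by simp
  also have "\<dots> = (\<integral>\<^sup>+\<xi>. ennreal (exp (- h * \<mu> (fst a))) * indicator ?A \<xi> \<partial>m o\<^sub>T)"
    using busemann_letter[OF a] by (intro nn_integral_cong) (auto split: split_indicator)
  also have "\<dots> = ennreal (exp (- h * \<mu> (fst a))) * emeasure (m o\<^sub>T) ?A"
    using A m by (intro nn_integral_cmult_indicator) simp
  finally have "measure (m o\<^sub>T) (cyl [a]) = exp (- h * \<mu> (fst a)) * measure (m o\<^sub>T) ?A"
    unfolding measure_def by (simp add: enn2real_mult)
  moreover have "measure (m o\<^sub>T) ?A = measure (m o\<^sub>T) Bd - measure (m o\<^sub>T) (cyl [linv a])"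
    using m cyl_Bd sets.top[of BB] by (intro finite_measure_Diff) auto
  ultimately show ?thesis by simp
qed

text \<open>The exponent \<open>h\<close> is determined by the family: the masses of the letter cylinders must add up
  to the total mass.\<close>

lemma PS_family_values:
  assumes ps: "patterson_sullivan_family F B T h m" and card: "card B \<ge> 2"
    and s: "(\<Sum>b\<in>B. 1 / (1 + exp (s * \<mu> b))) = 1 / 2"
  obtains P where "P > 0"
    "\<And>a. a \<in> Lam \<Longrightarrow> emeasure (m o\<^sub>T) (cyl [a]) = ennreal (P / (1 + exp (s * \<mu> (fst a))))"
proof -
  have m: "space (m o\<^sub>T) = Bd" "sets (m o\<^sub>T) = sets BB" "finite_measure (m o\<^sub>T)" "emeasure (m o\<^sub>T) Bd \<noteq> 0"
    using ps base_M unfolding patterson_sullivan_family_def by fastforce+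
  interpret finite_measure "m o\<^sub>T" by (rule m(3))
  define P where "P = measure (m o\<^sub>T) Bd"
  have P: "P > 0" using m(4) unfolding P_def by (simp add: emeasure_eq_measure zero_less_measure_iff)
  define p where "p a = measure (m o\<^sub>T) (cyl [a])" for a
  define q where "q b = exp (- h * \<mu> b)" for b
  have rec: "p a = q (fst a) * (P - p (linv a))" if "a \<in> Lam" for a
    using PS_family_letters[OF ps that] unfolding p_def q_def P_def .
  have total: "P = (\<Sum>b\<in>B. p (b, True) + p (b, False))"
  proof -
    have "P = (\<Sum>a\<in>Lam. p a)"
      unfolding P_def p_def letters_partition(1)
      by (rule finite_measure_finite_Union) (use finite_basis m letters_partition(2) in auto)
    also have "\<dots> = (\<Sum>b\<in>B. \<Sum>e\<in>UNIV. p (b, e))" by (simp add: sum.cartesian_product)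
    finally show ?thesis by (simp add: UNIV_bool add.commute)
  qed
  have eqs: "p (b, True) = q b * (P - p (b, False))" "p (b, False) = q b * (P - p (b, True))" if "b \<in> B" for b
    using rec[of "(b, True)"] rec[of "(b, False)"] that by (auto simp: linv_def)
  \<comment> \<open>For \<open>h = 0\<close> each letter and its inverse would together carry the
    full mass, which is impossible with two basis elements.\<close>
  have h0: "h \<noteq> 0"
  proof
    assume "h = 0"
    then have "p (b, True) + p (b, False) = P" if "b \<in> B" for b using eqs[OF that] unfolding q_def by simp
    then have "(\<Sum>b\<in>B. p (b, True) + p (b, False)) = (\<Sum>b\<in>B. P)" by (intro sum.cong) auto
    then have "P = real (card B) * P" using total by (metis sum_constant)
    then show False using P card by simp
  qed
  have val_p: "p (b, e) = P / (1 + exp (h * \<mu> b))" if b: "b \<in> B" for b e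
  proof -
    have "q b \<noteq> 1" using h0 pos[OF b] unfolding q_def by simp
    \<comment> \<open>Subtracting the two equations shows that a letter and its inverse have equal
      mass, since \<open>q b \<noteq> 1\<close>.\<close>
    moreover have "p (b, True) - p (b, False) = q b * (P - p (b, False)) - q b * (P - p (b, True))"
      using eqs[OF b] by linarith
    then have "(1 - q b) * (p (b, True) - p (b, False)) = 0" by (simp add: algebra_simps)
    ultimately have e: "p (b, True) = p (b, False)" by simp
    have "q b * exp (h * \<mu> b) = 1" unfolding q_def by (simp flip: exp_add)
    moreover have "p (b, e) = p (b, False)" using e by (cases e) simp_all
    moreover have "p (b, False) = q b * (P - p (b, False))" using eqs(2)[OF b] unfolding e .
    ultimately have pe: "q b * exp (h * \<mu> b) = 1" "p (b, e) = q b * (P - p (b, e))" by (simp_all only:)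
    have "p (b, e) * exp (h * \<mu> b) = q b * (P - p (b, e)) * exp (h * \<mu> b)"
      by (rule arg_cong[OF pe(2), of "\<lambda>x. x * exp (h * \<mu> b)"])
    then have "p (b, e) * exp (h * \<mu> b) = (q b * exp (h * \<mu> b)) * (P - p (b, e))"
      by (simp only: mult.assoc mult.commute[of "P - p (b, e)"])
    then have "p (b, e) * exp (h * \<mu> b) = P - p (b, e)" unfolding pe(1) by simp
    moreover have "1 + exp (h * \<mu> b) > 0" by (simp add: add_pos_pos)
    ultimately show ?thesis by (simp add: field_simps)
  qed
  have "P = (\<Sum>b\<in>B. 2 * (P / (1 + exp (h * \<mu> b))))" using total val_p by simp
  also have "\<dots> = 2 * P * (\<Sum>b\<in>B. 1 / (1 + exp (h * \<mu> b)))" by (simp add: sum_distrib_left mult.assoc)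
  finally have hs: "(\<Sum>b\<in>B. 1 / (1 + exp (h * \<mu> b))) = 1 / 2" using P by (simp add: field_simps)
  have B: "B \<noteq> {}" using card by auto
  \<comment> \<open>The sum is strictly decreasing in the exponent, so the normalisation holds for
    one exponent only.\<close>
  have mono: "(\<Sum>b\<in>B. 1 / (1 + exp (t * \<mu> b))) < (\<Sum>b\<in>B. 1 / (1 + exp (r * \<mu> b)))" if "r < t" for r t
  proof (rule sum_strict_mono[OF finite_basis B])
    fix b assume "b \<in> B"
    then have "exp (r * \<mu> b) < exp (t * \<mu> b)" using that pos by simp
    moreover have "0 < 1 + exp (r * \<mu> b)" by (simp add: add_pos_pos)
    ultimately show "1 / (1 + exp (t * \<mu> b)) < 1 / (1 + exp (r * \<mu> b))" by (intro divide_strict_left_mono) (auto intro!: mult_pos_pos add_pos_pos)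
  qed
  have "h = s" using mono[of h s] mono[of s h] hs s by (cases h s rule: linorder_cases) auto
  then have "emeasure (m o\<^sub>T) (cyl [a]) = ennreal (P / (1 + exp (s * \<mu> (fst a))))" if "a \<in> Lam" for a
    using val_p[of "fst a" "snd a"] that unfolding p_def by (auto simp: emeasure_eq_measure)
  then show ?thesis using that P by blast
qed

text \<open>Off the diagonal the distance is locally constant: it depends on two Busemann values and
  on the common prefix of the two ends.\<close>

lemma dist_to_geodesic_measurable:
  assumes x: "x \<in> M" and N: "sets N = sets (BB \<Otimes>\<^sub>M BB)"
  shows "(\<lambda>(\<xi>, \<zeta>). f (dist_to_geodesic T x \<xi> \<zeta>) :: ennreal) \<in>
    borel_measurable (restrict_space N (topspace (dbl_bdry_top F B)))"
proof -
  let ?D = "topspace (dbl_bdry_top F B)" and ?f = "\<lambda>(\<xi>, \<zeta>). f (dist_to_geodesic T x \<xi> \<zeta>)"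
  have sp: "space N = Bd \<times> Bd" using sets_eq_imp_space_eq[OF N] by (simp add: space_pair_measure)
  then have D: "?D \<inter> space N = ?D" unfolding topspace_dbl by auto
  have D': "?D \<in> sets N" using topspace_dbl_sets N by simp
  show ?thesis
  proof (rule measurableI)
    fix A :: "ennreal set"
    have "?f -` A \<inter> ?D \<in> sets (BB \<Otimes>\<^sub>M BB)"
    proof (rule locally_rectangular_sets)
      show "?f -` A \<inter> ?D \<subseteq> Bd \<times> Bd" unfolding topspace_dbl by auto
      fix \<omega> \<omega>' assume w: "\<omega> \<in> rays" "\<omega>' \<in> rays" "(ray_end \<omega>, ray_end \<omega>') \<in> ?f -` A \<inter> ?D"
      then have "\<omega> \<noteq> \<omega>'" unfolding topspace_dbl by auto
      then obtain n where n: "pre \<omega> n = pre \<omega>' n" "\<omega> n \<noteq> \<omega>' n" using distinct_ends_split w by metis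
      obtain n1 where n1: "\<forall>\<xi>\<in>cyl (pre \<omega> n1). busemann T \<xi> x o\<^sub>T = busemann T (ray_end \<omega>) x o\<^sub>T"
        using busemann_locally_constant[OF w(1) x] by blast
      obtain n2 where n2: "\<forall>\<xi>\<in>cyl (pre \<omega>' n2). busemann T \<xi> x o\<^sub>T = busemann T (ray_end \<omega>') x o\<^sub>T"
        using busemann_locally_constant[OF w(2) x] by blast
      \<comment> \<open>Prefixes of this length fix both Busemann values and exhibit the first
        letters in which the ends differ, hence \<open>Suc n\<close>.\<close>
      define k where "k = Max {n1, n2, Suc n}"
      have k: "n1 \<le> k" "n2 \<le> k" "Suc n \<le> k" unfolding k_def by auto
      have "p \<in> ?f -` A \<inter> ?D" if "p \<in> cyl (pre \<omega> k) \<times> cyl (pre \<omega>' k)" for p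
      proof -
        obtain \<eta> \<eta>' where e: "p = (ray_end \<eta>, ray_end \<eta>')" "\<eta> \<in> rays" "\<eta>' \<in> rays" "pre \<eta> k = pre \<omega> k" "pre \<eta>' k = pre \<omega>' k"
          using \<open>p \<in> cyl (pre \<omega> k) \<times> cyl (pre \<omega>' k)\<close> unfolding cyl_def by auto
        have en: "pre \<eta> n = pre \<eta>' n" "\<eta> n \<noteq> \<eta>' n" "pre \<eta> n = pre \<omega> n"
          using e n k(3) unfolding pre_eq_iff by auto
        have "busemann T (ray_end \<eta>) x o\<^sub>T = busemann T (ray_end \<omega>) x o\<^sub>T"
          using n1 cyl_pre_antimono[OF k(1)] e ray_end_in_cyl by (metis length_pre subsetD)
        moreover have "busemann T (ray_end \<eta>') x o\<^sub>T = busemann T (ray_end \<omega>') x o\<^sub>T"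
          using n2 cyl_pre_antimono[OF k(2)] e ray_end_in_cyl by (metis length_pre subsetD)
        ultimately have "dist_to_geodesic T x (ray_end \<eta>) (ray_end \<eta>') = dist_to_geodesic T x (ray_end \<omega>) (ray_end \<omega>')"
          using dist_to_geodesic_eq[OF e(2,3) en(1,2) x] dist_to_geodesic_eq[OF w(1,2) n x] en(3) by simp
        moreover have "ray_end \<eta> \<noteq> ray_end \<eta>'" using e en ray_end_inj unfolding inj_on_def by blast
        ultimately show ?thesis using w e unfolding topspace_dbl by simp
      qed
      then show "\<exists>n. cyl (pre \<omega> n) \<times> cyl (pre \<omega>' n) \<subseteq> ?f -` A \<inter> ?D" by blast
    qed
    then show "?f -` A \<inter> space (restrict_space N ?D) \<in> sets (restrict_space N ?D)"
      using D D' N by (subst sets_restrict_space_iff) (auto simp: space_restrict_space)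
  qed simp
qed

text \<open>Rewriting \<open>m x\<close> through \<open>m o\<^sub>T\<close> gives a conformal factor
  for each end, and these cancel against the factor of the current. Different first letters mean an
  empty common prefix, so no further term is left.\<close>

lemma PS_current_rectangle:
  assumes ps: "patterson_sullivan_family F B T h m" and x: "x \<in> M"
    and \<nu>: "\<nu> = density (restrict_space (m x \<Otimes>\<^sub>M m x) (topspace (dbl_bdry_top F B)))
           (\<lambda>(\<xi>, \<zeta>). ennreal (exp (2 * h * dist_to_geodesic T x \<xi> \<zeta>)))"
    and ab: "a \<noteq> b"
  shows "emeasure \<nu> (cyl [a] \<times> cyl [b]) = emeasure (m o\<^sub>T) (cyl [a]) * emeasure (m o\<^sub>T) (cyl [b])"
proof -
  let ?D = "topspace (dbl_bdry_top F B)" and ?R = "cyl [a] \<times> cyl [b]"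
  let ?e = "\<lambda>(\<xi>, \<zeta>). ennreal (exp (2 * h * dist_to_geodesic T x \<xi> \<zeta>))"
  define \<phi> where "\<phi> \<xi> = ennreal (exp (- h * busemann T \<xi> x o\<^sub>T))" for \<xi>
  have m: "space (m y) = Bd" "sets (m y) = sets BB" "finite_measure (m y)" if "y \<in> M" for y
    using ps that unfolding patterson_sullivan_family_def by fastforce+
  have sf: "sigma_finite_measure (m y)" if "y \<in> M" for y
    using m(3)[OF that] unfolding finite_measure_def by blast
  interpret mo: sigma_finite_measure "m o\<^sub>T" using sf by simp
  have mx: "m x = density (m o\<^sub>T) \<phi>"
    using ps x base_M unfolding patterson_sullivan_family_def \<phi>_def by blast
  have \<phi>: "\<phi> \<in> borel_measurable (m o\<^sub>T)"
  proof -
    have "(\<lambda>\<xi>. busemann T \<xi> x o\<^sub>T) \<in> borel_measurable (m o\<^sub>T)"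
      using busemann_measurable[OF x] by (simp add: measurable_cong_sets[OF m(2)[OF base_M] refl])
    then show ?thesis unfolding \<phi>_def by measurable
  qed
  have pair: "m x \<Otimes>\<^sub>M m x = density (m o\<^sub>T \<Otimes>\<^sub>M m o\<^sub>T) (\<lambda>(\<xi>, \<zeta>). \<phi> \<xi> * \<phi> \<zeta>)"
    unfolding mx by (rule pair_measure_density[OF \<phi> \<phi> sf[OF base_M] sf[OF x, unfolded mx]])
  have sN: "sets (m x \<Otimes>\<^sub>M m x) = sets (BB \<Otimes>\<^sub>M BB)" "sets (m o\<^sub>T \<Otimes>\<^sub>M m o\<^sub>T) = sets (BB \<Otimes>\<^sub>M BB)"
    using m(2) x by (auto intro!: sets_pair_measure_cong)
  have spN: "space (m x \<Otimes>\<^sub>M m x) = Bd \<times> Bd" "space (m o\<^sub>T \<Otimes>\<^sub>M m o\<^sub>T) = Bd \<times> Bd"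
    using m(1) x by (auto simp: space_pair_measure)
  have D: "?D \<inter> space (m x \<Otimes>\<^sub>M m x) \<in> sets (m x \<Otimes>\<^sub>M m x)"
    using topspace_dbl_sets spN sN unfolding topspace_dbl by (simp add: Int_absorb2 subset_eq)
  have disj: "cyl [a] \<inter> cyl [b] = {}" using ab by (intro cyl_disjoint) auto
  then have RD: "?R \<subseteq> ?D" unfolding topspace_dbl using cyl_Bd by blast
  have R: "?R \<in> sets (BB \<Otimes>\<^sub>M BB)" by auto
  have e: "?e \<in> borel_measurable (restrict_space (m x \<Otimes>\<^sub>M m x) ?D)"
    using dist_to_geodesic_measurable[OF x sN(1), of "\<lambda>r. ennreal (exp (2 * h * r))"] .
  have RR: "?R \<in> sets (restrict_space (m x \<Otimes>\<^sub>M m x) ?D)"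
    using D R RD sN by (subst sets_restrict_space_iff) auto
  \<comment> \<open>The density is known to be measurable on the restricted space; the indicator of
    \<open>?D\<close> extends it by zero to the whole product.\<close>
  have e': "(\<lambda>p. ?e p * indicator ?R p * indicator ?D p) \<in> borel_measurable (m x \<Otimes>\<^sub>M m x)"
  proof -
    have "(\<lambda>p. ?e p * indicator ?R p) \<in> borel_measurable (restrict_space (m x \<Otimes>\<^sub>M m x) ?D)"
      using e RR by (intro borel_measurable_times_ennreal borel_measurable_indicator) auto
    then show ?thesis by (rule iffD1[OF borel_measurable_restrict_space_iff_ennreal[OF D]])
  qed
  have "emeasure \<nu> ?R = (\<integral>\<^sup>+p. ?e p * indicator ?R p \<partial>restrict_space (m x \<Otimes>\<^sub>M m x) ?D)"
    unfolding \<nu> by (rule emeasure_density[OF e RR])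
  also have "\<dots> = (\<integral>\<^sup>+p. ?e p * indicator ?R p * indicator ?D p \<partial>(m x \<Otimes>\<^sub>M m x))"
    by (rule nn_integral_restrict_space[OF D])
  also have "\<dots> = (\<integral>\<^sup>+p. (case p of (\<xi>, \<zeta>) \<Rightarrow> \<phi> \<xi> * \<phi> \<zeta>) * (?e p * indicator ?R p * indicator ?D p) \<partial>(m o\<^sub>T \<Otimes>\<^sub>M m o\<^sub>T))"
    unfolding pair
  proof (rule nn_integral_density)
    show "(\<lambda>(\<xi>, \<zeta>). \<phi> \<xi> * \<phi> \<zeta>) \<in> borel_measurable (m o\<^sub>T \<Otimes>\<^sub>M m o\<^sub>T)"
      using \<phi> by measurable
    show "(\<lambda>p. ?e p * indicator ?R p * indicator ?D p) \<in> borel_measurable (m o\<^sub>T \<Otimes>\<^sub>M m o\<^sub>T)"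
      using e' by (simp add: measurable_cong_sets[OF trans[OF sN(1) sN(2)[symmetric]] refl])
  qed
  also have "\<dots> = (\<integral>\<^sup>+p. indicator ?R p \<partial>(m o\<^sub>T \<Otimes>\<^sub>M m o\<^sub>T))"
  proof (rule nn_integral_cong)
    fix p assume "p \<in> space (m o\<^sub>T \<Otimes>\<^sub>M m o\<^sub>T)"
    show "(case p of (\<xi>, \<zeta>) \<Rightarrow> \<phi> \<xi> * \<phi> \<zeta>) * (?e p * indicator ?R p * indicator ?D p) = indicator ?R p"
    proof (cases "p \<in> ?R")
      case True
      then obtain \<omega> \<omega>' where w: "p = (ray_end \<omega>, ray_end \<omega>')" "\<omega> \<in> rays" "\<omega>' \<in> rays" "\<omega> 0 = a" "\<omega>' 0 = b"
        unfolding cyl_def by (auto simp: pre_def)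
      have "dist_to_geodesic T x (ray_end \<omega>) (ray_end \<omega>') =
          (busemann T (ray_end \<omega>) x o\<^sub>T + busemann T (ray_end \<omega>') x o\<^sub>T) / 2"
        using dist_to_geodesic_eq[OF w(2,3), of 0 x] w ab x by simp
      then have "exp (- h * busemann T (ray_end \<omega>) x o\<^sub>T) * exp (- h * busemann T (ray_end \<omega>') x o\<^sub>T) *
          exp (2 * h * dist_to_geodesic T x (ray_end \<omega>) (ray_end \<omega>')) = 1"
        by (simp add: algebra_simps flip: exp_add)
      then show ?thesis using True RD w unfolding \<phi>_def by (simp add: subset_eq flip: ennreal_mult)
    qed simp
  qed
  also have "\<dots> = emeasure (m o\<^sub>T \<Otimes>\<^sub>M m o\<^sub>T) ?R" using R sN by simp
  also have "\<dots> = emeasure (m o\<^sub>T) (cyl [a]) * emeasure (m o\<^sub>T) (cyl [b])"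
    using m(2)[OF base_M] by (intro mo.emeasure_pair_measure_Times) auto
  finally show ?thesis .
qed

text \<open>Letter rectangles have product mass, so \<open>P\<close> is here the square of the
  constant in \<open>PS_family_values\<close>.\<close>

lemma PS_current_letters:
  assumes "patterson_sullivan_current F B T \<nu>" and "card B \<ge> 2"
    and "(\<Sum>b\<in>B. 1 / (1 + exp (s * \<mu> b))) = 1 / 2"
  obtains P where "P > 0" "\<And>a b. \<lbrakk>a \<in> Lam; b \<in> Lam; a \<noteq> b\<rbrakk> \<Longrightarrow>
    emeasure \<nu> (cyl [a] \<times> cyl [b]) =
      ennreal (P * (1 / (1 + exp (s * \<mu> (fst a)))) * (1 / (1 + exp (s * \<mu> (fst b)))))"
proof -
  obtain h m x where *: "patterson_sullivan_family F B T h m" "x \<in> M"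
    "\<nu> = density (restrict_space (m x \<Otimes>\<^sub>M m x) (topspace (dbl_bdry_top F B)))
           (\<lambda>(\<xi>, \<zeta>). ennreal (exp (2 * h * dist_to_geodesic T x \<xi> \<zeta>)))"
    using assms(1) unfolding patterson_sullivan_current_def by blast
  obtain P where P: "P > 0"
    "\<And>a. a \<in> Lam \<Longrightarrow> emeasure (m o\<^sub>T) (cyl [a]) = ennreal (P / (1 + exp (s * \<mu> (fst a))))"
    using PS_family_values[OF *(1) assms(2,3)] by blast
  have "emeasure \<nu> (cyl [a] \<times> cyl [b]) =
      ennreal (P\<^sup>2 * (1 / (1 + exp (s * \<mu> (fst a)))) * (1 / (1 + exp (s * \<mu> (fst b)))))"
    if "a \<in> Lam" "b \<in> Lam" "a \<noteq> b" for a b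
    unfolding PS_current_rectangle[OF * that(3)] P(2)[OF that(1)] P(2)[OF that(2)]
    using P(1) by (subst ennreal_mult[symmetric]) (auto simp: power2_eq_square add_nonneg_nonneg)
  then show ?thesis using that[of "P\<^sup>2"] P(1) by simp
qed

end

section \<open>Existence of the Patterson--Sullivan data\<close>

text \<open>Points of \<open>[0, 1)\<close> are coded by infinite words: the interval of a word is cut into
  consecutive intervals for its one-letter extensions.\<close>

fun locate :: "('a \<Rightarrow> real) \<Rightarrow> 'a list \<Rightarrow> real \<Rightarrow> 'a \<times> real" where
  "locate v (a # xs) s = (if s < v a then (a, s) else locate v xs (s - v a))"
| "locate v [] s = (undefined, s)"

fun offset :: "('a \<Rightarrow> real) \<Rightarrow> 'a list \<Rightarrow> 'a \<Rightarrow> real" where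
  "offset v (b # xs) a = (if b = a then 0 else v b + offset v xs a)"
| "offset v [] a = 0"

lemma locate_bounds:
  "\<lbrakk>0 \<le> s; s < sum_list (map v xs); locate v xs s = (a, r)\<rbrakk> \<Longrightarrow>
    a \<in> set xs \<and> 0 \<le> r \<and> r < v a"
  by (induction v xs s rule: locate.induct) (auto split: if_splits)

lemma locate_offset:
  "\<lbrakk>distinct xs; 0 \<le> s; s < sum_list (map v xs); locate v xs s = (a, r)\<rbrakk> \<Longrightarrow> s = offset v xs a + r"
proof (induction v xs s rule: locate.induct)
  case (1 v b xs s)
  show ?case
  proof (cases "s < v b")
    case False
    then have "a \<in> set xs" using 1(3-5) locate_bounds[of "s - v b" v xs a r] by auto
    then show ?thesis using 1 False by auto
  qed (use 1 in auto)
qed auto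

lemma offset_nonneg: "(\<And>b. b \<in> set xs \<Longrightarrow> 0 \<le> v b) \<Longrightarrow> 0 \<le> offset v xs a"
  by (induction xs) auto

lemma offset_le: "(\<And>b. b \<in> set xs \<Longrightarrow> 0 \<le> v b) \<Longrightarrow> a \<in> set xs \<Longrightarrow> offset v xs a + v a \<le> sum_list (map v xs)"
  by (induction xs) (auto intro!: sum_list_nonneg)

lemma offset_locate:
  "(\<And>b. b \<in> set xs \<Longrightarrow> 0 \<le> v b) \<Longrightarrow> a \<in> set xs \<Longrightarrow> 0 \<le> r \<Longrightarrow> r < v a \<Longrightarrow>
    locate v xs (offset v xs a + r) = (a, r)"
proof (induction xs)
  case (Cons b xs)
  show ?case
  proof (cases "b = a")
    case False
    moreover have "0 \<le> offset v xs a" using Cons(2) by (intro offset_nonneg) auto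
    ultimately show ?thesis using Cons by auto
  qed (use Cons in auto)
qed auto

text \<open>A substitute for a measure extension theorem: the words with prefix \<open>w\<close>
  correspond to an interval of length \<open>W w\<close>, so Lebesgue measure can be pushed forward
  along the code. Positivity of the weights met by a code keeps it away from words of weight
  0.\<close>

lemma interval_coding:
  fixes W :: "'a list \<Rightarrow> real"
  assumes fin: "finite L" and W0: "\<And>w. 0 \<le> W w" and W1: "W [] = 1"
    and Wsum: "\<And>w. W w = (\<Sum>a\<in>L. W (w @ [a]))"
  obtains code :: "real \<Rightarrow> nat \<Rightarrow> 'a" where
    "\<And>t n. t \<in> {0..<1} \<Longrightarrow> 0 < W (map (code t) [0..<n])"
    "\<And>w. set w \<subseteq> L \<Longrightarrow> \<exists>l. {t \<in> {0..<1}. map (code t) [0..<length w] = w} = {l..<l + W w}"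
proof -
  obtain xs where xs: "set xs = L" "distinct xs" using finite_distinct_list[OF fin] by blast
  have sl: "sum_list (map (\<lambda>a. W (w @ [a])) xs) = W w" for w
    using Wsum[of w] xs by (simp add: sum_list_distinct_conv_sum_set)
  \<comment> \<open>The state consists of the word read so far and the position inside the interval
    of this word.\<close>
  define step where "step p = (case p of (w, s) \<Rightarrow>
    (case locate (\<lambda>a. W (w @ [a])) xs s of (a, r) \<Rightarrow> (w @ [a], r)))" for p
  define st where "st t n = (step ^^ n) ([], t)" for t :: real and n
  define code where "code t n = last (fst (st t (Suc n)))" for t n
  have st0: "st t 0 = ([], t)" for t unfolding st_def by simp
  have stS: "st t (Suc n) = step (st t n)" for t n unfolding st_def by simp
  have words: "fst (st t n) = map (code t) [0..<n]" for t n
  proof (induction n)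
    case (Suc n)
    have "\<exists>x. fst (st t (Suc n)) = fst (st t n) @ [x]"
      unfolding stS step_def by (simp add: case_prod_beta)
    then obtain x where "fst (st t (Suc n)) = fst (st t n) @ [x]" by blast
    moreover from this have "code t n = x" unfolding code_def by simp
    ultimately show ?case using Suc by simp
  qed (simp add: st0)
  have inv: "0 \<le> snd (st t n) \<and> snd (st t n) < W (fst (st t n))" if "t \<in> {0..<1}" for t n
  proof (induction n)
    case (Suc n)
    obtain a r where ar: "locate (\<lambda>a. W (fst (st t n) @ [a])) xs (snd (st t n)) = (a, r)" by fastforce
    then have "st t (Suc n) = (fst (st t n) @ [a], r)" unfolding stS step_def by (simp add: case_prod_beta)
    moreover have "0 \<le> r \<and> r < W (fst (st t n) @ [a])" using locate_bounds[OF _ _ ar] Suc sl by simp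
    ultimately show ?case by simp
  qed (use that W1 in \<open>simp add: st0\<close>)
  have "0 < W (map (code t) [0..<n])" if "t \<in> {0..<1}" for t n
    using inv[OF that, of n] words[of t n] by simp
  \<comment> \<open>The induction also needs the position inside the interval, since the next letter
    is determined by it.\<close>
  moreover have "\<exists>l. {t \<in> {0..<1}. fst (st t (length w)) = w} = {l..<l + W w} \<and>
      (\<forall>t\<in>{l..<l + W w}. snd (st t (length w)) = t - l)" if "set w \<subseteq> L" for w
    using that
  proof (induction w rule: rev_induct)
    case Nil
    then show ?case using W1 by (intro exI[of _ 0]) (auto simp: st0)
  next
    case (snoc a w)
    then obtain l where l: "{t \<in> {0..<1}. fst (st t (length w)) = w} = {l..<l + W w}"
      "\<forall>t\<in>{l..<l + W w}. snd (st t (length w)) = t - l" by auto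
    let ?v = "\<lambda>a. W (w @ [a])"
    let ?l = "l + offset ?v xs a"
    have a: "a \<in> set xs" using snoc xs by simp
    have off: "0 \<le> offset ?v xs a" "offset ?v xs a + ?v a \<le> W w"
      using offset_nonneg[of xs ?v a] offset_le[of xs ?v a] W0 a sl by auto
    have next_state: "st t (Suc (length w)) = (w @ [fst (locate ?v xs (t - l))], snd (locate ?v xs (t - l)))"
      if "t \<in> {l..<l + W w}" for t
    proof -
      have "t \<in> {t \<in> {0..<1}. fst (st t (length w)) = w}" unfolding l(1) using that .
      then have "fst (st t (length w)) = w" by blast
      moreover have "snd (st t (length w)) = t - l" using l(2) that by blast
      ultimately show ?thesis unfolding stS step_def by (simp add: case_prod_beta)
    qed
    have iff: "fst (locate ?v xs (t - l)) = a \<longleftrightarrow> t \<in> {?l..<?l + ?v a}" if t: "t \<in> {l..<l + W w}" for t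
    proof
      assume f: "fst (locate ?v xs (t - l)) = a"
      have p: "locate ?v xs (t - l) = (a, snd (locate ?v xs (t - l)))" using f by (metis prod.collapse)
      have "t - l = offset ?v xs a + snd (locate ?v xs (t - l))"
        using locate_offset[OF xs(2) _ _ p] t sl by simp
      moreover have "0 \<le> snd (locate ?v xs (t - l)) \<and> snd (locate ?v xs (t - l)) < ?v a"
        using locate_bounds[OF _ _ p] t sl by simp
      ultimately show "t \<in> {?l..<?l + ?v a}" by auto
    next
      assume "t \<in> {?l..<?l + ?v a}"
      then show "fst (locate ?v xs (t - l)) = a"
        using offset_locate[of xs ?v a "t - ?l"] W0 a by simp
    qed
    have rem: "snd (locate ?v xs (t - l)) = t - ?l" if "t \<in> {?l..<?l + ?v a}" for t
      using offset_locate[of xs ?v a "t - ?l"] W0 a that by simp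
    have sub: "{?l..<?l + ?v a} \<subseteq> {l..<l + W w}" using off by auto
    have pre: "fst (st t (Suc (length w))) = w @ [a] \<Longrightarrow> fst (st t (length w)) = w" for t
      using words[of t "Suc (length w)"] words[of t "length w"] by simp
    have "{t \<in> {0..<1}. fst (st t (length (w @ [a]))) = w @ [a]} = {?l..<?l + ?v a}"
    proof (intro equalityI subsetI)
      fix t assume "t \<in> {t \<in> {0..<1}. fst (st t (length (w @ [a]))) = w @ [a]}"
      then have t: "t \<in> {0..<1}" "fst (st t (Suc (length w))) = w @ [a]" by auto
      then have "t \<in> {l..<l + W w}" using pre l by auto
      then show "t \<in> {?l..<?l + ?v a}" using iff next_state t by simp
    next
      fix t assume t: "t \<in> {?l..<?l + ?v a}"
      then have t': "t \<in> {l..<l + W w}" using sub by blast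
      then have "t \<in> {0..<1}" using l(1) by blast
      moreover have "fst (st t (Suc (length w))) = w @ [a]" using next_state[OF t'] iff[OF t'] t by simp
      ultimately show "t \<in> {t \<in> {0..<1}. fst (st t (length (w @ [a]))) = w @ [a]}" by simp
    qed
    moreover have "snd (st t (length (w @ [a]))) = t - ?l" if "t \<in> {?l..<?l + ?v a}" for t
      using next_state[of t] rem[OF that] sub that by auto
    ultimately show ?case by blast
  qed
  then have "\<exists>l. {t \<in> {0..<1}. map (code t) [0..<length w] = w} = {l..<l + W w}" if "set w \<subseteq> L" for w
    using that unfolding words by meson
  ultimately show ?thesis using that by blast
qed

locale entropy_one_group = fin_free_group F B + weighted_free_group F B \<mu>
  for F :: "('g, 'm) monoid_scheme" (structure) and B and \<mu> +
  assumes entropy_one: "(\<Sum>b\<in>B. 1 / (1 + exp (\<mu> b))) = 1 / 2"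
begin

text \<open>The element \<open>val w\<close> maps the ends that do not start with
  \<open>linv (last w)\<close> onto the cylinder of \<open>w\<close>. The first factor is the
  conformal factor of this translation, the second one the mass of those ends. Weight 0 for
  unreduced words lets sums run over all letters.\<close>

definition cyl_weight :: "('g \<times> bool) list \<Rightarrow> real" where
  "cyl_weight w = (if w \<in> reduced_words then if w = [] then 1 else exp (- wl \<mu> w) * (1 - 1 / (1 + exp (\<mu> (fst (last w))))) else 0)"

lemma letter_weight: "exp (- \<mu> b) * (1 - 1 / (1 + exp (\<mu> b))) = 1 / (1 + exp (\<mu> b))"
proof -
  have "1 + exp (\<mu> b) > 0" by (simp add: add_pos_pos)
  then show ?thesis by (simp add: field_simps exp_minus)
qed

lemma letter_prob_le: "b \<in> B \<Longrightarrow> 1 / (1 + exp (\<mu> b)) \<le> 1 / 2"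
  using pos[of b] by (intro divide_left_mono) (auto simp: less_imp_le add_pos_pos)

lemma sum_letters: "(\<Sum>a\<in>Lam. 1 / (1 + exp (\<mu> (fst a)))) = 1"
proof -
  have "(\<Sum>a\<in>Lam. 1 / (1 + exp (\<mu> (fst a)))) = (\<Sum>b\<in>B. \<Sum>e\<in>(UNIV::bool set). 1 / (1 + exp (\<mu> b)))"
    by (simp add: sum.cartesian_product case_prod_beta del: sum_constant)
  also have "\<dots> = 2 * (\<Sum>b\<in>B. 1 / (1 + exp (\<mu> b)))" by (simp add: sum_distrib_left)
  finally show ?thesis using entropy_one by simp
qed

lemma cyl_weight_bounds:
  assumes "w \<in> reduced_words"
  shows "exp (- wl \<mu> w) / 2 \<le> cyl_weight w" "cyl_weight w \<le> exp (- wl \<mu> w)"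
proof -
  have "exp (- wl \<mu> w) / 2 \<le> cyl_weight w \<and> cyl_weight w \<le> exp (- wl \<mu> w)"
  proof (cases "w = []")
    case False
    then have b: "fst (last w) \<in> B" using subsetD[OF reduced_words_D(1)[OF assms] last_in_set[OF False]] by (simp only: mem_Times_iff)
    let ?p = "1 / (1 + exp (\<mu> (fst (last w))))"
    have p: "?p \<le> 1 / 2" using letter_prob_le[OF b] .
    have p0: "0 \<le> ?p" by (simp add: add_nonneg_nonneg)
    have "exp (- wl \<mu> w) * (1 / 2) \<le> exp (- wl \<mu> w) * (1 - ?p)" using p by (intro mult_left_mono) auto
    moreover have "exp (- wl \<mu> w) * (1 - ?p) \<le> exp (- wl \<mu> w) * 1" using p0 by (intro mult_left_mono) auto
    ultimately show ?thesis using assms False unfolding cyl_weight_def by simp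
  qed (use assms in \<open>simp add: cyl_weight_def\<close>)
  then show "exp (- wl \<mu> w) / 2 \<le> cyl_weight w" "cyl_weight w \<le> exp (- wl \<mu> w)" by auto
qed

lemma cyl_weight_nonneg: "0 \<le> cyl_weight w"
  using cyl_weight_bounds(1)[of w] exp_gt_zero[of "- wl \<mu> w"] by (cases "w \<in> reduced_words") (auto simp: cyl_weight_def)

text \<open>After a non-empty \<open>w\<close> only \<open>linv (last w)\<close> is forbidden, which
  removes one share from the total mass 1 of the letters and leaves the second factor of
  \<open>cyl_weight\<close>. For the empty word the identity is the normalisation of the
  entropy.\<close>

lemma cyl_weight_sum: "cyl_weight w = (\<Sum>a\<in>Lam. cyl_weight (w @ [a]))"
proof (cases "w \<in> reduced_words")
  case False
  then have "w @ [a] \<notin> reduced_words" for a unfolding reduced_words_def by (auto simp: reduced_append)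
  then show ?thesis using False unfolding cyl_weight_def by simp
next
  case True
  let ?p = "\<lambda>a. 1 / (1 + exp (\<mu> (fst a)))"
  have e: "cyl_weight (w @ [a]) = (if w \<noteq> [] \<and> a = linv (last w) then 0 else exp (- wl \<mu> w) * ?p a)"
    if "a \<in> Lam" for a
  proof -
    have "w @ [a] \<in> reduced_words \<longleftrightarrow> \<not> (w \<noteq> [] \<and> a = linv (last w))"
      using True that unfolding reduced_words_def by (auto simp: reduced_append)
    moreover have "exp (- wl \<mu> (w @ [a])) * (1 - ?p a) = exp (- wl \<mu> w) * ?p a"
    proof -
      have "exp (- wl \<mu> (w @ [a])) = exp (- wl \<mu> w) * exp (- \<mu> (fst a))" by (simp flip: exp_add)
      then show ?thesis using letter_weight[of "fst a"] by (simp only: mult.assoc)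
    qed
    ultimately show ?thesis unfolding cyl_weight_def by simp
  qed
  show ?thesis
  proof (cases "w = []")
    case True
    have "(\<Sum>a\<in>Lam. cyl_weight (w @ [a])) = (\<Sum>a\<in>Lam. ?p a)"
      using e True by (intro sum.cong) auto
    then show ?thesis using sum_letters True unfolding cyl_weight_def reduced_words_def by simp
  next
    case False
    have l: "linv (last w) \<in> Lam"
      by (rule linv_Lam) (rule subsetD[OF reduced_words_D(1)[OF True] last_in_set[OF False]])
    have "(\<Sum>a\<in>Lam. cyl_weight (w @ [a])) = (\<Sum>a\<in>Lam - {linv (last w)}. exp (- wl \<mu> w) * ?p a)"
      by (rule sum.mono_neutral_cong_right) (use e False finite_basis in auto)
    also have "\<dots> = exp (- wl \<mu> w) * ((\<Sum>a\<in>Lam. ?p a) - ?p (linv (last w)))"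
    proof -
      have "(\<Sum>a\<in>Lam - {linv (last w)}. ?p a) = (\<Sum>a\<in>Lam. ?p a) - ?p (linv (last w))"
        using l finite_basis by (subst sum_diff1) auto
      then show ?thesis by (simp only: sum_distrib_left[symmetric])
    qed
    finally show ?thesis using sum_letters True False unfolding cyl_weight_def by simp
  qed
qed

text \<open>The image of Lebesgue measure on the unit interval under the coding by infinite reduced
  words.\<close>

lemma boundary_measure:
  obtains m where "sets m = sets BB" "\<And>w. w \<in> reduced_words \<Longrightarrow> emeasure m (cyl w) = ennreal (cyl_weight w)"
proof -
  have W: "finite Lam" "\<And>w. 0 \<le> cyl_weight w" "cyl_weight [] = 1" "\<And>w. cyl_weight w = (\<Sum>a\<in>Lam. cyl_weight (w @ [a]))"
    using finite_basis cyl_weight_nonneg cyl_weight_sum by (auto simp: cyl_weight_def reduced_words_def)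
  obtain code :: "real \<Rightarrow> nat \<Rightarrow> 'g \<times> bool" where code:
    "\<And>t n. t \<in> {0..<1} \<Longrightarrow> 0 < cyl_weight (map (code t) [0..<n])"
    "\<And>w. set w \<subseteq> Lam \<Longrightarrow> \<exists>l. {t \<in> {0..<1}. map (code t) [0..<length w] = w} = {l..<l + cyl_weight w}"
    using interval_coding[OF W] by blast
  \<comment> \<open>Prefixes of a code have positive weight, so they are reduced.\<close>
  have rays: "code t \<in> rays" if "t \<in> {0..<1}" for t
    using code(1)[OF that] by (intro rays_if_pre_reduced) (metis cyl_weight_def less_irrefl pre_def)
  let ?L = "restrict_space lborel {0..<1::real}"
  have sp: "space ?L = {0..<1}" by (simp add: space_restrict_space)
  have vim: "\<exists>l. (\<lambda>t. ray_end (code t)) -` cyl w \<inter> space ?L = {l..<l + cyl_weight w}" if w: "w \<in> reduced_words" for w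
  proof -
    have "(\<lambda>t. ray_end (code t)) -` cyl w \<inter> space ?L = {t \<in> {0..<1}. map (code t) [0..<length w] = w}"
      unfolding sp using ray_end_in_cyl[OF rays] by (auto simp: pre_def)
    then show ?thesis using code(2)[OF reduced_words_D(1)[OF w]] by simp
  qed
  have meas: "(\<lambda>t. ray_end (code t)) \<in> measurable ?L BB"
  proof (rule measurable_sigma_sets[OF sets_BB_cyl[of 0]])
    show "cyl ` {w \<in> reduced_words. 0 \<le> length w} \<subseteq> Pow Bd" using cyl_Bd by auto
    show "(\<lambda>t. ray_end (code t)) \<in> space ?L \<rightarrow> Bd" using rays sp by auto
    fix A assume "A \<in> cyl ` {w \<in> reduced_words. 0 \<le> length w}"
    then obtain w where w: "A = cyl w" "w \<in> reduced_words" by auto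
    obtain l where l: "(\<lambda>t. ray_end (code t)) -` cyl w \<inter> space ?L = {l..<l + cyl_weight w}" using vim[OF w(2)] by blast
    have "{l..<l + cyl_weight w} \<subseteq> {0..<1}" using l sp by blast
    then show "(\<lambda>t. ray_end (code t)) -` A \<inter> space ?L \<in> sets ?L"
      unfolding w l by (subst sets_restrict_space_iff) auto
  qed
  have "emeasure (distr ?L BB (\<lambda>t. ray_end (code t))) (cyl w) = ennreal (cyl_weight w)" if w: "w \<in> reduced_words" for w
  proof -
    obtain l where l: "(\<lambda>t. ray_end (code t)) -` cyl w \<inter> space ?L = {l..<l + cyl_weight w}" using vim[OF w] by blast
    have "{l..<l + cyl_weight w} \<subseteq> {0..<1}" using l sp by blast
    then have "emeasure ?L {l..<l + cyl_weight w} = ennreal (cyl_weight w)"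
      using cyl_weight_nonneg[of w] by (subst emeasure_restrict_space) auto
    then show ?thesis using emeasure_distr[OF meas] l by simp
  qed
  then show ?thesis using that[of "distr ?L BB (\<lambda>t. ray_end (code t))"] by simp
qed

end

section \<open>The conformal family of boundary measures\<close>

locale entropy_one_tree = entropy_one_group F B \<mu> + based_tree F B \<mu> T o\<^sub>T
  for F :: "('g, 'm) monoid_scheme" (structure) and B and \<mu> and T :: "('g, 'p) gtree" and o\<^sub>T
begin

lemma busemann_bound:
  assumes \<xi>: "\<xi> \<in> Bd" and x: "x \<in> M"
  shows "\<bar>busemann T \<xi> x o\<^sub>T\<bar> \<le> d x o\<^sub>T"
proof -
  obtain \<omega> where w: "\<omega> \<in> rays" "\<xi> = ray_end \<omega>" using Bd_cases[OF \<xi>] by metis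
  obtain K where "\<forall>n\<ge>K. d x (oray \<omega> n) - d o\<^sub>T (oray \<omega> n) = busemann T (ray_end \<omega>) x o\<^sub>T"
    using busemann_eventually[OF w(1) x base_M oray_tree_end[OF w(1)]] by blast
  then have "busemann T \<xi> x o\<^sub>T = d x (oray \<omega> K) - d o\<^sub>T (oray \<omega> K)" using w by simp
  moreover have "d x (oray \<omega> K) \<le> d x o\<^sub>T + d o\<^sub>T (oray \<omega> K)" "d o\<^sub>T (oray \<omega> K) \<le> d o\<^sub>T x + d x (oray \<omega> K)"
    using x w by (auto intro!: triangle simp: w)
  ultimately show ?thesis using commute[of x o\<^sub>T] by (simp add: abs_le_iff)
qed

lemma busemann_general_measurable:
  assumes "x \<in> M" "y \<in> M"
  shows "(\<lambda>\<xi>. busemann T \<xi> x y) \<in> borel_measurable BB"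
proof -
  have "(\<lambda>\<xi>. busemann T \<xi> x o\<^sub>T - busemann T \<xi> y o\<^sub>T) \<in> borel_measurable BB"
    using busemann_measurable assms by measurable
  moreover have eq: "busemann T \<xi> x y = busemann T \<xi> x o\<^sub>T - busemann T \<xi> y o\<^sub>T" if "\<xi> \<in> space BB" for \<xi>
    using busemann_cocycle[of \<xi> x y o\<^sub>T] that assms by simp
  ultimately show ?thesis by (simp only: measurable_cong[OF eq])
qed

context
  fixes m\<^sub>0 :: "'g bdry measure"
  assumes m0_sets: "sets m\<^sub>0 = sets BB" and m0_cyl: "\<And>w. w \<in> reduced_words \<Longrightarrow> emeasure m\<^sub>0 (cyl w) = ennreal (cyl_weight w)"
begin

abbreviation dens :: "'p \<Rightarrow> 'p \<Rightarrow> 'g bdry \<Rightarrow> ennreal" where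
  "dens x y \<equiv> \<lambda>\<xi>. ennreal (exp (- 1 * busemann T \<xi> x y))"

lemma m0_space: "space m\<^sub>0 = Bd"
  using sets_eq_imp_space_eq[OF m0_sets] by simp

lemma m0_total: "emeasure m\<^sub>0 Bd = 1"
  using m0_cyl[of "[]"] by (simp add: reduced_words_def cyl_weight_def)

lemma dens_measurable: "x \<in> M \<Longrightarrow> y \<in> M \<Longrightarrow> dens x y \<in> borel_measurable BB"
  using busemann_general_measurable by measurable

lemma dens_measurable_m0: "x \<in> M \<Longrightarrow> y \<in> M \<Longrightarrow> dens x y \<in> borel_measurable m\<^sub>0"
  using dens_measurable by (simp add: measurable_cong_sets[OF m0_sets refl])

lemma dens_mult:
  assumes "\<xi> \<in> Bd" "x \<in> M" "y \<in> M" "z \<in> M"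
  shows "dens x y \<xi> * dens y z \<xi> = dens x z \<xi>"
  using busemann_cocycle[OF assms] by (simp flip: ennreal_mult exp_add)

text \<open>Both sides are compared on cylinders of words longer than that of \<open>g\<close>. On
  such a cylinder the density is constant by \<open>busemann_orb\<close>, and \<open>g\<close> pulls
  it back to a cylinder whose weight differs by just this factor.\<close>

lemma m0_quasi_invariant:
  assumes g: "g \<in> carrier F"
  shows "distr m\<^sub>0 BB (bdry_act F g) = density m\<^sub>0 (dens (orb g) o\<^sub>T)"
proof -
  let ?N = "length (rwd g) + 1"
  let ?E = "insert {} (cyl ` {w \<in> reduced_words. ?N \<le> length w})"
  have gm: "bdry_act F g \<in> measurable m\<^sub>0 BB"
    using bdry_act_measurable[OF g] by (simp add: measurable_cong_sets[OF m0_sets refl])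
  have sig: "sets BB = sigma_sets Bd ?E"
  proof (rule antisym)
    show "sets BB \<subseteq> sigma_sets Bd ?E" unfolding sets_BB_cyl[of ?N] by (rule sigma_sets_mono') auto
    show "sigma_sets Bd ?E \<subseteq> sets BB"
    proof -
      have "?E \<subseteq> sets BB" by auto
      from sets.sigma_sets_subset[OF this] show ?thesis by (simp only: space_BB)
    qed
  qed
  show ?thesis
  proof (rule measure_eqI_generator_eq_countable[where E = ?E and \<Omega> = Bd
        and A = "cyl ` {w \<in> reduced_words. length w = ?N}"])
    show "Int_stable ?E"
    proof (rule Int_stableI)
      \<comment> \<open>Two cylinders are nested or disjoint, according to whether the shorter word
        is a prefix of the longer one.\<close>
      have *: "cyl u \<inter> cyl v \<in> ?E" if "u \<in> reduced_words" "v \<in> reduced_words" "?N \<le> length u" "length u \<le> length v" for u v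
      proof (cases "take (length u) v = u")
        case True
        have "cyl v \<subseteq> cyl u"
        proof
          fix \<xi> assume "\<xi> \<in> cyl v"
          then obtain \<omega> where w: "\<omega> \<in> rays" "\<xi> = ray_end \<omega>" "pre \<omega> (length v) = v" unfolding cyl_def by blast
          have "pre \<omega> (length u) = take (length u) (pre \<omega> (length v))" using that by simp
          then show "\<xi> \<in> cyl u" using w True ray_end_in_cyl by simp
        qed
        then have "cyl u \<inter> cyl v = cyl v" by blast
        then show ?thesis using that by auto
      next
        case False
        have "cyl u \<inter> cyl v = {}"
        proof (rule ccontr)
          assume "cyl u \<inter> cyl v \<noteq> {}"
          then obtain \<xi> where "\<xi> \<in> cyl u" "\<xi> \<in> cyl v" by blast
          then obtain \<omega> where w: "\<omega> \<in> rays" "\<xi> = ray_end \<omega>" "pre \<omega> (length v) = v" unfolding cyl_def by blast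
          then have "pre \<omega> (length u) = u" using \<open>\<xi> \<in> cyl u\<close> ray_end_in_cyl by simp
          moreover have "pre \<omega> (length u) = take (length u) (pre \<omega> (length v))" using that by simp
          ultimately show False using w False by simp
        qed
        then show ?thesis by simp
      qed
      fix X Y assume XY: "X \<in> ?E" "Y \<in> ?E"
      show "X \<inter> Y \<in> ?E"
      proof (cases "X = {} \<or> Y = {}")
        case False
        then obtain u v where uv: "X = cyl u" "Y = cyl v" "u \<in> reduced_words" "v \<in> reduced_words" "?N \<le> length u" "?N \<le> length v"
          using XY by auto
        show ?thesis
          using *[of u v] *[of v u] uv by (cases "length u \<le> length v") (auto simp: Int_commute)
      qed auto
    qed
    show "?E \<subseteq> Pow Bd" using cyl_Bd by auto
    show "sets (distr m\<^sub>0 BB (bdry_act F g)) = sigma_sets Bd ?E" using sig by simp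
    show "sets (density m\<^sub>0 (dens (orb g) o\<^sub>T)) = sigma_sets Bd ?E" using sig m0_sets by simp
    show "cyl ` {w \<in> reduced_words. length w = ?N} \<subseteq> ?E" by auto
    show "\<Union> (cyl ` {w \<in> reduced_words. length w = ?N}) = Bd"
    proof (rule equalityI; rule subsetI)
      fix \<xi> assume "\<xi> \<in> Bd"
      then obtain \<omega> where w: "\<omega> \<in> rays" "\<xi> = ray_end \<omega>" using Bd_cases by metis
      then have "pre \<omega> ?N \<in> {w \<in> reduced_words. length w = ?N}" "\<xi> \<in> cyl (pre \<omega> ?N)" using pre_reduced ray_end_in_cyl by auto
      then show "\<xi> \<in> \<Union> (cyl ` {w \<in> reduced_words. length w = ?N})" by (rule UN_I)
    qed (use cyl_Bd in blast)
    show "countable (cyl ` {w \<in> reduced_words. length w = ?N})"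
      using countable_reduced_words by (intro countable_image countable_subset[OF _ countable_reduced_words]) auto
    show "emeasure (distr m\<^sub>0 BB (bdry_act F g)) a \<noteq> \<infinity>" for a
    proof -
      have "emeasure (distr m\<^sub>0 BB (bdry_act F g)) a \<le> emeasure (distr m\<^sub>0 BB (bdry_act F g)) Bd"
        using emeasure_space[of "distr m\<^sub>0 BB (bdry_act F g)" a] by simp
      also have "\<dots> = emeasure m\<^sub>0 (bdry_act F g -` Bd \<inter> Bd)"
        using emeasure_distr[OF gm, of Bd] m0_space sets.top[of BB] by simp
      also have "\<dots> \<le> emeasure m\<^sub>0 Bd" using emeasure_space[of m\<^sub>0] m0_space by simp
      finally show ?thesis using m0_total by (auto simp: top_unique)
    qed
    fix X assume X: "X \<in> ?E"
    show "emeasure (distr m\<^sub>0 BB (bdry_act F g)) X = emeasure (density m\<^sub>0 (dens (orb g) o\<^sub>T)) X"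
    proof (cases "X = {}")
      case False
      then have "X \<in> cyl ` {w \<in> reduced_words. ?N \<le> length w}" using X by blast
      then obtain w where w: "X = cyl w" "w \<in> reduced_words" "length (rwd g) < length w" by auto
      obtain c x y where cxy: "rwd g = c @ x" "w = c @ y" "y \<noteq> []" "x = [] \<or> hd x \<noteq> hd y"
        "bdry_act F g -` cyl w \<inter> Bd = cyl (winv x @ y)" "winv x @ y \<in> reduced_words"
        using bdry_act_vimage_cyl[OF g w(2,3)] by blast
      have "emeasure (distr m\<^sub>0 BB (bdry_act F g)) X = ennreal (cyl_weight (winv x @ y))"
        using emeasure_distr[OF gm, of X] m0_space w cxy m0_cyl by simp
      also have "cyl_weight (winv x @ y) = exp (- (wlen \<mu> g - 2 * wl \<mu> c)) * cyl_weight w"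
        using cxy w unfolding cyl_weight_def wlen_def by (simp add: algebra_simps flip: exp_add)
      also have "ennreal \<dots> = ennreal (exp (- (wlen \<mu> g - 2 * wl \<mu> c))) * emeasure m\<^sub>0 X"
        using m0_cyl w cyl_weight_nonneg by (simp add: ennreal_mult)
      also have "\<dots> = (\<integral>\<^sup>+\<xi>. ennreal (exp (- (wlen \<mu> g - 2 * wl \<mu> c))) * indicator X \<xi> \<partial>m\<^sub>0)"
        using w m0_sets by (subst nn_integral_cmult_indicator) auto
      also have "\<dots> = (\<integral>\<^sup>+\<xi>. dens (orb g) o\<^sub>T \<xi> * indicator X \<xi> \<partial>m\<^sub>0)"
        using busemann_orb[OF g cxy(1), of _ y] cxy w
        by (intro nn_integral_cong) (auto split: split_indicator)
      also have "\<dots> = emeasure (density m\<^sub>0 (dens (orb g) o\<^sub>T)) X"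
        using w m0_sets g by (subst emeasure_density[OF dens_measurable_m0]) auto
      finally show ?thesis .
    qed simp
  qed
qed

text \<open>The measure at the base vertex is spread to all points by the densities that
  conformality demands. The cocycle identity then gives conformality in general, and equivariance
  reduces to \<open>m0_quasi_invariant\<close>.\<close>

lemma PS_family_exists: "patterson_sullivan_family F B T 1 (\<lambda>x. density m\<^sub>0 (dens x o\<^sub>T))"
  unfolding patterson_sullivan_family_def
proof (intro conjI ballI)
  fix x assume x: "x \<in> M"
  show "space (density m\<^sub>0 (dens x o\<^sub>T)) = topspace (bdry_top F B)" using m0_space by simp
  show "sets (density m\<^sub>0 (dens x o\<^sub>T)) = sets BB" using m0_sets by simp
  have em: "emeasure (density m\<^sub>0 (dens x o\<^sub>T)) Bd = (\<integral>\<^sup>+\<xi>. dens x o\<^sub>T \<xi> \<partial>m\<^sub>0)"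
  proof -
    have "Bd \<in> sets m\<^sub>0" using m0_space sets.top[of m\<^sub>0] by simp
    then have "emeasure (density m\<^sub>0 (dens x o\<^sub>T)) Bd = (\<integral>\<^sup>+\<xi>. dens x o\<^sub>T \<xi> * indicator Bd \<xi> \<partial>m\<^sub>0)"
      by (rule emeasure_density[OF dens_measurable_m0[OF x base_M]])
    also have "\<dots> = (\<integral>\<^sup>+\<xi>. dens x o\<^sub>T \<xi> \<partial>m\<^sub>0)"
      by (rule nn_integral_cong) (simp add: m0_space)
    finally show ?thesis .
  qed
  have "(\<integral>\<^sup>+\<xi>. dens x o\<^sub>T \<xi> \<partial>m\<^sub>0) \<le> (\<integral>\<^sup>+\<xi>. ennreal (exp (d x o\<^sub>T)) \<partial>m\<^sub>0)"
    using busemann_bound[OF _ x] m0_space by (intro nn_integral_mono) (auto simp: abs_le_iff intro!: ennreal_leI)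
  also have "\<dots> = ennreal (exp (d x o\<^sub>T))" using m0_space m0_total by simp
  finally have fin: "(\<integral>\<^sup>+\<xi>. dens x o\<^sub>T \<xi> \<partial>m\<^sub>0) < \<infinity>" using ennreal_less_top le_less_trans by fastforce
  show "finite_measure (density m\<^sub>0 (dens x o\<^sub>T))"
    by (rule finite_measureI) (use em fin m0_space in auto)
  have "ennreal (exp (- d x o\<^sub>T)) = (\<integral>\<^sup>+\<xi>. ennreal (exp (- d x o\<^sub>T)) \<partial>m\<^sub>0)" using m0_space m0_total by simp
  also have "\<dots> \<le> (\<integral>\<^sup>+\<xi>. dens x o\<^sub>T \<xi> \<partial>m\<^sub>0)"
    using busemann_bound[OF _ x] m0_space by (intro nn_integral_mono) (auto simp: abs_le_iff intro!: ennreal_leI)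
  finally have "(\<integral>\<^sup>+\<xi>. dens x o\<^sub>T \<xi> \<partial>m\<^sub>0) \<noteq> 0" by (auto simp: ennreal_eq_0_iff)
  then show "emeasure (density m\<^sub>0 (dens x o\<^sub>T)) (space (density m\<^sub>0 (dens x o\<^sub>T))) \<noteq> 0"
    using em m0_space by simp
next
  fix g x assume g: "g \<in> carrier F" and x: "x \<in> M"
  have gm: "bdry_act F g \<in> measurable m\<^sub>0 BB"
    using bdry_act_measurable[OF g] by (simp add: measurable_cong_sets[OF m0_sets refl])
  have "density m\<^sub>0 (dens x o\<^sub>T) = density m\<^sub>0 (\<lambda>\<xi>. dens (act g x) (orb g) (bdry_act F g \<xi>))"
  proof (rule density_cong)
    show "dens x o\<^sub>T \<in> borel_measurable m\<^sub>0" using dens_measurable_m0 x by simp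
    show "(\<lambda>\<xi>. dens (act g x) (orb g) (bdry_act F g \<xi>)) \<in> borel_measurable m\<^sub>0"
      using measurable_compose[OF gm dens_measurable[of "act g x" "orb g"]] g x by simp
    show "AE \<xi> in m\<^sub>0. dens x o\<^sub>T \<xi> = dens (act g x) (orb g) (bdry_act F g \<xi>)"
      using busemann_equivariant[OF g _ x base_M] m0_space by (intro AE_I2) simp
  qed
  then have "distr (density m\<^sub>0 (dens x o\<^sub>T)) BB (bdry_act F g) =
      density (distr m\<^sub>0 BB (bdry_act F g)) (dens (act g x) (orb g))"
    using density_distr[OF dens_measurable[of "act g x" "orb g"] gm] g x by simp
  also have "\<dots> = density m\<^sub>0 (\<lambda>\<xi>. dens (orb g) o\<^sub>T \<xi> * dens (act g x) (orb g) \<xi>)"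
    unfolding m0_quasi_invariant[OF g]
    by (rule density_density_eq) (use dens_measurable_m0 g x in auto)
  also have "\<dots> = density m\<^sub>0 (dens (act g x) o\<^sub>T)"
  proof (rule density_cong)
    show "(\<lambda>\<xi>. dens (orb g) o\<^sub>T \<xi> * dens (act g x) (orb g) \<xi>) \<in> borel_measurable m\<^sub>0"
      using dens_measurable_m0 g x by (intro borel_measurable_times_ennreal) auto
    show "AE \<xi> in m\<^sub>0. dens (orb g) o\<^sub>T \<xi> * dens (act g x) (orb g) \<xi> = dens (act g x) o\<^sub>T \<xi>"
      using dens_mult[of _ "act g x" "orb g" o\<^sub>T] g x m0_space by (intro AE_I2) (simp add: mult.commute)
  qed (use dens_measurable_m0 g x in auto)
  finally show "distr (density m\<^sub>0 (dens x o\<^sub>T)) BB (bdry_act F g) = density m\<^sub>0 (dens (act g x) o\<^sub>T)" .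
next
  fix x y assume xy: "x \<in> M" "y \<in> M"
  have "density (density m\<^sub>0 (dens y o\<^sub>T)) (dens x y) = density m\<^sub>0 (\<lambda>\<xi>. dens y o\<^sub>T \<xi> * dens x y \<xi>)"
    by (rule density_density_eq) (use dens_measurable_m0 xy in auto)
  also have "\<dots> = density m\<^sub>0 (dens x o\<^sub>T)"
  proof (rule density_cong)
    show "(\<lambda>\<xi>. dens y o\<^sub>T \<xi> * dens x y \<xi>) \<in> borel_measurable m\<^sub>0"
      using dens_measurable_m0 xy by (intro borel_measurable_times_ennreal) auto
    show "AE \<xi> in m\<^sub>0. dens y o\<^sub>T \<xi> * dens x y \<xi> = dens x o\<^sub>T \<xi>"
      using dens_mult[of _ x y o\<^sub>T] xy m0_space by (intro AE_I2) (simp add: mult.commute)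
  qed (use dens_measurable_m0 xy in auto)
  finally show "density m\<^sub>0 (dens x o\<^sub>T) = density (density m\<^sub>0 (dens y o\<^sub>T)) (dens x y)" by simp
qed

section \<open>Counting orbit points\<close>

definition ball_count :: "real \<Rightarrow> 'g set" where
  "ball_count R = {g \<in> carrier F. wlen \<mu> g \<le> R}"

lemma finite_ball_count: "finite (ball_count R)"
proof -
  obtain c where c: "c > 0" "\<And>w. set w \<subseteq> Lam \<Longrightarrow> c * real (length w) \<le> wl \<mu> w"
    using weight_bound by blast
  have "rwd ` ball_count R \<subseteq> {w. set w \<subseteq> Lam \<and> length w \<le> nat \<lfloor>R / c\<rfloor>}"
  proof
    fix w assume "w \<in> rwd ` ball_count R"
    then obtain g where g: "w = rwd g" "g \<in> carrier F" "wl \<mu> w \<le> R" unfolding ball_count_def wlen_def by auto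
    then have "c * real (length w) \<le> R" using c(2)[of w] rwd_Lam by fastforce
    then have "real (length w) \<le> R / c" using c(1) by (simp add: field_simps)
    then show "w \<in> {w. set w \<subseteq> Lam \<and> length w \<le> nat \<lfloor>R / c\<rfloor>}" using g rwd_Lam by (simp add: le_nat_floor)
  qed
  moreover have "finite {w. set w \<subseteq> Lam \<and> length w \<le> nat \<lfloor>R / c\<rfloor>}"
    by (rule finite_lists_length_le) (simp add: finite_basis)
  ultimately have "finite (rwd ` ball_count R)" by (rule finite_subset)
  moreover have "inj_on rwd (ball_count R)" unfolding ball_count_def using rwd_inj by (auto intro: inj_onI)
  ultimately show ?thesis by (rule finite_imageD)
qed

text \<open>Every end leaves the ball of radius \<open>R\<close>. Its last prefix inside has weight
  above \<open>R - L\<close>, so the cylinders of such prefixes cover the boundary, while each has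
  mass at most \<open>exp (- (R - L))\<close>.\<close>

lemma count_lower:
  obtains L where "\<And>R. 0 \<le> R \<Longrightarrow> exp (R - L) \<le> real (card (ball_count R))"
proof -
  \<comment> \<open>An upper bound for the weight of one letter, that is, for the amount by which
    the next prefix can exceed the present one.\<close>
  define L where "L = Max (insert 0 (\<mu> ` B))"
  have L: "\<mu> b \<le> L" if "b \<in> B" for b unfolding L_def using finite_basis that by simp
  have "exp (R - L) \<le> real (card (ball_count R))" if R: "0 \<le> R" for R
  proof -
    let ?S = "{g \<in> ball_count R. R - L < wlen \<mu> g}"
    have fS: "finite ?S" using finite_ball_count by simp
    have cover: "Bd \<subseteq> (\<Union>g\<in>?S. cyl (rwd g))"
    proof
      fix \<xi> assume "\<xi> \<in> Bd"
      then obtain \<omega> where w: "\<omega> \<in> rays" "\<xi> = ray_end \<omega>" using Bd_cases by metis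
      have "\<exists>n. R < wl \<mu> (pre \<omega> n)" using wl_pre_unbounded[OF w(1)] .
      then obtain n where n: "R < wl \<mu> (pre \<omega> n)" "\<forall>k<n. \<not> R < wl \<mu> (pre \<omega> k)"
        using exists_least_iff[of "\<lambda>n. R < wl \<mu> (pre \<omega> n)"] by blast
      have "n \<noteq> 0" using n(1) R by (auto intro: ccontr)
      then obtain k where k: "n = Suc k" using not0_implies_Suc by blast
      have "\<omega> k \<in> Lam" using w unfolding rays_def by auto
      then have "wl \<mu> (pre \<omega> n) \<le> wl \<mu> (pre \<omega> k) + L" unfolding k pre_Suc using L by auto
      moreover have "wl \<mu> (pre \<omega> k) \<le> R" using n(2) k by auto
      ultimately have "ray \<omega> k \<in> ?S"
        using n(1) w rwd_ray[OF w(1)] unfolding ball_count_def wlen_def by simp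
      moreover have "\<xi> \<in> cyl (rwd (ray \<omega> k))" using rwd_ray[OF w(1)] ray_end_in_cyl w by simp
      ultimately show "\<xi> \<in> (\<Union>g\<in>?S. cyl (rwd g))" by blast
    qed
    have "1 \<le> emeasure m\<^sub>0 (\<Union>g\<in>?S. cyl (rwd g))"
      unfolding m0_total[symmetric] using cover m0_sets fS by (intro emeasure_mono) auto
    also have "\<dots> \<le> (\<Sum>g\<in>?S. emeasure m\<^sub>0 (cyl (rwd g)))"
      by (rule emeasure_subadditive_finite[OF fS]) (simp add: m0_sets image_subset_iff)
    also have "\<dots> \<le> (\<Sum>g\<in>?S. ennreal (exp (- (R - L))))"
    proof (rule sum_mono)
      fix g assume g: "g \<in> ?S"
      then have r: "rwd g \<in> reduced_words" using rwd_reduced unfolding ball_count_def by blast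
      have "cyl_weight (rwd g) \<le> exp (- wl \<mu> (rwd g))" using cyl_weight_bounds[OF r] by blast
      also have "\<dots> \<le> exp (- (R - L))" using g unfolding wlen_def by simp
      finally show "emeasure m\<^sub>0 (cyl (rwd g)) \<le> ennreal (exp (- (R - L)))"
        using m0_cyl[OF r] by (simp add: ennreal_leI)
    qed
    also have "\<dots> = ennreal (real (card ?S) * exp (- (R - L)))"
      unfolding sum_constant ennreal_of_nat_eq_real_of_nat by (rule ennreal_mult[symmetric]) auto
    finally have "1 \<le> real (card ?S) * exp (- (R - L))" by (simp flip: ennreal_1)
    also have "\<dots> \<le> real (card (ball_count R)) * exp (- (R - L))"
      using finite_ball_count by (intro mult_right_mono) (auto intro: card_mono)
    finally have "1 * exp (R - L) \<le> real (card (ball_count R)) * exp (- (R - L)) * exp (R - L)"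
      by (intro mult_right_mono) auto
    also have "\<dots> = real (card (ball_count R))" by (simp only: mult.assoc flip: exp_add) simp
    finally show ?thesis by simp
  qed
  then show ?thesis using that by blast
qed

text \<open>Cylinders of different words with equally many letters are disjoint, and inside the ball
  each has mass at least \<open>exp (- R) / 2\<close>. There are at most \<open>R / c + 1\<close>
  possible numbers of letters, and this polynomial factor does not affect the growth rate.\<close>

lemma count_upper:
  obtains c where "c > 0" "\<And>R. 0 \<le> R \<Longrightarrow> real (card (ball_count R)) \<le> 2 * (R / c + 1) * exp R"
proof -
  obtain c where c: "c > 0" "\<And>w. set w \<subseteq> Lam \<Longrightarrow> c * real (length w) \<le> wl \<mu> w"
    using weight_bound by blast
  have level: "real (card {g \<in> ball_count R. length (rwd g) = n}) \<le> 2 * exp R" for R n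
  proof -
    let ?S = "{g \<in> ball_count R. length (rwd g) = n}"
    have fS: "finite ?S" using finite_ball_count by simp
    have SC: "g \<in> carrier F" if "g \<in> ?S" for g using that unfolding ball_count_def by blast
    have "ennreal (real (card ?S) * (exp (- R) / 2)) = (\<Sum>g\<in>?S. ennreal (exp (- R) / 2))"
      unfolding sum_constant ennreal_of_nat_eq_real_of_nat by (rule ennreal_mult) auto
    also have "\<dots> \<le> (\<Sum>g\<in>?S. emeasure m\<^sub>0 (cyl (rwd g)))"
    proof (rule sum_mono)
      fix g assume g: "g \<in> ?S"
      have r: "rwd g \<in> reduced_words" using rwd_reduced SC[OF g] .
      have "exp (- R) / 2 \<le> exp (- wl \<mu> (rwd g)) / 2" using g unfolding ball_count_def wlen_def by simp
      also have "\<dots> \<le> cyl_weight (rwd g)" using cyl_weight_bounds[OF r] by blast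
      finally show "ennreal (exp (- R) / 2) \<le> emeasure m\<^sub>0 (cyl (rwd g))"
        using m0_cyl[OF r] by (simp add: ennreal_leI)
    qed
    also have "\<dots> = emeasure m\<^sub>0 (\<Union>g\<in>?S. cyl (rwd g))"
    proof (rule sum_emeasure)
      show "disjoint_family_on (\<lambda>g. cyl (rwd g)) ?S"
        unfolding disjoint_family_on_def
      proof (intro ballI impI)
        fix g h assume gh: "g \<in> ?S" "h \<in> ?S" "g \<noteq> h"
        then have "rwd g \<noteq> rwd h" using rwd_inj SC by blast
        then show "cyl (rwd g) \<inter> cyl (rwd h) = {}" using gh by (intro cyl_disjoint) auto
      qed
    qed (simp_all add: fS m0_sets image_subset_iff)
    also have "\<dots> \<le> 1" using emeasure_space[of m\<^sub>0] m0_space m0_total by simp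
    finally have "real (card ?S) * (exp (- R) / 2) \<le> 1" by (simp flip: ennreal_1)
    then show ?thesis by (simp add: exp_minus field_simps)
  qed
  have "real (card (ball_count R)) \<le> 2 * (R / c + 1) * exp R" if R: "0 \<le> R" for R
  proof -
    define K where "K = nat \<lfloor>R / c\<rfloor>"
    have "ball_count R = (\<Union>n\<in>{..K}. {g \<in> ball_count R. length (rwd g) = n})"
    proof (intro equalityI subsetI)
      fix g assume g: "g \<in> ball_count R"
      then have "c * real (length (rwd g)) \<le> R" using c(2)[of "rwd g"] rwd_Lam[of g]
        unfolding ball_count_def wlen_def by fastforce
      then have "real (length (rwd g)) \<le> R / c" using c(1) by (simp add: field_simps)
      then have "length (rwd g) \<le> K" unfolding K_def by (simp add: le_nat_floor)
      then show "g \<in> (\<Union>n\<in>{..K}. {g \<in> ball_count R. length (rwd g) = n})" using g by simp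
    qed auto
    then have "card (ball_count R) \<le> (\<Sum>n\<in>{..K}. card {g \<in> ball_count R. length (rwd g) = n})"
      using card_UN_le[of "{..K}" "\<lambda>n. {g \<in> ball_count R. length (rwd g) = n}"] by simp
    then have "real (card (ball_count R)) \<le> (\<Sum>n\<in>{..K}. real (card {g \<in> ball_count R. length (rwd g) = n}))"
      by (simp flip: of_nat_sum)
    also have "\<dots> \<le> (\<Sum>n\<in>{..K}. 2 * exp R)" using level by (rule sum_mono)
    also have "\<dots> = (real K + 1) * (2 * exp R)" by (simp add: algebra_simps)
    also have "\<dots> \<le> (R / c + 1) * (2 * exp R)"
      using R c(1) unfolding K_def by (intro mult_right_mono) (auto simp: of_nat_floor)
    finally show ?thesis by (simp add: mult.commute mult.left_commute)
  qed
  then show ?thesis using that c(1) by blast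
qed

lemma volume_entropy_one: "volume_entropy F T 1"
  unfolding volume_entropy_def
proof
  fix x assume x: "x \<in> M"
  \<comment> \<open>Displacements at \<open>x\<close> and at \<open>o\<^sub>T\<close> differ by at
    most twice the distance of these points.\<close>
  define r where "r = 2 * d x o\<^sub>T"
  have r: "r \<ge> 0" unfolding r_def by simp
  let ?N = "\<lambda>R. {g \<in> carrier F. d x (act g x) \<le> R}"
  have close: "\<bar>d x (act g x) - wlen \<mu> g\<bar> \<le> r" if g: "g \<in> carrier F" for g
  proof -
    have "d x (act g x) \<le> d x o\<^sub>T + d o\<^sub>T (act g x)" "d o\<^sub>T (act g x) \<le> d o\<^sub>T (orb g) + d (orb g) (act g x)"
      "d o\<^sub>T (orb g) \<le> d o\<^sub>T x + d x (orb g)" "d x (orb g) \<le> d x (act g x) + d (act g x) (orb g)"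
      by (rule triangle; simp add: x g)+
    moreover have "d (orb g) (act g x) = d o\<^sub>T x" "d (act g x) (orb g) = d x o\<^sub>T" using x g by auto
    ultimately show ?thesis using commute[of x o\<^sub>T] base_dist[OF g] unfolding r_def by (simp add: abs_le_iff)
  qed
  have sub: "ball_count (R - r) \<subseteq> ?N R" "?N R \<subseteq> ball_count (R + r)" for R
    using close unfolding ball_count_def by (force simp: abs_le_iff)+
  have finN: "finite (?N R)" for R using sub(2) finite_ball_count finite_subset by blast
  obtain L where L: "\<And>R. 0 \<le> R \<Longrightarrow> exp (R - L) \<le> real (card (ball_count R))" using count_lower by blast
  obtain c where c: "c > 0" "\<And>R. 0 \<le> R \<Longrightarrow> real (card (ball_count R)) \<le> 2 * (R / c + 1) * exp R"
    using count_upper by blast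
  have low: "(R - r - L) / R \<le> ln (real (card (?N R))) / R" if R: "R > r" for R
  proof -
    have "exp (R - r - L) \<le> real (card (?N R))"
      using L[of "R - r"] R card_mono[OF finN sub(1)[of R]] by (smt (verit) of_nat_le_iff)
    moreover have "0 < real (card (?N R))" using calculation exp_gt_zero less_le_trans by blast
    ultimately have "R - r - L \<le> ln (real (card (?N R)))" by (simp add: ln_ge_iff)
    then show ?thesis using R r by (intro divide_right_mono) auto
  qed
  have up: "ln (real (card (?N R))) / R \<le> (ln (2 * ((R + r) / c + 1)) + (R + r)) / R" if R: "R > r" for R
  proof -
    have "0 < exp (R - r - L)" by simp
    also have "exp (R - r - L) \<le> real (card (?N R))"
      using L[of "R - r"] R card_mono[OF finN sub(1)[of R]] by (smt (verit) of_nat_le_iff)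
    finally have pos: "0 < real (card (?N R))" .
    have "real (card (?N R)) \<le> 2 * ((R + r) / c + 1) * exp (R + r)"
      using c(2)[of "R + r"] R r card_mono[OF finite_ball_count sub(2)[of R]] by (smt (verit) of_nat_le_iff)
    then have "ln (real (card (?N R))) \<le> ln (2 * ((R + r) / c + 1) * exp (R + r))"
      using pos by (subst ln_le_cancel_iff) auto
    also have "\<dots> = ln (2 * ((R + r) / c + 1)) + (R + r)"
    proof -
      have "0 < 2 * ((R + r) / c + 1)" using R r c(1) by (intro mult_pos_pos add_nonneg_pos) auto
      then show ?thesis by (subst ln_mult) auto
    qed
    finally show ?thesis using R r by (intro divide_right_mono) auto
  qed
  show "((\<lambda>R. ln (real (card (?N R))) / R) \<longlongrightarrow> 1) at_top"
  proof (rule tendsto_sandwich)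
    show "((\<lambda>R. (R - r - L) / R) \<longlongrightarrow> 1) at_top" by real_asymp
    show "((\<lambda>R. (ln (2 * ((R + r) / c + 1)) + (R + r)) / R) \<longlongrightarrow> 1) at_top"
      using c(1) by real_asymp
    show "\<forall>\<^sub>F R in at_top. (R - r - L) / R \<le> ln (real (card (?N R))) / R"
      using eventually_gt_at_top[of r] by (rule eventually_mono) (rule low)
    show "\<forall>\<^sub>F R in at_top. ln (real (card (?N R))) / R \<le> (ln (2 * ((R + r) / c + 1)) + (R + r)) / R"
      using eventually_gt_at_top[of r] by (rule eventually_mono) (rule up)
  qed
qed

end

lemma PS_current_exists: "\<exists>\<nu>. patterson_sullivan_current F B T \<nu>"
proof -
  obtain m where m: "sets m = sets BB" "\<And>w. w \<in> reduced_words \<Longrightarrow> emeasure m (cyl w) = ennreal (cyl_weight w)"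
    using boundary_measure by blast
  show ?thesis
    unfolding patterson_sullivan_current_def
    using volume_entropy_one[OF m] PS_family_exists[OF m] base_M by blast
qed

end

section \<open>Rose trees\<close>

context based_tree
begin

lemma lt_formula: "g \<in> carrier F \<Longrightarrow> lt g = max 0 (wlen \<mu> (g \<otimes> g) - wlen \<mu> g)"
  using lt_eq[of g o\<^sub>T] base_dist by simp

text \<open>The core of a non-trivial element contains at least one letter, and its weight bounds
  all displacements. A bound that is uniform in \<open>g\<close> and \<open>x\<close> yields
  freeness and discreteness together.\<close>

lemma displacement_bound: "\<exists>c>0. \<forall>g\<in>carrier F. \<forall>x\<in>M. g \<noteq> \<one> \<longrightarrow> c \<le> d x (act g x)"
proof -
  obtain c where c: "c > 0" "\<And>w. set w \<subseteq> Lam \<Longrightarrow> c * real (length w) \<le> wl \<mu> w"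
    using weight_bound by blast
  have "c \<le> d x (act g x)" if g: "g \<in> carrier F" "g \<noteq> \<one>" and x: "x \<in> M" for g x
  proof -
    obtain v where v: "v \<noteq> []" "set v \<subseteq> Lam" "wlen \<mu> (g \<otimes> g) - wlen \<mu> g = wl \<mu> v"
      using cyclic_core[OF g] by metis
    have "c * 1 \<le> c * real (length v)" using v(1) c(1) by (intro mult_left_mono) (auto simp: Suc_le_eq)
    also have "\<dots> \<le> wl \<mu> v" using c(2) v(2) by blast
    also have "\<dots> \<le> lt g" using lt_formula[OF g(1)] v(3) by simp
    finally show ?thesis using lt_le[OF g(1) x] by simp
  qed
  then show ?thesis using c(1) by blast
qed

lemma free_action: "free_tree_action F T"
proof -
  obtain c where "c > 0" "\<forall>g\<in>carrier F. \<forall>x\<in>M. g \<noteq> \<one> \<longrightarrow> c \<le> d x (act g x)"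
    using displacement_bound by blast
  then show ?thesis unfolding free_tree_action_def stabilizer_def by force
qed

lemma discrete_action: "discrete_tree_action F T"
  unfolding discrete_tree_action_def
proof
  fix x assume x: "x \<in> M"
  obtain c where c: "c > 0" "\<forall>g\<in>carrier F. \<forall>x\<in>M. g \<noteq> \<one> \<longrightarrow> c \<le> d x (act g x)"
    using displacement_bound by blast
  let ?O = "orbit F act x"
  have OM: "?O \<subseteq> M" using x unfolding orbit_def by auto
  have sep: "y = z" if yz: "y \<in> ?O" "z \<in> ?O" "d y z < c" for y z
  proof -
    obtain g h where gh: "g \<in> carrier F" "h \<in> carrier F" "y = act g x" "z = act h x"
      using yz unfolding orbit_def by auto
    have "d y z = d x (act (inv g \<otimes> h) x)" using gh x by (simp add: d_act_left act_mult)
    then have "inv g \<otimes> h = \<one>" using c(2) gh x yz(3) by force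
    then have "g = h" using gh by (metis inv_equality inv_inv inv_closed)
    then show ?thesis using gh by simp
  qed
  show "subtopology (ttop T) ?O = discrete_topology ?O"
  proof (rule sym, subst discrete_topology_unique, intro conjI ballI)
    show "topspace (subtopology (ttop T) ?O) = ?O" using OM by auto
    fix y assume y: "y \<in> ?O"
    have "openin (subtopology (ttop T) ?O) (?O \<inter> mball y c)" by (simp add: openin_subtopology_Int2)
    moreover have "?O \<inter> mball y c = {y}" using y sep[OF y, symmetric] OM c(1) by auto
    ultimately show "openin (subtopology (ttop T) ?O) {y}" by simp
  qed
qed

text \<open>Every segment between orbit points extends on both sides to a long segment between orbit points,
  and hence lies between two translates of any given point \<open>y\<close>.\<close>

lemma minimal_action:
  assumes B: "B \<noteq> {}" and span: "\<And>p. p \<in> M \<Longrightarrow> \<exists>x\<in>carrier F. btw o\<^sub>T p (orb x)"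
  shows "minimal_tree_action F T"
  unfolding minimal_tree_action_def
proof (intro allI impI)
  fix S assume S: "S \<noteq> {} \<and> connectedin (ttop T) S \<and> (\<forall>g\<in>carrier F. act g ` S \<subseteq> S)"
  then have SM: "S \<subseteq> M" using connectedin_subset_topspace by fastforce
  obtain y where y: "y \<in> S" using S by blast
  then have yM: "y \<in> M" using SM by blast
  define r where "r = d o\<^sub>T y"
  have "p \<in> S" if p: "p \<in> M" for p
  proof -
    \<comment> \<open>The extension below needs a first and a last letter. If \<open>p\<close> is
      the base vertex, any basis element will do.\<close>
    have "\<exists>x\<in>carrier F. x \<noteq> \<one> \<and> btw o\<^sub>T p (orb x)"
    proof -
      obtain x where x: "x \<in> carrier F" "btw o\<^sub>T p (orb x)" using span[OF p] by blast
      show ?thesis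
      proof (cases "x = \<one>")
        case True
        then have "d o\<^sub>T p = 0" using x commute[of p o\<^sub>T] unfolding btw_def by simp
        then have po: "p = o\<^sub>T" using p by simp
        obtain b where "b \<in> B" using B by blast
        then have b: "(b, True) \<in> Lam" by simp
        then have "rwd (val [(b, True)]) = [(b, True)]" by (intro rwd_val) (simp add: reduced_words_def)
        then have "val [(b, True)] \<noteq> \<one>" by (metis list.distinct(1) rwd_one)
        moreover have "btw o\<^sub>T p (orb (val [(b, True)]))" unfolding po btw_def by simp
        ultimately show ?thesis using val_closed[of "[(b, True)]"] b by auto
      qed (use x in blast)
    qed
    then obtain x where x: "x \<in> carrier F" "x \<noteq> \<one>" "btw o\<^sub>T p (orb x)" by blast
    then have w: "rwd x \<noteq> []" "rwd x \<in> reduced_words" using rwd_eq_Nil rwd_reduced by auto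
    \<comment> \<open>Powers of \<open>a\<close> lead away from \<open>o\<^sub>T\<close> in the
      direction opposite to \<open>orb x\<close>, and powers of \<open>b\<close> continue beyond
      \<open>orb x\<close> without cancellation. The power \<open>n\<close> makes both extensions
      longer than \<open>r\<close>, the distance from an orbit point to the corresponding translate
      of \<open>y\<close>.\<close>
    define a where "a = linv (hd (rwd x))"
    define b where "b = last (rwd x)"
    have ab: "a \<in> Lam" "b \<in> Lam"
      unfolding a_def b_def using subsetD[OF reduced_words_D(1)[OF w(2)]] w(1)
      by (blast intro: linv_Lam hd_in_set last_in_set)+
    obtain n where n: "r < real n * \<mu> (fst a)" "r < real n * \<mu> (fst b)" "n > 0"
    proof -
      have pp: "0 < \<mu> (fst a)" "0 < \<mu> (fst b)" using ab pos by auto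
      obtain n1 where n1: "r < real n1 * \<mu> (fst a)" using ex_less_of_nat_mult[OF pp(1)] by blast
      obtain n2 where n2: "r < real n2 * \<mu> (fst b)" using ex_less_of_nat_mult[OF pp(2)] by blast
      have "real n1 * \<mu> (fst a) \<le> real (n1 + n2 + 1) * \<mu> (fst a)"
        "real n2 * \<mu> (fst b) \<le> real (n1 + n2 + 1) * \<mu> (fst b)" using pp by (auto intro!: mult_right_mono)
      then show ?thesis using that[of "n1 + n2 + 1"] n1 n2 by linarith
    qed
    have wlr: "wl \<mu> (replicate n z) = real n * \<mu> (fst z)" for z by (induction n) (auto simp: algebra_simps)
    have red: "reduced_word (replicate n z)" for z :: "'g \<times> bool"
    proof (induction n)
      case (Suc n)
      then show ?case by (cases n) auto
    qed simp
    let ?g = "val (replicate n a)" and ?h = "val (rwd x @ replicate n b)"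
    have gR: "replicate n a \<in> reduced_words" "rwd x @ replicate n b \<in> reduced_words"
      using ab red w n(3) unfolding reduced_words_def by (auto simp: reduced_append b_def hd_replicate)
    then have gc: "?g \<in> carrier F" "?h \<in> carrier F" and gr: "rwd ?g = replicate n a" "rwd ?h = rwd x @ replicate n b"
      using rwd_val[OF gR(1)] rwd_val[OF gR(2)] val_closed[OF reduced_words_D(1)[OF gR(1)]]
        val_closed[OF reduced_words_D(1)[OF gR(2)]] by blast+
    have l: "lcp (replicate n a) (rwd x @ v) = []" for v
    proof -
      obtain u us where "rwd x = u # us" using w by (cases "rwd x") auto
      moreover obtain k where "n = Suc k" using n(3) not0_implies_Suc by blast
      ultimately show ?thesis unfolding a_def by simp
    qed
    have l3: "lcp (rwd x) (rwd x @ replicate n b) = rwd x"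
      using lcp_append[of "[]" "replicate n b" "rwd x"] by simp
    let ?A = "orb ?g" and ?C = "orb ?h" and ?X = "act ?g y" and ?Y = "act ?h y"
    have M': "?A \<in> M" "?C \<in> M" "?X \<in> M" "?Y \<in> M" "orb x \<in> M" using gc yM x by auto
    have dA: "d ?A o\<^sub>T = real n * \<mu> (fst a)" using base_dist[OF gc(1)] commute gr wlr unfolding wlen_def by simp
    have dAx: "d ?A (orb x) = real n * \<mu> (fst a) + wlen \<mu> x"
      using orb_dist[OF gc(1) x(1)] wmet_eq[OF gc(1) x(1)] gr l[of "[]"] wlr unfolding wlen_def by simp
    have dxC: "d (orb x) ?C = real n * \<mu> (fst b)"
      using orb_dist[OF x(1) gc(2)] wmet_eq[OF x(1) gc(2)] gr l3 wlr unfolding wlen_def by simp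
    have dAC: "d ?A ?C = real n * \<mu> (fst a) + wlen \<mu> x + real n * \<mu> (fst b)"
      using orb_dist[OF gc] wmet_eq[OF gc] gr l wlr unfolding wlen_def by simp
    have px: "d o\<^sub>T p + d p (orb x) = wlen \<mu> x" using x base_dist unfolding btw_def by simp
    have t: "d ?A p \<le> d ?A o\<^sub>T + d o\<^sub>T p" "d p ?C \<le> d p (orb x) + d (orb x) ?C" "d ?A ?C \<le> d ?A p + d p ?C"
      using triangle M' p base_M by auto
    have pA: "d ?A p = real n * \<mu> (fst a) + d o\<^sub>T p" "d p ?C = d p (orb x) + real n * \<mu> (fst b)"
      using t dA dxC dAC px by linarith+
    have dX: "d ?A ?X = r" "d ?C ?Y = r" using gc yM unfolding r_def by auto
    have gAX: "0 < gp p ?A ?X"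
    proof -
      have "d p ?A \<le> d p ?X + d ?X ?A" using triangle M' p by blast
      moreover have "r < d p ?A" using pA n nonneg[of o\<^sub>T p] commute[of p ?A] by linarith
      ultimately show ?thesis using dX commute[of ?X ?A] unfolding gromov_product_def by simp
    qed
    have gCY: "0 < gp p ?Y ?C"
    proof -
      have "d p ?C \<le> d p ?Y + d ?Y ?C" using triangle M' p by blast
      moreover have "r < d p ?C" using pA n nonneg[of p "orb x"] by linarith
      ultimately show ?thesis using dX commute[of ?Y ?C] unfolding gromov_product_def by simp
    qed
    \<comment> \<open>The point \<open>p\<close> separates \<open>?A\<close> from \<open>?C\<close>,
      while \<open>?X\<close> is on the side of \<open>?A\<close> and \<open>?Y\<close> on the side
      of \<open>?C\<close>; so \<open>p\<close> separates \<open>?X\<close> from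
      \<open>?Y\<close>.\<close>
    have "gp p ?A ?C = 0" using pA dAC px commute[of p ?A] unfolding gromov_product_def by simp
    moreover have "min (gp p ?A ?X) (gp p ?X ?C) \<le> gp p ?A ?C" using gp_ultra M' p by blast
    moreover have "min (gp p ?X ?Y) (gp p ?Y ?C) \<le> gp p ?X ?C" using gp_ultra M' p by blast
    ultimately have "gp p ?X ?Y \<le> 0" using gAX gCY by (auto simp: min_def split: if_splits)
    then have "gp p ?X ?Y = 0" using gp_nonneg[of p ?X ?Y] M' p by simp
    then have "btw ?X p ?Y" using commute[of p ?X] unfolding gromov_product_def btw_def by simp
    moreover have "?X \<in> S" "?Y \<in> S" using S y gc by blast+
    ultimately show ?thesis using connectedin_contains_btw[of S ?X ?Y p] S p by blast
  qed
  then show "S = M" using SM by blast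
qed

lemma cv_tree_if_span:
  assumes "B \<noteq> {}" and "\<And>p. p \<in> M \<Longrightarrow> \<exists>x\<in>carrier F. btw o\<^sub>T p (orb x)"
  shows "cv_tree F T"
  unfolding cv_tree_def
  using real_tree isometric free_action discrete_action minimal_action[OF assms] by blast

end

lemma lcp_self [simp]: "lcp u u = u"
  by (induction u) auto

locale rose = fin_free_group F B + weighted_free_group F B \<mu>
  for F :: "('g, 'm) monoid_scheme" (structure) and B and \<mu>
begin

text \<open>The pair \<open>(x, t)\<close> stands for the point at distance \<open>t\<close> from the base point on the segment
  from the base point to its translate by \<open>x\<close>; different pairs may stand for the same point.
  Points are compared through their distances to the vertices \<open>vertex z\<close>.\<close>

definition V :: "('g \<times> real) set" where
  "V = {(x, t). x \<in> carrier F \<and> 0 \<le> t \<and> t \<le> wlen \<mu> x}"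

definition common_len :: "'g \<Rightarrow> 'g \<Rightarrow> real" where
  "common_len x y = wl \<mu> (lcp (rwd x) (rwd y))"

text \<open>The Gromov product at the base point: the length along which the two radial segments
  coincide.\<close>

definition meet :: "'g \<times> real \<Rightarrow> 'g \<times> real \<Rightarrow> real" where
  "meet p q = min (min (snd p) (snd q)) (common_len (fst p) (fst q))"

definition pdist :: "'g \<times> real \<Rightarrow> 'g \<times> real \<Rightarrow> real" where
  "pdist p q = snd p + snd q - 2 * meet p q"

definition vertex :: "'g \<Rightarrow> 'g \<times> real" where
  "vertex z = (z, wlen \<mu> z)"

lemma common_len_comm: "common_len x y = common_len y x"
  by (simp add: common_len_def lcp_comm)

lemma common_len_le: "x \<in> carrier F \<Longrightarrow> common_len x y \<le> wlen \<mu> x"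
  unfolding common_len_def wlen_def using wl_lcp_le rwd_Lam by blast

lemma common_len_nonneg: "x \<in> carrier F \<Longrightarrow> 0 \<le> common_len x y"
  unfolding common_len_def using rwd_Lam[of x] pos by (intro wl_lcp_nonneg) (auto simp: less_imp_le subset_eq)

lemma common_len_self: "common_len x x = wlen \<mu> x"
  by (simp add: common_len_def wlen_def)

lemma common_len_ultra: "x \<in> carrier F \<Longrightarrow> min (common_len x y) (common_len y z) \<le> common_len x z"
  unfolding common_len_def using rwd_Lam[of x] pos by (intro wl_lcp_ultra) (auto simp: less_imp_le subset_eq)

lemma V_D: "p \<in> V \<Longrightarrow> fst p \<in> carrier F" "p \<in> V \<Longrightarrow> 0 \<le> snd p" "p \<in> V \<Longrightarrow> snd p \<le> wlen \<mu> (fst p)"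
  by (auto simp: V_def)

lemma vertex_V [simp]: "z \<in> carrier F \<Longrightarrow> vertex z \<in> V"
  using wlen_nonneg by (simp add: V_def vertex_def)

lemma meet_comm: "meet p q = meet q p"
  by (simp add: meet_def common_len_comm min.commute)

lemma meet_ultra:
  assumes "p \<in> V" "q \<in> V" "r \<in> V"
  shows "min (meet p q) (meet q r) \<le> meet p r"
  using common_len_ultra[of "fst p" "fst q" "fst r"] V_D[OF assms(1)] unfolding meet_def
  by (auto simp: min_def split: if_splits)

lemma pdist_comm: "pdist p q = pdist q p"
  by (simp add: pdist_def meet_comm)

lemma pdist_nonneg: "0 \<le> pdist p q"
  unfolding pdist_def meet_def by auto

lemma pdist_four:
  assumes "p \<in> V" "q \<in> V" "r \<in> V" "s \<in> V"
  shows "pdist p q + pdist r s \<le> pdist p r + pdist q s \<or> pdist p q + pdist r s \<le> pdist p s + pdist q r"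
  using ultra_four_point[where A = meet, OF meet_comm meet_ultra assms] unfolding pdist_def by auto

lemma pdist_tri:
  assumes "p \<in> V" "q \<in> V" "r \<in> V"
  shows "pdist p r \<le> pdist p q + pdist q r"
proof -
  have "meet p q \<le> snd q" "meet q r \<le> snd q" unfolding meet_def by auto
  then show ?thesis using meet_ultra[OF assms] unfolding pdist_def by (auto simp: min_def split: if_splits)
qed

lemma pdist_vertex: "g \<in> carrier F \<Longrightarrow> h \<in> carrier F \<Longrightarrow> pdist (vertex g) (vertex h) = wmet \<mu> g h"
  using common_len_le[of g h] common_len_le[of h g] common_len_comm[of g h]
  by (auto simp: pdist_def meet_def vertex_def wmet_eq min_def simp flip: common_len_def)

lemma pdist_self: "p \<in> V \<Longrightarrow> pdist p p = 0"
  using V_D[of p] by (simp add: pdist_def meet_def common_len_self)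

text \<open>Distances to vertices determine all distances, which justifies comparing points through
  them. If \<open>q\<close> is not below the branch point, the end of its segment lies beyond it as
  seen from \<open>p\<close>; otherwise \<open>q\<close> is on the way from the base vertex to
  \<open>p\<close>.\<close>

lemma pdist_attained:
  assumes p: "p \<in> V" and q: "q \<in> V"
  shows "\<exists>z\<in>carrier F. \<bar>pdist p (vertex z) - pdist q (vertex z)\<bar> = pdist p q"
proof -
  obtain x t where p': "p = (x, t)" "x \<in> carrier F" "0 \<le> t" "t \<le> wlen \<mu> x" using p unfolding V_def by auto
  obtain y s where q': "q = (y, s)" "y \<in> carrier F" "0 \<le> s" "s \<le> wlen \<mu> y" using q unfolding V_def by auto
  have l: "common_len x y \<le> wlen \<mu> y" using common_len_le[OF q'(2), of x] common_len_comm by simp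
  show ?thesis
  proof (cases "min t (common_len x y) \<le> s")
    case True
    have "pdist q (vertex y) = wlen \<mu> y - s" using q' by (simp add: pdist_def meet_def vertex_def common_len_self)
    moreover have "pdist p (vertex y) = t + wlen \<mu> y - 2 * min t (common_len x y)"
      using p' l by (auto simp: pdist_def meet_def vertex_def min_def)
    moreover have "pdist p q = t + s - 2 * min t (common_len x y)"
      using p' q' True by (auto simp: pdist_def meet_def min_def split: if_splits)
    ultimately have "\<bar>pdist p (vertex y) - pdist q (vertex y)\<bar> = pdist p q" using pdist_nonneg[of p q] by simp
    then show ?thesis using q' by blast
  next
    case False
    have "common_len z \<one> = 0" for z unfolding common_len_def by (cases "rwd z") auto
    then have "pdist p (vertex \<one>) = t" "pdist q (vertex \<one>) = s" using p' q' by (auto simp: pdist_def meet_def vertex_def)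
    moreover have "pdist p q = t - s" using False p' q' by (auto simp: pdist_def meet_def min_def split: if_splits)
    ultimately have "\<bar>pdist p (vertex \<one>) - pdist q (vertex \<one>)\<bar> = pdist p q" using pdist_nonneg[of p q] by simp
    then show ?thesis by blast
  qed
qed

lemma pdist_diff_le:
  assumes "p \<in> V" "q \<in> V" "z \<in> carrier F"
  shows "\<bar>pdist p (vertex z) - pdist q (vertex z)\<bar> \<le> pdist p q"
  using pdist_tri[OF assms(1,2) vertex_V[OF assms(3)]] pdist_tri[OF assms(2,1) vertex_V[OF assms(3)]] pdist_comm[of p q]
  by (simp add: abs_le_iff)

lemma pdist_intermediate:
  assumes p: "p \<in> V" and q: "q \<in> V" and r: "0 \<le> r" "r \<le> pdist p q"
  shows "\<exists>c\<in>V. pdist p c = r \<and> pdist c q = pdist p q - r"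
proof -
  \<comment> \<open>Descends from \<open>p\<close> towards the branch point. The part beyond the
    branch point is reached by exchanging \<open>p\<close> and \<open>q\<close>.\<close>
  have main: "\<exists>c\<in>V. pdist p c = r \<and> pdist c q = pdist p q - r"
    if pq: "p \<in> V" "q \<in> V" "0 \<le> r" "r \<le> snd p - meet p q" for p q r
  proof (intro bexI conjI)
    have m: "0 \<le> meet p q"
      unfolding meet_def using common_len_nonneg[of "fst p" "fst q"] V_D[OF pq(1)] V_D[OF pq(2)] by simp
    show "(fst p, snd p - r) \<in> V" using V_D[OF pq(1)] pq m by (simp add: V_def)
    show "pdist p (fst p, snd p - r) = r"
      using V_D[OF pq(1)] pq by (simp add: pdist_def meet_def common_len_self)
    show "pdist (fst p, snd p - r) q = pdist p q - r"
      using pq unfolding pdist_def meet_def by (auto simp: min_def split: if_splits)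
  qed
  show ?thesis
  proof (cases "r \<le> snd p - meet p q")
    case False
    have "pdist p q - r \<le> snd q - meet q p" using False meet_comm unfolding pdist_def by simp
    then obtain c where "c \<in> V" "pdist q c = pdist p q - r" "pdist c p = pdist q p - (pdist p q - r)"
      using main[OF q p, of "pdist p q - r"] r by auto
    then show ?thesis using pdist_comm by (intro bexI[of _ c]) auto
  qed (use main[OF p q r(1)] in blast)
qed

lemma pdist_point:
  assumes "p \<in> V" "q \<in> V" "c \<in> V" "z \<in> V" and "pdist p c + pdist c q = pdist p q"
  shows "pdist c z = max (pdist p z - pdist p c) (pdist q z - pdist c q)"
proof -
  have "pdist c z \<le> max (pdist p z - pdist p c) (pdist q z - pdist c q)"
    using pdist_four[of c z p q] assms pdist_comm[of c p] pdist_comm[of z q] pdist_comm[of z p] by auto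
  moreover have "pdist p z \<le> pdist p c + pdist c z" "pdist q z \<le> pdist q c + pdist c z" using pdist_tri assms by auto
  ultimately show ?thesis using pdist_comm[of c q] by (auto simp: max_def)
qed

lemma pdist_radial:
  assumes "p \<in> V"
  shows "pdist (vertex \<one>) p = snd p" "pdist p (vertex (fst p)) = wlen \<mu> (fst p) - snd p"
proof -
  have "common_len \<one> (fst p) = 0" unfolding common_len_def by simp
  then show "pdist (vertex \<one>) p = snd p" using V_D[OF assms] by (simp add: pdist_def meet_def vertex_def)
  show "pdist p (vertex (fst p)) = wlen \<mu> (fst p) - snd p"
    using V_D[OF assms] by (simp add: pdist_def meet_def vertex_def common_len_self)
qed

definition same :: "'g \<times> real \<Rightarrow> ('g \<Rightarrow> real) \<Rightarrow> bool" where
  "same p f \<longleftrightarrow> p \<in> V \<and> (\<forall>z\<in>carrier F. pdist p (vertex z) = f z)"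

text \<open>The translate of \<open>p\<close> lies on the segment from \<open>vertex g\<close> to
  the translate of the endpoint of \<open>p\<close>. This segment need not start at the base vertex,
  so a pair naming the point has to be found.\<close>

lemma shift_exists:
  assumes g: "g \<in> carrier F" and p: "p \<in> V"
  shows "\<exists>q. same q (\<lambda>z. pdist p (vertex (inv g \<otimes> z)))"
proof -
  let ?x = "fst p" and ?t = "snd p"
  have x: "?x \<in> carrier F" "0 \<le> ?t" "?t \<le> wlen \<mu> ?x" using V_D[OF p] by auto
  have gx: "g \<otimes> ?x \<in> carrier F" using g x by simp
  have len: "pdist (vertex g) (vertex (g \<otimes> ?x)) = wlen \<mu> ?x"
    using pdist_vertex[OF g gx] wmet_mult_left[of g \<one> ?x] g x by (simp add: wmet_one)
  then obtain c where c: "c \<in> V" "pdist (vertex g) c = ?t" "pdist c (vertex (g \<otimes> ?x)) = wlen \<mu> ?x - ?t"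
    using pdist_intermediate[of "vertex g" "vertex (g \<otimes> ?x)" ?t] g gx x by auto
  have "pdist c (vertex z) = pdist p (vertex (inv g \<otimes> z))" if z: "z \<in> carrier F" for z
  proof -
    have iz: "inv g \<otimes> z \<in> carrier F" using g z by simp
    have gz: "g \<otimes> (inv g \<otimes> z) = z" using g z by (simp flip: m_assoc)
    have "pdist c (vertex z) = max (pdist (vertex g) (vertex z) - ?t) (pdist (vertex (g \<otimes> ?x)) (vertex z) - (wlen \<mu> ?x - ?t))"
      using pdist_point[of "vertex g" "vertex (g \<otimes> ?x)" c "vertex z"] c len g gx z by simp
    moreover have "pdist p (vertex (inv g \<otimes> z)) = max (pdist (vertex \<one>) (vertex (inv g \<otimes> z)) - ?t)
        (pdist (vertex ?x) (vertex (inv g \<otimes> z)) - (wlen \<mu> ?x - ?t))"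
    proof -
      have "pdist (vertex \<one>) (vertex ?x) = wlen \<mu> ?x" using pdist_vertex[of \<one> ?x] x by (simp add: wmet_one)
      then show ?thesis
        using pdist_point[of "vertex \<one>" "vertex ?x" p "vertex (inv g \<otimes> z)"] pdist_radial[OF p] p x iz by simp
    qed
    moreover have "pdist (vertex g) (vertex z) = pdist (vertex \<one>) (vertex (inv g \<otimes> z))"
      using pdist_vertex[OF g z] pdist_vertex[OF one_closed iz] wmet_mult_left[of g \<one> "inv g \<otimes> z"] g iz gz by simp
    moreover have "pdist (vertex (g \<otimes> ?x)) (vertex z) = pdist (vertex ?x) (vertex (inv g \<otimes> z))"
      using pdist_vertex[OF gx z] pdist_vertex[OF x(1) iz] wmet_mult_left[of g ?x "inv g \<otimes> z"] g x iz gz by simp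
    ultimately show ?thesis by simp
  qed
  then show ?thesis using c unfolding same_def by blast
qed

definition shift :: "'g \<Rightarrow> 'g \<times> real \<Rightarrow> 'g \<times> real" where
  "shift g p = (SOME q. same q (\<lambda>z. pdist p (vertex (inv g \<otimes> z))))"

text \<open>Selects one pair among all those that stand for the same point. The condition involves
  \<open>p\<close> only through its distances to vertices, so equivalent pairs receive the same
  choice.\<close>

definition normal_pair :: "'g \<times> real \<Rightarrow> 'g \<times> real" where
  "normal_pair p = (SOME q. q \<in> V \<and> (\<forall>z\<in>carrier F. pdist q (vertex z) = pdist p (vertex z)))"

text \<open>An injection of pairs into the reals: the integer part numbers the group element, and
  the fractional part records \<open>snd p\<close> through the injection of the non-negative reals
  into \<open>[0, 1)\<close>.\<close>

definition code :: "'g \<times> real \<Rightarrow> real" where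
  "code p = real (to_nat_on (carrier F) (fst p)) + snd p / (1 + snd p)"

definition pt :: "'g \<times> real \<Rightarrow> real" where
  "pt p = code (normal_pair p)"

definition pr :: "real \<Rightarrow> 'g \<times> real" where
  "pr a = inv_into V code a"

text \<open>Off the tree the distance is 0, because \<open>Metric_space\<close> asks for symmetry
  and non-negativity on the whole type. The action is extensional, because
  \<open>group_action\<close> takes its values in the bijections of \<open>BijGroup\<close>.\<close>

definition rose_tree :: "('g, real) gtree" where
  "rose_tree = \<lparr>tpts = pt ` V,
     tdist = (\<lambda>a b. if a \<in> pt ` V \<and> b \<in> pt ` V then pdist (pr a) (pr b) else 0),
     tact = (\<lambda>g. \<lambda>a\<in>pt ` V. pt (shift g (pr a)))\<rparr>"

lemma same_shift: "g \<in> carrier F \<Longrightarrow> p \<in> V \<Longrightarrow> same (shift g p) (\<lambda>z. pdist p (vertex (inv g \<otimes> z)))"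
  unfolding shift_def by (rule someI_ex[OF shift_exists])

lemma shift: "g \<in> carrier F \<Longrightarrow> p \<in> V \<Longrightarrow> shift g p \<in> V"
  and pdist_shift_vertex: "g \<in> carrier F \<Longrightarrow> p \<in> V \<Longrightarrow> z \<in> carrier F \<Longrightarrow> pdist (shift g p) (vertex z) = pdist p (vertex (inv g \<otimes> z))"
  using same_shift unfolding same_def by blast+

lemma normal_pair: "p \<in> V \<Longrightarrow> normal_pair p \<in> V"
  and pdist_normal_vertex: "p \<in> V \<Longrightarrow> z \<in> carrier F \<Longrightarrow> pdist (normal_pair p) (vertex z) = pdist p (vertex z)"
proof -
  assume "p \<in> V"
  then have "\<exists>q. q \<in> V \<and> (\<forall>z\<in>carrier F. pdist q (vertex z) = pdist p (vertex z))" by blast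
  from someI_ex[OF this] show "normal_pair p \<in> V" "z \<in> carrier F \<Longrightarrow> pdist (normal_pair p) (vertex z) = pdist p (vertex z)"
    unfolding normal_pair_def[symmetric] by auto
qed

lemma normal_pair_cong: "(\<And>z. z \<in> carrier F \<Longrightarrow> pdist p (vertex z) = pdist q (vertex z)) \<Longrightarrow> normal_pair p = normal_pair q"
  unfolding normal_pair_def by simp

lemma pt_cong: "(\<And>z. z \<in> carrier F \<Longrightarrow> pdist p (vertex z) = pdist q (vertex z)) \<Longrightarrow> pt p = pt q"
  unfolding pt_def using normal_pair_cong by metis

lemma pdist_cong_left:
  assumes "p \<in> V" "p' \<in> V" "q \<in> V" "\<And>z. z \<in> carrier F \<Longrightarrow> pdist p (vertex z) = pdist p' (vertex z)"
  shows "pdist p q = pdist p' q"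
proof -
  have "pdist p q \<le> pdist p' q" if pp: "p \<in> V" "p' \<in> V" "\<And>z. z \<in> carrier F \<Longrightarrow> pdist p (vertex z) = pdist p' (vertex z)" for p p'
    using pdist_attained[OF pp(1) assms(3)] pdist_diff_le[OF pp(2) assms(3)] pp(3) by fastforce
  then show ?thesis using assms by (metis antisym)
qed

lemma pdist_normal: "p \<in> V \<Longrightarrow> q \<in> V \<Longrightarrow> pdist (normal_pair p) (normal_pair q) = pdist p q"
  using pdist_cong_left[of "normal_pair p" p "normal_pair q"] pdist_cong_left[of "normal_pair q" q p] normal_pair pdist_normal_vertex pdist_comm by metis

lemma pdist_shift:
  assumes g: "g \<in> carrier F" and p: "p \<in> V" "q \<in> V"
  shows "pdist (shift g p) (shift g q) = pdist p q"
proof (rule antisym)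
  obtain z where z: "z \<in> carrier F" "\<bar>pdist (shift g p) (vertex z) - pdist (shift g q) (vertex z)\<bar> = pdist (shift g p) (shift g q)"
    using pdist_attained shift g p by meson
  then show "pdist (shift g p) (shift g q) \<le> pdist p q"
    using pdist_diff_le[OF p, of "inv g \<otimes> z"] pdist_shift_vertex g p by simp
  obtain z where z: "z \<in> carrier F" "\<bar>pdist p (vertex z) - pdist q (vertex z)\<bar> = pdist p q"
    using pdist_attained p by meson
  have "inv g \<otimes> (g \<otimes> z) = z" using g z by (simp flip: m_assoc)
  then show "pdist p q \<le> pdist (shift g p) (shift g q)"
    using pdist_diff_le[OF shift[OF g p(1)] shift[OF g p(2)], of "g \<otimes> z"] pdist_shift_vertex[OF g] p g z by simp
qed

lemma countable_carrier: "countable (carrier F)"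
  using countable_reduced_words val_bij by (metis bij_betw_imp_surj_on countable_image)

lemma code_inj: "inj_on code V"
proof (rule inj_onI)
  fix p q assume p: "p \<in> V" and q: "q \<in> V" and eq: "code p = code q"
  let ?f = "\<lambda>t::real. t / (1 + t)"
  have f: "0 \<le> ?f t \<and> ?f t < 1" if "0 \<le> t" for t using that by simp
  have "real (to_nat_on (carrier F) (fst p)) + ?f (snd p) = real (to_nat_on (carrier F) (fst q)) + ?f (snd q)"
    using eq unfolding code_def .
  moreover have "0 \<le> ?f (snd p) \<and> ?f (snd p) < 1" "0 \<le> ?f (snd q) \<and> ?f (snd q) < 1"
    using f[OF V_D(2)[OF p]] f[OF V_D(2)[OF q]] by auto
  ultimately have n: "to_nat_on (carrier F) (fst p) = to_nat_on (carrier F) (fst q)" by linarith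
  then have "fst p = fst q"
    using inj_on_to_nat_on[OF countable_carrier] V_D(1) p q unfolding inj_on_def by blast
  moreover have "?f (snd p) = ?f (snd q)" using eq n unfolding code_def by simp
  then have "snd p * (1 + snd q) = snd q * (1 + snd p)"
    using V_D(2)[OF p] V_D(2)[OF q] by (simp add: frac_eq_eq)
  then have "snd p = snd q" by (simp add: algebra_simps)
  ultimately show "p = q" by (rule prod_eqI)
qed

lemma pr_pt: "p \<in> V \<Longrightarrow> pr (pt p) = normal_pair p"
  unfolding pr_def pt_def using inv_into_f_f[OF code_inj] normal_pair by blast

lemma tpts_rose [simp]: "tpts rose_tree = pt ` V"
  by (simp add: rose_tree_def)

lemma tdist_rose: "p \<in> V \<Longrightarrow> q \<in> V \<Longrightarrow> tdist rose_tree (pt p) (pt q) = pdist p q"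
  by (simp add: rose_tree_def pr_pt pdist_normal)

lemma tact_rose: "g \<in> carrier F \<Longrightarrow> p \<in> V \<Longrightarrow> tact rose_tree g (pt p) = pt (shift g p)"
proof -
  assume g: "g \<in> carrier F" and p: "p \<in> V"
  have "pt (shift g (normal_pair p)) = pt (shift g p)"
    by (rule pt_cong) (use g p normal_pair pdist_shift_vertex pdist_normal_vertex in auto)
  then show ?thesis using p by (simp add: rose_tree_def pr_pt)
qed

lemma rose_Metric_space: "Metric_space (pt ` V) (tdist rose_tree)"
proof
  show "0 \<le> tdist rose_tree a b" for a b unfolding rose_tree_def using pdist_nonneg by simp
  show "tdist rose_tree a b = tdist rose_tree b a" for a b unfolding rose_tree_def using pdist_comm by simp
  fix a b c assume "a \<in> pt ` V" "b \<in> pt ` V"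
  then obtain p q where pq: "p \<in> V" "q \<in> V" "a = pt p" "b = pt q" by auto
  show "tdist rose_tree a b = 0 \<longleftrightarrow> a = b"
  proof
    assume "tdist rose_tree a b = 0"
    then have "pdist p (vertex z) = pdist q (vertex z)" if "z \<in> carrier F" for z
      using pdist_diff_le[OF pq(1,2) that] pq tdist_rose by simp
    then show "a = b" unfolding pq by (rule pt_cong)
  next
    assume "a = b"
    then show "tdist rose_tree a b = 0" using tdist_rose[OF pq(1) pq(1)] pq pdist_self by simp
  qed
  assume "c \<in> pt ` V"
  then obtain r where "r \<in> V" "c = pt r" by auto
  then show "tdist rose_tree a c \<le> tdist rose_tree a b + tdist rose_tree b c"
    using pdist_tri pq tdist_rose by simp
qed

lemma rose_rtree: "rtree (tpts rose_tree) (tdist rose_tree)"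
proof (intro rtree.intro rtree_axioms.intro)
  show "Metric_space (tpts rose_tree) (tdist rose_tree)" using rose_Metric_space by simp
  show "tpts rose_tree \<noteq> {}" using vertex_V[OF one_closed] unfolding tpts_rose by blast
next
  fix x y z w assume "x \<in> tpts rose_tree" "y \<in> tpts rose_tree" "z \<in> tpts rose_tree" "w \<in> tpts rose_tree"
  then obtain p q r s where "p \<in> V" "q \<in> V" "r \<in> V" "s \<in> V" "x = pt p" "y = pt q" "z = pt r" "w = pt s" by auto
  then show "tdist rose_tree x y + tdist rose_tree z w \<le> tdist rose_tree x z + tdist rose_tree y w \<or>
      tdist rose_tree x y + tdist rose_tree z w \<le> tdist rose_tree x w + tdist rose_tree y z"
    using pdist_four tdist_rose by simp
next
  fix x y s assume xy: "x \<in> tpts rose_tree" "y \<in> tpts rose_tree" and s: "0 \<le> s" "s \<le> tdist rose_tree x y"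
  then obtain p q where pq: "p \<in> V" "q \<in> V" "x = pt p" "y = pt q" by auto
  then obtain c where "c \<in> V" "pdist p c = s" "pdist c q = pdist p q - s"
    using pdist_intermediate[OF pq(1,2) s(1)] s(2) tdist_rose by auto
  then show "\<exists>c\<in>tpts rose_tree. tdist rose_tree x c = s \<and> tdist rose_tree c y = tdist rose_tree x y - s"
    using pq tdist_rose by (intro bexI[of _ "pt c"]) auto
qed

lemma tact_mult:
  assumes g: "g \<in> carrier F" "h \<in> carrier F" and p: "p \<in> V"
  shows "tact rose_tree (g \<otimes> h) (pt p) = tact rose_tree g (tact rose_tree h (pt p))"
proof -
  have "pt (shift (g \<otimes> h) p) = pt (shift g (shift h p))"
  proof (rule pt_cong)
    fix z assume z: "z \<in> carrier F"
    have "inv (g \<otimes> h) \<otimes> z = inv h \<otimes> (inv g \<otimes> z)" using g z by (simp add: inv_mult_group m_assoc)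
    then show "pdist (shift (g \<otimes> h) p) (vertex z) = pdist (shift g (shift h p)) (vertex z)"
      using pdist_shift_vertex g p z shift by simp
  qed
  then show ?thesis using tact_rose g p shift by simp
qed

lemma tact_one:
  assumes p: "p \<in> V" shows "tact rose_tree \<one> (pt p) = pt p"
proof -
  have "pt (shift \<one> p) = pt p" by (rule pt_cong) (use pdist_shift_vertex p in simp)
  then show ?thesis using tact_rose p by simp
qed

lemma rose_action: "group_action F (pt ` V) (tact rose_tree)"
proof -
  have cl: "tact rose_tree g a \<in> pt ` V" if "g \<in> carrier F" "a \<in> pt ` V" for g a
    using that tact_rose shift by auto
  have inv1: "tact rose_tree (inv g) (tact rose_tree g a) = a" "tact rose_tree g (tact rose_tree (inv g) a) = a"
    if "g \<in> carrier F" "a \<in> pt ` V" for g a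
    using that tact_mult[of "inv g" g] tact_mult[of g "inv g"] tact_one by auto
  have ext: "tact rose_tree g \<in> extensional (pt ` V)" for g unfolding rose_tree_def by simp
  have bij: "tact rose_tree g \<in> Bij (pt ` V)" if g: "g \<in> carrier F" for g
    unfolding Bij_def using ext
    by (auto intro!: bij_betw_byWitness[where f' = "tact rose_tree (inv g)"] simp: inv1[OF g] cl g)
  have "tact rose_tree (g \<otimes> h) = compose (pt ` V) (tact rose_tree g) (tact rose_tree h)"
    if "g \<in> carrier F" "h \<in> carrier F" for g h
  proof (rule extensionalityI[OF ext])
    show "compose (pt ` V) (tact rose_tree g) (tact rose_tree h) \<in> extensional (pt ` V)"
      by (rule compose_extensional)
    fix a assume "a \<in> pt ` V"
    then show "tact rose_tree (g \<otimes> h) a = compose (pt ` V) (tact rose_tree g) (tact rose_tree h) a"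
      using tact_mult[OF that] by (auto simp: compose_def)
  qed
  then have "tact rose_tree \<in> hom F (BijGroup (pt ` V))"
    using bij by (auto simp: hom_def BijGroup_def)
  then show ?thesis
    unfolding group_action_def group_hom_def group_hom_axioms_def
    using group_BijGroup is_group by blast
qed

lemma pt_shift_base:
  assumes g: "g \<in> carrier F"
  shows "pt (shift g (vertex \<one>)) = pt (vertex g)"
proof (rule pt_cong)
  fix z assume z: "z \<in> carrier F"
  have "g \<otimes> (inv g \<otimes> z) = z" using g z by (simp flip: m_assoc)
  then have "wmet \<mu> \<one> (inv g \<otimes> z) = wmet \<mu> g z"
    using wmet_mult_left[of g \<one> "inv g \<otimes> z"] g z by simp
  then show "pdist (shift g (vertex \<one>)) (vertex z) = pdist (vertex g) (vertex z)"
    using pdist_shift_vertex[OF g vertex_V[OF one_closed] z] pdist_vertex g z by simp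
qed

lemma rose_based: "based_tree F B \<mu> rose_tree (pt (vertex \<one>))"
proof -
  have "isometric_action F rose_tree"
    unfolding isometric_action_def using rose_action tact_rose tdist_rose pdist_shift shift by auto
  moreover have "tdist rose_tree (pt (vertex \<one>)) (tact rose_tree g (pt (vertex \<one>))) = wlen \<mu> g"
    if g: "g \<in> carrier F" for g
  proof -
    show ?thesis using tact_rose tdist_rose pt_shift_base[OF g] g pdist_vertex[of \<one> g] by (simp add: wmet_one)
  qed
  moreover have "pt (vertex \<one>) \<in> tpts rose_tree" using vertex_V[OF one_closed] by simp
  moreover have "tree_action F rose_tree"
    by (intro tree_action.intro tree_action_axioms.intro rose_rtree is_group calculation(1))
  ultimately show ?thesis
    by (intro based_tree.intro based_tree_axioms.intro fin_free_group_axioms weighted_free_group_axioms)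
qed

lemma rose_cv_tree:
  assumes "B \<noteq> {}" shows "cv_tree F rose_tree"
proof -
  interpret R: based_tree F B \<mu> rose_tree "pt (vertex \<one>)" by (rule rose_based)
  show ?thesis
  proof (rule R.cv_tree_if_span[OF assms])
    fix a assume "a \<in> tpts rose_tree"
    then obtain p where p: "p \<in> V" "a = pt p" by auto
    have x: "fst p \<in> carrier F" using V_D p by blast
    have orb: "tact rose_tree (fst p) (pt (vertex \<one>)) = pt (vertex (fst p))"
      using tact_rose pt_shift_base[OF x] x by simp
    have "R.btw (pt (vertex \<one>)) a (tact rose_tree (fst p) (pt (vertex \<one>)))"
      unfolding R.btw_def orb p(2)
      using tdist_rose p x pdist_radial[OF p(1)] pdist_vertex[of \<one> "fst p"] by (simp add: wmet_one)
    then show "\<exists>x\<in>carrier F. R.btw (pt (vertex \<one>)) a (tact rose_tree x (pt (vertex \<one>)))" using x by blast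
  qed
qed

end

section \<open>Degenerating roses\<close>

lemma measure_scale: "0 \<le> c \<Longrightarrow> measure (scale_measure (ennreal c) \<nu>) A = c * measure \<nu> A"
  by (simp add: measure_def enn2real_mult)

lemma mem_current_class: "\<nu> \<in> current_class \<nu>"
proof -
  have "scale_measure (ennreal 1) \<nu> = \<nu>" by (rule measure_eqI) auto
  then show ?thesis unfolding current_class_def by (intro CollectI exI[of _ 1]) auto
qed

lemma current_class_eqD:
  assumes "current_class \<nu> = current_class \<nu>'"
  obtains c where "c > 0" "\<And>A. measure \<nu> A = c * measure \<nu>' A"
proof -
  have "\<nu> \<in> current_class \<nu>'" using mem_current_class assms by blast
  then obtain c where "c > 0" "\<nu> = scale_measure (ennreal c) \<nu>'" unfolding current_class_def by auto
  then show ?thesis using that measure_scale[of c \<nu>'] by auto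
qed

section \<open>Projective length functions and projective currents\<close>

context fin_free_group
begin

text \<open>The length function of a weighted rose, written in terms of words. In this form it also
  makes sense for weights that vanish on some letters, as happens in the limit.\<close>

definition tlen :: "('g \<Rightarrow> real) \<Rightarrow> 'g \<Rightarrow> real" where
  "tlen \<mu> = (\<lambda>g\<in>carrier F. max 0 (wlen \<mu> (g \<otimes> g) - wlen \<mu> g))"

lemma wlen_scale: "wlen (\<lambda>b. c * \<mu> b) g = c * wlen \<mu> g"
  by (simp add: wlen_def wl_scale)

lemma tlen_scale: "c > 0 \<Longrightarrow> g \<in> carrier F \<Longrightarrow> tlen (\<lambda>b. c * \<mu> b) g = c * tlen \<mu> g"
  by (auto simp: tlen_def wlen_scale max_def algebra_simps)

lemma val_True: "b \<in> B \<Longrightarrow> val [(b, True)] = b"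
  using B_carrier by (auto simp: val_Cons)

lemma tlen_basis: "b \<in> B \<Longrightarrow> 0 \<le> \<mu> b \<Longrightarrow> tlen \<mu> b = \<mu> b"
  using wlen_pair[of "(b, True)" "(b, True)" \<mu>] wlen_letter[of "(b, True)" \<mu>] val_True[of b] B_carrier
  by (auto simp: tlen_def)

lemma proj_class_scale:
  assumes "c \<noteq> 0" "\<And>g. g \<in> carrier F \<Longrightarrow> f g = c * f' g"
  shows "proj_class F f = proj_class F f'"
proof -
  have 1: "(\<lambda>g\<in>carrier F. r * f g) = (\<lambda>g\<in>carrier F. (r * c) * f' g)" for r
    using assms(2) by (intro restrict_ext) simp
  have 2: "(\<lambda>g\<in>carrier F. r * f' g) = (\<lambda>g\<in>carrier F. (r / c) * f g)" for r
    using assms by (intro restrict_ext) simp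
  show ?thesis
    unfolding proj_class_def
  proof (intro equalityI subsetI)
    fix \<phi> assume "\<phi> \<in> {(\<lambda>g\<in>carrier F. r * f g) |r. r \<noteq> 0}"
    then obtain r where "r \<noteq> 0" "\<phi> = (\<lambda>g\<in>carrier F. (r * c) * f' g)" unfolding 1 by blast
    then show "\<phi> \<in> {(\<lambda>g\<in>carrier F. r * f' g) |r. r \<noteq> 0}"
      using assms(1) by (intro CollectI exI[of _ "r * c"]) simp
  next
    fix \<phi> assume "\<phi> \<in> {(\<lambda>g\<in>carrier F. r * f' g) |r. r \<noteq> 0}"
    then obtain r where "r \<noteq> 0" "\<phi> = (\<lambda>g\<in>carrier F. (r / c) * f g)" unfolding 2 by blast
    then show "\<phi> \<in> {(\<lambda>g\<in>carrier F. r * f g) |r. r \<noteq> 0}"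
      using assms(1) by (intro CollectI exI[of _ "r / c"]) simp
  qed
qed

lemma proj_class_eqD:
  assumes "proj_class F f = proj_class F f'" "f \<in> extensional (carrier F)"
  obtains c where "c \<noteq> 0" "\<And>g. g \<in> carrier F \<Longrightarrow> f g = c * f' g"
proof -
  have "f = (\<lambda>g\<in>carrier F. 1 * f g)" using assms(2) by (simp add: extensional_restrict)
  then have "f \<in> proj_class F f" unfolding proj_class_def by (intro CollectI exI[of _ 1]) simp
  then obtain c where "c \<noteq> 0" "f = (\<lambda>g\<in>carrier F. c * f' g)" using assms(1) unfolding proj_class_def by auto
  then show ?thesis using that[of c] by simp
qed

lemma letter_rect_facts:
  assumes "a \<noteq> b"
  shows "(cyl [a], cyl [b]) \<in> clopen_rectangles F B"
    and "compactin (dbl_bdry_top F B) (cyl [a] \<times> cyl [b])"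
proof -
  have d: "cyl [a] \<inter> cyl [b] = {}" using assms by (intro cyl_disjoint) auto
  then show "(cyl [a], cyl [b]) \<in> clopen_rectangles F B" unfolding clopen_rectangles_def by auto
  show "compactin (dbl_bdry_top F B) (cyl [a] \<times> cyl [b])"
    unfolding dbl_bdry_top_def compactin_subtopology compactin_Times
    using d compactin_cyl by auto
qed

lemma continuous_measure_rect:
  assumes "a \<noteq> b"
  shows "continuous_map (Curr_top F B) euclideanreal (\<lambda>\<nu>. measure \<nu> (cyl [a] \<times> cyl [b]))"
proof -
  let ?P = "product_topology (\<lambda>_. euclideanreal) (clopen_rectangles F B)"
  let ?f = "\<lambda>\<nu>. \<lambda>(S, S')\<in>clopen_rectangles F B. measure \<nu> (S \<times> S')"
  have "continuous_map ?P euclideanreal (\<lambda>x. x (cyl [a], cyl [b]))"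
    by (rule continuous_map_product_projection[OF letter_rect_facts(1)[OF assms]])
  then have "continuous_map (Curr_top F B) euclideanreal ((\<lambda>x. x (cyl [a], cyl [b])) \<circ> ?f)"
    unfolding Curr_top_def by (rule continuous_map_pullback)
  moreover have "(\<lambda>x. x (cyl [a], cyl [b])) \<circ> ?f = (\<lambda>\<nu>. measure \<nu> (cyl [a] \<times> cyl [b]))"
    using letter_rect_facts(1)[OF assms] by (auto simp: fun_eq_iff)
  ultimately show ?thesis by simp
qed

lemma topspace_Curr [simp]: "topspace (Curr_top F B) = Curr F B"
  unfolding Curr_top_def topspace_pullback_topology by auto

lemma topspace_PCurr: "topspace (PCurr_top F B) = current_class ` nonzero_currents F B"
  unfolding PCurr_top_def topspace_quotient_topology by (auto simp: nonzero_currents_def)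

text \<open>The inequality is homogeneous, so its validity depends on the projective class only. The
  opposite strict inequality defines an open set of classes; if the limit lay in it, so would late
  members of the sequence.\<close>

lemma PCurr_limit_inequality:
  assumes lim: "limitin (PCurr_top F B) (\<lambda>n. current_class (\<nu> n)) (current_class \<eta>) sequentially"
    and \<nu>: "\<And>n. \<nu> n \<in> nonzero_currents F B" and \<eta>: "\<eta> \<in> nonzero_currents F B"
    and ab: "a \<noteq> b" "a' \<noteq> b'"
    and le: "\<And>n. r * measure (\<nu> n) (cyl [a] \<times> cyl [b]) \<le> s * measure (\<nu> n) (cyl [a'] \<times> cyl [b'])"
  shows "r * measure \<eta> (cyl [a] \<times> cyl [b]) \<le> s * measure \<eta> (cyl [a'] \<times> cyl [b'])"
proof (rule ccontr)
  define \<Psi> where "\<Psi> \<nu> = r * measure \<nu> (cyl [a] \<times> cyl [b]) - s * measure \<nu> (cyl [a'] \<times> cyl [b'])" for \<nu>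
  assume "\<not> ?thesis"
  then have pos: "\<Psi> \<eta> > 0" unfolding \<Psi>_def by simp
  have scale: "\<Psi> \<nu> > 0" if "current_class \<nu> = current_class \<nu>'" "\<Psi> \<nu>' > 0" for \<nu> \<nu>'
  proof -
    obtain c where "c > 0" "\<And>A. measure \<nu> A = c * measure \<nu>' A" using current_class_eqD[OF \<open>current_class \<nu> = current_class \<nu>'\<close>] by metis
    moreover then have "\<Psi> \<nu> = c * \<Psi> \<nu>'" unfolding \<Psi>_def by (simp add: algebra_simps)
    ultimately show ?thesis using that by simp
  qed
  let ?N = "subtopology (Curr_top F B) (nonzero_currents F B)"
  have topN: "topspace ?N = nonzero_currents F B" by (auto simp: nonzero_currents_def)
  \<comment> \<open>\<open>\<Psi>\<close> changes by a positive factor within a class, so the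
    preimage of \<open>U\<close> is again the set where \<open>\<Psi>\<close> is positive.\<close>
  define U where "U = current_class ` {\<nu> \<in> nonzero_currents F B. \<Psi> \<nu> > 0}"
  have "continuous_map (Curr_top F B) euclideanreal \<Psi>"
    unfolding \<Psi>_def using continuous_measure_rect[OF ab(1)] continuous_measure_rect[OF ab(2)]
    by (intro continuous_map_diff continuous_map_real_mult_left)
  then have "continuous_map ?N euclideanreal \<Psi>" by (rule continuous_map_from_subtopology)
  then have "openin ?N {\<nu> \<in> topspace ?N. \<Psi> \<nu> \<in> {0<..}}" by (rule openin_continuous_map_preimage) simp
  moreover have "{\<nu> \<in> topspace ?N. current_class \<nu> \<in> U} = {\<nu> \<in> topspace ?N. \<Psi> \<nu> \<in> {0<..}}"
    unfolding U_def topN using scale by auto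
  ultimately have "openin (PCurr_top F B) U"
    unfolding PCurr_top_def openin_quotient_topology U_def topN by auto
  moreover have "current_class \<eta> \<in> U" unfolding U_def using pos \<eta> by blast
  ultimately obtain n where "current_class (\<nu> n) \<in> U"
    using lim unfolding limitin_sequentially by blast
  then have "\<Psi> (\<nu> n) > 0" unfolding U_def using scale by blast
  then show False using le[of n] unfolding \<Psi>_def by simp
qed

text \<open>Two different ends share a prefix \<open>c\<close> and then branch, so translation by
  the inverse of \<open>val c\<close> brings them into a letter rectangle. If all letter rectangles
  were null, countably many null translates would cover the space.\<close>

lemma nonzero_current_positive_rect:
  assumes \<eta>: "\<eta> \<in> nonzero_currents F B"
  obtains a b where "a \<in> Lam" "b \<in> Lam" "a \<noteq> b" "measure \<eta> (cyl [a] \<times> cyl [b]) > 0"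
proof -
  have C: "\<eta> \<in> Curr F B" "emeasure \<eta> (space \<eta>) \<noteq> 0" using \<eta> unfolding nonzero_currents_def by auto
  have rad: "radon_measure (dbl_bdry_top F B) \<eta>" using C unfolding Curr_def by blast
  have sp: "space \<eta> = topspace (dbl_bdry_top F B)" and st: "sets \<eta> = sets (borel_on (dbl_bdry_top F B))"
    and fin: "\<And>K. compactin (dbl_bdry_top F B) K \<Longrightarrow> emeasure \<eta> K < \<infinity>"
    using rad unfolding radon_measure_def by auto
  have open_rect: "cyl u \<times> cyl v \<in> sets \<eta>" if "cyl u \<inter> cyl v = {}" for u v
  proof -
    have "openin (dbl_bdry_top F B) (cyl u \<times> cyl v)"
    proof -
      have "cyl u \<times> cyl v = (cyl u \<times> cyl v) \<inter> {(\<zeta>, \<xi>). \<zeta> \<noteq> \<xi>}" using that by auto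
      moreover have "openin (dbl_bdry_top F B) ((cyl u \<times> cyl v) \<inter> {(\<zeta>, \<xi>). \<zeta> \<noteq> \<xi>})"
        unfolding dbl_bdry_top_def by (rule openin_subtopology_Int) (simp add: openin_prod_Times_iff)
      ultimately show ?thesis by simp
    qed
    moreover have "{U. openin (dbl_bdry_top F B) U} \<subseteq> Pow (topspace (dbl_bdry_top F B))"
      using openin_subset by blast
    ultimately show ?thesis unfolding st borel_on_def by (simp add: sigma_sets.Basic)
  qed
  have "\<exists>a\<in>Lam. \<exists>b\<in>Lam. a \<noteq> b \<and> emeasure \<eta> (cyl [a] \<times> cyl [b]) \<noteq> 0"
  proof (rule ccontr)
    assume "\<not> ?thesis"
    then have zero: "emeasure \<eta> (cyl [a] \<times> cyl [b]) = 0" if "a \<in> Lam" "b \<in> Lam" "a \<noteq> b" for a b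
      using that by meson
    \<comment> \<open>The common prefix of two ends together with the letters at which they
      branch.\<close>
    let ?I = "{(c, a, b). c @ [a] \<in> reduced_words \<and> c @ [b] \<in> reduced_words \<and> a \<noteq> b}"
    let ?R = "\<lambda>(c, a, b). cyl (c @ [a]) \<times> cyl (c @ [b])"
    have null: "?R i \<in> null_sets \<eta>" if "i \<in> ?I" for i
    proof -
      obtain c a b where "i = (c, a, b)" by (rule prod_cases3)
      then have i: "i = (c, a, b)" "c @ [a] \<in> reduced_words" "c @ [b] \<in> reduced_words" "a \<noteq> b" using \<open>i \<in> ?I\<close> by simp_all
      have L: "a \<in> Lam" "b \<in> Lam" "c \<in> reduced_words" using i unfolding reduced_words_def by (auto simp: reduced_append)
      let ?g = "val c"
      have g: "?g \<in> carrier F" "rwd ?g = c @ []" using rwd_val[OF L(3)] val_closed[OF reduced_words_D(1)[OF L(3)]] by auto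
      have im: "bdry_act F (inv ?g) ` cyl (c @ [a]) = cyl [a]" "bdry_act F (inv ?g) ` cyl (c @ [b]) = cyl [b]"
        using bdry_act_cyl[OF g, of "[a]"] bdry_act_cyl[OF g, of "[b]"] i reduced_words_D by auto
      have d: "cyl (c @ [a]) \<inter> cyl (c @ [b]) = {}" using i by (intro cyl_disjoint) auto
      have "emeasure \<eta> (map_prod (bdry_act F (inv ?g)) (bdry_act F (inv ?g)) ` (cyl (c @ [a]) \<times> cyl (c @ [b]))) =
          emeasure \<eta> (cyl (c @ [a]) \<times> cyl (c @ [b]))"
        using C(1) g open_rect[OF d] unfolding Curr_def by simp
      then have "emeasure \<eta> (cyl (c @ [a]) \<times> cyl (c @ [b])) = 0"
        using zero[OF L(1,2) i(4)] im by (simp add: map_prod_surj_on)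
      then show ?thesis using open_rect[OF d] i by auto
    qed
    have "countable ?I"
    proof (rule countable_subset)
      show "?I \<subseteq> (\<lambda>(u, v). (butlast u, last u, last v)) ` (reduced_words \<times> reduced_words)" by force
      show "countable ((\<lambda>(u, v). (butlast u, last u, last v)) ` (reduced_words \<times> reduced_words))"
        using countable_reduced_words by (intro countable_image countable_SIGMA)
    qed
    then have "(\<Union>i\<in>?I. ?R i) \<in> null_sets \<eta>" using null by (rule null_sets_UN')
    moreover have "space \<eta> \<subseteq> (\<Union>i\<in>?I. ?R i)"
    proof
      fix p assume "p \<in> space \<eta>"
      then obtain \<xi> \<zeta> where p: "p = (\<xi>, \<zeta>)" "\<xi> \<in> Bd" "\<zeta> \<in> Bd" "\<xi> \<noteq> \<zeta>" unfolding sp topspace_dbl by auto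
      obtain \<omega> where w: "\<omega> \<in> rays" "\<xi> = ray_end \<omega>" using Bd_cases[OF p(2)] by metis
      obtain \<omega>' where w': "\<omega>' \<in> rays" "\<zeta> = ray_end \<omega>'" using Bd_cases[OF p(3)] by metis
      obtain n where n: "pre \<omega> n = pre \<omega>' n" "\<omega> n \<noteq> \<omega>' n" using distinct_ends_split w w' p(4) by metis
      have "(pre \<omega> n, \<omega> n, \<omega>' n) \<in> ?I"
        using pre_reduced[OF w(1), of "Suc n"] pre_reduced[OF w'(1), of "Suc n"] n by (simp add: pre_Suc)
      moreover have "p \<in> ?R (pre \<omega> n, \<omega> n, \<omega>' n)"
        using p w w' n ray_end_in_cyl by (simp add: pre_Suc)
      ultimately show "p \<in> (\<Union>i\<in>?I. ?R i)" by (rule UN_I)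
    qed
    ultimately have "space \<eta> \<in> null_sets \<eta>" by (rule null_sets_subset[OF _ sets.top])
    then show False using C(2) by auto
  qed
  then obtain a b where ab: "a \<in> Lam" "b \<in> Lam" "a \<noteq> b" "emeasure \<eta> (cyl [a] \<times> cyl [b]) \<noteq> 0" by blast
  have "measure \<eta> (cyl [a] \<times> cyl [b]) > 0"
    using ab(4) fin[OF letter_rect_facts(2)[OF ab(3)]]
    by (simp add: measure_def enn2real_positive_iff zero_less_iff_neq_zero)
  then show ?thesis using that ab by blast
qed

text \<open>The rose tree and its current make the choice in \<open>PS_map\<close> a meaningful one.
  Of the chosen tree only the projective length function is known; \<open>base_point_exists\<close>
  recovers a vertex from it, and with it the masses.\<close>

lemma rose_point:
  assumes pos: "\<And>b. b \<in> B \<Longrightarrow> 0 < \<mu> b" and card: "card B \<ge> 2"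
    and sum: "(\<Sum>b\<in>B. 1 / (1 + exp (\<mu> b))) = 1 / 2"
  shows "proj_class F (tlen \<mu>) \<in> CV F"
    and "\<exists>\<nu>. PS_map F B (proj_class F (tlen \<mu>)) = current_class \<nu> \<and>
      (\<exists>P>0. \<forall>a\<in>Lam. \<forall>b\<in>Lam. a \<noteq> b \<longrightarrow> measure \<nu> (cyl [a] \<times> cyl [b]) =
        P * (1 / (1 + exp (\<mu> (fst a)))) * (1 / (1 + exp (\<mu> (fst b)))))"
proof -
  have B: "B \<noteq> {}" using card by auto
  have wf: "weighted_free_group F B \<mu>" using pos by unfold_locales
  interpret R: rose F B \<mu> using wf by (intro rose.intro fin_free_group_axioms)
  interpret entropy_one_group F B \<mu>
    by (intro entropy_one_group.intro fin_free_group_axioms wf entropy_one_group_axioms.intro sum)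
  interpret T1: entropy_one_tree F B \<mu> R.rose_tree "R.pt (R.vertex \<one>)"
    by (intro entropy_one_tree.intro entropy_one_group_axioms R.rose_based)
  let ?T = "R.rose_tree"
  have len: "length_fun F ?T = tlen \<mu>"
  proof (rule extensionalityI)
    show "length_fun F ?T \<in> extensional (carrier F)" "tlen \<mu> \<in> extensional (carrier F)"
      unfolding length_fun_def tlen_def by auto
  qed (simp add: T1.lt_formula tlen_def)
  have cvT: "cv_tree F ?T" using R.rose_cv_tree[OF B] .
  then show "proj_class F (tlen \<mu>) \<in> CV F" unfolding CV_def cv_def using len by force
  let ?Q = "\<lambda>C. \<exists>(T :: ('g, real) gtree) \<nu>. cv_tree F T \<and> proj_class F (length_fun F T) = proj_class F (tlen \<mu>) \<and>
     patterson_sullivan_current F B T \<nu> \<and> C = current_class \<nu>"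
  obtain \<nu>0 where "patterson_sullivan_current F B ?T \<nu>0" using T1.PS_current_exists by blast
  then have "?Q (current_class \<nu>0)" using cvT len by auto
  then have "?Q (PS_map F B (proj_class F (tlen \<mu>)))" unfolding PS_map_def by (rule someI)
  then obtain T :: "('g, real) gtree" and \<nu> where T: "cv_tree F T"
    "proj_class F (length_fun F T) = proj_class F (tlen \<mu>)" "patterson_sullivan_current F B T \<nu>"
    "PS_map F B (proj_class F (tlen \<mu>)) = current_class \<nu>" by blast
  have "length_fun F T \<in> extensional (carrier F)" unfolding length_fun_def by auto
  then obtain c where c: "c \<noteq> 0" "\<And>g. g \<in> carrier F \<Longrightarrow> length_fun F T g = c * tlen \<mu> g"
    using proj_class_eqD[OF T(2)] by metis
  have tact: "tree_action F T"
    using T(1) real_tree_imp_rtree is_group unfolding cv_tree_def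
    by (intro tree_action.intro tree_action_axioms.intro) auto
  interpret T: tree_action F T by (rule tact)
  obtain b where b: "b \<in> B" using B by blast
  then have bF: "b \<in> carrier F" using B_carrier by blast
  \<comment> \<open>A projective class admits negative factors as well; they are excluded because
    translation lengths are non-negative.\<close>
  have "0 \<le> c * \<mu> b" using T.lt_nonneg[OF bF] c(2)[OF bF] tlen_basis[OF b] pos[OF b] by simp
  then have c0: "c > 0" using pos[OF b] c(1) by (simp add: zero_le_mult_iff)
  let ?\<mu> = "\<lambda>b. c * \<mu> b"
  have wf': "weighted_free_group F B ?\<mu>" using pos c0 by unfold_locales simp
  interpret W: weighted_tree F B ?\<mu> T
  proof (intro weighted_tree.intro fin_free_group_axioms wf' tact weighted_tree_axioms.intro)
    fix g assume g: "g \<in> carrier F"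
    have "length_fun F T g = tlen ?\<mu> g" using c(2)[OF g] tlen_scale[OF c0 g] by simp
    then show "length_fun F T g = max 0 (wlen ?\<mu> (g \<otimes> g) - wlen ?\<mu> g)" using g by (simp add: tlen_def)
  qed
  obtain z where z: "z \<in> tpts T" "\<And>g. g \<in> carrier F \<Longrightarrow> tdist T z (tact T g z) = wlen ?\<mu> g"
    using W.base_point_exists by blast
  interpret bt: based_tree F B ?\<mu> T z
    by (intro based_tree.intro fin_free_group_axioms wf' tact based_tree_axioms.intro z)
  \<comment> \<open>Lengths in the chosen tree are multiplied by \<open>c\<close>, so its exponent
    is \<open>1 / c\<close> and the masses are unchanged.\<close>
  have "(\<Sum>b\<in>B. 1 / (1 + exp (1 / c * ?\<mu> b))) = 1 / 2" using sum c0 by simp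
  from bt.PS_current_letters[OF T(3) card this] obtain P where P: "P > 0"
    "\<And>a b. \<lbrakk>a \<in> Lam; b \<in> Lam; a \<noteq> b\<rbrakk> \<Longrightarrow> emeasure \<nu> (cyl [a] \<times> cyl [b]) =
      ennreal (P * (1 / (1 + exp (1 / c * (c * \<mu> (fst a))))) * (1 / (1 + exp (1 / c * (c * \<mu> (fst b))))))"
    by blast
  have "measure \<nu> (cyl [a] \<times> cyl [b]) = P * (1 / (1 + exp (\<mu> (fst a)))) * (1 / (1 + exp (\<mu> (fst b))))"
    if "a \<in> Lam" "b \<in> Lam" "a \<noteq> b" for a b
  proof -
    have "0 \<le> P * (1 / (1 + exp (\<mu> (fst a)))) * (1 / (1 + exp (\<mu> (fst b))))"
      using P(1) by (intro mult_nonneg_nonneg) (auto simp: add_nonneg_nonneg)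
    then show ?thesis using P(2)[OF that] c0 by (simp add: measure_def)
  qed
  then show "\<exists>\<nu>. PS_map F B (proj_class F (tlen \<mu>)) = current_class \<nu> \<and>
      (\<exists>P>0. \<forall>a\<in>Lam. \<forall>b\<in>Lam. a \<noteq> b \<longrightarrow> measure \<nu> (cyl [a] \<times> cyl [b]) =
        P * (1 / (1 + exp (\<mu> (fst a)))) * (1 / (1 + exp (\<mu> (fst b)))))"
    using T(4) P(1) by blast
qed

lemma wlen_tendsto:
  assumes "\<And>b. b \<in> B \<Longrightarrow> (\<lambda>n. \<mu> n b) \<longlonglongrightarrow> \<mu>' b" and g: "g \<in> carrier F"
  shows "(\<lambda>n. wlen (\<mu> n) g) \<longlonglongrightarrow> wlen \<mu>' g"
proof -
  have "(\<lambda>n. wl (\<mu> n) w) \<longlonglongrightarrow> wl \<mu>' w" if "set w \<subseteq> Lam" for w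
    using that
  proof (induction w)
    case (Cons x w)
    then have "fst x \<in> B" by auto
    then show ?case using Cons assms(1) by (auto intro!: tendsto_add)
  qed simp
  then show ?thesis unfolding wlen_def using rwd_Lam[OF g] by blast
qed

text \<open>The letter \<open>b\<close> keeps a positive weight along the sequence and in the limit.
  So none of the length functions is zero, and passing to projective classes is continuous
  there.\<close>

lemma PFun_limit:
  assumes lim: "\<And>b. b \<in> B \<Longrightarrow> (\<lambda>n. \<mu> n b) \<longlonglongrightarrow> \<mu>' b"
    and nz: "b \<in> B" "\<And>n. 0 < \<mu> n b" "0 < \<mu>' b"
  shows "limitin (PFun_top F) (\<lambda>n. proj_class F (tlen (\<mu> n))) (proj_class F (tlen \<mu>')) sequentially"
proof -
  let ?S = "subtopology (fun_top F) (- {\<lambda>g\<in>carrier F. 0})"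
  have bF: "b \<in> carrier F" using nz B_carrier by blast
  have ne: "tlen \<mu> \<noteq> (\<lambda>g\<in>carrier F. 0)" if "0 < \<mu> b" for \<mu>
  proof
    assume eq: "tlen \<mu> = (\<lambda>g\<in>carrier F. 0)"
    have "tlen \<mu> b = 0" unfolding eq using bF by simp
    then show False using tlen_basis[OF nz(1)] that by simp
  qed
  have "limitin (fun_top F) (\<lambda>n. tlen (\<mu> n)) (tlen \<mu>') sequentially"
    unfolding fun_top_def limitin_componentwise
  proof (intro conjI ballI)
    show "tlen \<mu>' \<in> extensional (carrier F)" unfolding tlen_def by simp
    show "\<forall>\<^sub>F n in sequentially. tlen (\<mu> n) \<in> topspace (product_topology (\<lambda>_. euclideanreal) (carrier F))"
      unfolding tlen_def by simp
    fix g assume g: "g \<in> carrier F"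
    have "(\<lambda>n. max 0 (wlen (\<mu> n) (g \<otimes> g) - wlen (\<mu> n) g)) \<longlonglongrightarrow> max 0 (wlen \<mu>' (g \<otimes> g) - wlen \<mu>' g)"
      using wlen_tendsto[OF lim] g by (intro tendsto_max tendsto_diff tendsto_const) auto
    then show "limitin euclideanreal (\<lambda>n. tlen (\<mu> n) g) (tlen \<mu>' g) sequentially"
      using g by (simp add: tlen_def)
  qed
  then have "limitin ?S (\<lambda>n. tlen (\<mu> n)) (tlen \<mu>') sequentially"
    unfolding limitin_subtopology using ne nz by simp
  moreover have "continuous_map ?S (PFun_top F) (proj_class F)"
    unfolding PFun_top_def using quotient_map_quotient_topology by (rule quotient_imp_continuous_map)
  ultimately show ?thesis using continuous_map_limit by (fastforce simp: comp_def)
qed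

text \<open>The weights of the letters are prescribed through the numbers \<open>p b = 1 / (1 + exp (\<mu> b))\<close>,
  so that the normalisation of the entropy becomes a linear condition on \<open>p\<close>.\<close>

definition prob_weight :: "('g \<Rightarrow> real) \<Rightarrow> 'g \<Rightarrow> real" where
  "prob_weight p b = ln (1 / p b - 1)"

lemma prob_weight:
  assumes "0 < p b" "p b < 1 / 2"
  shows "1 / (1 + exp (prob_weight p b)) = p b" "0 < prob_weight p b"
proof -
  have g: "1 / p b - 1 > 1" using assms by (simp add: field_simps)
  then have "exp (prob_weight p b) = 1 / p b - 1" unfolding prob_weight_def by simp
  then show "1 / (1 + exp (prob_weight p b)) = p b" by simp
  show "0 < prob_weight p b" unfolding prob_weight_def using g by (intro ln_gt_zero)
qed

text \<open>The petals other than \<open>x\<close> and \<open>y\<close> get mass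
  \<open>\<delta>\<close>, and the remainder \<open>r\<close> of the required sum 1/2 is divided in
  the ratio \<open>s : 1 - s\<close>. The factor 8 keeps \<open>r\<close> between 3/8 and 1/2, so
  for \<open>s\<close> between 1/4 and 1/2 the masses of \<open>x\<close> and \<open>y\<close> stay
  above 3/32 and below 1/2.\<close>

definition degeneration :: "'g \<Rightarrow> 'g \<Rightarrow> real \<Rightarrow> nat \<Rightarrow> 'g \<Rightarrow> real" where
  "degeneration x y s n b = (let \<delta> = 1 / (8 * real (card B) * (real n + 1));
      r = 1 / 2 - real (card B - 2) * \<delta> in if b = x then s * r else if b = y then (1 - s) * r else \<delta>)"

text \<open>The ends of the range of \<open>s\<close> are the two ratios to be compared. The petal
  \<open>z\<close> supplies the scale by which lengths are divided.\<close>

context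
  fixes x y z :: 'g and s :: real
  assumes xyz: "x \<in> B" "y \<in> B" "z \<in> B" "x \<noteq> y" "z \<noteq> x" "z \<noteq> y" and s: "1 / 4 \<le> s" "s \<le> 1 / 2"
begin

abbreviation "deg \<equiv> degeneration x y s"

abbreviation "small n \<equiv> 1 / (8 * real (card B) * (real n + 1))"

lemma card_B: "card B \<ge> 3"
proof -
  have "card {x, y, z} \<le> card B" using xyz finite_basis by (intro card_mono) auto
  then show ?thesis using xyz by simp
qed

lemma small: "0 < small n" "small n \<le> 1 / 24" "real (card B - 2) * small n \<le> 1 / 8"
proof -
  have k: "3 \<le> real (card B)" using card_B by simp
  then show "0 < small n" by simp
  have "24 * 1 \<le> 8 * real (card B) * (real n + 1)" using k by (intro mult_mono) auto
  then show "small n \<le> 1 / 24" by (simp add: field_simps)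
  have "real (card B - 2) \<le> real (card B) * 1" by simp
  also have "\<dots> \<le> real (card B) * (real n + 1)" by (rule mult_left_mono) simp_all
  finally have "real (card B - 2) / (8 * (real (card B) * (real n + 1))) \<le>
      real (card B) * (real n + 1) / (8 * (real (card B) * (real n + 1)))" using k by (intro divide_right_mono) auto
  also have "\<dots> = 1 / 8"
  proof -
    have "real (card B) * (real n + 1) \<noteq> 0" using k by auto
    moreover have "K / (8 * K) = 1 / 8" if "K \<noteq> 0" for K :: real using that by simp
    ultimately show ?thesis by blast
  qed
  finally show "real (card B - 2) * small n \<le> 1 / 8" by (simp add: mult.assoc)
qed

lemma deg_values:
  "deg n x = s * (1 / 2 - real (card B - 2) * small n)"
  "deg n y = (1 - s) * (1 / 2 - real (card B - 2) * small n)"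
  "b \<noteq> x \<Longrightarrow> b \<noteq> y \<Longrightarrow> deg n b = small n"
  using xyz(4) unfolding degeneration_def Let_def by simp_all

lemma deg_bounds: "3 / 32 \<le> deg n x" "deg n x < 1 / 2" "3 / 32 \<le> deg n y" "deg n y < 1 / 2"
proof -
  define r where "r = 1 / 2 - real (card B - 2) * small n"
  have r: "3 / 8 \<le> r" "r \<le> 1 / 2" 
  proof -
    have "0 \<le> real (card B - 2) * small n" using small(1)[of n] by (intro mult_nonneg_nonneg) auto
    then show "3 / 8 \<le> r" "r \<le> 1 / 2" using small(3)[of n] unfolding r_def by linarith+
  qed
  have b: "3 / 32 \<le> t * r \<and> t * r < 1 / 2" if t: "1 / 4 \<le> t" "t \<le> 3 / 4" for t
  proof -
    have "1 / 4 * (3 / 8) \<le> t * r" using t r by (intro mult_mono) auto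
    moreover have "t * r \<le> 3 / 4 * (1 / 2)" using t r by (intro mult_mono) auto
    ultimately show ?thesis by simp
  qed
  show "3 / 32 \<le> deg n x" "deg n x < 1 / 2" "3 / 32 \<le> deg n y" "deg n y < 1 / 2"
    unfolding deg_values r_def[symmetric] using b[of s] b[of "1 - s"] s by auto
qed

lemma deg_range: "0 < deg n b" "deg n b < 1 / 2"
proof -
  consider "b = x" | "b = y" | "b \<noteq> x" "b \<noteq> y" by blast
  then have "0 < deg n b \<and> deg n b < 1 / 2"
  proof cases
    case 3
    then show ?thesis using deg_values(3)[OF 3] small[of n] by simp
  qed (use deg_bounds[of n] in auto)
  then show "0 < deg n b" "deg n b < 1 / 2" by auto
qed

lemma deg_sum: "(\<Sum>b\<in>B. 1 / (1 + exp (prob_weight (deg n) b))) = 1 / 2"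
proof -
  have "(\<Sum>b\<in>B. 1 / (1 + exp (prob_weight (deg n) b))) = (\<Sum>b\<in>B. deg n b)"
    using prob_weight(1) deg_range by simp
  also have "\<dots> = deg n x + (deg n y + (\<Sum>b\<in>B - {x} - {y}. deg n b))"
    using xyz finite_basis by (simp add: sum.remove[of B x] sum.remove[of "B - {x}" y])
  also have "(\<Sum>b\<in>B - {x} - {y}. deg n b) = (\<Sum>b\<in>B - {x} - {y}. small n)"
    using deg_values(3) by (intro sum.cong) auto
  also have "\<dots> = real (card B - 2) * small n"
  proof -
    have "card (B - {x} - {y}) = card B - 2" using xyz finite_basis by simp
    then show ?thesis by simp
  qed
  also have "deg n x + (deg n y + real (card B - 2) * small n) = 1 / 2"
  proof -
    have "s * (1 / 2 - w) + ((1 - s) * (1 / 2 - w) + w) = 1 / 2" for w by (simp add: field_simps)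
    then show ?thesis unfolding deg_values by blast
  qed
  finally show ?thesis .
qed

text \<open>The lengths of \<open>x\<close> and \<open>y\<close> stay bounded, whereas all other
  petals have one common length that grows logarithmically. Division by this length leaves limits 0
  and 1, whatever \<open>s\<close> is.\<close>

lemma deg_limit:
  "limitin (PFun_top F) (\<lambda>n. proj_class F (tlen (prob_weight (deg n))))
     (proj_class F (tlen (\<lambda>b. if b = x \<or> b = y then 0 else 1))) sequentially"
proof -
  define \<kappa> where "\<kappa> n = prob_weight (deg n) z" for n
  have \<kappa>0: "0 < \<kappa> n" for n unfolding \<kappa>_def using prob_weight(2) deg_range by blast
  have \<kappa>inf: "filterlim \<kappa> at_top sequentially"
  proof -
    have "0 < real (card B)" using card_B by simp
    then have "filterlim (\<lambda>n. ln (8 * real (card B) * (real n + 1) - 1)) at_top sequentially"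
      by real_asymp
    moreover have "\<kappa> n = ln (8 * real (card B) * (real n + 1) - 1)" for n
      unfolding \<kappa>_def prob_weight_def using deg_values(3)[OF xyz(5,6)] by simp
    ultimately show ?thesis by presburger
  qed
  have bounded: "(\<lambda>n. (1 / \<kappa> n) * prob_weight (deg n) b) \<longlonglongrightarrow> 0" if b: "b = x \<or> b = y" for b
  proof (rule tendsto_sandwich)
    \<comment> \<open>The constant comes from the lower bound 3/32 for the masses of
      \<open>x\<close> and \<open>y\<close>.\<close>
    have pw: "0 \<le> prob_weight (deg n) b \<and> prob_weight (deg n) b \<le> ln (32 / 3)" for n
    proof -
      have d: "3 / 32 \<le> deg n b" "deg n b < 1 / 2" using b deg_bounds by auto
      then have "1 / deg n b - 1 \<le> 32 / 3" "1 / deg n b - 1 > 1" by (auto simp: field_simps)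
      then show ?thesis unfolding prob_weight_def by simp
    qed
    show "\<forall>\<^sub>F n in sequentially. 0 \<le> (1 / \<kappa> n) * prob_weight (deg n) b"
      using pw \<kappa>0 by (simp add: less_imp_le)
    show "\<forall>\<^sub>F n in sequentially. (1 / \<kappa> n) * prob_weight (deg n) b \<le> ln (32 / 3) / \<kappa> n"
      using pw \<kappa>0 by (intro always_eventually allI) (simp add: divide_right_mono less_imp_le)
    show "(\<lambda>n. ln (32 / 3) / \<kappa> n) \<longlonglongrightarrow> 0"
      by (rule real_tendsto_divide_at_top[OF tendsto_const \<kappa>inf])
  qed simp
  have other: "(1 / \<kappa> n) * prob_weight (deg n) b = 1" if "\<not> (b = x \<or> b = y)" for b n
  proof -
    have "prob_weight (deg n) b = \<kappa> n"
      unfolding \<kappa>_def prob_weight_def using deg_values(3)[OF xyz(5,6)] deg_values(3)[of b] that by simp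
    then show ?thesis using \<kappa>0[of n] by simp
  qed
  have "limitin (PFun_top F) (\<lambda>n. proj_class F (tlen (\<lambda>b. (1 / \<kappa> n) * prob_weight (deg n) b)))
     (proj_class F (tlen (\<lambda>b. if b = x \<or> b = y then 0 else 1))) sequentially"
  proof (rule PFun_limit[OF _ xyz(3)])
    fix b
    show "(\<lambda>n. (1 / \<kappa> n) * prob_weight (deg n) b) \<longlonglongrightarrow> (if b = x \<or> b = y then 0 else 1)"
    proof (cases "b = x \<or> b = y")
      case False
      then show ?thesis unfolding other[OF False] by simp
    qed (use bounded[of b] in simp)
  next
    show "0 < (1 / \<kappa> n) * prob_weight (deg n) z" for n using \<kappa>0[of n] unfolding \<kappa>_def by simp
  qed (use xyz in simp)
  moreover have "proj_class F (tlen (\<lambda>b. (1 / \<kappa> n) * prob_weight (deg n) b)) = proj_class F (tlen (prob_weight (deg n)))" for n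
    using tlen_scale[of "1 / \<kappa> n"] \<kappa>0[of n] by (intro proj_class_scale[of "1 / \<kappa> n"]) auto
  ultimately show ?thesis by simp
qed

lemma deg_in_CV: "proj_class F (tlen (prob_weight (deg n))) \<in> CV F"
  by (rule rose_point(1)) (use prob_weight(2) deg_range deg_sum card_B in auto)

text \<open>A point of \<open>PCurr_top\<close> is the class of some non-zero current, and this
  current is a positive multiple of the measure found in \<open>rose_point\<close>. Hence the ratios
  of its masses are the same.\<close>

lemma deg_current:
  assumes "PS_map F B (proj_class F (tlen (prob_weight (deg n)))) \<in> topspace (PCurr_top F B)"
  shows "\<exists>\<nu>\<in>nonzero_currents F B. PS_map F B (proj_class F (tlen (prob_weight (deg n)))) = current_class \<nu> \<and>
      (\<exists>P>0. \<forall>a\<in>Lam. \<forall>b\<in>Lam. a \<noteq> b \<longrightarrow> measure \<nu> (cyl [a] \<times> cyl [b]) = P * deg n (fst a) * deg n (fst b))"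
proof -
  let ?c = "proj_class F (tlen (prob_weight (deg n)))"
  have "\<exists>\<nu>. PS_map F B ?c = current_class \<nu> \<and>
      (\<exists>P>0. \<forall>a\<in>Lam. \<forall>b\<in>Lam. a \<noteq> b \<longrightarrow> measure \<nu> (cyl [a] \<times> cyl [b]) =
        P * (1 / (1 + exp (prob_weight (deg n) (fst a)))) * (1 / (1 + exp (prob_weight (deg n) (fst b)))))"
    by (rule rose_point(2)) (use prob_weight(2) deg_range deg_sum card_B in auto)
  then obtain \<nu> P where \<nu>: "PS_map F B ?c = current_class \<nu>" "P > 0"
    "\<forall>a\<in>Lam. \<forall>b\<in>Lam. a \<noteq> b \<longrightarrow> measure \<nu> (cyl [a] \<times> cyl [b]) = P * deg n (fst a) * deg n (fst b)"
    unfolding prob_weight(1)[where p = "deg n", OF deg_range] by blast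
  obtain \<nu>' where \<nu>': "\<nu>' \<in> nonzero_currents F B" "PS_map F B ?c = current_class \<nu>'"
    using assms unfolding topspace_PCurr by blast
  obtain c where c: "c > 0" "\<And>A. measure \<nu>' A = c * measure \<nu> A"
    using current_class_eqD[of \<nu>' \<nu>] \<nu>(1) \<nu>'(2) by metis
  have "measure \<nu>' (cyl [a] \<times> cyl [b]) = (c * P) * deg n (fst a) * deg n (fst b)"
    if "a \<in> Lam" "b \<in> Lam" "a \<noteq> b" for a b
  proof -
    have "measure \<nu> (cyl [a] \<times> cyl [b]) = P * deg n (fst a) * deg n (fst b)" using \<nu>(3) that by meson
    then show ?thesis unfolding c(2) by (simp only: mult.assoc)
  qed
  moreover have "0 < c * P" using c(1) \<nu>(2) by simp
  ultimately show ?thesis using \<nu>' by blast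
qed

end

theorem no_continuous_extension:
  assumes card: "card B \<ge> 3"
    and f: "continuous_map (subtopology (PFun_top F) (CV_closure F)) (PCurr_top F B) f"
    and ext: "\<forall>c\<in>CV F. f c = PS_map F B c"
  shows False
proof -
  obtain D where D: "D \<subseteq> B" "card D = 3" using obtain_subset_with_card_n[OF card] by metis
  then obtain x y z where xyz': "D = {x, y, z}" "x \<noteq> y" "x \<noteq> z" "y \<noteq> z" by (auto simp: card_3_iff)
  then have xyz: "x \<in> B" "y \<in> B" "z \<in> B" "x \<noteq> y" "z \<noteq> x" "z \<noteq> y" using D by auto
  define cinf where "cinf = proj_class F (tlen (\<lambda>b. if b = x \<or> b = y then 0 else 1))"
  define cn where "cn s n = proj_class F (tlen (prob_weight (degeneration x y s n)))" for s n
  have CVn: "cn s n \<in> CV F" if "1 / 4 \<le> s" "s \<le> 1 / 2" for s n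
    unfolding cn_def using deg_in_CV[OF xyz that] .
  have lim: "limitin (PFun_top F) (cn s) cinf sequentially" if "1 / 4 \<le> s" "s \<le> 1 / 2" for s
    using deg_limit[OF xyz that] unfolding cn_def cinf_def by (simp add: fun_eq_iff)
  have CVcl: "c \<in> CV_closure F" if "c \<in> CV F" "c \<in> topspace (PFun_top F)" for c
    using closure_of_subset_Int[of "PFun_top F" "CV F"] that unfolding CV_closure_def by blast
  have cn_cl: "cn s n \<in> CV_closure F" if s: "1 / 4 \<le> s" "s \<le> 1 / 2" for s n
  proof -
    have pw: "0 < prob_weight (degeneration x y s n) b" for b
      using prob_weight(2) deg_range[OF xyz s] by blast
    \<comment> \<open>Convergence of the constant sequence certifies that \<open>cn s n\<close> is a
      point of the space, so that it belongs to the closure.\<close>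
    have "limitin (PFun_top F) (\<lambda>_. cn s n) (cn s n) sequentially"
      unfolding cn_def by (rule PFun_limit[OF _ xyz(1)]) (use pw in auto)
    then show ?thesis using CVcl CVn[OF s] by simp
  qed
  have cinf_cl: "cinf \<in> CV_closure F"
    using lim[of "1/2"] cn_cl[of "1/2"] unfolding CV_closure_def
    by (intro limitin_closedin[OF _ closedin_closure_of]) auto
  have flim: "limitin (PCurr_top F B) (f \<circ> cn s) (f cinf) sequentially" if s: "1 / 4 \<le> s" "s \<le> 1 / 2" for s
  proof (rule continuous_map_limit[OF f])
    show "limitin (subtopology (PFun_top F) (CV_closure F)) (cn s) cinf sequentially"
      unfolding limitin_subtopology using lim[OF s] cn_cl[OF s] cinf_cl by simp
  qed
  have "f cinf \<in> topspace (PCurr_top F B)" using flim[of "1/2"] limitin_topspace by fastforce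
  then obtain \<eta> where \<eta>: "\<eta> \<in> nonzero_currents F B" "f cinf = current_class \<eta>" unfolding topspace_PCurr by blast
  have seq: "\<exists>\<nu>. (\<forall>n. \<nu> n \<in> nonzero_currents F B) \<and>
      limitin (PCurr_top F B) (\<lambda>n. current_class (\<nu> n)) (current_class \<eta>) sequentially \<and>
      (\<forall>n. \<exists>P>0. \<forall>a\<in>Lam. \<forall>b\<in>Lam. a \<noteq> b \<longrightarrow> measure (\<nu> n) (cyl [a] \<times> cyl [b]) =
        P * degeneration x y s n (fst a) * degeneration x y s n (fst b))" if s: "1 / 4 \<le> s" "s \<le> 1 / 2" for s
  proof -
    have fc: "f (cn s n) = PS_map F B (cn s n)" for n using ext CVn[OF s] by blast
    have "cn s n \<in> topspace (subtopology (PFun_top F) (CV_closure F))" for n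
      using cn_cl[OF s, of n] closure_of_subset_topspace[of "PFun_top F" "CV F"]
      unfolding CV_closure_def by auto
    \<comment> \<open>Continuity of \<open>f\<close> includes that its values are points of
      \<open>PCurr_top\<close>; this makes the Patterson--Sullivan classes classes of non-zero
      currents.\<close>
    then have "PS_map F B (cn s n) \<in> topspace (PCurr_top F B)" for n
      using continuous_map_image_subset_topspace[OF f] fc[of n] by (metis image_subset_iff)
    then have "\<exists>\<nu>. \<nu> \<in> nonzero_currents F B \<and> PS_map F B (cn s n) = current_class \<nu> \<and>
      (\<exists>P>0. \<forall>a\<in>Lam. \<forall>b\<in>Lam. a \<noteq> b \<longrightarrow> measure \<nu> (cyl [a] \<times> cyl [b]) =
        P * degeneration x y s n (fst a) * degeneration x y s n (fst b))" for n
      using deg_current[OF xyz s, of n] unfolding cn_def by blast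
    then obtain \<nu> where \<nu>: "\<And>n. \<nu> n \<in> nonzero_currents F B" "\<And>n. PS_map F B (cn s n) = current_class (\<nu> n)"
      "\<And>n. \<exists>P>0. \<forall>a\<in>Lam. \<forall>b\<in>Lam. a \<noteq> b \<longrightarrow> measure (\<nu> n) (cyl [a] \<times> cyl [b]) =
        P * degeneration x y s n (fst a) * degeneration x y s n (fst b)" by metis
    have "f \<circ> cn s = (\<lambda>n. current_class (\<nu> n))" using fc \<nu>(2) by auto
    then show ?thesis using flim[OF s] \<nu>(1,3) \<eta>(2) by (intro exI[of _ \<nu>]) simp
  qed
  obtain \<nu> where \<nu>: "\<And>n. \<nu> n \<in> nonzero_currents F B"
    "limitin (PCurr_top F B) (\<lambda>n. current_class (\<nu> n)) (current_class \<eta>) sequentially"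
    "\<And>n. \<exists>P>0. \<forall>a\<in>Lam. \<forall>b\<in>Lam. a \<noteq> b \<longrightarrow> measure (\<nu> n) (cyl [a] \<times> cyl [b]) =
        P * degeneration x y (1 / 2) n (fst a) * degeneration x y (1 / 2) n (fst b)"
    using seq[of "1 / 2"] by auto
  obtain \<nu>' where \<nu>': "\<And>n. \<nu>' n \<in> nonzero_currents F B"
    "limitin (PCurr_top F B) (\<lambda>n. current_class (\<nu>' n)) (current_class \<eta>) sequentially"
    "\<And>n. \<exists>P>0. \<forall>a\<in>Lam. \<forall>b\<in>Lam. a \<noteq> b \<longrightarrow> measure (\<nu>' n) (cyl [a] \<times> cyl [b]) =
        P * degeneration x y (1 / 4) n (fst a) * degeneration x y (1 / 4) n (fst b)"
    using seq[of "1 / 4"] by auto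
  obtain a b where ab: "a \<in> Lam" "b \<in> Lam" "a \<noteq> b" "measure \<eta> (cyl [a] \<times> cyl [b]) > 0"
    using nonzero_current_positive_rect[OF \<eta>(1)] .
  define X where "X = measure \<eta> (cyl [(x, True)] \<times> cyl [(x, False)])"
  define Y where "Y = measure \<eta> (cyl [(y, True)] \<times> cyl [(y, False)])"
  have L: "(x, True) \<in> Lam" "(x, False) \<in> Lam" "(y, True) \<in> Lam" "(y, False) \<in> Lam" using xyz by auto
  \<comment> \<open>All products of two letter masses are at most 1/4, while the square of the mass
    of \<open>x\<close> is at least 9/1024, so 100 is a sufficient factor. A limit current that
    charges some letter rectangle therefore charges the one of \<open>x\<close> and its
    inverse.\<close>
  have "1 * measure \<eta> (cyl [a] \<times> cyl [b]) \<le> 100 * measure \<eta> (cyl [(x, True)] \<times> cyl [(x, False)])"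
  proof (rule PCurr_limit_inequality[OF \<nu>(2,1) \<eta>(1) ab(3)])
    fix n
    obtain P where P: "P > 0" "\<forall>a\<in>Lam. \<forall>b\<in>Lam. a \<noteq> b \<longrightarrow> measure (\<nu> n) (cyl [a] \<times> cyl [b]) =
        P * degeneration x y (1 / 2) n (fst a) * degeneration x y (1 / 2) n (fst b)" using \<nu>(3)[of n] by meson
    let ?p = "degeneration x y (1 / 2) n"
    have p: "0 < ?p b" "?p b < 1 / 2" for b using deg_range[OF xyz, of "1/2"] by auto
    have "?p (fst a) * ?p (fst b) \<le> 1 / 2 * (1 / 2)" using p by (intro mult_mono) (auto simp: less_imp_le)
    moreover have "3 / 32 * (3 / 32) \<le> ?p x * ?p x"
      using deg_bounds(1)[OF xyz, of "1/2" n] by (intro mult_mono) auto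
    ultimately have "?p (fst a) * ?p (fst b) \<le> 100 * (?p x * ?p x)" by linarith
    then have "P * (?p (fst a) * ?p (fst b)) \<le> P * (100 * (?p x * ?p x))" using P(1) by simp
    moreover have "measure (\<nu> n) (cyl [a] \<times> cyl [b]) = P * ?p (fst a) * ?p (fst b)"
      using P(2) ab(1-3) by meson
    moreover have "measure (\<nu> n) (cyl [(x, True)] \<times> cyl [(x, False)]) = P * ?p x * ?p x"
      using P(2) L by simp
    ultimately show "1 * measure (\<nu> n) (cyl [a] \<times> cyl [b]) \<le> 100 * measure (\<nu> n) (cyl [(x, True)] \<times> cyl [(x, False)])"
      by (simp add: mult.assoc mult.left_commute)
  qed simp
  then have X: "X > 0" unfolding X_def using ab(4) by simp
  \<comment> \<open>Equal shares give equal masses on the two rectangles. Below, the shares 1/4 and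
    3/4 give masses in the ratio 1 to 9, so the same limit satisfies \<open>9 * X \<le> Y\<close>
    too.\<close>
  have "1 * Y \<le> 1 * X"
    unfolding X_def Y_def
  proof (rule PCurr_limit_inequality[OF \<nu>(2,1) \<eta>(1)])
    fix n
    obtain P where P: "\<forall>a\<in>Lam. \<forall>b\<in>Lam. a \<noteq> b \<longrightarrow> measure (\<nu> n) (cyl [a] \<times> cyl [b]) =
        P * degeneration x y (1 / 2) n (fst a) * degeneration x y (1 / 2) n (fst b)" using \<nu>(3)[of n] by meson
    have "degeneration x y (1 / 2) n x = degeneration x y (1 / 2) n y"
      using deg_values(1,2)[OF xyz, of "1/2" n] by simp
    then show "1 * measure (\<nu> n) (cyl [(y, True)] \<times> cyl [(y, False)]) \<le>
        1 * measure (\<nu> n) (cyl [(x, True)] \<times> cyl [(x, False)])"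
      using P L by simp
  qed auto
  moreover have "9 * X \<le> 1 * Y"
    unfolding X_def Y_def
  proof (rule PCurr_limit_inequality[OF \<nu>'(2,1) \<eta>(1)])
    fix n
    obtain P where P: "\<forall>a\<in>Lam. \<forall>b\<in>Lam. a \<noteq> b \<longrightarrow> measure (\<nu>' n) (cyl [a] \<times> cyl [b]) =
        P * degeneration x y (1 / 4) n (fst a) * degeneration x y (1 / 4) n (fst b)" using \<nu>'(3)[of n] by meson
    have "degeneration x y (1 / 4) n y = 3 * degeneration x y (1 / 4) n x"
      using deg_values(1,2)[OF xyz, of "1/4" n] by simp
    then show "9 * measure (\<nu>' n) (cyl [(x, True)] \<times> cyl [(x, False)]) \<le>
        1 * measure (\<nu>' n) (cyl [(y, True)] \<times> cyl [(y, False)])"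
      using P L by simp
  qed auto
  ultimately show False using X by simp
qed

end

text \<open>Each of the three maps in question would be a continuous extension in rank at least 3,
  which \<open>no_continuous_extension\<close> excludes.\<close>

theorem corollary1p2:
  fixes F :: "('g, 'm) monoid_scheme" and B :: "'g set" and k :: nat
  assumes "group F" and "free_basis F B" and "finite B" and "card B = k" and "k \<ge> 2"
  shows "(k \<ge> 3 \<longrightarrow>
      \<not> (\<exists>f. homeomorphic_map
               (subtopology (PFun_top F) (CV_closure F))
               (subtopology (PCurr_top F B) (PCurr_top F B closure_of (PS_map F B ` CV F))) f
             \<and> (\<forall>c\<in>CV F. f c = PS_map F B c))
      \<and> \<not> (\<exists>f. continuous_map (subtopology (PFun_top F) (CV_closure F)) (PCurr_top F B) f
             \<and> (\<forall>c\<in>CV F. f c = PS_map F B c)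
             \<and> embedding_map (subtopology (PFun_top F) (CV_boundary F)) (PCurr_top F B) f))
    \<and> (k \<ge> 5 \<longrightarrow>
      \<not> (\<exists>f. continuous_map (subtopology (PFun_top F) (CV_closure F)) (PCurr_top F B) f
             \<and> (\<forall>c\<in>CV F. f c = PS_map F B c)))"
proof -
  interpret fin_free_group F B
    using assms by (intro fin_free_group.intro free_group.intro free_group_axioms.intro fin_free_group_axioms.intro)
  have none: False
    if "k \<ge> 3" "continuous_map (subtopology (PFun_top F) (CV_closure F)) (PCurr_top F B) f"
      "\<forall>c\<in>CV F. f c = PS_map F B c" for f
    using no_continuous_extension that assms(4) by blast
  \<comment> \<open>A homeomorphism onto a subspace is in particular continuous into the whole
    space.\<close>
  have "continuous_map X Y f" if "homeomorphic_map X (subtopology Y S) f" for X Y S and f :: "'x \<Rightarrow> 'y"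
    using homeomorphic_imp_continuous_map[OF that] continuous_map_in_subtopology by blast
  note homeo = this
  show ?thesis
  proof (intro conjI impI notI)
    assume k: "k \<ge> 3"
    show False if "\<exists>f. homeomorphic_map (subtopology (PFun_top F) (CV_closure F))
        (subtopology (PCurr_top F B) (PCurr_top F B closure_of (PS_map F B ` CV F))) f
        \<and> (\<forall>c\<in>CV F. f c = PS_map F B c)"
      using that none[OF k homeo] by blast
    show False if "\<exists>f. continuous_map (subtopology (PFun_top F) (CV_closure F)) (PCurr_top F B) f
        \<and> (\<forall>c\<in>CV F. f c = PS_map F B c)
        \<and> embedding_map (subtopology (PFun_top F) (CV_boundary F)) (PCurr_top F B) f"
      using that none[OF k] by blast
  next
    assume "k \<ge> 5"
    then have k: "k \<ge> 3" by simp
    show False if "\<exists>f. continuous_map (subtopology (PFun_top F) (CV_closure F)) (PCurr_top F B) f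
        \<and> (\<forall>c\<in>CV F. f c = PS_map F B c)"
      using that none[OF k] by blast
  qed
qed

end
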